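(* Let $G$ be a locally compact group. (1) If $G$ is amenable, then $L^{1}(G)$ is $\Delta$-weak $\phi$-amenable for each $\phi\in\Delta(L^{1}(G))\cup\{0\}$. (2) For $1<p<\infty$ and $\phi\in\Delta(A_{p}(G))\cup\{0\}$, the Figa-Talamanca-Herz algebra $A_{p}(G)$ is $\Delta$-weak $\phi$-amenable if and only if $G$ is amenable.
   Context: For a complex Banach algebra $A$, $\Delta(A)$ denotes the set of all nonzero algebra homomorphisms $A\to\mathbb{C}$ (characters; these are automatically bounded), $A^{*}$ the dual space and $A^{**}$ the bidual. For $a\in A$ and $f\in A^{*}$, the functional $f.a\in A^{*}$ is defined by $(f.a)(b)=f(ab)$ for $b\in A$. For $\phi\in\Delta(A)\cup\{0\}$, $A$ is called $\Delta$-weak $\phi$-amenable if there exists $m\in A^{**}$ such that $m(\phi)=0$ and $m(\psi.a)=\psi(a)$ for all $a\in\ker(\phi)$ and all $\psi\in\Delta(A)$. $L^{1}(G)$ is the group algebra (with respect to left Haar measure) with norm $\|\cdot\|_1$ and convolution product. For $1<p<\infty$ and $1/p+1/q=1$, $A_{p}(G)$ is the subspace of $C_{0}(G)$ consisting of the functions of the form $u=\sum_{i=1}^{\infty}f_{i}\ast\widetilde{g_{i}}$ with $f_i\in L^{p}(G)$, $g_i\in L^{q}(G)$ and $\sum_{i=1}^{\infty}\|f_i\|_p\|g_i\|_q<\infty$, where $\widetilde{g}(x)=\overline{g(x^{-1})}$. With pointwise operations and the norm $\|u\|_{A_p(G)}=\inf\{\sum_{i}\|f_i\|_p\|g_i\|_q: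 u=\sum_i f_i\ast\widetilde{g_i}\}$ it is a Banach algebra. Its characters are exactly the point evaluations $u\mapsto u(x)$, $x\in G$. $G$ is amenable if there exists $m\in L^{\infty}(G)^{*}$ with $m\geq0$, $m(1)=1$ and $m(L_xf)=m(f)$ for all $x\in G$, $f\in L^{\infty}(G)$, where $L_xf(y)=f(x^{-1}y)$. *)

theory Defs
  imports "HOL-Analysis.Analysis"
begin

section \<open>Complex normed spaces and algebras with explicit carrier\<close>

text \<open>
  The spaces and algebras below depend on a measure and on an exponent, so they are records with an
  explicit carrier.  The zero vector and the additive inverse are determined by the scalar
  multiplication.
\<close>

record 'a normed_sp =
  vcarrier :: "'a set"
  vadd :: "'a \<Rightarrow> 'a \<Rightarrow> 'a"
  vscale :: "complex \<Rightarrow> 'a \<Rightarrow> 'a"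
  vnorm :: "'a \<Rightarrow> real"

record 'a normed_alg = "'a normed_sp" +
  vmult :: "'a \<Rightarrow> 'a \<Rightarrow> 'a"

text \<open>
  A functional on a carrier is represented by the function that vanishes outside the carrier; thus
  equal functionals are equal functions, the operations on functionals are the pointwise ones, and
  the zero functional is \<open>\<lambda>_. 0\<close>.
\<close>

definition linear_functional :: "('a, 'm) normed_sp_scheme \<Rightarrow> ('a \<Rightarrow> complex) \<Rightarrow> bool" where
  "linear_functional X f \<longleftrightarrow>
     (\<forall>x. x \<notin> vcarrier X \<longrightarrow> f x = 0) \<and>
     (\<forall>x\<in>vcarrier X. \<forall>y\<in>vcarrier X. f (vadd X x y) = f x + f y) \<and>
     (\<forall>c. \<forall>x\<in>vcarrier X. f (vscale X c x) = c * f x)"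

definition dual :: "('a, 'm) normed_sp_scheme \<Rightarrow> ('a \<Rightarrow> complex) normed_sp" where
  "dual X = \<lparr>
     vcarrier = {f. linear_functional X f \<and> (\<exists>C. \<forall>x\<in>vcarrier X. cmod (f x) \<le> C * vnorm X x)},
     vadd = (\<lambda>f g x. f x + g x),
     vscale = (\<lambda>c f x. c * f x),
     vnorm = (\<lambda>f. Sup {cmod (f x) |x. x \<in> vcarrier X \<and> vnorm X x \<le> 1}) \<rparr>"

definition characters :: "('a, 'm) normed_alg_scheme \<Rightarrow> ('a \<Rightarrow> complex) set" where
  "characters A =
     {\<phi>. linear_functional A \<phi> \<and>
         (\<forall>a\<in>vcarrier A. \<forall>b\<in>vcarrier A. \<phi> (vmult A a b) = \<phi> a * \<phi> b) \<and>
         (\<exists>a\<in>vcarrier A. \<phi> a \<noteq> 0)}"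

definition dual_act :: "('a, 'm) normed_alg_scheme \<Rightarrow> ('a \<Rightarrow> complex) \<Rightarrow> 'a \<Rightarrow> 'a \<Rightarrow> complex" where
  "dual_act A f a = (\<lambda>b. if b \<in> vcarrier A then f (vmult A a b) else 0)"

definition Delta_weak_amenable :: "('a, 'm) normed_alg_scheme \<Rightarrow> ('a \<Rightarrow> complex) \<Rightarrow> bool" where
  "Delta_weak_amenable A \<phi> \<longleftrightarrow>
     (\<exists>m\<in>vcarrier (dual (dual A)).
        m \<phi> = 0 \<and>
        (\<forall>a\<in>vcarrier A. \<phi> a = 0 \<longrightarrow> (\<forall>\<psi>\<in>characters A. m (dual_act A \<psi> a) = \<psi> a)))"


section \<open>Haar measure\<close>

text \<open>
  A topological group is a type of class \<^class>\<open>topological_group_add\<close>.  This class does not assume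
  commutativity: \<open>x + y\<close> is the group product \<open>xy\<close>, \<open>- x\<close> is the inverse of \<open>x\<close> and
  \<open>0\<close> is the identity.  A left Haar measure is a nonzero left-invariant Radon measure on the
  Borel sets; it need not be sigma-finite.
\<close>

definition left_haar_measure :: "'g::{topological_group_add,t2_space} measure \<Rightarrow> bool" where
  "left_haar_measure \<mu> \<longleftrightarrow>
     sets \<mu> = sets borel \<and>
     emeasure \<mu> UNIV \<noteq> 0 \<and>
     (\<forall>K. compact K \<longrightarrow> emeasure \<mu> K < \<infinity>) \<and>
     (\<forall>A\<in>sets borel. emeasure \<mu> A = (INF U\<in>{U. open U \<and> A \<subseteq> U}. emeasure \<mu> U)) \<and>
     (\<forall>U. open U \<longrightarrow> emeasure \<mu> U = (SUP K\<in>{K. compact K \<and> K \<subseteq> U}. emeasure \<mu> K)) \<and>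
     (\<forall>x. \<forall>A\<in>sets borel. emeasure \<mu> ((+) x ` A) = emeasure \<mu> A)"

definition left_translate :: "'g::group_add \<Rightarrow> ('g \<Rightarrow> complex) \<Rightarrow> 'g \<Rightarrow> complex" where
  "left_translate x f = (\<lambda>y. f (- x + y))"

definition tilde :: "('g::group_add \<Rightarrow> complex) \<Rightarrow> 'g \<Rightarrow> complex" where
  "tilde g = (\<lambda>x. cnj (g (- x)))"

text \<open>
  For integrable \<open>f\<close> and \<open>g\<close> the integral converges for almost every \<open>x\<close>; elsewhere the Bochner
  integral is \<open>0\<close>.
\<close>

definition convolution ::
    "'g::group_add measure \<Rightarrow> ('g \<Rightarrow> complex) \<Rightarrow> ('g \<Rightarrow> complex) \<Rightarrow> 'g \<Rightarrow> complex" where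
  "convolution \<mu> f g = (\<lambda>x. \<integral>y. f y * g (- y + x) \<partial>\<mu>)"


section \<open>The group algebra\<close>

text \<open>Elements are classes of integrable functions modulo equality almost everywhere.\<close>

definition L1_fun :: "'g measure \<Rightarrow> ('g \<Rightarrow> complex) set" where
  "L1_fun \<mu> = {f. integrable \<mu> f}"

definition L1_rel :: "'g measure \<Rightarrow> (('g \<Rightarrow> complex) \<times> ('g \<Rightarrow> complex)) set" where
  "L1_rel \<mu> = {(f, g). f \<in> L1_fun \<mu> \<and> g \<in> L1_fun \<mu> \<and> (AE x in \<mu>. f x = g x)}"

definition L1_algebra :: "'g::group_add measure \<Rightarrow> ('g \<Rightarrow> complex) set normed_alg" where
  "L1_algebra \<mu> = \<lparr>
     vcarrier = L1_fun \<mu> // L1_rel \<mu>,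
     vadd = (\<lambda>F G. \<Union>f\<in>F. \<Union>g\<in>G. L1_rel \<mu> `` {\<lambda>x. f x + g x}),
     vscale = (\<lambda>c F. \<Union>f\<in>F. L1_rel \<mu> `` {\<lambda>x. c * f x}),
     vnorm = (\<lambda>F. the_elem ((\<lambda>f. \<integral>x. cmod (f x) \<partial>\<mu>) ` F)),
     vmult = (\<lambda>F G. \<Union>f\<in>F. \<Union>g\<in>G. L1_rel \<mu> `` {convolution \<mu> f g}) \<rparr>"


section \<open>Essentially bounded functions and amenability\<close>

text \<open>
  Since the group need not be sigma-compact, measurability and null sets are taken in the local
  sense, i.e. on Borel sets of finite measure, so that the resulting space is the dual of the group
  algebra.
\<close>

definition locally_AE :: "'g measure \<Rightarrow> ('g \<Rightarrow> bool) \<Rightarrow> bool" where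
  "locally_AE \<mu> P \<longleftrightarrow> (\<forall>F\<in>sets \<mu>. emeasure \<mu> F < \<infinity> \<longrightarrow> (AE x in \<mu>. x \<in> F \<longrightarrow> P x))"

definition Linf_fun :: "'g measure \<Rightarrow> ('g \<Rightarrow> complex) set" where
  "Linf_fun \<mu> =
     {f. (\<forall>F\<in>sets \<mu>. emeasure \<mu> F < \<infinity> \<longrightarrow> f \<in> borel_measurable (restrict_space \<mu> F)) \<and>
         (\<exists>C. locally_AE \<mu> (\<lambda>x. cmod (f x) \<le> C))}"

definition Linf_rel :: "'g measure \<Rightarrow> (('g \<Rightarrow> complex) \<times> ('g \<Rightarrow> complex)) set" where
  "Linf_rel \<mu> = {(f, g). f \<in> Linf_fun \<mu> \<and> g \<in> Linf_fun \<mu> \<and> locally_AE \<mu> (\<lambda>x. f x = g x)}"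

definition Linf_space :: "'g measure \<Rightarrow> ('g \<Rightarrow> complex) set normed_sp" where
  "Linf_space \<mu> = \<lparr>
     vcarrier = Linf_fun \<mu> // Linf_rel \<mu>,
     vadd = (\<lambda>F G. \<Union>f\<in>F. \<Union>g\<in>G. Linf_rel \<mu> `` {\<lambda>x. f x + g x}),
     vscale = (\<lambda>c F. \<Union>f\<in>F. Linf_rel \<mu> `` {\<lambda>x. c * f x}),
     vnorm = (\<lambda>F. the_elem ((\<lambda>f. Inf {C. 0 \<le> C \<and> locally_AE \<mu> (\<lambda>x. cmod (f x) \<le> C)}) ` F)) \<rparr>"

text \<open>\<open>\<mu>\<close> is meant to be a left Haar measure of the group.\<close>

definition amenable_group :: "'g::group_add measure \<Rightarrow> bool" where
  "amenable_group \<mu> \<longleftrightarrow>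
     (\<exists>m\<in>vcarrier (dual (Linf_space \<mu>)).
        (\<forall>f\<in>Linf_fun \<mu>. locally_AE \<mu> (\<lambda>x. f x \<in> \<real>\<^sub>\<ge>\<^sub>0) \<longrightarrow> m (Linf_rel \<mu> `` {f}) \<in> \<real>\<^sub>\<ge>\<^sub>0) \<and>
        m (Linf_rel \<mu> `` {\<lambda>_. 1}) = 1 \<and>
        (\<forall>x. \<forall>f\<in>Linf_fun \<mu>.
           m (Linf_rel \<mu> `` {left_translate x f}) = m (Linf_rel \<mu> `` {f})))"


section \<open>The Figa-Talamanca--Herz algebra\<close>

definition Lp_fun :: "real \<Rightarrow> 'g measure \<Rightarrow> ('g \<Rightarrow> complex) set" where
  "Lp_fun p \<mu> = {f. f \<in> borel_measurable \<mu> \<and> integrable \<mu> (\<lambda>x. cmod (f x) powr p)}"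

definition Lp_norm :: "real \<Rightarrow> 'g measure \<Rightarrow> ('g \<Rightarrow> complex) \<Rightarrow> real" where
  "Lp_norm p \<mu> f = (\<integral>x. cmod (f x) powr p \<partial>\<mu>) powr (1 / p)"

definition C0_fun :: "('g::topological_space \<Rightarrow> complex) set" where
  "C0_fun = {u. continuous_on UNIV u \<and>
               (\<forall>\<epsilon>>0. \<exists>K. compact K \<and> (\<forall>x. x \<notin> K \<longrightarrow> cmod (u x) < \<epsilon>))}"

text \<open>
  The conjugate exponent of \<open>p\<close> is \<open>q = p / (p - 1)\<close>.  Representatives \<open>f i\<close> and \<open>g i\<close> may be
  used instead of classes because \<open>convolution \<mu> (f i) (tilde (g i))\<close> and the norms do not change
  when \<open>f i\<close> or \<open>g i\<close> is modified on a null set.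
\<close>

definition Ap_representation ::
    "real \<Rightarrow> 'g::group_add measure \<Rightarrow> (nat \<Rightarrow> 'g \<Rightarrow> complex) \<Rightarrow> (nat \<Rightarrow> 'g \<Rightarrow> complex) \<Rightarrow>
     ('g \<Rightarrow> complex) \<Rightarrow> bool" where
  "Ap_representation p \<mu> f g u \<longleftrightarrow>
     (let q = p / (p - 1) in
        (\<forall>i. f i \<in> Lp_fun p \<mu>) \<and> (\<forall>i. g i \<in> Lp_fun q \<mu>) \<and>
        summable (\<lambda>i. Lp_norm p \<mu> (f i) * Lp_norm q \<mu> (g i)) \<and>
        (\<forall>x. (\<lambda>i. convolution \<mu> (f i) (tilde (g i)) x) sums u x))"

definition Ap_norm ::
    "real \<Rightarrow> 'g::group_add measure \<Rightarrow> ('g \<Rightarrow> complex) \<Rightarrow> real" where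
  "Ap_norm p \<mu> u =
     Inf {\<Sum>i. Lp_norm p \<mu> (f i) * Lp_norm (p / (p - 1)) \<mu> (g i) |f g. Ap_representation p \<mu> f g u}"

definition Ap_algebra ::
    "real \<Rightarrow> 'g::{topological_group_add,t2_space} measure \<Rightarrow> ('g \<Rightarrow> complex) normed_alg" where
  "Ap_algebra p \<mu> = \<lparr>
     vcarrier = {u \<in> C0_fun. \<exists>f g. Ap_representation p \<mu> f g u},
     vadd = (\<lambda>u v x. u x + v x),
     vscale = (\<lambda>c u x. c * u x),
     vnorm = Ap_norm p \<mu>,
     vmult = (\<lambda>u v x. u x * v x) \<rparr>"

end

theory Submission
 imports Defs
begin

text \<open>
 A mean on the dual with the required properties is a weak-* limit of differences \<open>a - b\<close> of elements
 of the unit ball on which \<open>\<phi>\<close> is nearly \<open>0\<close> and every other character is nearly \<open>1\<close>; the limit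
 extends from finite sets of characters by Hahn--Banach.

 For the group algebra, \<open>a\<close> is an approximate unit and \<open>b\<close> an average of its translates: every
 character multiplies translates by a unimodular function \<open>\<xi>\<close> on the group, which determines the
 character, and the average of the translates weighted by the conjugates of the powers of \<open>\<xi> x\<close>
 preserves the value of \<open>\<phi>\<close> and makes small the value of a character with a different factor at \<open>x\<close>.

 The characters of the Figa-Talamanca--Herz algebra are the point evaluations. If \<open>G\<close> is amenable,
 Reiter's condition yields functions of norm at most \<open>1\<close> close to \<open>1\<close> on finite sets. Conversely, the
 mean prevents the averages over finite sets of translations from being strict contractions of
 \<open>L\<^sup>p\<close>. By uniform convexity, in the form of a refined Young inequality, functions whose norm is
 nearly preserved by an average are nearly invariant, and their \<open>p\<close>-th powers satisfy Reiter's
 condition.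
\<close>

section \<open>Sublinear functionals and limits of bounded families\<close>

text \<open>A Haar measure need not be \<sigma>-finite, and the Borel sets of a product may exceed
  the product of the Borel sets. Integrals are therefore exchanged only where regularity permits:
  products in \<open>Ap\<close> are built from Riemann sums, and Fubini is proved for finite inner
  regular measures, which serves convolutions in L1 because integrable functions live on
  \<sigma>-compact sets.

  The norm of \<open>Ap\<close> is an infimum over representations and awkward to handle. It is
  replaced by the predicate \<open>atomic\<close>, which bounds decompositions into continuous
  functions of compact support and is stable under series and, up to the factor \<open>Kp\<close>,
  under products. The constants lost in this way are harmless, since no sharp bound rests on them.
  The elements of norm at most 1 that the criterion for weak amenability demands are always single
  functions \<open>cv f g\<close>, whose norm is estimated directly.

  The condition \<open>reiter\<close> is the hinge between invariant means and \<open>Ap\<close>. It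
  speaks of finitely many group elements at a time, as does each approximation of a functional on
  the characters.\<close>

definition sublinear_on :: "('a => real) set => (('a => real) => real) => bool" where
 "sublinear_on V q \<longleftrightarrow>
   (\<forall>f\<in>V. \<forall>g\<in>V. q (\<lambda>x. f x + g x) \<le> q f + q g) \<and> (\<forall>c>0. \<forall>f\<in>V. q (\<lambda>x. c * f x) \<le> c * q f)"

lemma sublinear_on_add:
 "sublinear_on V q ==> f \<in> V ==> g \<in> V ==> q (\<lambda>x. f x + g x) \<le> q f + q g"
 by (simp add: sublinear_on_def)

lemma sublinear_on_scale:
 assumes q: "sublinear_on V q" and V: "\<And>c f. f \<in> V ==> (\<lambda>x. c * f x) \<in> V" and f: "f \<in> V" and c: "c > 0"
 shows "q (\<lambda>x. c * f x) = c * q f"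
proof (rule antisym)
 show "q (\<lambda>x. c * f x) \<le> c * q f" using q f c by (auto simp: sublinear_on_def)
 have "q (\<lambda>x. (1/c) * (c * f x)) \<le> (1/c) * q (\<lambda>x. c * f x)"
  using q V[OF f, of c] c unfolding sublinear_on_def by (metis zero_less_divide_1_iff)
 moreover have "(\<lambda>x. (1/c) * (c * f x)) = f" using c by auto
 ultimately show "c * q f \<le> q (\<lambda>x. c * f x)" using c by (simp add: field_simps)
qed

lemma sublinear_on_zero:
 assumes q: "sublinear_on V q" and V: "\<And>c f. f \<in> V ==> (\<lambda>x. c * f x) \<in> V" and f: "f \<in> V"
 shows "q (\<lambda>x. 0) = 0"
proof -
 have "(\<lambda>x. 0) \<in> V" using V[OF f, of 0] by simp
 from sublinear_on_scale[OF q V this, of 2] show ?thesis by simp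
qed

lemma sublinear_on_minus:
 assumes q: "sublinear_on V q" and V: "\<And>c f. f \<in> V ==> (\<lambda>x. c * f x) \<in> V" and f: "f \<in> V"
 shows "- q (\<lambda>x. - f x) \<le> q f"
proof -
 have m: "(\<lambda>x. - f x) \<in> V" using V[OF f, of "-1"] by simp
 have "q (\<lambda>x. f x + - f x) \<le> q f + q (\<lambda>x. - f x)"
  by (rule sublinear_on_add[OF q f m])
 then show ?thesis using sublinear_on_zero[OF q V f] by simp
qed

text \<open>A minimal sublinear functional below \<open>p\<close> is linear.\<close>

lemma dominated_linear_functional:
 assumes p: "sublinear_on V p"
  and Va: "\<And>f g. f \<in> V ==> g \<in> V ==> (\<lambda>x. f x + g x) \<in> V"
  and Vs: "\<And>c f. f \<in> V ==> (\<lambda>x. c * f x) \<in> V"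
 obtains \<Lambda> where "\<And>f g. f \<in> V ==> g \<in> V ==> \<Lambda> (\<lambda>x. f x + g x) = \<Lambda> f + \<Lambda> g"
  "\<And>c f. f \<in> V ==> \<Lambda> (\<lambda>x. c * f x) = c * \<Lambda> f" "\<And>f. f \<in> V ==> \<Lambda> f \<le> p f"
proof -
 \<comment> \<open>Members of \<open>A\<close> vanish outside \<open>V\<close>: if they were
   arbitrary there, they could be lowered without end and none would be minimal. The order
   \<open>P\<close> is the reverse of the pointwise one, so that Zorn's lemma gives a minimal
   member.\<close>
 define A where "A = {q. sublinear_on V q \<and> (\<forall>f\<in>V. q f \<le> p f) \<and> (\<forall>f. f \<notin> V --> q f = 0)}"
 define P where "P = (\<lambda>q r :: ('a => real) => real. \<forall>f. r f \<le> q f)"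
 have lower: "- p (\<lambda>x. - f x) \<le> q f" if "q \<in> A" "f \<in> V" for q f
 proof -
  have "q (\<lambda>x. - f x) \<le> p (\<lambda>x. - f x)"
   using that Vs[OF that(2), of "-1"] unfolding A_def by auto
  moreover have "- q (\<lambda>x. - f x) \<le> q f"
   using sublinear_on_minus[of V q f] that Vs unfolding A_def by blast
  ultimately show ?thesis by linarith
 qed
 have "\<exists>m\<in>A. \<forall>a\<in>A. P m a --> a = m"
 proof (rule predicate_Zorn)
  show "partial_order_on A (relation_of P A)"
   unfolding partial_order_on_def preorder_on_def refl_on_def trans_def antisym_def relation_of_def P_def
   by (auto intro: order_trans) (meson antisym ext)
  fix C assume C: "C \<in> Chains (relation_of P A)"
  show "\<exists>u\<in>A. \<forall>a\<in>C. P a u"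
  proof (cases "C = {}")
   case True
   have eq: "sublinear_on V (\<lambda>f. if f \<in> V then p f else 0)"
    using p Va Vs unfolding sublinear_on_def by auto
   then show ?thesis using True unfolding A_def
    by (intro bexI[of _ "\<lambda>f. if f \<in> V then p f else 0"]) auto
  next
   case False
   have CA: "C \<subseteq> A" using C unfolding Chains_def relation_of_def by auto
   have ch: "P q r \<or> P r q" if "q \<in> C" "r \<in> C" for q r
    using C that unfolding Chains_def relation_of_def by auto
   define u where "u = (\<lambda>f. if f \<in> V then (INF q\<in>C. q f) else 0)"
   have bdd: "bdd_below ((\<lambda>q. q f) ` C)" if "f \<in> V" for f
    using lower CA that by (intro bdd_belowI[of _ "- p (\<lambda>x. - f x)"]) auto
   have ule: "u f \<le> q f" if "f \<in> V" "q \<in> C" for f q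
    unfolding u_def using that bdd by (auto intro: cINF_lower)
   have uge: "c \<le> u f" if "f \<in> V" "\<And>q. q \<in> C ==> c \<le> q f" for f c
    unfolding u_def using that False by (auto intro: cINF_greatest)
   have "sublinear_on V u"
    unfolding sublinear_on_def
   proof (intro conjI ballI allI impI)
    fix f g assume fg: "f \<in> V" "g \<in> V"
    \<comment> \<open>Members of a chain are comparable, so the smaller of \<open>q\<close> and
      \<open>r\<close> is below both and supplies the inequality for the infimum.\<close>
    have *: "u (\<lambda>x. f x + g x) \<le> q f + r g" if qr: "q \<in> C" "r \<in> C" for q r
    proof -
     have "\<exists>s\<in>C. s f \<le> q f \<and> s g \<le> r g"
      using ch[OF qr] qr unfolding P_def by blast
     then obtain s where s: "s \<in> C" "s f \<le> q f" "s g \<le> r g" by blast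
     have "u (\<lambda>x. f x + g x) \<le> s (\<lambda>x. f x + g x)" using ule Va fg s by blast
     also have "\<dots> \<le> s f + s g" using s(1) CA fg sublinear_on_add[of V s f g] unfolding A_def by blast
     finally show ?thesis using s by linarith
    qed
    have "u (\<lambda>x. f x + g x) - u f \<le> u g"
    proof (rule uge[OF fg(2)])
     fix r assume r: "r \<in> C"
     have "u (\<lambda>x. f x + g x) - r g \<le> u f"
      by (rule uge[OF fg(1)]) (use *[OF _ r] in \<open>simp add: algebra_simps\<close>)
     then show "u (\<lambda>x. f x + g x) - u f \<le> r g" by linarith
    qed
    then show "u (\<lambda>x. f x + g x) \<le> u f + u g" by linarith
   next
    fix c :: real and f assume c: "0 < c" and f: "f \<in> V"
    have "u (\<lambda>x. c * f x) / c \<le> u f"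
    proof (rule uge[OF f])
     fix q assume q: "q \<in> C"
     have "u (\<lambda>x. c * f x) \<le> q (\<lambda>x. c * f x)" using ule Vs f q by blast
     also have "\<dots> \<le> c * q f" using q CA c f unfolding A_def sublinear_on_def by blast
     finally show "u (\<lambda>x. c * f x) / c \<le> q f" using c by (simp add: field_simps)
    qed
    then show "u (\<lambda>x. c * f x) \<le> c * u f" using c by (simp add: field_simps)
   qed
   moreover have "u f \<le> p f" if "f \<in> V" for f
   proof -
    obtain q where "q \<in> C" using False by blast
    then show ?thesis using ule[OF that, of q] CA that unfolding A_def by force
   qed
   ultimately have "u \<in> A" unfolding A_def by (auto simp: u_def)
   moreover have "P a u" if "a \<in> C" for a
    using ule that CA unfolding P_def A_def by (auto simp: u_def)
   ultimately show ?thesis by blast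
  qed
 qed
 then obtain m where m: "m \<in> A" and mmin: "\<And>a. a \<in> A ==> P m a ==> a = m" by blast
 have msub: "sublinear_on V m" using m unfolding A_def by blast
 have super: "m f + m g \<le> m (\<lambda>x. f x + g x)" if f: "f \<in> V" and g: "g \<in> V" for f g
 proof -
  \<comment> \<open>The classical modification of \<open>m\<close> in the direction
    \<open>g\<close>. It is again sublinear and below \<open>m\<close>, hence equal to
    \<open>m\<close> by minimality; its competitor at t = 1 then gives superadditivity.\<close>
  define r where "r = (\<lambda>f. if f \<in> V then (INF t\<in>{0..}. m (\<lambda>x. f x + t * g x) - t * m g) else 0)"
  have Vt: "(\<lambda>x. f x + t * g x) \<in> V" if "f \<in> V" for f t
   using Va[OF that Vs[OF g, of t]] by simp
  have hom: "m (\<lambda>x. t * f x) = t * m f" if "t \<ge> 0" "f \<in> V" for t f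
   using sublinear_on_scale[OF msub Vs that(2), of t] sublinear_on_zero[OF msub Vs that(2)] that
   by (cases "t = 0") auto
  have low: "- m (\<lambda>x. - f x) \<le> m (\<lambda>x. f x + t * g x) - t * m g" if "f \<in> V" "t \<ge> 0" for f t
  proof -
   have "(\<lambda>x. - f x) \<in> V" using Vs[OF that(1), of "-1"] by simp
   then have "m (\<lambda>x. (f x + t * g x) + - f x) \<le> m (\<lambda>x. f x + t * g x) + m (\<lambda>x. - f x)"
    by (intro sublinear_on_add[OF msub] Vt that)
   then show ?thesis using hom[OF that(2) g] by simp
  qed
  have bdd: "bdd_below ((\<lambda>t. m (\<lambda>x. f x + t * g x) - t * m g) ` {0..})" if "f \<in> V" for f
   using low[OF that] by (intro bdd_belowI[of _ "- m (\<lambda>x. - f x)"]) auto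
  have rle: "r f \<le> m (\<lambda>x. f x + t * g x) - t * m g" if "f \<in> V" "t \<ge> 0" for f t
   unfolding r_def using that bdd by (auto intro!: cINF_lower)
  have rge: "c \<le> r f" if "f \<in> V" "\<And>t. t \<ge> 0 ==> c \<le> m (\<lambda>x. f x + t * g x) - t * m g" for f c
   unfolding r_def using that by (auto intro!: cINF_greatest)
  have rm: "r f \<le> m f" if "f \<in> V" for f using rle[OF that, of 0] by simp
  have "sublinear_on V r"
   unfolding sublinear_on_def
  proof (intro conjI ballI allI impI)
   fix f h assume fg: "f \<in> V" "h \<in> V"
   have *: "r (\<lambda>x. f x + h x) \<le> (m (\<lambda>x. f x + t * g x) - t * m g) + (m (\<lambda>x. h x + s * g x) - s * m g)"
    if "t \<ge> 0" "s \<ge> 0" for t s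
   proof -
    have "r (\<lambda>x. f x + h x) \<le> m (\<lambda>x. (f x + h x) + (t + s) * g x) - (t + s) * m g"
     using rle[OF Va[OF fg], of "t + s"] that by simp
    moreover have "(\<lambda>x. (f x + h x) + (t + s) * g x) = (\<lambda>x. (f x + t * g x) + (h x + s * g x))"
     by (auto simp: algebra_simps)
    moreover have "m (\<lambda>x. (f x + t * g x) + (h x + s * g x)) \<le> m (\<lambda>x. f x + t * g x) + m (\<lambda>x. h x + s * g x)"
     by (intro sublinear_on_add[OF msub] Vt fg)
    ultimately show ?thesis by (simp add: algebra_simps)
   qed
   have "r (\<lambda>x. f x + h x) - r f \<le> r h"
   proof (rule rge[OF fg(2)])
    fix s :: real assume s: "s \<ge> 0"
    have "r (\<lambda>x. f x + h x) - (m (\<lambda>x. h x + s * g x) - s * m g) \<le> r f"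
     by (rule rge[OF fg(1)]) (use *[OF _ s] in \<open>simp add: algebra_simps\<close>)
    then show "r (\<lambda>x. f x + h x) - r f \<le> m (\<lambda>x. h x + s * g x) - s * m g" by linarith
   qed
   then show "r (\<lambda>x. f x + h x) \<le> r f + r h" by linarith
  next
   fix c :: real and f assume c: "0 < c" and f: "f \<in> V"
   have "r (\<lambda>x. c * f x) / c \<le> r f"
   proof (rule rge[OF f])
    fix t :: real assume t: "t \<ge> 0"
    have "r (\<lambda>x. c * f x) \<le> m (\<lambda>x. c * f x + (c * t) * g x) - (c * t) * m g"
     using rle[OF Vs[OF f], of "c * t" c] c t by simp
    moreover have "(\<lambda>x. c * f x + (c * t) * g x) = (\<lambda>x. c * (f x + t * g x))"
     by (auto simp: algebra_simps)
    moreover have "m (\<lambda>x. c * (f x + t * g x)) = c * m (\<lambda>x. f x + t * g x)"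
     using hom[of c "\<lambda>x. f x + t * g x"] c Vt[OF f] by simp
    ultimately show "r (\<lambda>x. c * f x) / c \<le> m (\<lambda>x. f x + t * g x) - t * m g"
     using c by (simp add: field_simps)
   qed
   then show "r (\<lambda>x. c * f x) \<le> c * r f" using c by (simp add: field_simps)
  qed
  moreover have "r f \<le> p f" if "f \<in> V" for f
   using rm[OF that] m that unfolding A_def by force
  ultimately have "r \<in> A" unfolding A_def by (auto simp: r_def)
  moreover have "P m r" using rm m unfolding P_def A_def by (auto simp: r_def)
  ultimately have "r = m" using mmin by blast
  then show ?thesis using rle[OF f, of 1] by simp
 qed
 show thesis
 proof (rule that[of m])
  show add: "m (\<lambda>x. f x + g x) = m f + m g" if "f \<in> V" "g \<in> V" for f g
   using super[OF that] msub that unfolding sublinear_on_def by (intro antisym) auto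
  show "m (\<lambda>x. c * f x) = c * m f" if f: "f \<in> V" for c f
  proof -
   have z: "m (\<lambda>x. 0) = 0" by (rule sublinear_on_zero[OF msub Vs f])
   have pos: "m (\<lambda>x. c * f x) = c * m f" if "c > 0" for c
    using sublinear_on_scale[OF msub Vs f that] .
   have "m (\<lambda>x. c * f x + (-c) * f x) = m (\<lambda>x. c * f x) + m (\<lambda>x. (-c) * f x)"
    using add[OF Vs[OF f] Vs[OF f]] .
   then have neg: "m (\<lambda>x. (-c) * f x) = - m (\<lambda>x. c * f x)" using z by simp
   show ?thesis
    using pos[of c] pos[of "-c"] neg z by (cases c "0::real" rule: linorder_cases) auto
  qed
  show "m f \<le> p f" if "f \<in> V" for f using m that unfolding A_def by blast
 qed
qed

text \<open>Tychonoff's theorem in the role of Banach-Alaoglu: the families \<open>\<Phi> i\<close>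
  lie in a product of closed discs. The filter is part of the conclusion, so that linearity, bounds
  and positivity can later be read off as limits of the corresponding relations for
  \<open>\<Phi> i\<close>.\<close>

lemma pointwise_limit:
 fixes \<Phi> :: "'i => 'd => complex"
 assumes bd: "\<And>i d. cmod (\<Phi> i d) \<le> C d"
  and approx: "\<And>S e. finite S ==> S \<subseteq> A ==> 0 < e ==> \<exists>i. \<forall>s\<in>S. cmod (\<Phi> i s - L s) < e"
 obtains U :: "'i filter" and M
 where "U \<noteq> bot" "\<And>d. ((\<lambda>i. \<Phi> i d) \<longlongrightarrow> M d) U" "\<And>s. s \<in> A ==> M s = L s"
proof -
 define idx where "idx = (\<lambda>S n. SOME i. \<forall>s\<in>S. cmod (\<Phi> i s - L s) < 1 / real (Suc n))"
 have idx: "cmod (\<Phi> (idx S n) s - L s) < 1 / real (Suc n)" if "finite S" "S \<subseteq> A" "s \<in> S" for S n s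
 proof -
  have "\<exists>i. \<forall>s\<in>S. cmod (\<Phi> i s - L s) < 1 / real (Suc n)" by (rule approx[OF that(1,2)]) simp
  from someI_ex[OF this] show ?thesis using that(3) unfolding idx_def by blast
 qed
 \<comment> \<open>An index is chosen for each finite set of constraints and each precision 1/(n+1);
   along this filter every constraint is met in the limit. The filter need not converge at the
   remaining coordinates.\<close>
 define F where "F = filtermap (\<lambda>(S, n). idx S n) (finite_subsets_at_top A \<times>\<^sub>F sequentially)"
 have Fb: "F \<noteq> bot" unfolding F_def by (simp add: filtermap_bot_iff prod_filter_eq_bot)
 have lim: "((\<lambda>i. \<Phi> i s) \<longlongrightarrow> L s) F" if s: "s \<in> A" for s
 proof (rule tendstoI)
  fix e :: real assume e: "e > 0"
  obtain N where N: "1 / real (Suc N) < e" using e nat_approx_posE by blast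
  have ev1: "\<forall>\<^sub>F S in finite_subsets_at_top A. finite S \<and> S \<subseteq> A \<and> s \<in> S"
   unfolding eventually_finite_subsets_at_top by (intro exI[of _ "{s}"]) (use s in auto)
  have ev2: "\<forall>\<^sub>F n in sequentially. n \<ge> N" by (rule eventually_ge_at_top)
  have "\<forall>\<^sub>F x in finite_subsets_at_top A \<times>\<^sub>F sequentially. dist (\<Phi> (case x of (S, n) => idx S n) s) (L s) < e"
   unfolding eventually_prod_filter
  proof (intro exI conjI allI impI)
   show "\<forall>\<^sub>F S in finite_subsets_at_top A. finite S \<and> S \<subseteq> A \<and> s \<in> S" by (rule ev1)
   show "\<forall>\<^sub>F n in sequentially. n \<ge> N" by (rule ev2)
   fix S n assume S: "finite S \<and> S \<subseteq> A \<and> s \<in> S" and n: "N \<le> n"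
   have "cmod (\<Phi> (idx S n) s - L s) < 1 / real (Suc n)" using idx S by blast
   also have "\<dots> \<le> 1 / real (Suc N)" using n by (simp add: field_simps)
   finally show "dist (\<Phi> (case (S, n) of (S, n) => idx S n) s) (L s) < e" using N by (simp add: dist_norm)
  qed
  then show "\<forall>\<^sub>F i in F. dist (\<Phi> i s) (L s) < e" unfolding F_def eventually_filtermap .
 qed
 define K where "K = (\<Pi>\<^sub>E d\<in>UNIV. cball (0::complex) (C d))"
 have "compactin (product_topology (\<lambda>_::'d. euclidean :: complex topology) UNIV) K"
  unfolding K_def compactin_PiE by auto
 then have K: "compact K" by (simp add: euclidean_product_topology)
 have "filtermap \<Phi> F \<noteq> bot" using Fb by (simp add: filtermap_bot_iff)
 moreover have "eventually (\<lambda>x. x \<in> K) (filtermap \<Phi> F)"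
  unfolding eventually_filtermap K_def using bd by (intro always_eventually) (auto simp: dist_norm)
 ultimately obtain M where M: "inf (nhds M) (filtermap \<Phi> F) \<noteq> bot"
  using K unfolding compact_filter by blast
 \<comment> \<open>A refinement of \<open>F\<close> along which \<open>\<Phi>\<close> converges to
   the cluster point \<open>M\<close>. It is proper precisely because \<open>M\<close> is a cluster
   point.\<close>
 define U where "U = inf F (filtercomap \<Phi> (nhds M))"
 have "U \<noteq> bot"
 proof
  assume "U = bot"
  then have "eventually (\<lambda>_. False) U" by simp
  then obtain P Q where PQ: "eventually P F" "eventually Q (filtercomap \<Phi> (nhds M))" "\<And>x. P x ==> Q x ==> False"
   unfolding U_def eventually_inf by blast
  then obtain R where R: "eventually R (nhds M)" "\<And>x. R (\<Phi> x) ==> Q x"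
   unfolding eventually_filtercomap by blast
  have "eventually (\<lambda>x. \<not> R (\<Phi> x)) F" using PQ(1) by eventually_elim (use PQ(3) R(2) in blast)
  then have "eventually (\<lambda>y. \<not> R y) (filtermap \<Phi> F)" by (simp add: eventually_filtermap)
  then have "eventually (\<lambda>_. False) (inf (nhds M) (filtermap \<Phi> F))"
   using R(1) unfolding eventually_inf by blast
  then show False using M by (simp add: eventually_False)
 qed
 moreover have tl: "((\<lambda>i. \<Phi> i d) \<longlongrightarrow> M d) U" for d
 proof -
  have 1: "(\<Phi> \<longlongrightarrow> M) U" unfolding U_def
   by (rule filterlim_mono[OF filterlim_filtercomap order_refl inf_le2])
  have "continuous_on UNIV (\<lambda>f::'d=>complex. f d)" by (rule continuous_on_product_coordinates)
  from continuous_on_tendsto_compose[OF this 1] show ?thesis by simp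
 qed
 moreover have "M s = L s" if "s \<in> A" for s
 proof -
  have "((\<lambda>i. \<Phi> i s) \<longlongrightarrow> L s) U" using lim[OF that] unfolding U_def
   by (rule filterlim_mono[OF _ order_refl inf_le1])
  from tendsto_unique[OF \<open>U \<noteq> bot\<close> tl this] show ?thesis .
 qed
 ultimately show thesis using that by blast
qed

section \<open>A criterion for weak amenability\<close>

lemma zero_in_dual: "(\<lambda>_. 0) \<in> vcarrier (dual X)"
 unfolding dual_def linear_functional_def by (auto intro!: exI[of _ 0])

text \<open>The supremum in \<open>dual\<close> is one of reals and says nothing until its set is
  known to be bounded. The constant of a bounded functional may be negative, hence the absolute
  value in the proof.\<close>

lemma dual_le_norm:
 assumes F: "F \<in> vcarrier (dual X)" and nn: "\<And>x. x \<in> vcarrier X ==> 0 \<le> vnorm X x"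
  and x: "x \<in> vcarrier X" "vnorm X x \<le> 1"
 shows "cmod (F x) \<le> vnorm (dual X) F"
proof -
 obtain C where C: "\<And>x. x \<in> vcarrier X ==> cmod (F x) \<le> C * vnorm X x"
  using F unfolding dual_def by auto
 have "cmod (F y) \<le> \<bar>C\<bar>" if "y \<in> vcarrier X" "vnorm X y \<le> 1" for y
 proof -
  have "cmod (F y) \<le> C * vnorm X y" by (rule C[OF that(1)])
  also have "\<dots> \<le> \<bar>C\<bar> * 1" using that nn by (intro mult_mono) auto
  finally show ?thesis by simp
 qed
 then have "bdd_above {cmod (F x) |x. x \<in> vcarrier X \<and> vnorm X x \<le> 1}"
  by (intro bdd_aboveI[of _ "\<bar>C\<bar>"]) auto
 then show ?thesis unfolding dual_def using x by (auto intro!: cSup_upper)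
qed

lemma dual_act_character:
 assumes "\<psi> \<in> characters A" "a \<in> vcarrier A"
 shows "dual_act A \<psi> a = (\<lambda>b. \<psi> a * \<psi> b)"
 using assms unfolding dual_act_def characters_def linear_functional_def by auto

text \<open>
 On a character \<open>\<psi>\<close> the functional \<open>\<psi>.a\<close> is \<open>\<psi>(a) \<psi>\<close>, so that \<open>m\<close> only has to take the value \<open>1\<close>
 at all characters other than \<open>\<phi>\<close>.
\<close>

lemma Delta_weak_amenableI:
 assumes nn: "\<And>x. x \<in> vcarrier A ==> 0 \<le> vnorm A x"
  and bdd: "\<And>\<psi>. \<psi> \<in> characters A ==> \<exists>C. \<forall>x\<in>vcarrier A. cmod (\<psi> x) \<le> C * vnorm A x"
  and phi: "\<phi> \<in> characters A \<union> {\<lambda>_. 0}"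
  and approx: "\<And>S e. finite S ==> S \<subseteq> characters A - {\<phi>} ==> e > 0 ==>
    \<exists>a b. a \<in> vcarrier A \<and> b \<in> vcarrier A \<and> vnorm A a \<le> 1 \<and> vnorm A b \<le> 1 \<and>
     cmod (\<phi> a - \<phi> b) < e \<and> (\<forall>\<psi>\<in>S. cmod (\<psi> a - \<psi> b - 1) < e)"
 shows "Delta_weak_amenable A \<phi>"
proof -
 define D where "D = vcarrier (dual A)"
 define good where "good = {(a, b). a \<in> vcarrier A \<and> b \<in> vcarrier A \<and> vnorm A a \<le> 1 \<and> vnorm A b \<le> 1}"
 \<comment> \<open>The default value 0 makes the bound required by \<open>pointwise_limit\<close>
   hold at every index, and it makes the limit vanish outside the dual space, as the representation
   of functionals prescribes.\<close>
 define \<Phi> where "\<Phi> = (\<lambda>(i::'a \<times> 'a) F. if i \<in> good \<and> F \<in> D then F (fst i) - F (snd i) else 0 :: complex)"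
 define L :: "('a => complex) => complex" where "L = (\<lambda>\<psi>. if \<psi> = \<phi> then 0 else 1)"
 have charD: "characters A \<subseteq> D"
  using bdd unfolding D_def dual_def characters_def by auto
 have phiD: "\<phi> \<in> D" using phi charD zero_in_dual[of A] unfolding D_def by auto
 have b1: "cmod (\<Phi> i F) \<le> (if F \<in> D then 2 * \<bar>vnorm (dual A) F\<bar> else 0)" for i F
 proof -
  have "cmod (F (fst i) - F (snd i)) \<le> 2 * vnorm (dual A) F" if "i \<in> good" "F \<in> D"
  proof -
   have "cmod (F (fst i)) \<le> vnorm (dual A) F" "cmod (F (snd i)) \<le> vnorm (dual A) F"
    using that nn unfolding good_def D_def by (auto intro!: dual_le_norm)
   then show ?thesis using norm_triangle_ineq4[of "F (fst i)" "F (snd i)"] by linarith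
  qed
  then show ?thesis unfolding \<Phi>_def by auto
 qed
 have b2: "\<exists>i. \<forall>s\<in>S. cmod (\<Phi> i s - L s) < e" if S: "finite S" "S \<subseteq> insert \<phi> (characters A)" "0 < e" for S e
 proof -
  have "finite (S - {\<phi>})" "S - {\<phi>} \<subseteq> characters A - {\<phi>}" using S by auto
  from approx[OF this S(3)] obtain a b where ab: "a \<in> vcarrier A" "b \<in> vcarrier A" "vnorm A a \<le> 1"
   "vnorm A b \<le> 1" "cmod (\<phi> a - \<phi> b) < e" "\<And>\<psi>. \<psi> \<in> S - {\<phi>} ==> cmod (\<psi> a - \<psi> b - 1) < e"
   by blast
  have "cmod (\<Phi> (a, b) s - L s) < e" if "s \<in> S" for s
   using ab S that charD phiD unfolding \<Phi>_def L_def good_def by (cases "s = \<phi>") auto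
  then show ?thesis by blast
 qed
 from pointwise_limit[of \<Phi> "\<lambda>F. if F \<in> D then 2 * \<bar>vnorm (dual A) F\<bar> else 0", OF b1 b2] obtain U M where
  U: "U \<noteq> bot" and M: "\<And>d. ((\<lambda>i. \<Phi> i d) \<longlongrightarrow> M d) U" and Mval: "\<And>s. s \<in> insert \<phi> (characters A) ==> M s = L s"
  by blast
 have D0: "M F = 0" if "F \<notin> D" for F
 proof -
  have "((\<lambda>i. 0) \<longlongrightarrow> M F) U" using M[of F] that unfolding \<Phi>_def by simp
  then show ?thesis using tendsto_unique[OF U _ tendsto_const] by blast
 qed
 have Da: "(\<lambda>x. F x + G x) \<in> D" if FG: "F \<in> D" "G \<in> D" for F G
 proof -
  obtain C C' where C: "\<And>x. x \<in> vcarrier A ==> cmod (F x) \<le> C * vnorm A x"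
   "\<And>x. x \<in> vcarrier A ==> cmod (G x) \<le> C' * vnorm A x"
   using FG unfolding D_def dual_def by auto
  have "cmod (F x + G x) \<le> (C + C') * vnorm A x" if "x \<in> vcarrier A" for x
   using C[OF that] norm_triangle_ineq[of "F x" "G x"] by (simp add: algebra_simps)
  then have "\<exists>K. \<forall>x\<in>vcarrier A. cmod (F x + G x) \<le> K * vnorm A x" by blast
  then show ?thesis using FG unfolding D_def dual_def linear_functional_def
   by (simp add: algebra_simps)
 qed
 have Ds: "(\<lambda>x. c * F x) \<in> D" if FG: "F \<in> D" for c F
 proof -
  obtain C where C: "\<And>x. x \<in> vcarrier A ==> cmod (F x) \<le> C * vnorm A x"
   using FG unfolding D_def dual_def by auto
  have "cmod (c * F x) \<le> (cmod c * C) * vnorm A x" if "x \<in> vcarrier A" for x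
   using mult_left_mono[OF C[OF that], of "cmod c"] by (simp add: norm_mult algebra_simps)
  then have "\<exists>K. \<forall>x\<in>vcarrier A. cmod (c * F x) \<le> K * vnorm A x" by blast
  then show ?thesis using FG unfolding D_def dual_def linear_functional_def
   by (simp add: algebra_simps)
 qed
 have Madd: "M (\<lambda>x. F x + G x) = M F + M G" if "F \<in> D" "G \<in> D" for F G
 proof -
  have "((\<lambda>i. \<Phi> i F + \<Phi> i G) \<longlongrightarrow> M F + M G) U" using M by (intro tendsto_add)
  moreover have "(\<lambda>i. \<Phi> i F + \<Phi> i G) = (\<lambda>i. \<Phi> i (\<lambda>x. F x + G x))"
   using that Da[OF that] unfolding \<Phi>_def by auto
  ultimately show ?thesis using tendsto_unique[OF U] M by metis
 qed
 have Msc: "M (\<lambda>x. c * F x) = c * M F" if "F \<in> D" for F c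
 proof -
  have "((\<lambda>i. c * \<Phi> i F) \<longlongrightarrow> c * M F) U" using M by (intro tendsto_mult tendsto_const)
  moreover have "(\<lambda>i. c * \<Phi> i F) = (\<lambda>i. \<Phi> i (\<lambda>x. c * F x))"
   using that Ds[OF that] unfolding \<Phi>_def by (auto simp: algebra_simps)
  ultimately show ?thesis using tendsto_unique[OF U] M by metis
 qed
 have Mb: "cmod (M F) \<le> 2 * vnorm (dual A) F" if "F \<in> D" for F
 proof -
  have "\<exists>a\<in>vcarrier A. vnorm A a \<le> 1" using approx[of "{}" 1] by auto
  then have n0: "vnorm (dual A) F \<ge> 0"
   using dual_le_norm[of F A] that nn unfolding D_def by (meson norm_ge_zero order_trans)
  have "((\<lambda>i. cmod (\<Phi> i F)) \<longlongrightarrow> cmod (M F)) U" using M by (intro tendsto_norm)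
  moreover have "\<forall>\<^sub>F i in U. cmod (\<Phi> i F) \<le> 2 * vnorm (dual A) F"
   using b1[of _ F] that n0 by (intro always_eventually) auto
  ultimately show ?thesis using U by (rule tendsto_upperbound)
 qed
 have "M \<in> vcarrier (dual (dual A))"
  using D0 Madd Msc Mb unfolding dual_def[of "dual A"] linear_functional_def
  by (auto simp: D_def dual_def[of A])
 moreover have "M \<phi> = 0" using Mval[of \<phi>] unfolding L_def by simp
 moreover have "M (dual_act A \<psi> a) = \<psi> a" if a: "a \<in> vcarrier A" "\<phi> a = 0" and psi: "\<psi> \<in> characters A" for a \<psi>
 proof -
  have "M (dual_act A \<psi> a) = \<psi> a * M \<psi>"
   using dual_act_character[OF psi a(1)] Msc[of \<psi> "\<psi> a"] psi charD by auto
  then show ?thesis using Mval[of \<psi>] psi a(2) unfolding L_def by auto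
 qed
 ultimately show ?thesis unfolding Delta_weak_amenable_def by blast
qed

section \<open>Topological groups and Haar measure\<close>

lemma compact_tube:
 fixes W :: "('a::topological_space \<times> 'b::topological_space) set"
 assumes "compact K" "open W" "\<And>x. x \<in> K ==> (x, y) \<in> W"
 obtains V where "open V" "y \<in> V" "\<And>x v. x \<in> K ==> v \<in> V ==> (x, v) \<in> W"
proof -
 have "\<exists>U V. openin euclidean U \<and> openin euclidean V \<and> K \<subseteq> U \<and> y \<in> V \<and> U \<times> V \<subseteq> W"
  by (rule tube_lemma_left) (use assms in auto)
 then show thesis using that by fastforce
qed

lemma open_tube_set:
 fixes f :: "'a::topological_space \<times> 'b::topological_space => 'c::topological_space"
 assumes "continuous_on UNIV f" "compact K" "open W" "\<And>x. x \<in> K ==> f (x, y) \<in> W"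
 obtains V where "open V" "y \<in> V" "\<And>x v. x \<in> K ==> v \<in> V ==> f (x, v) \<in> W"
proof -
 have "open (f -` W)" using assms by (simp add: open_vimage)
 from compact_tube[OF assms(2) this, of y] assms(4) obtain V where
  "open V" "y \<in> V" "\<And>x v. x \<in> K ==> v \<in> V ==> (x, v) \<in> f -` W" by auto
 then show thesis using that by auto
qed

lemma compact_add:
 fixes K L :: "'g::topological_group_add set"
 assumes "compact K" "compact L"
 shows "compact ((\<lambda>(x, y). x + y) ` (K \<times> L))"
 by (intro compact_continuous_image compact_Times assms)
   (auto simp: split_beta intro!: continuous_intros)

lemma compact_uminus:
 fixes K :: "'g::topological_group_add set"
 shows "compact K ==> compact (uminus ` K)"
 by (intro compact_continuous_image) (auto intro!: continuous_intros)

lemma compact_left_translate: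
 fixes K :: "'g::topological_group_add set"
 shows "compact K ==> compact ((+) x ` K)"
 by (intro compact_continuous_image) (auto intro!: continuous_intros)

lemma left_translate_image: "(+) x ` A = {y::'g::group_add. - x + y \<in> A}"
 by (force simp: image_iff add.assoc[symmetric])

definition Cc :: "('g::topological_space => complex) set" where
 "Cc = {f. continuous_on UNIV f \<and> (\<exists>K. compact K \<and> (\<forall>x. x \<notin> K --> f x = 0))}"

lemma CcE:
 assumes "f \<in> Cc"
 obtains K where "compact K" "\<And>x. x \<notin> K ==> f x = 0"
 using assms unfolding Cc_def by auto

lemma Cc_continuous: "f \<in> Cc ==> continuous_on UNIV f"
 unfolding Cc_def by auto

lemma Cc_compose2:
 fixes h :: "complex => complex => complex"
 assumes "f \<in> Cc" "g \<in> Cc" "continuous_on UNIV (\<lambda>z. h (fst z) (snd z))" "h 0 0 = 0"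
 shows "(\<lambda>x. h (f x) (g x)) \<in> Cc"
proof -
 from CcE[OF assms(1)] obtain K where K: "compact K" "\<And>x. x \<notin> K ==> f x = 0" by blast
 from CcE[OF assms(2)] obtain L where L: "compact L" "\<And>x. x \<notin> L ==> g x = 0" by blast
 have "continuous_on UNIV ((\<lambda>z. h (fst z) (snd z)) \<circ> (\<lambda>x. (f x, g x)))"
  using assms by (intro continuous_on_compose continuous_on_Pair Cc_continuous)
   (auto intro: continuous_on_subset)
 then show ?thesis unfolding Cc_def using K L assms(4)
  unfolding o_def by (intro CollectI conjI exI[of _ "K \<union> L"] compact_Un) auto
qed

lemma Cc_compose: "f \<in> Cc ==> continuous_on UNIV h ==> h 0 = 0 ==> (\<lambda>x. h (f x)) \<in> Cc"
 by (rule Cc_compose2[of f f "\<lambda>x y. h x"])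
   (auto intro!: continuous_on_compose2[of UNIV h] continuous_intros)

lemma Cc_add: "f \<in> Cc ==> g \<in> Cc ==> (\<lambda>x. f x + g x) \<in> Cc"
 by (rule Cc_compose2[of f g]) (auto intro!: continuous_intros)

lemma Cc_diff: "f \<in> Cc ==> g \<in> Cc ==> (\<lambda>x. f x - g x) \<in> Cc"
 by (rule Cc_compose2[of f g]) (auto intro!: continuous_intros)

lemma Cc_scale: "f \<in> Cc ==> (\<lambda>x. c * f x) \<in> Cc"
 by (rule Cc_compose[of f "\<lambda>x. c * x"]) (auto intro!: continuous_intros)

lemma Cc_mult: "f \<in> Cc ==> continuous_on UNIV g ==> (\<lambda>x. f x * g x) \<in> Cc"
 unfolding Cc_def by (auto intro!: continuous_intros)

lemma Cc_zero: "(\<lambda>x. 0) \<in> Cc"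
 unfolding Cc_def by (auto intro!: exI[of _ "{}"])

lemma Cc_translate:
 fixes f :: "'g::topological_group_add => complex"
 assumes "f \<in> Cc"
 shows "(\<lambda>y. f (x + y)) \<in> Cc"
proof -
 from CcE[OF assms] obtain K where K: "compact K" "\<And>x. x \<notin> K ==> f x = 0" by blast
 have "continuous_on UNIV (\<lambda>y. f (x + y))"
  by (rule continuous_on_compose2[OF Cc_continuous[OF assms]]) (auto intro!: continuous_intros)
 moreover have "f (x + y) = 0" if "y \<notin> (+) (-x) ` K" for y
  using K(2)[of "x + y"] that unfolding left_translate_image by auto
 ultimately show ?thesis unfolding Cc_def using compact_left_translate[OF K(1), of "-x"] by blast
qed

lemma Cc_bounded:
 assumes "f \<in> Cc"
 obtains M where "M > 0" "\<And>x. cmod (f x) \<le> M"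
proof -
 from CcE[OF assms] obtain K where K: "compact K" "\<And>x. x \<notin> K ==> f x = 0" by blast
 have "compact (f ` K)"
  by (intro compact_continuous_image K continuous_on_subset[OF Cc_continuous[OF assms]]) auto
 then have "bounded (f ` K)" by (rule compact_imp_bounded)
 then obtain M where M: "\<And>x. x \<in> K ==> cmod (f x) \<le> M"
  unfolding bounded_iff by blast
 show thesis
 proof (rule that[of "\<bar>M\<bar> + 1"])
  show "cmod (f x) \<le> \<bar>M\<bar> + 1" for x
   using M[of x] K(2)[of x] by (cases "x \<in> K") auto
 qed auto
qed

text \<open>The map \<open>a\<close> stands for a left or a right translation, so that both kinds of
  uniform continuity come from one argument. A tube around the compact support settles the points x
  in it; a symmetric neighbourhood settles those with a v x in it, by moving back with - v.\<close>

lemma Cc_uniform_aux: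
 fixes f :: "'g::topological_group_add => complex" and a :: "'g => 'g => 'g"
 assumes f: "f \<in> Cc" and e: "e > 0"
  and a: "continuous_on UNIV (\<lambda>z. a (fst z) (snd z))" "\<And>x. a 0 x = x" "\<And>v x. a (- v) (a v x) = x"
 obtains V where "open V" "0 \<in> V" "\<And>v x. v \<in> V ==> cmod (f (a v x) - f x) < e"
proof -
 from CcE[OF f] obtain K where K: "compact K" "\<And>x. x \<notin> K ==> f x = 0" by blast
 have "continuous_on UNIV (\<lambda>z. (snd z, fst z))" by (intro continuous_intros)
 have sw: "continuous_on UNIV (\<lambda>z. a (snd z) (fst z))"
  by (rule continuous_on_compose2[OF a(1), of UNIV "\<lambda>z. (snd z, fst z)", simplified])
    (auto intro!: continuous_intros)
 have fc: "continuous_on UNIV f" using f by (rule Cc_continuous)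
 have "continuous_on UNIV (\<lambda>z. f (a (snd z) (fst z)) - f (fst z))"
  by (intro continuous_intros continuous_on_compose2[OF fc sw] continuous_on_compose2[OF fc continuous_on_fst]) auto
 from open_tube_set[OF this K(1) open_ball[of 0 e], of 0] obtain V where
  V0: "open V" "0 \<in> V" "\<And>x v. x \<in> K ==> v \<in> V ==> f (a v x) - f x \<in> ball 0 e"
  using a(2) e by (metis (no_types, lifting) centre_in_ball diff_self fst_conv snd_conv)
 then have V: "open V" "0 \<in> V" "\<And>x v. x \<in> K ==> v \<in> V ==> cmod (f (a v x) - f x) < e"
  by (auto simp: dist_norm norm_minus_commute)
 define W where "W = V \<inter> uminus -` V"
 show thesis
 proof (rule that[of W])
  show "open W" unfolding W_def
   by (intro open_Int V(1) open_vimage) (auto intro!: continuous_intros)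
  show "0 \<in> W" using V(2) unfolding W_def by simp
  show "cmod (f (a v x) - f x) < e" if v: "v \<in> W" for v x
  proof (cases "x \<in> K")
   case True
   then show ?thesis using V(3) v unfolding W_def by simp
  next
   case nx: False
   show ?thesis
   proof (cases "a v x \<in> K")
    case True
    then have "cmod (f (a (-v) (a v x)) - f (a v x)) < e" using V(3) v unfolding W_def by blast
    then show ?thesis using a(3) by (simp add: norm_minus_commute)
   next
    case False
    then show ?thesis using nx K(2) e by simp
   qed
  qed
 qed
qed

lemma Cc_uniform_left:
 fixes f :: "'g::topological_group_add => complex"
 assumes f: "f \<in> Cc" and e: "e > 0"
 obtains V where "open V" "0 \<in> V" "\<And>v x. v \<in> V ==> cmod (f (v + x) - f x) < e"
 by (rule Cc_uniform_aux[OF f e, of "\<lambda>v x. v + x"]) (auto simp: add.assoc[symmetric] intro!: continuous_intros)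

lemma Cc_uniform_right:
 fixes f :: "'g::topological_group_add => complex"
 assumes f: "f \<in> Cc" and e: "e > 0"
 obtains V where "open V" "0 \<in> V" "\<And>v x. v \<in> V ==> cmod (f (x + v) - f x) < e"
 by (rule Cc_uniform_aux[OF f e, of "\<lambda>v x. x + v"]) (auto simp: add.assoc intro!: continuous_intros)

text \<open>Finitely many translates of \<open>V\<close> cover the compact set, and each point is
  sent to the base point of one of them. A Borel map with finite range turns integrals into finite
  sums; it is the source of all Riemann sums below.\<close>

lemma borel_selector:
 fixes T :: "'g::{topological_group_add,t2_space} set"
 assumes "compact T" "open V" "0 \<in> V"
 obtains \<tau> where "finite (range \<tau>)" "\<And>y. {t. \<tau> t = y} \<in> sets borel"
  "\<And>t. t \<in> T ==> - \<tau> t + t \<in> V" "\<And>t. t \<in> T ==> \<tau> t \<in> T"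
proof -
 define O' where "O' = (\<lambda>s. {t. - s + t \<in> V})"
 have op: "open (O' s)" for s
 proof -
  have "O' s = (\<lambda>t. - s + t) -` V" unfolding O'_def by auto
  then show ?thesis using open_vimage[OF assms(2), of "\<lambda>t. - s + t"] by (simp add: continuous_intros)
 qed
 have "T \<subseteq> (\<Union>s\<in>T. O' s)" using assms(3) unfolding O'_def by auto
 then obtain F where F: "F \<subseteq> T" "finite F" "T \<subseteq> (\<Union>s\<in>F. O' s)"
  by (rule compactE_image[OF assms(1) op])
 have "\<exists>\<tau>. finite (range \<tau>) \<and> (\<forall>y. {t. \<tau> t = y} \<in> sets borel) \<and>
   (\<forall>t\<in>(\<Union>s\<in>F. O' s). - \<tau> t + t \<in> V \<and> \<tau> t \<in> F)"
  using F(2)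
 proof (induction F rule: finite_induct)
  case empty
  show ?case by (intro exI[of _ "\<lambda>_. 0"]) auto
 next
  case (insert s F)
  then obtain \<tau> where \<tau>: "finite (range \<tau>)" "\<And>y. {t. \<tau> t = y} \<in> sets borel"
   "\<And>t. t \<in> (\<Union>s\<in>F. O' s) ==> - \<tau> t + t \<in> V \<and> \<tau> t \<in> F" by blast
  define \<sigma> where "\<sigma> = (\<lambda>t. if t \<in> O' s then s else \<tau> t)"
  have "range \<sigma> \<subseteq> insert s (range \<tau>)" unfolding \<sigma>_def by auto
  then have "finite (range \<sigma>)" using \<tau>(1) by (meson finite_insert finite_subset)
  moreover have "{t. \<sigma> t = y} \<in> sets borel" for y
  proof -
   have "{t. \<sigma> t = y} = ((if s = y then UNIV else {}) \<inter> O' s) \<union> ({t. \<tau> t = y} - O' s)"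
    unfolding \<sigma>_def by auto
   also have "\<dots> \<in> sets borel" using \<tau>(2)[of y] op[of s] by auto
   finally show ?thesis .
  qed
  moreover have "- \<sigma> t + t \<in> V \<and> \<sigma> t \<in> insert s F" if "t \<in> (\<Union>s\<in>insert s F. O' s)" for t
   using \<tau>(3)[of t] that unfolding \<sigma>_def by (auto simp: O'_def)
  ultimately show ?case by blast
 qed
 then obtain \<tau> where "finite (range \<tau>)" "\<And>y. {t. \<tau> t = y} \<in> sets borel"
  "\<And>t. t \<in> (\<Union>s\<in>F. O' s) ==> - \<tau> t + t \<in> V \<and> \<tau> t \<in> F" by blast
 then show thesis using F by (intro that[of \<tau>]) blast+
qed

lemma less_add_ennreal: "a < \<infinity> ==> 0 < e ==> a < a + ennreal e"
 by (cases a) (auto simp: ennreal_plus[symmetric] ennreal_less_iff simp del: ennreal_plus)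

lemma diff_less_ennreal:
 assumes "a < b + ennreal e" "b < \<infinity>" "0 < e"
 shows "a - b < ennreal e"
proof (cases "a \<le> b")
 case True
 then show ?thesis using assms by (simp add: diff_eq_0_ennreal)
next
 case False
 obtain r where r: "b = ennreal r" "r \<ge> 0" using assms(2) by (cases b) auto
 have "a < \<infinity>" using assms(1,2) by (auto simp: less_top[symmetric])
 then obtain q where q: "a = ennreal q" "q \<ge> 0" by (cases a) auto
 have "q < r + e" using assms(1,3) r q by (simp add: ennreal_plus[symmetric] ennreal_less_iff del: ennreal_plus)
 then show ?thesis using r q assms(3) by (simp add: ennreal_minus ennreal_lessI)
qed

locale haar =
 fixes \<mu> :: "'g::{topological_group_add,t2_space} measure"
 assumes locally_compact: "locally compact (UNIV :: 'g set)"
  and left_haar: "left_haar_measure \<mu>"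
begin

abbreviation haar_integral (binder "LI " 10) where
 "haar_integral f \<equiv> integral\<^sup>L \<mu> f"

lemma sets_haar [simp, measurable_cong]: "sets \<mu> = sets borel"
 using left_haar unfolding left_haar_measure_def by simp

lemma space_haar [simp]: "space \<mu> = UNIV"
 using sets_eq_imp_space_eq[OF sets_haar] by simp

lemma measurable_haar [simp]: "measurable \<mu> M = measurable borel M"
 by (rule measurable_cong_sets) auto

lemma emeasure_compact: "compact K ==> emeasure \<mu> K < \<infinity>"
 using left_haar unfolding left_haar_measure_def by simp

lemma emeasure_outer:
 "A \<in> sets borel ==> emeasure \<mu> A = (INF U\<in>{U. open U \<and> A \<subseteq> U}. emeasure \<mu> U)"
 using left_haar[unfolded left_haar_measure_def] by metis

lemma emeasure_inner_open:
 "open U ==> emeasure \<mu> U = (SUP K\<in>{K. compact K \<and> K \<subseteq> U}. emeasure \<mu> K)"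
 using left_haar[unfolded left_haar_measure_def] by metis

lemma emeasure_left_translate: "A \<in> sets borel ==> emeasure \<mu> ((+) x ` A) = emeasure \<mu> A"
 using left_haar[unfolded left_haar_measure_def] by metis

lemma compact_borel: "compact K ==> K \<in> sets borel" for K :: "'g set"
 by (simp add: borel_closed compact_imp_closed)

lemma compact_neighbourhood:
 fixes x :: 'g
 assumes "open U" "x \<in> U"
 obtains V C where "open V" "compact C" "x \<in> V" "V \<subseteq> C" "C \<subseteq> U"
proof -
 have "openin (top_of_set UNIV) U" using assms by simp
 from locallyE[OF locally_compact this assms(2)] obtain V C where
  "openin (top_of_set UNIV) V" "compact C" "x \<in> V" "V \<subseteq> C" "C \<subseteq> U" by metis
 then show thesis using that by simp
qed

lemma continuous_borel: "continuous_on UNIV f ==> f \<in> borel_measurable borel"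
 for f :: "'g => 'b::topological_space"
 by (rule borel_measurable_continuous_onI)

lemma add_measurable: "(\<lambda>y. x + y) \<in> measurable borel (borel :: 'g measure)" for x :: 'g
 by (rule continuous_borel) (intro continuous_intros)

lemma borel_translate: "A \<in> sets borel ==> (+) x ` A \<in> sets borel" for A :: "'g set"
proof -
 assume A: "A \<in> sets borel"
 have "(\<lambda>y. - x + y) -` A \<inter> space borel \<in> sets borel" using add_measurable A by (rule measurable_sets)
 moreover have "(\<lambda>y. - x + y) -` A \<inter> space borel = (+) x ` A" unfolding left_translate_image by auto
 ultimately show ?thesis by simp
qed

lemma distr_translate: "distr \<mu> \<mu> (\<lambda>y. x + y) = \<mu>"
proof (rule measure_eqI)
 fix A assume "A \<in> sets (distr \<mu> \<mu> (\<lambda>y. x + y))"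
 then have A: "A \<in> sets borel" by simp
 have "emeasure (distr \<mu> \<mu> (\<lambda>y. x + y)) A = emeasure \<mu> ((\<lambda>y. x + y) -` A)"
  using A add_measurable[of x] by (subst emeasure_distr) (auto cong: measurable_cong_sets)
 also have "(\<lambda>y. x + y) -` A = (+) (- x) ` A" unfolding left_translate_image by auto
 also have "emeasure \<mu> \<dots> = emeasure \<mu> A" using A by (rule emeasure_left_translate)
 finally show "emeasure (distr \<mu> \<mu> (\<lambda>y. x + y)) A = emeasure \<mu> A" .
qed simp

lemma add_measurable_haar: "(\<lambda>y. x + y) \<in> measurable \<mu> \<mu>"
 using add_measurable[of x] by (auto cong: measurable_cong_sets)

lemma measurable_translate:
 "f \<in> measurable borel M ==> (\<lambda>y. f (x + y)) \<in> measurable borel M" for x :: 'g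
 using measurable_compose[OF add_measurable[of x]] by blast

lemma nn_integral_translate:
 assumes "f \<in> borel_measurable borel"
 shows "(\<integral>\<^sup>+ y. f (x + y) \<partial>\<mu>) = (\<integral>\<^sup>+ y. f y \<partial>\<mu>)"
proof -
 have "(\<integral>\<^sup>+ y. f y \<partial>\<mu>) = (\<integral>\<^sup>+ y. f y \<partial>distr \<mu> \<mu> (\<lambda>y. x + y))" by (simp add: distr_translate)
 also have "\<dots> = (\<integral>\<^sup>+ y. f (x + y) \<partial>\<mu>)"
  using assms by (intro nn_integral_distr add_measurable_haar) simp
 finally show ?thesis by simp
qed

lemma integrable_translate:
 fixes f :: "'g => 'b::{banach, second_countable_topology}"
 assumes "integrable \<mu> f"
 shows "integrable \<mu> (\<lambda>y. f (x + y))"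
 by (rule integrable_distr[OF add_measurable_haar]) (simp add: distr_translate assms)

lemma integral_translate:
 fixes f :: "'g => 'b::{banach, second_countable_topology}"
 shows "(LI y. f (x + y)) = (LI y. f y)"
proof (cases "f \<in> borel_measurable borel")
 case True
 have "(LI y. f y) = (\<integral> y. f y \<partial>distr \<mu> \<mu> (\<lambda>y. x + y))" by (simp add: distr_translate)
 also have "\<dots> = (LI y. f (x + y))"
  using True by (intro integral_distr add_measurable_haar) simp
 finally show ?thesis by simp
next
 case False
 \<comment> \<open>Translating back shows that measurability fails for both functions or for none;
   when it fails, both integrals have the default value 0.\<close>
 have "(\<lambda>y. f (x + y)) \<notin> borel_measurable borel"
 proof
  assume "(\<lambda>y. f (x + y)) \<in> borel_measurable borel"
  from measurable_translate[OF this, of "- x"] show False using False by (simp add: add.assoc[symmetric])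
 qed
 then have "\<not> integrable \<mu> f" "\<not> integrable \<mu> (\<lambda>y. f (x + y))"
  using False borel_measurable_integrable by force+
 then show ?thesis by (simp add: not_integrable_integral_eq)
qed

text \<open>Finitely many translates of a nonempty open set cover a given compact set. A null open
  set would make all compact sets null and then, by inner regularity, the whole group.\<close>

lemma emeasure_open_pos:
 assumes U: "open U" "U \<noteq> {}"
 shows "emeasure \<mu> U > 0"
proof (rule ccontr)
 assume "\<not> emeasure \<mu> U > 0"
 then have z: "emeasure \<mu> U = 0" by (simp add: not_gr_zero)
 have cz: "emeasure \<mu> K = 0" if K: "compact K" for K
 proof -
  obtain u where u: "u \<in> U" using U by blast
  have op: "open ((+) x ` U)" for x
  proof -
   have "(+) x ` U = (\<lambda>y. - x + y) -` U" unfolding left_translate_image by auto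
   then show ?thesis using open_vimage[OF U(1), of "\<lambda>y. - x + y"] by (simp add: continuous_intros)
  qed
  have cov: "K \<subseteq> (\<Union>x\<in>UNIV. (+) x ` U)"
  proof
   fix k :: 'g
   have "k = (k + - u) + u" by (simp add: add.assoc)
   then show "k \<in> (\<Union>x\<in>UNIV. (+) x ` U)" using u by blast
  qed
  obtain F where F: "finite F" "K \<subseteq> (\<Union>x\<in>F. (+) x ` U)"
   by (rule compactE_image[OF K op cov])
  have "emeasure \<mu> K \<le> emeasure \<mu> (\<Union>x\<in>F. (+) x ` U)"
   using F op by (intro emeasure_mono) auto
  also have "\<dots> \<le> (\<Sum>x\<in>F. emeasure \<mu> ((+) x ` U))"
   using F op by (intro emeasure_subadditive_finite) auto
  also have "\<dots> = 0" using z emeasure_left_translate[of U] U by simp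
  finally show ?thesis by simp
 qed
 have "emeasure \<mu> UNIV = (SUP K\<in>{K. compact K \<and> K \<subseteq> UNIV}. emeasure \<mu> K)"
  by (rule emeasure_inner_open) simp
 also have "\<dots> = (SUP K\<in>{K::'g set. compact K \<and> K \<subseteq> UNIV}. 0)" using cz by (intro SUP_cong) auto
 also have "\<dots> = 0" by (rule cSUP_const) (auto intro!: exI[of _ "{}"])
 finally have "emeasure \<mu> UNIV = 0" .
 then show False using left_haar[unfolded left_haar_measure_def] by metis
qed

lemma outer_open:
 assumes A: "A \<in> sets borel" "emeasure \<mu> A < \<infinity>" and e: "(e::real) > 0"
 obtains U where "open U" "A \<subseteq> U" "emeasure \<mu> U < \<infinity>" "emeasure \<mu> (U - A) < ennreal e"
proof -
 have "(INF U\<in>{U. open U \<and> A \<subseteq> U}. emeasure \<mu> U) < emeasure \<mu> A + ennreal e"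
  unfolding emeasure_outer[OF A(1), symmetric] by (rule less_add_ennreal[OF A(2) e])
 then obtain U where U: "open U" "A \<subseteq> U" "emeasure \<mu> U < emeasure \<mu> A + ennreal e"
  unfolding INF_less_iff by auto
 then have fin: "emeasure \<mu> U < \<infinity>" using A(2) by (simp add: less_top order_less_trans)
 have "emeasure \<mu> (U - A) = emeasure \<mu> U - emeasure \<mu> A"
  using A U by (intro emeasure_Diff) auto
 also have "\<dots> < ennreal e" by (rule diff_less_ennreal[OF U(3) A(2) e])
 finally show thesis using that U fin by blast
qed

text \<open>Inner regularity is given for open sets and has to be transferred to \<open>A\<close>.
  Enclose \<open>A\<close> in an open \<open>U\<close> of finite measure, approximate
  \<open>U\<close> from inside by a compact \<open>L\<close>, and remove from \<open>L\<close> an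
  open \<open>W\<close> that covers U - A with little excess.\<close>

lemma inner_compact:
 assumes A: "A \<in> sets borel" "emeasure \<mu> A < \<infinity>" and e: "(e::real) > 0"
 obtains K where "compact K" "K \<subseteq> A" "emeasure \<mu> (A - K) < ennreal e"
proof -
 obtain U where U: "open U" "A \<subseteq> U" "emeasure \<mu> U < \<infinity>"
  by (rule outer_open[OF A zero_less_one])
 have "emeasure \<mu> (U - A) < \<infinity>"
  using emeasure_mono[of "U - A" U \<mu>] U by (simp add: order_le_less_trans)
 moreover have "U - A \<in> sets borel" using U A by auto
 ultimately obtain W where W: "open W" "U - A \<subseteq> W" "emeasure \<mu> W < \<infinity>" "emeasure \<mu> (W - (U - A)) < ennreal (e/2)"
  using outer_open[of "U - A" "e/2"] e by (metis half_gt_zero)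
 have "\<exists>L. compact L \<and> L \<subseteq> U \<and> emeasure \<mu> (U - L) < ennreal (e/2)"
 proof -
  have "emeasure \<mu> U < (SUP K\<in>{K. compact K \<and> K \<subseteq> U}. emeasure \<mu> K) + ennreal (e/2)"
   unfolding emeasure_inner_open[OF U(1), symmetric] using less_add_ennreal[OF U(3), of "e/2"] e by simp
  then have "emeasure \<mu> U < (SUP K\<in>{K. compact K \<and> K \<subseteq> U}. emeasure \<mu> K + ennreal (e/2))"
   by (subst ennreal_SUP_add_left) (auto intro!: exI[of _ "{}"])
  then obtain L where L: "compact L" "L \<subseteq> U" "emeasure \<mu> U < emeasure \<mu> L + ennreal (e/2)"
   unfolding less_SUP_iff by auto
  have "emeasure \<mu> (U - L) = emeasure \<mu> U - emeasure \<mu> L"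
   using L U emeasure_compact[OF L(1)] compact_borel[OF L(1)] by (intro emeasure_Diff) auto
  also have "\<dots> < ennreal (e/2)"
   using L(3) emeasure_compact[OF L(1)] e by (intro diff_less_ennreal) auto
  finally show ?thesis using L by blast
 qed
 then obtain L where L: "compact L" "L \<subseteq> U" "emeasure \<mu> (U - L) < ennreal (e/2)" by blast
 show thesis
 proof (rule that[of "L - W"])
  show "compact (L - W)" using L W by (simp add: compact_diff)
  show "L - W \<subseteq> A" using L W by auto
  have "emeasure \<mu> (A - (L - W)) \<le> emeasure \<mu> ((U - L) \<union> (W - (U - A)))"
   using U W L A compact_borel[OF L(1)] by (intro emeasure_mono) auto
  also have "\<dots> \<le> emeasure \<mu> (U - L) + emeasure \<mu> (W - (U - A))"
   using U W A compact_borel[OF L(1)] by (intro emeasure_subadditive) auto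
  also have "\<dots> < ennreal (e/2) + ennreal (e/2)" using L W by (intro add_strict_mono)
  also have "\<dots> = ennreal e" using e by (simp add: ennreal_plus[symmetric] del: ennreal_plus)
  finally show "emeasure \<mu> (A - (L - W)) < ennreal e" .
 qed
qed

text \<open>
 An open set of finite measure is the union of a null set and a \<open>\<sigma>\<close>-compact set; every point of it
 lies in a translate of the latter, since nonempty open sets have positive measure.
\<close>

lemma sigma_compact_cover:
 assumes A: "A \<in> sets borel" "emeasure \<mu> A < \<infinity>"
 obtains K :: "nat => 'g set" where "\<And>n. compact (K n)" "A \<subseteq> (\<Union>n. K n)"
proof -
 obtain U where U: "open U" "A \<subseteq> U" "emeasure \<mu> U < \<infinity>"
  by (rule outer_open[OF A zero_less_one])
 have "\<exists>L. compact L \<and> L \<subseteq> U \<and> emeasure \<mu> (U - L) < ennreal (1 / real (Suc n))" for n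
 proof -
  have "U \<in> sets borel" "1 / real (Suc n) > 0" using U by auto
  then show ?thesis using inner_compact[of U "1 / real (Suc n)"] U(3) by metis
 qed
 then obtain L where L: "\<And>n. compact (L n)" "\<And>n. L n \<subseteq> U"
  "\<And>n. emeasure \<mu> (U - L n) < ennreal (1 / real (Suc n))" by metis
 have null: "emeasure \<mu> (U - (\<Union>n. L n)) = 0"
 proof -
  have *: "emeasure \<mu> (U - (\<Union>n. L n)) \<le> ennreal (1 / real (Suc n))" for n
  proof -
   have "emeasure \<mu> (U - (\<Union>n. L n)) \<le> emeasure \<mu> (U - L n)"
    using U compact_borel[OF L(1)] by (intro emeasure_mono) auto
   then show ?thesis using L(3)[of n] by simp
  qed
  have "emeasure \<mu> (U - (\<Union>n. L n)) \<le> 0 + ennreal e" if "e > 0" for e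
  proof -
   obtain n where "1 / real (Suc n) < e" using nat_approx_posE \<open>e > 0\<close> by blast
   then have "ennreal (1 / real (Suc n)) \<le> ennreal e" by (intro ennreal_leI) simp
   then show ?thesis using *[of n] by simp
  qed
  then have "emeasure \<mu> (U - (\<Union>n. L n)) \<le> 0" by (rule ennreal_le_epsilon)
  then show ?thesis by simp
 qed
 obtain V C where V: "open V" "compact C" "(0::'g) \<in> V" "V \<subseteq> C"
  using compact_neighbourhood[OF open_UNIV, of 0] by (metis UNIV_I)
 show thesis
 proof (rule that[of "\<lambda>n. (\<lambda>(x, y). x + y) ` (L n \<times> uminus ` C)"])
  show "compact ((\<lambda>(x, y). x + y) ` (L n \<times> uminus ` C))" for n
   by (intro compact_add L compact_uminus V)
  show "A \<subseteq> (\<Union>n. (\<lambda>(x, y). x + y) ` (L n \<times> uminus ` C))"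
  proof
   fix x assume "x \<in> A"
   then have x: "x \<in> U" using U by auto
   have "(+) x ` V = (\<lambda>y. - x + y) -` V" unfolding left_translate_image by auto
   then have op: "open ((+) x ` V \<inter> U)"
    using open_vimage[OF V(1), of "\<lambda>y. - x + y"] U by (simp add: continuous_intros open_Int)
   have "x \<in> (+) x ` V \<inter> U" using x V(3) by force
   then have "emeasure \<mu> ((+) x ` V \<inter> U) > 0" using emeasure_open_pos[OF op] by blast
   moreover have "emeasure \<mu> ((+) x ` V \<inter> U) \<le> emeasure \<mu> (U - (\<Union>n. L n))"
    if "(+) x ` V \<inter> (\<Union>n. L n) = {}"
    using that U compact_borel[OF L(1)] by (intro emeasure_mono) auto
   ultimately have "(+) x ` V \<inter> (\<Union>n. L n) \<noteq> {}" using null by auto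
   then obtain v n where v: "v \<in> V" "x + v \<in> L n" by blast
   have "x = (x + v) + - v" by (simp add: add.assoc)
   then show "x \<in> (\<Union>n. (\<lambda>(x, y). x + y) ` (L n \<times> uminus ` C))"
    using v V(4) by (force intro!: image_eqI[of _ _ "(x + v, - v)"])
  qed
 qed
qed

lemma Cc_integrable:
 assumes "f \<in> Cc"
 shows "integrable \<mu> f"
proof -
 from CcE[OF assms] obtain K where K: "compact K" "\<And>x. x \<notin> K ==> f x = 0" by blast
 obtain M where M: "M > 0" "\<And>x. cmod (f x) \<le> M" using Cc_bounded[OF assms] by blast
 have "integrable \<mu> (\<lambda>x. indicator K x *\<^sub>R M)"
  using compact_borel[OF K(1)] emeasure_compact[OF K(1)] by (intro integrable_indicator) auto
 then show ?thesis
  using K M continuous_borel[OF Cc_continuous[OF assms]]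
  by (elim Bochner_Integration.integrable_bound)
    (auto simp: indicator_def intro!: always_eventually)
qed

lemma Urysohn_Cc:
 fixes K U :: "'g set"
 assumes "compact K" "open U" "K \<subseteq> U"
 obtains h :: "'g => real" where "(\<lambda>x. complex_of_real (h x)) \<in> Cc" "\<And>x. 0 \<le> h x" "\<And>x. h x \<le> 1"
  "\<And>x. x \<in> K ==> h x = 1" "\<And>x. x \<notin> U ==> h x = 0"
proof -
 have H: "Hausdorff_space (euclidean :: 'g topology)"
  unfolding Hausdorff_space_def disjnt_def using hausdorff by auto
 have "locally_compact_space (euclidean :: 'g topology)"
  unfolding locally_compact_space_def
 proof (intro ballI)
  fix x :: 'g
  obtain V C where "open V" "compact C" "x \<in> V" "V \<subseteq> C"
   using compact_neighbourhood[OF open_UNIV, of x] by (metis UNIV_I)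
  then show "\<exists>U K. openin euclidean U \<and> compactin euclidean K \<and> x \<in> U \<and> U \<subseteq> K" by auto
 qed
 then have cr: "completely_regular_space (euclidean :: 'g topology)"
  using H locally_compact_regular_imp_completely_regular_space by blast
 \<comment> \<open>The function found below vanishes outside \<open>V\<close>; the compact set
   \<open>C\<close> between \<open>V\<close> and \<open>U\<close> is what makes its support
   compact.\<close>
 obtain V C where VC: "open V" "compact C" "K \<subseteq> V" "V \<subseteq> C" "C \<subseteq> U"
 proof -
  have "\<exists>V C. open V \<and> compact C \<and> x \<in> V \<and> V \<subseteq> C \<and> C \<subseteq> U" if "x \<in> K" for x
   using compact_neighbourhood[OF assms(2), of x] that assms(3) by (metis subsetD)
  then obtain V C where *: "\<And>x. x \<in> K ==> open (V x) \<and> compact (C x) \<and> x \<in> V x \<and> V x \<subseteq> C x \<and> C x \<subseteq> U"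
   by metis
  have 1: "\<And>x. x \<in> K ==> open (V x)" and 2: "K \<subseteq> (\<Union>x\<in>K. V x)" using * by auto
  obtain F where F: "F \<subseteq> K" "finite F" "K \<subseteq> (\<Union>x\<in>F. V x)"
   by (rule compactE_image[OF assms(1) 1 2])
  show thesis
  proof (rule that[of "\<Union>x\<in>F. V x" "\<Union>x\<in>F. C x"])
   show "open (\<Union>x\<in>F. V x)" "(\<Union>x\<in>F. V x) \<subseteq> (\<Union>x\<in>F. C x)" "(\<Union>x\<in>F. C x) \<subseteq> U"
    using * F by blast+
   show "compact (\<Union>x\<in>F. C x)" using * F by (intro compact_UN) auto
  qed (use F in auto)
 qed
 obtain f where f: "continuous_map euclidean (subtopology euclidean {0..1::real}) f" "f ` (-V) \<subseteq> {0}" "f ` K \<subseteq> {1}"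
  by (rule Urysohn_completely_regular_compact_closed[of 0 1 "euclidean::'g topology" K "- V"])
    (use cr assms VC in \<open>auto simp: disjnt_def closed_Compl\<close>)
 have fc: "continuous_on UNIV f" and f01: "\<And>x. 0 \<le> f x \<and> f x \<le> 1"
  using f(1) unfolding continuous_map_in_subtopology by auto
 show thesis
 proof (rule that[of f])
  show "(\<lambda>x. complex_of_real (f x)) \<in> Cc"
   unfolding Cc_def
  proof (intro CollectI conjI exI[of _ C])
   show "continuous_on UNIV (\<lambda>x. complex_of_real (f x))" using fc by (intro continuous_intros)
   show "\<forall>x. x \<notin> C --> complex_of_real (f x) = 0" using f(2) VC by (auto simp: image_subset_iff)
  qed (rule VC)
 qed (use f f01 VC in \<open>auto simp: image_subset_iff\<close>)
qed

end

section \<open>Lebesgue spaces\<close>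

lemma conjugate_exponent:
 fixes p :: real
 assumes "p > 1"
 shows "p / (p - 1) > 1" "1 / p + 1 / (p / (p - 1)) = 1" "(p - 1) * (p / (p - 1)) = p"
  "(p / (p - 1)) / (p / (p - 1) - 1) = p"
proof -
 have "p - 1 > 0" using assms by simp
 then show "p / (p - 1) > 1" "1 / p + 1 / (p / (p - 1)) = 1" "(p - 1) * (p / (p - 1)) = p"
  using assms by (auto simp: field_simps)
 have "p / (p - 1) - 1 = 1 / (p - 1)" using \<open>p - 1 > 0\<close> by (simp add: field_simps)
 then show "(p / (p - 1)) / (p / (p - 1) - 1) = p" using \<open>p - 1 > 0\<close> by simp
qed

text \<open>A crude substitute for Minkowski's inequality. It makes the L^p functions a vector space
  and serves density arguments, where the factor 2^p can be absorbed in the choice of the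
  tolerance.\<close>

lemma powr_norm_add_le:
 fixes a b :: complex
 assumes "p > 0"
 shows "cmod (a + b) powr p \<le> 2 powr p * (cmod a powr p + cmod b powr p)"
proof -
 have "cmod (a + b) \<le> 2 * max (cmod a) (cmod b)" using norm_triangle_ineq[of a b] by linarith
 then have "cmod (a + b) powr p \<le> (2 * max (cmod a) (cmod b)) powr p"
  using assms by (intro powr_mono2) auto
 also have "\<dots> = 2 powr p * max (cmod a) (cmod b) powr p" by (simp add: powr_mult)
 also have "\<dots> \<le> 2 powr p * (cmod a powr p + cmod b powr p)"
  by (intro mult_left_mono) (auto simp: max_def)
 finally show ?thesis .
qed

context haar
begin

lemma Lp_fun_measurable: "f \<in> Lp_fun p \<mu> ==> f \<in> borel_measurable borel"
 unfolding Lp_fun_def by auto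

lemma Lp_fun_integrable: "f \<in> Lp_fun p \<mu> ==> integrable \<mu> (\<lambda>x. cmod (f x) powr p)"
 unfolding Lp_fun_def by auto

lemma Lp_fun_add:
 assumes "p > 0" "f \<in> Lp_fun p \<mu>" "g \<in> Lp_fun p \<mu>"
 shows "(\<lambda>x. f x + g x) \<in> Lp_fun p \<mu>"
  and "(LI x. cmod (f x + g x) powr p) \<le>
   2 powr p * ((LI x. cmod (f x) powr p) + (LI x. cmod (g x) powr p))"
proof -
 note [measurable] = Lp_fun_measurable[OF assms(2)] Lp_fun_measurable[OF assms(3)]
 have i: "integrable \<mu> (\<lambda>x. 2 powr p * (cmod (f x) powr p + cmod (g x) powr p))"
  using Lp_fun_integrable assms by (intro integrable_mult_right Bochner_Integration.integrable_add) auto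
 have j: "integrable \<mu> (\<lambda>x. cmod (f x + g x) powr p)"
  using powr_norm_add_le[OF assms(1)]
  by (intro Bochner_Integration.integrable_bound[OF i]) (auto intro!: always_eventually)
 then show "(\<lambda>x. f x + g x) \<in> Lp_fun p \<mu>" unfolding Lp_fun_def by auto
 have "(LI x. cmod (f x + g x) powr p) \<le> (LI x. 2 powr p * (cmod (f x) powr p + cmod (g x) powr p))"
  using powr_norm_add_le[OF assms(1)] by (intro integral_mono i j) auto
 also have "\<dots> = 2 powr p * ((LI x. cmod (f x) powr p) + (LI x. cmod (g x) powr p))"
  using Lp_fun_integrable assms by (simp add: Bochner_Integration.integral_add)
 finally show "(LI x. cmod (f x + g x) powr p) \<le>
   2 powr p * ((LI x. cmod (f x) powr p) + (LI x. cmod (g x) powr p))" .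
qed

lemma Lp_fun_scale:
 assumes "f \<in> Lp_fun p \<mu>"
 shows "(\<lambda>x. c * f x) \<in> Lp_fun p \<mu>"
proof -
 note [measurable] = Lp_fun_measurable[OF assms]
 show ?thesis
  using Lp_fun_integrable[OF assms] unfolding Lp_fun_def
  by (auto simp: norm_mult powr_mult)
qed

lemma Lp_fun_diff:
 assumes "p > 0" "f \<in> Lp_fun p \<mu>" "g \<in> Lp_fun p \<mu>"
 shows "(\<lambda>x. f x - g x) \<in> Lp_fun p \<mu>"
  and "(LI x. cmod (f x - g x) powr p) \<le>
   2 powr p * ((LI x. cmod (f x) powr p) + (LI x. cmod (g x) powr p))"
 using Lp_fun_add[OF assms(1,2) Lp_fun_scale[OF assms(3), of "-1"]] by auto

lemma Lp_fun_zero: "(\<lambda>x. 0) \<in> Lp_fun p \<mu>"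
 unfolding Lp_fun_def by auto

lemma Lp_fun_sum:
 assumes "p > 0" "finite I" "\<And>i. i \<in> I ==> f i \<in> Lp_fun p \<mu>"
 shows "(\<lambda>x. \<Sum>i\<in>I. f i x) \<in> Lp_fun p \<mu>"
 using assms(2,3) by (induction I rule: finite_induct) (auto intro: Lp_fun_zero Lp_fun_add assms(1))

lemma Lp_fun_translate:
 assumes "f \<in> Lp_fun p \<mu>"
 shows "(\<lambda>y. f (x + y)) \<in> Lp_fun p \<mu>"
 using assms integrable_translate[of "\<lambda>y. cmod (f y) powr p" x] measurable_translate[of f borel x]
 unfolding Lp_fun_def by auto

lemma Lp_norm_translate: "Lp_norm p \<mu> (\<lambda>y. f (x + y)) = Lp_norm p \<mu> f"
 unfolding Lp_norm_def using integral_translate[of "\<lambda>y. cmod (f y) powr p" x] by simp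

lemma Lp_norm_scale: "p > 0 ==> Lp_norm p \<mu> (\<lambda>y. c * f y) = cmod c * Lp_norm p \<mu> f"
 unfolding Lp_norm_def by (simp add: norm_mult powr_mult powr_powr)

lemma Lp_norm_nonneg: "0 \<le> Lp_norm p \<mu> f"
 unfolding Lp_norm_def by simp

lemma Lp_norm_powr: "p > 0 ==> Lp_norm p \<mu> f powr p = (LI x. cmod (f x) powr p)"
 unfolding Lp_norm_def by (simp add: powr_powr)

lemma Lp_norm_leI:
 assumes "p > 0" "c \<ge> 0" "(LI x. cmod (f x) powr p) \<le> c powr p"
 shows "Lp_norm p \<mu> f \<le> c"
proof -
 have "Lp_norm p \<mu> f \<le> (c powr p) powr (1/p)"
  unfolding Lp_norm_def using assms by (intro powr_mono2) auto
 then show ?thesis using assms by (simp add: powr_powr)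
qed

lemma Cc_Lp:
 assumes "p > 0" "f \<in> Cc"
 shows "f \<in> Lp_fun p \<mu>"
proof -
 have "(\<lambda>x. complex_of_real (cmod (f x) powr p)) \<in> Cc"
 proof (rule Cc_compose[OF assms(2)])
  show "continuous_on UNIV (\<lambda>z. complex_of_real (cmod z powr p))"
   using assms(1) by (auto intro!: continuous_intros continuous_on_powr')
 qed (use assms in auto)
 from Cc_integrable[OF this] have "integrable \<mu> (\<lambda>x. cmod (f x) powr p)" by (simp add: complex_of_real_integrable_eq)
 then show ?thesis unfolding Lp_fun_def using continuous_borel[OF Cc_continuous[OF assms(2)]] by auto
qed

lemma indicator_Lp:
 assumes "A \<in> sets borel" "emeasure \<mu> A < \<infinity>"
 shows "(indicator A :: 'g => complex) \<in> Lp_fun p \<mu>"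
  and "(LI x. cmod (indicator A x :: complex) powr p) = measure \<mu> A"
proof -
 have *: "(\<lambda>x. cmod (indicator A x :: complex) powr p) = indicator A" by (auto simp: indicator_def)
 show "(indicator A :: 'g => complex) \<in> Lp_fun p \<mu>"
  unfolding Lp_fun_def mem_Collect_eq * using assms by auto
 show "(LI x. cmod (indicator A x :: complex) powr p) = measure \<mu> A"
  unfolding * using assms by auto
qed

text \<open>Induction along the density of the span of the indicators of compact sets. The limit
  case is phrased with the integral of the p-th power, so that it combines with
  \<open>powr_norm_add_le\<close> without roots.\<close>

lemma Lp_induct [consumes 2, case_names indicator add scale limit]:
 assumes p: "p > 0" and f: "f \<in> Lp_fun p \<mu>"
  and ind: "\<And>K. compact K ==> P (indicator K)"
  and add: "\<And>f g. f \<in> Lp_fun p \<mu> ==> g \<in> Lp_fun p \<mu> ==> P f ==> P g ==> P (\<lambda>x. f x + g x)"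
  and scale: "\<And>c f. f \<in> Lp_fun p \<mu> ==> P f ==> P (\<lambda>x. c * f x)"
  and lim: "\<And>f. f \<in> Lp_fun p \<mu> ==>
   (\<And>e. e > 0 ==> \<exists>h\<in>Lp_fun p \<mu>. P h \<and> (LI x. cmod (f x - h x) powr p) < e) ==> P f"
 shows "P f"
proof (rule lim[OF f])
 have indA: "P (indicator A)" if A: "A \<in> sets borel" "emeasure \<mu> A < \<infinity>" for A
 proof (rule lim[OF indicator_Lp(1)[OF A]])
  fix e :: real assume e: "e > 0"
  obtain K where K: "compact K" "K \<subseteq> A" "emeasure \<mu> (A - K) < ennreal e" by (rule inner_compact[OF A e])
  have *: "(\<lambda>x. cmod (indicator A x - indicator K x :: complex) powr p) = indicator (A - K)"
   using K(2) by (intro ext) (auto simp: indicator_def)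
  have m: "A - K \<in> sets borel" using A compact_borel[OF K(1)] by auto
  have "(LI x. cmod (indicator A x - indicator K x :: complex) powr p) = measure \<mu> (A - K)"
   unfolding * using m by simp
  also have "\<dots> < e" using K(3) e unfolding measure_def
   by (metis enn2real_less_iff infinity_ennreal_def less_top order_less_trans ennreal_less_top)
  finally show "\<exists>h\<in>Lp_fun p \<mu>. P h \<and> (LI x. cmod (indicator A x - h x) powr p) < e"
   using ind[OF K(1)] indicator_Lp(1)[OF compact_borel[OF K(1)] emeasure_compact[OF K(1)]] by blast
 qed
 have simple: "P s \<and> s \<in> Lp_fun p \<mu>" if s: "simple_function \<mu> s" and si: "\<And>c. c \<noteq> 0 ==> emeasure \<mu> {x. s x = c} < \<infinity>"
  for s :: "'g => complex"
 proof -
  have fin: "finite (range s)" using s by (simp add: simple_function_def)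
  have ms: "{x. s x = c} \<in> sets borel" for c
  proof -
   have "s -` {c} \<inter> space \<mu> \<in> sets \<mu>" by (rule simple_functionD(2)[OF s])
   moreover have "s -` {c} \<inter> space \<mu> = {x. s x = c}" by auto
   ultimately show ?thesis by simp
  qed
  have L: "(indicator {x. s x = c} :: 'g => complex) \<in> Lp_fun p \<mu>" if "c \<noteq> 0" for c
   by (rule indicator_Lp(1)[OF ms si[OF that]])
  have S: "P (\<lambda>x. \<Sum>c\<in>F. c * indicator {x. s x = c} x)" if "finite F" "0 \<notin> F" for F
   using that
  proof (induction F rule: finite_induct)
   case empty
   have "(indicator {} :: 'g => complex) = (\<lambda>x. 0)" by auto
   then show ?case using ind[OF compact_empty] by simp
  next
   case (insert c F)
   have "(\<lambda>x. \<Sum>c\<in>F. c * indicator {x. s x = c} x) \<in> Lp_fun p \<mu>"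
    by (intro Lp_fun_sum p Lp_fun_scale L) (use insert in auto)
   then have "P (\<lambda>x. c * indicator {x. s x = c} x + (\<Sum>c\<in>F. c * indicator {x. s x = c} x))"
    by (intro add scale Lp_fun_scale indA ms si L insert.IH) (use insert in auto)
   then show ?case by (simp only: sum.insert[OF insert.hyps(1,2)])
  qed
  have eq: "s = (\<lambda>x. \<Sum>c\<in>range s - {0}. c * indicator {x. s x = c} x)"
  proof
   fix x
   have "(\<Sum>c\<in>range s - {0}. c * indicator {x. s x = c} x) = (\<Sum>c\<in>range s - {0}. if s x = c then c else 0)"
    by (intro sum.cong) (auto simp: indicator_def)
   also have "\<dots> = s x" using fin by (auto simp: sum.delta')
   finally show "s x = (\<Sum>c\<in>range s - {0}. c * indicator {x. s x = c} x)" by simp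
  qed
  have "P (\<lambda>x. \<Sum>c\<in>range s - {0}. c * indicator {x. s x = c} x)" by (rule S) (use fin in auto)
  moreover have "(\<lambda>x. \<Sum>c\<in>range s - {0}. c * indicator {x. s x = c} x) \<in> Lp_fun p \<mu>"
   by (intro Lp_fun_sum p Lp_fun_scale L) (use fin in auto)
  ultimately show ?thesis using eq by simp
 qed
 fix e :: real assume e: "e > 0"
 note [measurable] = Lp_fun_measurable[OF f]
 obtain s where s: "\<And>i. simple_function \<mu> (s i)" "\<And>x. (\<lambda>i. s i x) \<longlonglongrightarrow> f x" "\<And>i x. cmod (s i x) \<le> 2 * cmod (f x)"
  using borel_measurable_implies_sequence_metric[of f \<mu> 0] by auto
 \<comment> \<open>From |s i| \<le> 2 |f|; the right-hand side is the dominating function for the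
   convergence theorem.\<close>
 have s3: "cmod (f x - s i x) powr p \<le> (3 * cmod (f x)) powr p" for i x
  using s(3)[of i x] norm_triangle_ineq4[of "f x" "s i x"] p by (intro powr_mono2) auto
 have fp: "integrable \<mu> (\<lambda>x. (3 * cmod (f x)) powr p)"
  using Lp_fun_integrable[OF f] by (simp add: powr_mult)
 have sm[measurable]: "s i \<in> borel_measurable borel" for i using borel_measurable_simple_function[OF s(1)[of i]] by simp
 \<comment> \<open>Chebyshev: where s i = c the integrable function (2 |f|)^p is at least
   |c|^p.\<close>
 have sfin: "emeasure \<mu> {x. s i x = c} < \<infinity>" if "c \<noteq> 0" for i c
 proof -
  have m: "{x. s i x = c} \<in> sets borel" by measurable
  have ge: "(2 * cmod (f x)) powr p \<ge> cmod c powr p" if "s i x = c" for x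
   using s(3)[of i x] that p by (intro powr_mono2) auto
  have "integrable \<mu> (\<lambda>x. indicator {x. s i x = c} x *\<^sub>R (cmod c powr p))"
  proof (rule Bochner_Integration.integrable_bound[of \<mu> "\<lambda>x. (2 * cmod (f x)) powr p"])
   show "integrable \<mu> (\<lambda>x. (2 * cmod (f x)) powr p)" using Lp_fun_integrable[OF f] by (simp add: powr_mult)
   show "AE x in \<mu>. norm (indicator {x. s i x = c} x *\<^sub>R (cmod c powr p)) \<le> norm ((2 * cmod (f x)) powr p)"
    using ge by (intro always_eventually) (auto simp: indicator_def)
  qed (use m in simp)
  then have "integrable \<mu> (\<lambda>x. indicator {x. s i x = c} x *\<^sub>R (cmod c powr p) / (cmod c powr p))"
   by (rule integrable_divide)
  moreover have "(\<lambda>x. indicator {x. s i x = c} x *\<^sub>R (cmod c powr p) / (cmod c powr p)) = (indicator {x. s i x = c} :: 'g => real)"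
   using that by (auto simp: indicator_def)
  ultimately show ?thesis using m by (simp add: integrable_indicator_iff)
 qed
 have "(\<lambda>i. \<integral>x. cmod (f x - s i x) powr p \<partial>\<mu>) \<longlonglongrightarrow> (LI x. 0)"
 proof (rule integral_dominated_convergence[OF _ _ fp])
  show "AE x in \<mu>. (\<lambda>i. cmod (f x - s i x) powr p) \<longlonglongrightarrow> 0"
  proof (rule always_eventually, rule allI)
   fix x
   have "(\<lambda>i. cmod (f x - s i x)) \<longlonglongrightarrow> 0"
    using tendsto_norm[OF tendsto_diff[OF tendsto_const[of "f x"] s(2)[of x]]] by simp
   then show "(\<lambda>i. cmod (f x - s i x) powr p) \<longlonglongrightarrow> 0"
    using p by (intro tendsto_zero_powrI[where b=p]) auto
  qed
 qed (use s3 in \<open>auto intro!: always_eventually\<close>)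
 then have "\<forall>\<^sub>F i in sequentially. (LI x. cmod (f x - s i x) powr p) < e"
  using e by (intro order_tendstoD) auto
 then obtain i where "(LI x. cmod (f x - s i x) powr p) < e" by (auto simp: eventually_sequentially)
 then show "\<exists>h\<in>Lp_fun p \<mu>. P h \<and> (LI x. cmod (f x - h x) powr p) < e"
  using simple[OF s(1) sfin] by blast
qed

lemma Cc_dense:
 assumes p: "p > 0" and f: "f \<in> Lp_fun p \<mu>" and e: "e > 0"
 obtains h where "h \<in> Cc" "(LI x. cmod (f x - h x) powr p) < e"
proof -
 have "\<forall>e>0. \<exists>h\<in>Cc. (LI x. cmod (f x - h x) powr p) < e"
  using p f
 proof (induction rule: Lp_induct)
  case (indicator K)
  show ?case
  proof (intro allI impI)
   fix e :: real assume e: "e > 0"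
   obtain U where U: "open U" "K \<subseteq> U" "emeasure \<mu> U < \<infinity>" "emeasure \<mu> (U - K) < ennreal e"
    by (rule outer_open[OF compact_borel[OF indicator] emeasure_compact[OF indicator] e])
   obtain h where h: "(\<lambda>x. complex_of_real (h x)) \<in> Cc" "\<And>x. 0 \<le> h x" "\<And>x. h x \<le> 1"
    "\<And>x. x \<in> K ==> h x = 1" "\<And>x. x \<notin> U ==> h x = 0" using Urysohn_Cc[OF indicator U(1,2)] by metis
   have m: "U - K \<in> sets borel" using U compact_borel[OF indicator] by auto
   have fin: "emeasure \<mu> (U - K) < \<infinity>" using U(4) by (simp add: order_less_trans)
   have b: "cmod (indicat_real K x - complex_of_real (h x)) powr p \<le> indicat_real (U - K) x" for x
   proof (cases "x \<in> U - K")
    case True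
    then have "cmod (indicat_real K x - complex_of_real (h x)) \<le> 1" using h(2,3)[of x] by simp
    then have "cmod (indicat_real K x - complex_of_real (h x)) powr p \<le> 1 powr p"
     using p by (intro powr_mono2) auto
    then show ?thesis using True by simp
   next
    case False
    then show ?thesis using h(4,5)[of x] U(2) by (auto simp: indicator_def)
   qed
   have b': "cmod (indicator K x - complex_of_real (h x)) powr p \<le> indicat_real (U - K) x" for x
    using b[of x] by (auto simp: indicator_def)
   have "(\<lambda>x. indicator K x - complex_of_real (h x)) \<in> Lp_fun p \<mu>"
    by (intro Lp_fun_diff p Cc_Lp h indicator_Lp compact_borel emeasure_compact indicator)
   then have "(LI x. cmod (indicator K x - complex_of_real (h x)) powr p) \<le> (LI x. indicat_real (U - K) x)"
    using m fin b' by (intro integral_mono Lp_fun_integrable) auto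
   also have "\<dots> = measure \<mu> (U - K)" using m by simp
   also have "\<dots> < e" using U(4) e fin unfolding measure_def by (simp add: enn2real_less_iff)
   finally show "\<exists>h\<in>Cc. (LI x. cmod (indicator K x - h x) powr p) < e" by (rule bexI[OF _ h(1)])
  qed
 next
  case (add f g)
  show ?case
  proof (intro allI impI)
   fix e :: real assume e: "e > 0"
   define d where "d = e / (2 * 2 powr p)"
   have d: "d > 0" using e unfolding d_def by simp
   obtain h k where hk: "h \<in> Cc" "k \<in> Cc" "(LI x. cmod (f x - h x) powr p) < d" "(LI x. cmod (g x - k x) powr p) < d"
    using add d by blast
   have "(LI x. cmod ((f x - h x) + (g x - k x)) powr p) \<le>
    2 powr p * ((LI x. cmod (f x - h x) powr p) + (LI x. cmod (g x - k x) powr p))"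
    by (intro Lp_fun_add p Lp_fun_diff add Cc_Lp hk)
   also have "\<dots> < 2 powr p * (d + d)" using hk by (intro mult_strict_left_mono) auto
   also have "\<dots> = e" unfolding d_def by (simp add: field_simps)
   finally show "\<exists>h\<in>Cc. (LI x. cmod (f x + g x - h x) powr p) < e"
    using hk by (intro bexI[of _ "\<lambda>x. h x + k x"] Cc_add) (auto simp: algebra_simps)
  qed
 next
  case (scale c f)
  show ?case
  proof (intro allI impI)
   fix e :: real assume e: "e > 0"
   define d where "d = e / (cmod c powr p + 1)"
   have c1: "cmod c powr p + 1 > 0" by (simp add: add_nonneg_pos)
   have d: "d > 0" using e c1 unfolding d_def by simp
   obtain h where h: "h \<in> Cc" "(LI x. cmod (f x - h x) powr p) < d"
    using scale d by blast
   have "(LI x. cmod (c * f x - c * h x) powr p) = cmod c powr p * (LI x. cmod (f x - h x) powr p)"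
    by (simp add: right_diff_distrib[symmetric] norm_mult powr_mult)
   also have "\<dots> \<le> cmod c powr p * d" using h by (intro mult_left_mono) auto
   also have "\<dots> < e" using e c1 unfolding d_def by (simp add: field_simps)
   finally show "\<exists>h\<in>Cc. (LI x. cmod (c * f x - h x) powr p) < e"
    by (rule bexI[OF _ Cc_scale[OF h(1)]])
  qed
 next
  case (limit f)
  show ?case
  proof (intro allI impI)
   fix e :: real assume e: "e > 0"
   define d where "d = e / (2 * 2 powr p)"
   have d: "d > 0" using e unfolding d_def by simp
   obtain g where g: "g \<in> Lp_fun p \<mu>" "\<forall>e>0. \<exists>h\<in>Cc. (LI x. cmod (g x - h x) powr p) < e"
    "(LI x. cmod (f x - g x) powr p) < d" using limit(2)[OF d] by blast
   then obtain h where h: "h \<in> Cc" "(LI x. cmod (g x - h x) powr p) < d" using d by blast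
   have "(LI x. cmod ((f x - g x) + (g x - h x)) powr p) \<le>
    2 powr p * ((LI x. cmod (f x - g x) powr p) + (LI x. cmod (g x - h x) powr p))"
    by (intro Lp_fun_add p Lp_fun_diff limit Cc_Lp g h)
   also have "\<dots> < 2 powr p * (d + d)" using g h by (intro mult_strict_left_mono) auto
   also have "\<dots> = e" unfolding d_def by (simp add: field_simps)
   finally show "\<exists>h\<in>Cc. (LI x. cmod (f x - h x) powr p) < e" using h by auto
  qed
 qed
 then show thesis using that e by blast
qed

text \<open>The partial sums are \<open>Cc\<close> approximants of f at distance 2^-n. By the crude
  triangle inequality consecutive ones differ by at most 4 times the larger distance 2^-(n-1), which
  gives the 8; here 2 \<le> 2^p is used to hide the constants under the p-th power.\<close>

lemma Cc_series:
 assumes p: "p \<ge> 1" and f: "f \<in> Lp_fun p \<mu>" and f1: "(LI x. cmod (f x) powr p) \<le> 1"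
 obtains s :: "nat => 'g => complex" where "\<And>n. s n \<in> Cc" "\<And>n. Lp_norm p \<mu> (s n) \<le> 8 * (1/2) ^ n"
  "(\<lambda>n. \<integral>x. cmod (f x - (\<Sum>k<n. s k x)) powr p \<partial>\<mu>) \<longlonglongrightarrow> 0"
proof -
 have p0: "p > 0" using p by simp
 have two: "2 \<le> (2::real) powr p" using powr_mono[of 1 p 2] p by simp
 define d where "d = (\<lambda>n. ((1/2)::real) ^ n)"
 have d: "d n > 0" for n unfolding d_def by simp
 have "\<exists>h\<in>Cc. (LI x. cmod (f x - h x) powr p) < d n powr p" for n
  by (rule Cc_dense[OF p0 f, of "d n powr p"]) (use d[of n] in auto)
 then obtain h where h: "\<And>n. h n \<in> Cc" "\<And>n. (LI x. cmod (f x - h n x) powr p) < d n powr p" by metis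
 define s where "s = (\<lambda>n. if n = 0 then h 0 else (\<lambda>x. h n x - h (n - 1) x))"
 have sum: "(\<Sum>k<Suc n. s k x) = h n x" for n x
  by (induction n) (auto simp: s_def)
 have quad: "2 powr p * (2 * c powr p) \<le> (4 * c) powr p" if "c \<ge> 0" for c
 proof -
  have "2 powr p * (2 * c powr p) \<le> 2 powr p * (2 powr p * c powr p)"
   using two by (intro mult_left_mono mult_right_mono) auto
  also have "\<dots> = (4 * c) powr p" using powr_mult[of 2 "2 * c" p] powr_mult[of 2 c p] that by (simp add: mult.assoc[symmetric])
  finally show ?thesis .
 qed
 have fh: "(\<lambda>x. f x - h n x) \<in> Lp_fun p \<mu>" for n by (intro Lp_fun_diff p0 f Cc_Lp h)
 show thesis
 proof (rule that[of s])
  show "s n \<in> Cc" for n unfolding s_def using h by (auto intro!: Cc_diff)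
  show "Lp_norm p \<mu> (s n) \<le> 8 * (1/2) ^ n" for n
  proof (cases n)
   case 0
   have "(LI x. cmod (f x - (f x - h 0 x)) powr p) \<le>
    2 powr p * ((LI x. cmod (f x) powr p) + (LI x. cmod (f x - h 0 x) powr p))"
    by (intro Lp_fun_diff p0 fh f)
   also have "\<dots> \<le> 2 powr p * (2 * 1 powr p)"
    using f1 h(2)[of 0] unfolding d_def by (intro mult_left_mono) auto
   also have "\<dots> \<le> (4 * 1) powr p" by (rule quad) simp
   finally have "Lp_norm p \<mu> (h 0) \<le> 4" using p0 by (intro Lp_norm_leI) auto
   then show ?thesis using 0 unfolding s_def by simp
  next
   case (Suc m)
   have "(LI x. cmod ((f x - h m x) - (f x - h (Suc m) x)) powr p) \<le>
    2 powr p * ((LI x. cmod (f x - h m x) powr p) + (LI x. cmod (f x - h (Suc m) x) powr p))"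
    by (intro Lp_fun_diff p0 fh)
   also have "\<dots> \<le> 2 powr p * (2 * d m powr p)"
   proof -
    have "d (Suc m) powr p \<le> d m powr p" using p0 d by (intro powr_mono2) (auto simp: d_def)
    then show ?thesis using h(2)[of m] h(2)[of "Suc m"] by (intro mult_left_mono) auto
   qed
   also have "\<dots> \<le> (4 * d m) powr p" by (rule quad) (use d[of m] in simp)
   finally have "Lp_norm p \<mu> (\<lambda>x. h (Suc m) x - h m x) \<le> 4 * d m"
    using p0 d[of m] by (intro Lp_norm_leI) auto
   then show ?thesis using Suc unfolding s_def d_def by simp
  qed
  have "(\<lambda>n. \<integral>x. cmod (f x - (\<Sum>k<Suc n. s k x)) powr p \<partial>\<mu>) \<longlonglongrightarrow> 0"
  proof (rule tendsto_sandwich[OF _ _ tendsto_const])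
   show "\<forall>\<^sub>F n in sequentially. (LI x. cmod (f x - (\<Sum>k<Suc n. s k x)) powr p) \<le> d n powr p"
    using h(2) unfolding sum by (intro always_eventually) (auto intro: less_imp_le)
   have "(\<lambda>n. d n) \<longlonglongrightarrow> 0" unfolding d_def by (intro LIMSEQ_power_zero) auto
   then show "(\<lambda>n. d n powr p) \<longlonglongrightarrow> 0"
    using p0 less_imp_le[OF d] by (intro tendsto_zero_powrI[where b=p]) auto
  qed (auto intro!: always_eventually)
  then show "(\<lambda>n. \<integral>x. cmod (f x - (\<Sum>k<n. s k x)) powr p \<partial>\<mu>) \<longlonglongrightarrow> 0"
   by (rule LIMSEQ_imp_Suc)
 qed
qed

lemma Hoelder:
 assumes p: "p > 1" and f: "f \<in> Lp_fun p \<mu>" and g: "g \<in> Lp_fun (p / (p - 1)) \<mu>"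
 shows "integrable \<mu> (\<lambda>x. f x * g x)"
  and "(LI x. cmod (f x) * cmod (g x)) \<le> Lp_norm p \<mu> f * Lp_norm (p / (p - 1)) \<mu> g"
  and "cmod (LI x. f x * g x) \<le> Lp_norm p \<mu> f * Lp_norm (p / (p - 1)) \<mu> g"
proof -
 define q where "q = p / (p - 1)"
 have q: "q > 1" "1 / p + 1 / q = 1" using conjugate_exponent[OF p] unfolding q_def by auto
 have g: "g \<in> Lp_fun q \<mu>" using g unfolding q_def .
 note [measurable] = Lp_fun_measurable[OF f] Lp_fun_measurable[OF g]
 have Y: "a * b \<le> a powr p / p + b powr q / q" if "a \<ge> 0" "b \<ge> 0" for a b
  by (rule Youngs_inequality) (use p q that in auto)
 have i0: "integrable \<mu> (\<lambda>x. cmod (f x) powr p / p + cmod (g x) powr q / q)"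
  using Lp_fun_integrable[OF f] Lp_fun_integrable[OF g] by auto
 have i1: "integrable \<mu> (\<lambda>x. f x * g x)"
  using Y p q by (intro Bochner_Integration.integrable_bound[OF i0])
   (auto simp: norm_mult intro!: always_eventually order_trans[OF _ abs_ge_self])
 then show "integrable \<mu> (\<lambda>x. f x * g x)" .
 have i2: "integrable \<mu> (\<lambda>x. cmod (f x) * cmod (g x))"
  using integrable_norm[OF i1] by (simp add: norm_mult)
 have main: "(LI x. cmod (f x) * cmod (g x)) \<le> Lp_norm p \<mu> f * Lp_norm q \<mu> g"
 proof (cases "Lp_norm p \<mu> f = 0 \<or> Lp_norm q \<mu> g = 0")
  case True
  then have "(LI x. cmod (f x) powr p) = 0 \<or> (LI x. cmod (g x) powr q) = 0"
   using Lp_norm_powr[of p f] Lp_norm_powr[of q g] p q by auto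
  then have "(AE x in \<mu>. cmod (f x) powr p = 0) \<or> (AE x in \<mu>. cmod (g x) powr q = 0)"
   using integral_nonneg_eq_0_iff_AE[OF Lp_fun_integrable[OF f]] integral_nonneg_eq_0_iff_AE[OF Lp_fun_integrable[OF g]]
   by auto
  then have "AE x in \<mu>. cmod (f x) * cmod (g x) = 0" by auto
  then have "(LI x. cmod (f x) * cmod (g x)) = 0" by (subst integral_cong_AE[where g="\<lambda>_. 0"]) auto
  then show ?thesis using True Lp_norm_nonneg by auto
 next
  case False
  define A B where "A = Lp_norm p \<mu> f" and "B = Lp_norm q \<mu> g"
  have A: "A > 0" and B: "B > 0" using False Lp_norm_nonneg[of p f] Lp_norm_nonneg[of q g] unfolding A_def B_def by auto
  have If: "(LI x. cmod (f x) powr p) = A powr p" and Ig: "(LI x. cmod (g x) powr q) = B powr q"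
   unfolding A_def B_def using p q by (simp_all add: Lp_norm_powr)
  have "(LI x. cmod (f x) / A * (cmod (g x) / B)) \<le> (LI x. (cmod (f x) powr p / A powr p) / p + (cmod (g x) powr q / B powr q) / q)"
  proof (rule integral_mono)
   show "integrable \<mu> (\<lambda>x. cmod (f x) / A * (cmod (g x) / B))"
    using integrable_divide[OF i2, of "A * B"] by simp
   show "integrable \<mu> (\<lambda>x. cmod (f x) powr p / A powr p / p + cmod (g x) powr q / B powr q / q)"
    using Lp_fun_integrable[OF f] Lp_fun_integrable[OF g] by auto
   show "cmod (f x) / A * (cmod (g x) / B) \<le> cmod (f x) powr p / A powr p / p + cmod (g x) powr q / B powr q / q" for x
    using Y[of "cmod (f x) / A" "cmod (g x) / B"] A B by (simp add: powr_divide)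
  qed
  also have "\<dots> = 1 / p + 1 / q"
   using Lp_fun_integrable[OF f] Lp_fun_integrable[OF g] A B If Ig by (simp add: Bochner_Integration.integral_add)
  finally have "(LI x. cmod (f x) * cmod (g x)) / (A * B) \<le> 1" using q by simp
  then show ?thesis using A B unfolding A_def B_def by (simp add: field_simps)
 qed
 then show "(LI x. cmod (f x) * cmod (g x)) \<le> Lp_norm p \<mu> f * Lp_norm (p / (p - 1)) \<mu> g"
  unfolding q_def .
 have "cmod (LI x. f x * g x) \<le> (LI x. cmod (f x * g x))" by (rule integral_norm_bound)
 with main show "cmod (LI x. f x * g x) \<le> Lp_norm p \<mu> f * Lp_norm (p / (p - 1)) \<mu> g"
  unfolding q_def by (simp add: norm_mult)
qed

text \<open>The function x \<mapsto> \<langle>f, L_x g\<rangle>, a coefficient of the left regular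
  representation. In this form of f * g~ only left translations occur, so that neither inversion of
  the variable of integration nor a modular function enters.\<close>

definition cv :: "('g => complex) => ('g => complex) => 'g => complex" where
 "cv f g = (\<lambda>x. \<integral>y. f y * cnj (g (- x + y)) \<partial>\<mu>)"

lemma convolution_tilde: "convolution \<mu> f (tilde g) = cv f g"
 unfolding convolution_def tilde_def cv_def by (simp add: minus_add)

lemma Lp_fun_cnj: "f \<in> Lp_fun p \<mu> ==> (\<lambda>x. cnj (f x)) \<in> Lp_fun p \<mu>"
 using borel_measurable_continuous_onI[of cnj, THEN measurable_compose[rotated], of f borel]
 unfolding Lp_fun_def by (auto intro: continuous_intros)

lemma Lp_norm_cnj: "Lp_norm p \<mu> (\<lambda>x. cnj (f x)) = Lp_norm p \<mu> f"
 unfolding Lp_norm_def by simp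

lemma cv_integrable:
 assumes p: "p > 1" and f: "f \<in> Lp_fun p \<mu>" and g: "g \<in> Lp_fun (p / (p - 1)) \<mu>"
 shows "integrable \<mu> (\<lambda>y. f y * cnj (g (- x + y)))"
 by (intro Hoelder(1)[OF p f] Lp_fun_cnj Lp_fun_translate g)

lemma cv_bound:
 assumes p: "p > 1" and f: "f \<in> Lp_fun p \<mu>" and g: "g \<in> Lp_fun (p / (p - 1)) \<mu>"
 shows "cmod (cv f g x) \<le> Lp_norm p \<mu> f * Lp_norm (p / (p - 1)) \<mu> g"
 using Hoelder(3)[OF p f Lp_fun_cnj[OF Lp_fun_translate[OF g, of "- x"]]]
 unfolding cv_def Lp_norm_cnj Lp_norm_translate .

lemma cv_add_left:
 assumes p: "p > 1" and f: "f \<in> Lp_fun p \<mu>" "f' \<in> Lp_fun p \<mu>" and g: "g \<in> Lp_fun (p / (p - 1)) \<mu>"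
 shows "cv (\<lambda>y. f y + f' y) g x = cv f g x + cv f' g x"
 unfolding cv_def using cv_integrable[OF p _ g, of _ x] f
 by (simp add: distrib_right Bochner_Integration.integral_add)

lemma cv_add_right:
 assumes p: "p > 1" and f: "f \<in> Lp_fun p \<mu>" and g: "g \<in> Lp_fun (p / (p - 1)) \<mu>" "g' \<in> Lp_fun (p / (p - 1)) \<mu>"
 shows "cv f (\<lambda>y. g y + g' y) x = cv f g x + cv f g' x"
 unfolding cv_def using cv_integrable[OF p f, of _ x] g
 by (simp add: distrib_left Bochner_Integration.integral_add)

lemma cv_scale_left: "cv (\<lambda>y. c * f y) g x = c * cv f g x"
 unfolding cv_def by (simp add: mult.assoc)

lemma cv_scale_right: "cv f (\<lambda>y. c * g y) x = cnj c * cv f g x"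
 unfolding cv_def by (simp add: mult.left_commute)

lemma cv_left_translate: "cv f g (s + x) = cv (\<lambda>y. f (s + y)) g x"
 unfolding cv_def
proof -
 have "- (s + x) + (s + y) = - x + y" for y
  by (simp only: minus_add add.assoc[symmetric] minus_add_cancel add.right_inverse) (simp add: add.assoc)
 then show "(LI y. f y * cnj (g (- (s + x) + y))) = (LI y. f (s + y) * cnj (g (- x + y)))"
  using integral_translate[of "\<lambda>y. f y * cnj (g (- (s + x) + y))" s] by simp
qed

end

section \<open>Atomic decompositions in the Figa-Talamanca--Herz algebra\<close>

text \<open>Absolute summability of the whole family permits its enumeration along
  \<open>prod_decode\<close>. This is how a series of decompositions becomes a single
  decomposition.\<close>

lemma double_sums:
 fixes f :: "nat => nat => 'c::banach"
 assumes f: "\<And>n. summable (\<lambda>i. norm (f n i))" "\<And>n. (\<Sum>i. norm (f n i)) \<le> c n" and c: "summable c"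
  and w: "\<And>n. f n sums w n" "w sums W"
 shows "summable (\<lambda>k. norm (f (fst (prod_decode k)) (snd (prod_decode k))))"
  and "(\<lambda>k. f (fst (prod_decode k)) (snd (prod_decode k))) sums W"
proof -
 have bij: "bij_betw prod_decode UNIV (UNIV \<times> UNIV)" using bij_prod_decode by simp
 have fn: "(\<lambda>i. norm (f n i)) summable_on UNIV" for n
  using f(1) by (subst summable_on_UNIV_nonneg_real_iff) auto
 have fi: "infsum (\<lambda>i. norm (f n i)) UNIV = (\<Sum>i. norm (f n i))" for n
  using norm_summable_imp_has_sum[OF _ summable_sums[OF f(1)[of n]]] f(1) by (intro infsumI) auto
 have cs: "(\<lambda>n. norm (infsum (\<lambda>i. norm (f n i)) UNIV)) summable_on UNIV"
  unfolding fi
 proof (subst summable_on_UNIV_nonneg_real_iff)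
  show "summable (\<lambda>n. norm (\<Sum>i. norm (f n i)))"
   by (rule summable_comparison_test'[OF c, of 0]) (use f suminf_nonneg[OF f(1)] in auto)
 qed auto
 have abs: "(\<lambda>z. norm (f (fst z) (snd z))) summable_on (UNIV \<times> UNIV)"
  unfolding Infinite_Sum.abs_summable_on_Sigma_iff fst_conv snd_conv using fn cs by blast
 have s: "(\<lambda>z. f (fst z) (snd z)) summable_on (UNIV \<times> UNIV)" by (rule abs_summable_summable[OF abs])
 have wi: "infsum (\<lambda>i. f n i) UNIV = w n" for n
  using norm_summable_imp_has_sum[OF f(1) w(1)] by (rule infsumI)
 have wn: "norm (w n) \<le> c n" for n
  using summable_norm[OF f(1)[of n]] f(2)[of n] sums_unique[OF w(1)[of n]] by simp
 have "summable (\<lambda>n. norm (w n))"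
  by (rule summable_comparison_test'[OF c, of 0]) (use wn in auto)
 then have "infsum w UNIV = W"
  using norm_summable_imp_has_sum[OF _ w(2)] infsumI by blast
 then have "infsum (\<lambda>z. f (fst z) (snd z)) (UNIV \<times> UNIV) = W"
  using infsum_Sigma_banach[OF s] wi by simp
 then have "((\<lambda>z. f (fst z) (snd z)) has_sum W) (UNIV \<times> UNIV)"
  using s has_sum_infsum by blast
 then have "((\<lambda>k. f (fst (prod_decode k)) (snd (prod_decode k))) has_sum W) UNIV"
  by (subst has_sum_reindex_bij_betw[OF bij])
 then show "(\<lambda>k. f (fst (prod_decode k)) (snd (prod_decode k))) sums W"
  by (rule has_sum_imp_sums)
 have "(\<lambda>k. norm (f (fst (prod_decode k)) (snd (prod_decode k)))) summable_on UNIV"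
  using summable_on_reindex_bij_betw[OF bij, of "\<lambda>z. norm (f (fst z) (snd z))"] abs by simp
 then show "summable (\<lambda>k. norm (f (fst (prod_decode k)) (snd (prod_decode k))))"
  by (rule summable_on_imp_summable)
qed

lemma norm_integral_le:
 fixes f :: "'a => 'b::{banach, second_countable_topology}"
 assumes "integrable M f" "integrable M g" "\<And>x. x \<in> space M ==> norm (f x) \<le> g x"
 shows "norm (\<integral>x. f x \<partial>M) \<le> (\<integral>x. g x \<partial>M)"
 by (rule order_trans[OF integral_norm_bound integral_mono]) (use assms in auto)

lemma half_powers: "summable (\<lambda>n. c * (1/2::real) ^ n)" "(\<Sum>n. c * (1/2::real) ^ n) = 2 * c"
proof -
 have "(\<lambda>n. c * (1/2::real) ^ n) sums (c * (1 / (1 - 1/2)))" by (intro sums_mult geometric_sums) simp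
 then show "summable (\<lambda>n. c * (1/2::real) ^ n)" "(\<Sum>n. c * (1/2::real) ^ n) = 2 * c"
  by (simp_all add: sums_iff)
qed

locale haar_p = haar \<mu> for \<mu> :: "'g::{topological_group_add,t2_space} measure" +
 fixes p :: real
 assumes p1: "1 < p"
begin

abbreviation Ap where
 "Ap \<equiv> vcarrier (Ap_algebra p \<mu>)"

definition q :: real where "q = p / (p - 1)"

lemma q1: "1 < q" and pq: "1 / p + 1 / q = 1"
 using conjugate_exponent[OF p1] unfolding q_def by auto

lemma p0: "0 < p" and q0: "0 < q"
 using p1 q1 by auto

lemmas cv_bound_p = cv_bound[OF p1, folded q_def]
lemmas cv_add_left_p = cv_add_left[OF p1, folded q_def]
lemmas cv_add_right_p = cv_add_right[OF p1, folded q_def]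

text \<open>The atoms are normalised and the coefficients carry the size, so that scaling and
  summation act on \<open>a\<close> alone. Atoms in \<open>Cc\<close> give access to continuity,
  supports and uniform continuity. The number c is an upper bound and not an infimum; no minimiser
  is ever sought.\<close>

definition decomposition ::
  "(nat => complex) => (nat => 'g => complex) => (nat => 'g => complex) => ('g => complex) => real => bool" where
 "decomposition a f g w c \<longleftrightarrow>
   (\<forall>i. f i \<in> Cc \<and> g i \<in> Cc \<and> Lp_norm p \<mu> (f i) \<le> 1 \<and> Lp_norm q \<mu> (g i) \<le> 1) \<and>
   summable (\<lambda>i. cmod (a i)) \<and> (\<Sum>i. cmod (a i)) \<le> c \<and>
   (\<forall>x. (\<lambda>i. a i * cv (f i) (g i) x) sums w x)"

definition atomic :: "('g => complex) => real => bool" where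
 "atomic w c \<longleftrightarrow> (\<exists>a f g. decomposition a f g w c)"

lemma cv_atom_bound:
 assumes "f \<in> Cc" "g \<in> Cc" "Lp_norm p \<mu> f \<le> 1" "Lp_norm q \<mu> g \<le> 1"
 shows "cmod (cv f g x) \<le> 1"
proof -
 have "cmod (cv f g x) \<le> Lp_norm p \<mu> f * Lp_norm q \<mu> g"
  by (intro cv_bound_p Cc_Lp p0 q0 assms)
 also have "\<dots> \<le> 1 * 1" using assms Lp_norm_nonneg by (intro mult_mono) auto
 finally show ?thesis by simp
qed

lemma atomic_nonneg:
 assumes "atomic w c"
 shows "0 \<le> c"
proof -
 obtain a f g where "decomposition a f g w c" using assms unfolding atomic_def by blast
 then have "summable (\<lambda>i. cmod (a i))" "(\<Sum>i. cmod (a i)) \<le> c" unfolding decomposition_def by blast+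
 then show ?thesis using suminf_nonneg[of "\<lambda>i. cmod (a i)"] by auto
qed

lemma atomic_mono: "atomic w c ==> c \<le> d ==> atomic w d"
 unfolding atomic_def decomposition_def by (meson order_trans)

lemma atomic_bound:
 assumes "atomic w c"
 shows "cmod (w x) \<le> c"
proof -
 obtain a f g where w: "\<And>i::nat. f i \<in> Cc \<and> g i \<in> Cc \<and> Lp_norm p \<mu> (f i) \<le> 1 \<and> Lp_norm q \<mu> (g i) \<le> 1"
  "summable (\<lambda>i. cmod (a i))" "(\<Sum>i. cmod (a i)) \<le> c" "\<And>x. (\<lambda>i. a i * cv (f i) (g i) x) sums w x"
  using assms unfolding atomic_def decomposition_def by blast
 have b: "cmod (a i * cv (f i) (g i) x) \<le> cmod (a i)" for i
  using mult_left_mono[OF cv_atom_bound, of "f i" "g i" "cmod (a i)" x] w(1)[of i] by (simp add: norm_mult)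
 have s: "summable (\<lambda>i. cmod (a i * cv (f i) (g i) x))"
  by (rule summable_comparison_test'[OF w(2), of 0]) (use b in auto)
 have "cmod (w x) \<le> (\<Sum>i. cmod (a i * cv (f i) (g i) x))"
  using summable_norm[OF s] sums_unique[OF w(4)[of x]] by simp
 also have "\<dots> \<le> (\<Sum>i. cmod (a i))" by (intro suminf_le b s w)
 finally show ?thesis using w(3) by linarith
qed

text \<open>Countable subadditivity, which takes the place of completeness of the algebra: sums,
  products, limits of Riemann sums and geometric series are all shown to be members through this
  lemma.\<close>

lemma atomic_sums:
 assumes w: "\<And>n. atomic (w n) (c n)" and c: "summable c" and W: "\<And>x. (\<lambda>n. w n x) sums W x"
 shows "atomic W (suminf c)"
proof -
 obtain a f g where "\<And>n. decomposition (a n) (f n) (g n) (w n) (c n)"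
  using w unfolding atomic_def by metis
 then have fg: "\<And>n i. f n i \<in> Cc \<and> g n i \<in> Cc \<and> Lp_norm p \<mu> (f n i) \<le> 1 \<and> Lp_norm q \<mu> (g n i) \<le> 1"
  and a: "\<And>n. summable (\<lambda>i. cmod (a n i))" "\<And>n. (\<Sum>i. cmod (a n i)) \<le> c n"
  and s: "\<And>n x. (\<lambda>i. a n i * cv (f n i) (g n i) x) sums w n x"
  unfolding decomposition_def by auto
 define A where "A = (\<lambda>k. a (fst (prod_decode k)) (snd (prod_decode k)))"
 define F where "F = (\<lambda>k. f (fst (prod_decode k)) (snd (prod_decode k)))"
 define G where "G = (\<lambda>k. g (fst (prod_decode k)) (snd (prod_decode k)))"
 have a0: "(\<Sum>i. cmod (a n i)) \<ge> 0" for n using suminf_nonneg[OF a(1)] by auto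
 have sa: "summable (\<lambda>n. \<Sum>i. cmod (a n i))"
  by (rule summable_comparison_test'[OF c, of 0]) (use a a0 in auto)
 have A: "summable (\<lambda>k. cmod (A k))" "(\<lambda>k. cmod (A k)) sums (\<Sum>n. \<Sum>i. cmod (a n i))"
  using double_sums[of "\<lambda>n i. cmod (a n i)" c "\<lambda>n. \<Sum>i. cmod (a n i)" "\<Sum>n. \<Sum>i. cmod (a n i)"]
   a c summable_sums[OF sa] summable_sums[OF a(1)] unfolding A_def by simp_all
 have "(\<Sum>k. cmod (A k)) \<le> suminf c"
  using A(2) suminf_le[OF a(2) sa c] by (simp add: sums_iff)
 moreover have "(\<lambda>k. A k * cv (F k) (G k) x) sums W x" for x
 proof -
  have b: "cmod (a n i * cv (f n i) (g n i) x) \<le> cmod (a n i)" for n i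
   using mult_left_mono[OF cv_atom_bound, of "f n i" "g n i" "cmod (a n i)" x] fg[of n i] by (simp add: norm_mult)
  have sb: "summable (\<lambda>i. cmod (a n i * cv (f n i) (g n i) x))" for n
   by (rule summable_comparison_test'[OF a(1)[of n], of 0]) (use b in auto)
  have "(\<Sum>i. cmod (a n i * cv (f n i) (g n i) x)) \<le> c n" for n
   using suminf_le[OF b[of n] sb[of n] a(1)[of n]] a(2)[of n] by linarith
  from double_sums(2)[OF sb this c s W] show ?thesis unfolding A_def F_def G_def .
 qed
 ultimately show ?thesis unfolding atomic_def decomposition_def using A(1) fg
  by (intro exI[of _ A] exI[of _ F] exI[of _ G]) (auto simp: F_def G_def)
qed

lemma atomic_scale:
 assumes "atomic w c"
 shows "atomic (\<lambda>x. b * w x) (cmod b * c)"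
proof -
 obtain a f g where w: "\<And>i::nat. f i \<in> Cc \<and> g i \<in> Cc \<and> Lp_norm p \<mu> (f i) \<le> 1 \<and> Lp_norm q \<mu> (g i) \<le> 1"
  "summable (\<lambda>i. cmod (a i))" "(\<Sum>i. cmod (a i)) \<le> c" "\<And>x. (\<lambda>i. a i * cv (f i) (g i) x) sums w x"
  using assms unfolding atomic_def decomposition_def by blast
 have "summable (\<lambda>i. cmod (b * a i))" "(\<Sum>i. cmod (b * a i)) \<le> cmod b * c"
  using w(2,3) by (auto simp: norm_mult suminf_mult intro: summable_mult mult_left_mono)
 moreover have "(\<lambda>i. (b * a i) * cv (f i) (g i) x) sums (b * w x)" for x
  using sums_mult[OF w(4)[of x], of b] by (simp add: mult.assoc)
 ultimately show ?thesis unfolding atomic_def decomposition_def using w(1)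
  by (intro exI[of _ "\<lambda>i. b * a i"] exI[of _ f] exI[of _ g]) auto
qed

lemma atomic_zero: "atomic (\<lambda>x. 0) 0"
 unfolding atomic_def decomposition_def
 using Cc_zero by (intro exI[of _ "\<lambda>_. 0"] exI[of _ "\<lambda>_ _. 0"]) (auto simp: Lp_norm_def)

lemma atomic_sum:
 assumes "finite I" "\<And>i. i \<in> I ==> atomic (w i) (c i)"
 shows "atomic (\<lambda>x. \<Sum>i\<in>I. w i x) (\<Sum>i\<in>I. c i)"
proof -
 have add: "atomic (\<lambda>x. u x + v x) (c + d)" if u: "atomic u c" and v: "atomic v d" for u v c d
 proof -
  define w where "w = (\<lambda>n. if n = 0 then u else if n = Suc 0 then v else (\<lambda>x. 0))"
  define e where "e = (\<lambda>n. if n = 0 then c else if n = Suc 0 then d else 0)"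
  have e: "e sums (\<Sum>n\<in>{0, Suc 0}. e n)"
   by (rule sums_finite) (auto simp: e_def)
  have "atomic W (suminf e)" if "\<And>x. (\<lambda>n. w n x) sums W x" for W
   by (rule atomic_sums[of w e]) (use u v atomic_zero e that in \<open>auto simp: w_def e_def sums_iff\<close>)
  moreover have "(\<lambda>n. w n x) sums (u x + v x)" for x
  proof -
   have "(\<lambda>n. w n x) sums (\<Sum>n\<in>{0, Suc 0}. w n x)" by (rule sums_finite) (auto simp: w_def)
   then show ?thesis by (simp add: w_def)
  qed
  ultimately show ?thesis using e by (simp add: sums_iff e_def)
 qed
 show ?thesis using assms
  by (induction I rule: finite_induct) (auto intro: atomic_zero add)
qed

lemma atomic_add:
 assumes "atomic u c" "atomic v d"
 shows "atomic (\<lambda>x. u x + v x) (c + d)"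
 using atomic_sum[of "{True, False}" "\<lambda>b. if b then u else v" "\<lambda>b. if b then c else d"] assms by simp

lemma atomic_Cc:
 assumes f: "f \<in> Cc" and g: "g \<in> Cc" and \<alpha>: "Lp_norm p \<mu> f \<le> \<alpha>" and \<beta>: "Lp_norm q \<mu> g \<le> \<beta>"
 shows "atomic (cv f g) (\<alpha> * \<beta>)"
proof -
 have n: "0 \<le> \<alpha>" "0 \<le> \<beta>"
  using \<alpha> \<beta> Lp_norm_nonneg[of p f] Lp_norm_nonneg[of q g] by linarith+
 show ?thesis
 proof (cases "\<alpha> = 0 \<or> \<beta> = 0")
  case True
  have "cmod (cv f g x) \<le> Lp_norm p \<mu> f * Lp_norm q \<mu> g" for x
   by (intro cv_bound_p Cc_Lp p0 q0 f g)
  moreover have "Lp_norm p \<mu> f * Lp_norm q \<mu> g = 0"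
   using True \<alpha> \<beta> Lp_norm_nonneg[of p f] Lp_norm_nonneg[of q g] by auto
  ultimately have "cv f g = (\<lambda>x. 0)" by auto
  then show ?thesis using atomic_zero True by auto
 next
  case False
  then have ab: "\<alpha> > 0" "\<beta> > 0" using n by auto
  define f' g' where "f' = (\<lambda>x. complex_of_real (1 / \<alpha>) * f x)" and "g' = (\<lambda>x. complex_of_real (1 / \<beta>) * g x)"
  have fg: "f' \<in> Cc" "g' \<in> Cc" unfolding f'_def g'_def by (intro Cc_scale f g)+
  have nn: "Lp_norm p \<mu> f' \<le> 1" "Lp_norm q \<mu> g' \<le> 1"
   unfolding f'_def g'_def Lp_norm_scale[OF p0] Lp_norm_scale[OF q0] using \<alpha> \<beta> ab by (simp_all add: norm_divide)
  have eq: "cv f g x = complex_of_real (\<alpha> * \<beta>) * cv f' g' x" for x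
   unfolding f'_def g'_def cv_scale_left cv_scale_right using ab by simp
  define a where "a = (\<lambda>n::nat. if n = 0 then complex_of_real (\<alpha> * \<beta>) else 0)"
  have "(\<lambda>n. cmod (a n)) sums (\<Sum>n\<in>{0}. cmod (a n))" by (rule sums_finite) (auto simp: a_def)
  then have 1: "summable (\<lambda>n. cmod (a n))" "(\<Sum>n. cmod (a n)) \<le> \<alpha> * \<beta>"
   using ab by (auto simp: sums_iff a_def norm_mult)
  have "(\<lambda>n. a n * cv f' g' x) sums (\<Sum>n\<in>{0}. a n * cv f' g' x)" for x by (rule sums_finite) (auto simp: a_def)
  then have "(\<lambda>n. a n * cv f' g' x) sums cv f g x" for x using eq[of x] by (simp add: a_def)
  then show ?thesis unfolding atomic_def decomposition_def using 1 fg nn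
   by (intro exI[of _ a] exI[of _ "\<lambda>_. f'"] exI[of _ "\<lambda>_. g'"]) auto
 qed
qed

lemma cv_sums_left:
 assumes f: "f \<in> Lp_fun p \<mu>" and g: "g \<in> Lp_fun q \<mu>" and s: "\<And>n. s n \<in> Cc"
  and lim: "(\<lambda>n. \<integral>x. cmod (f x - (\<Sum>k<n. s k x)) powr p \<partial>\<mu>) \<longlonglongrightarrow> 0"
 shows "(\<lambda>n. cv (s n) g x) sums cv f g x"
 unfolding sums_def
proof -
 have sL: "s n \<in> Lp_fun p \<mu>" for n by (intro Cc_Lp p0 s)
 have S: "(\<lambda>x. \<Sum>k<n. s k x) \<in> Lp_fun p \<mu>" for n by (intro Lp_fun_sum p0 sL) auto
 have D: "(\<lambda>x. f x - (\<Sum>k<n. s k x)) \<in> Lp_fun p \<mu>" for n by (intro Lp_fun_diff p0 f S)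
 have sum: "cv (\<lambda>x. \<Sum>k<n. s k x) g x = (\<Sum>k<n. cv (s k) g x)" for n
 proof (induction n)
  case 0
  show ?case by (simp add: cv_def)
 next
  case (Suc n)
  have "cv (\<lambda>x. (\<Sum>k<n. s k x) + s n x) g x = cv (\<lambda>x. \<Sum>k<n. s k x) g x + cv (s n) g x"
   by (intro cv_add_left_p S sL g)
  then show ?case using Suc by simp
 qed
 have diff: "cmod (cv f g x - (\<Sum>k<n. cv (s k) g x)) \<le>
  (LI x. cmod (f x - (\<Sum>k<n. s k x)) powr p) powr (1 / p) * Lp_norm q \<mu> g" for n
 proof -
  have "cv (\<lambda>x. (f x - (\<Sum>k<n. s k x)) + (\<Sum>k<n. s k x)) g x = cv (\<lambda>x. f x - (\<Sum>k<n. s k x)) g x + cv (\<lambda>x. \<Sum>k<n. s k x) g x"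
   by (intro cv_add_left_p S D g)
  then have "cv f g x - (\<Sum>k<n. cv (s k) g x) = cv (\<lambda>x. f x - (\<Sum>k<n. s k x)) g x" by (simp add: sum)
  then show ?thesis using cv_bound_p[OF D[of n] g, of x] unfolding Lp_norm_def by simp
 qed
 have "(\<lambda>n. (LI x. cmod (f x - (\<Sum>k<n. s k x)) powr p) powr (1 / p)) \<longlonglongrightarrow> 0"
  using lim p0 by (intro tendsto_zero_powrI[where b="1/p"]) auto
 from tendsto_mult_right[OF this, of "Lp_norm q \<mu> g"]
 have "(\<lambda>n. (LI x. cmod (f x - (\<Sum>k<n. s k x)) powr p) powr (1 / p) * Lp_norm q \<mu> g) \<longlonglongrightarrow> 0" by simp
 then have "(\<lambda>n. cv f g x - (\<Sum>k<n. cv (s k) g x)) \<longlonglongrightarrow> 0"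
  by (rule Lim_null_comparison[OF always_eventually, rotated]) (use diff in simp)
 then have "(\<lambda>n. cv f g x - (cv f g x - (\<Sum>k<n. cv (s k) g x))) \<longlonglongrightarrow> cv f g x - 0"
  by (intro tendsto_diff tendsto_const)
 then show "(\<lambda>n. \<Sum>k<n. cv (s k) g x) \<longlonglongrightarrow> cv f g x" by simp
qed

lemma cv_sums_right:
 assumes f: "f \<in> Lp_fun p \<mu>" and g: "g \<in> Lp_fun q \<mu>" and s: "\<And>n. s n \<in> Cc"
  and lim: "(\<lambda>n. \<integral>x. cmod (g x - (\<Sum>k<n. s k x)) powr q \<partial>\<mu>) \<longlonglongrightarrow> 0"
 shows "(\<lambda>n. cv f (s n) x) sums cv f g x"
 unfolding sums_def
proof -
 have sL: "s n \<in> Lp_fun q \<mu>" for n by (intro Cc_Lp q0 s)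
 have S: "(\<lambda>x. \<Sum>k<n. s k x) \<in> Lp_fun q \<mu>" for n by (intro Lp_fun_sum q0 sL) auto
 have D: "(\<lambda>x. g x - (\<Sum>k<n. s k x)) \<in> Lp_fun q \<mu>" for n by (intro Lp_fun_diff q0 g S)
 have sum: "cv f (\<lambda>x. \<Sum>k<n. s k x) x = (\<Sum>k<n. cv f (s k) x)" for n
 proof (induction n)
  case 0
  show ?case by (simp add: cv_def)
 next
  case (Suc n)
  have "cv f (\<lambda>x. (\<Sum>k<n. s k x) + s n x) x = cv f (\<lambda>x. \<Sum>k<n. s k x) x + cv f (s n) x"
   by (intro cv_add_right_p S sL f)
  then show ?case using Suc by simp
 qed
 have diff: "cmod (cv f g x - (\<Sum>k<n. cv f (s k) x)) \<le>
  Lp_norm p \<mu> f * (LI x. cmod (g x - (\<Sum>k<n. s k x)) powr q) powr (1 / q)" for n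
 proof -
  have "cv f (\<lambda>x. (g x - (\<Sum>k<n. s k x)) + (\<Sum>k<n. s k x)) x = cv f (\<lambda>x. g x - (\<Sum>k<n. s k x)) x + cv f (\<lambda>x. \<Sum>k<n. s k x) x"
   by (intro cv_add_right_p S D f)
  then have "cv f g x - (\<Sum>k<n. cv f (s k) x) = cv f (\<lambda>x. g x - (\<Sum>k<n. s k x)) x" by (simp add: sum)
  then show ?thesis using cv_bound_p[OF f D[of n], of x] unfolding Lp_norm_def by simp
 qed
 have "(\<lambda>n. (LI x. cmod (g x - (\<Sum>k<n. s k x)) powr q) powr (1 / q)) \<longlonglongrightarrow> 0"
  using lim q0 by (intro tendsto_zero_powrI[where b="1/q"]) auto
 from tendsto_mult_left[OF this, of "Lp_norm p \<mu> f"]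
 have "(\<lambda>n. Lp_norm p \<mu> f * (LI x. cmod (g x - (\<Sum>k<n. s k x)) powr q) powr (1 / q)) \<longlonglongrightarrow> 0" by simp
 then have "(\<lambda>n. cv f g x - (\<Sum>k<n. cv f (s k) x)) \<longlonglongrightarrow> 0"
  by (rule Lim_null_comparison[OF always_eventually, rotated]) (use diff in simp)
 then have "(\<lambda>n. cv f g x - (cv f g x - (\<Sum>k<n. cv f (s k) x))) \<longlonglongrightarrow> cv f g x - 0"
  by (intro tendsto_diff tendsto_const)
 then show "(\<lambda>n. \<Sum>k<n. cv f (s k) x) \<longlonglongrightarrow> cv f g x" by simp
qed

text \<open>Both factors are expanded by \<open>Cc_series\<close>. The norms in one expansion add up
  to at most 8 (1 + 1/2 + 1/4 + ...) = 16, and 256 = 16 * 16. Homogeneity reduces the general case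
  to factors of norm 1.\<close>

lemma atomic_cv:
 assumes f: "f \<in> Lp_fun p \<mu>" and g: "g \<in> Lp_fun q \<mu>"
 shows "atomic (cv f g) (256 * (Lp_norm p \<mu> f * Lp_norm q \<mu> g))"
proof -
 have right: "atomic (cv f g) (16 * \<alpha>)"
  if f: "f \<in> Cc" "Lp_norm p \<mu> f \<le> \<alpha>" and g: "g \<in> Lp_fun q \<mu>" "(LI x. cmod (g x) powr q) \<le> 1" for f g \<alpha>
 proof -
  obtain s :: "nat => 'g => complex" where s: "\<And>n. s n \<in> Cc" "\<And>n. Lp_norm q \<mu> (s n) \<le> 8 * (1/2) ^ n"
   "(\<lambda>n. \<integral>x. cmod (g x - (\<Sum>k<n. s k x)) powr q \<partial>\<mu>) \<longlonglongrightarrow> 0"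
   by (rule Cc_series[OF less_imp_le[OF q1] g]) (rule that)
  have "atomic (cv f g) (suminf (\<lambda>n. \<alpha> * 8 * (1/2) ^ n))"
  proof (rule atomic_sums)
   show "atomic (cv f (s n)) (\<alpha> * 8 * (1/2) ^ n)" for n
    using atomic_Cc[OF f(1) s(1) f(2) s(2)] by (simp add: mult.assoc)
   show "(\<lambda>n. cv f (s n) x) sums cv f g x" for x
    by (intro cv_sums_right Cc_Lp p0 f g s)
  qed (rule half_powers)
  then show ?thesis unfolding half_powers by (simp add: mult.commute)
 qed
 have left: "atomic (cv f g) 256"
  if f: "f \<in> Lp_fun p \<mu>" "(LI x. cmod (f x) powr p) \<le> 1" and g: "g \<in> Lp_fun q \<mu>" "(LI x. cmod (g x) powr q) \<le> 1" for f g
 proof -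
  obtain s :: "nat => 'g => complex" where s: "\<And>n. s n \<in> Cc" "\<And>n. Lp_norm p \<mu> (s n) \<le> 8 * (1/2) ^ n"
   "(\<lambda>n. \<integral>x. cmod (f x - (\<Sum>k<n. s k x)) powr p \<partial>\<mu>) \<longlonglongrightarrow> 0"
   by (rule Cc_series[OF less_imp_le[OF p1] f]) (rule that)
  have "atomic (cv f g) (suminf (\<lambda>n. 128 * (1/2) ^ n))"
  proof (rule atomic_sums)
   show "atomic (cv (s n) g) (128 * (1/2) ^ n)" for n
    using right[OF s(1,2) g] by simp
   show "(\<lambda>n. cv (s n) g x) sums cv f g x" for x
    by (intro cv_sums_left f g s)
  qed (rule half_powers)
  then show ?thesis unfolding half_powers by simp
 qed
 define \<alpha> \<beta> where "\<alpha> = Lp_norm p \<mu> f" and "\<beta> = Lp_norm q \<mu> g"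
 have n: "0 \<le> \<alpha>" "0 \<le> \<beta>" unfolding \<alpha>_def \<beta>_def by (rule Lp_norm_nonneg)+
 show ?thesis
 proof (cases "\<alpha> = 0 \<or> \<beta> = 0")
  case True
  have "cmod (cv f g x) \<le> \<alpha> * \<beta>" for x
   unfolding \<alpha>_def \<beta>_def by (intro cv_bound_p f g)
  then have "cv f g = (\<lambda>x. 0)" using True by auto
  then show ?thesis using atomic_zero True unfolding \<alpha>_def \<beta>_def by auto
 next
  case False
  then have ab: "\<alpha> > 0" "\<beta> > 0" using n by auto
  define f' g' where "f' = (\<lambda>x. complex_of_real (1 / \<alpha>) * f x)" and "g' = (\<lambda>x. complex_of_real (1 / \<beta>) * g x)"
  have fg: "f' \<in> Lp_fun p \<mu>" "g' \<in> Lp_fun q \<mu>" unfolding f'_def g'_def by (intro Lp_fun_scale f g)+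
  have nn: "Lp_norm p \<mu> f' = 1" "Lp_norm q \<mu> g' = 1"
   unfolding f'_def g'_def Lp_norm_scale[OF p0] Lp_norm_scale[OF q0] using ab
   by (simp_all add: norm_divide \<alpha>_def[symmetric] \<beta>_def[symmetric])
  then have "(LI x. cmod (f' x) powr p) \<le> 1" "(LI x. cmod (g' x) powr q) \<le> 1"
   using Lp_norm_powr[OF p0, of f'] Lp_norm_powr[OF q0, of g'] by auto
  then have a: "atomic (cv f' g') 256" by (intro left fg)
  have eq: "cv f g = (\<lambda>x. complex_of_real (\<alpha> * \<beta>) * cv f' g' x)"
   unfolding f'_def g'_def cv_scale_left cv_scale_right using ab by (simp add: fun_eq_iff)
  show ?thesis unfolding eq using atomic_scale[OF a, of "complex_of_real (\<alpha> * \<beta>)"] ab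
   by (simp add: \<alpha>_def[symmetric] \<beta>_def[symmetric] norm_mult mult.commute)
 qed
qed

lemma cv_Cc:
 assumes f: "f \<in> Cc" and g: "g \<in> Cc"
 shows "cv f g \<in> Cc"
proof -
 from CcE[OF f] obtain K where K: "compact K" "\<And>x. x \<notin> K ==> f x = 0" by blast
 from CcE[OF g] obtain L where L: "compact L" "\<And>x. x \<notin> L ==> g x = 0" by blast
 have fL: "f \<in> Lp_fun p \<mu>" and gL: "g \<in> Lp_fun q \<mu>" by (intro Cc_Lp p0 q0 f g)+
 have int: "integrable \<mu> (\<lambda>y. f y * cnj (g (- x + y)))" for x
  using cv_integrable[OF p1 fL] gL unfolding q_def by blast
 have fi: "integrable \<mu> (\<lambda>y. cmod (f y))" using Cc_integrable[OF f] by (rule integrable_norm)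
 have "continuous_on UNIV (cv f g)"
  unfolding continuous_on_def
 proof (intro ballI)
  fix x
  show "(cv f g \<longlongrightarrow> cv f g x) (at x within UNIV)"
  proof (rule tendstoI)
   fix e :: real assume e: "e > 0"
   define d where "d = e / ((LI y. cmod (f y)) + 1)"
   have i0: "(LI y. cmod (f y)) + 1 > 0" by (simp add: add_nonneg_pos)
   have d: "d > 0" using e i0 unfolding d_def by simp
   obtain V where V: "open V" "0 \<in> V" "\<And>v x. v \<in> V ==> cmod (g (v + x) - g x) < d"
    using Cc_uniform_left[OF g d] by blast
   have "open ((\<lambda>x'. - x' + x) -` V)" by (intro open_vimage V) (auto intro!: continuous_intros)
   moreover have "x \<in> (\<lambda>x'. - x' + x) -` V" using V(2) by simp
   ultimately have ev: "\<forall>\<^sub>F x' in at x. - x' + x \<in> V"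
    unfolding eventually_at_topological by (intro exI[of _ "(\<lambda>x'. - x' + x) -` V"]) auto
   show "\<forall>\<^sub>F x' in at x within UNIV. dist (cv f g x') (cv f g x) < e"
    using ev
   proof eventually_elim
    case (elim x')
    have gd: "cmod (cnj (g (- x' + y)) - cnj (g (- x + y))) \<le> d" for y
    proof -
     have "- x' + y = (- x' + x) + (- x + y)" by (simp add: add.assoc[symmetric])
     then have "cmod (g (- x' + y) - g (- x + y)) < d" using V(3)[OF elim] by metis
     then show ?thesis by (metis complex_cnj_diff complex_mod_cnj less_imp_le)
    qed
    have "cmod (cv f g x' - cv f g x) = cmod (LI y. f y * cnj (g (- x' + y)) - f y * cnj (g (- x + y)))"
     unfolding cv_def using int by (simp add: Bochner_Integration.integral_diff)
    also have "\<dots> \<le> (LI y. cmod (f y) * d)"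
    proof (rule norm_integral_le)
     show "integrable \<mu> (\<lambda>y. f y * cnj (g (- x' + y)) - f y * cnj (g (- x + y)))"
      by (intro Bochner_Integration.integrable_diff int)
     show "integrable \<mu> (\<lambda>y. cmod (f y) * d)" using fi by simp
     show "cmod (f y * cnj (g (- x' + y)) - f y * cnj (g (- x + y))) \<le> cmod (f y) * d" for y
      using mult_left_mono[OF gd[of y], of "cmod (f y)"] by (simp add: right_diff_distrib[symmetric] norm_mult)
    qed
    also have "\<dots> < e" using i0 e unfolding d_def by (simp add: field_simps)
    finally show ?case by (simp add: dist_norm)
   qed
  qed
 qed
 moreover have "cv f g x = 0" if "x \<notin> (\<lambda>(x, y). x + y) ` (K \<times> uminus ` L)" for x
 proof -
  have "f y * cnj (g (- x + y)) = 0" for y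
  proof (cases "y \<in> K \<and> - x + y \<in> L")
   case True
   have "x = y + - (- x + y)" by (simp add: minus_add add.assoc[symmetric])
   then have "x \<in> (\<lambda>(x, y). x + y) ` (K \<times> uminus ` L)" using True by (force intro!: image_eqI[of _ _ "(y, - (- x + y))"])
   then show ?thesis using that by blast
  qed (use K L in auto)
  then show ?thesis unfolding cv_def by (simp only: Bochner_Integration.integral_zero)
 qed
 ultimately show ?thesis unfolding Cc_def using compact_add[OF K(1) compact_uminus[OF L(1)]] by blast
qed

text \<open>Each atom is bounded by 1, so the coefficients are a majorant for the M-test and w is a
  uniform limit of members of \<open>Cc\<close>.\<close>

lemma atomic_C0:
 assumes "atomic w c"
 shows "w \<in> C0_fun"
proof -
 obtain a f g where w: "\<And>i::nat. f i \<in> Cc \<and> g i \<in> Cc \<and> Lp_norm p \<mu> (f i) \<le> 1 \<and> Lp_norm q \<mu> (g i) \<le> 1"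
  "summable (\<lambda>i. cmod (a i))" "\<And>x. (\<lambda>i. a i * cv (f i) (g i) x) sums w x"
  using assms unfolding atomic_def decomposition_def by blast
 have b: "cmod (a i * cv (f i) (g i) x) \<le> cmod (a i)" for i x
  using mult_left_mono[OF cv_atom_bound, of "f i" "g i" "cmod (a i)" x] w(1)[of i] by (simp add: norm_mult)
 have "uniform_limit UNIV (\<lambda>n x. \<Sum>i<n. a i * cv (f i) (g i) x) (\<lambda>x. \<Sum>i. a i * cv (f i) (g i) x) sequentially"
  by (rule Weierstrass_m_test[OF b w(2)])
 moreover have "(\<lambda>x. \<Sum>i. a i * cv (f i) (g i) x) = w" using w(3) by (auto simp: sums_iff)
 ultimately have ul: "uniform_limit UNIV (\<lambda>n x. \<Sum>i<n. a i * cv (f i) (g i) x) w sequentially" by simp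
 have S: "(\<lambda>x. \<Sum>i<n. a i * cv (f i) (g i) x) \<in> Cc" for n
 proof (induction n)
  case (Suc n)
  show ?case unfolding sum.lessThan_Suc using w(1) by (intro Cc_add Suc Cc_scale cv_Cc) auto
 qed (simp add: Cc_zero)
 have "continuous_on UNIV w"
  by (rule uniform_limit_theorem[OF _ ul]) (auto intro: always_eventually Cc_continuous[OF S])
 moreover have "\<exists>K. compact K \<and> (\<forall>x. x \<notin> K --> cmod (w x) < e)" if "e > 0" for e
 proof -
  have "\<forall>\<^sub>F n in sequentially. \<forall>x\<in>UNIV. dist (\<Sum>i<n. a i * cv (f i) (g i) x) (w x) < e"
   using uniform_limitD[OF ul that] .
  then obtain n where n: "\<And>x. dist (\<Sum>i<n. a i * cv (f i) (g i) x) (w x) < e"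
   by (auto simp: eventually_sequentially)
  from CcE[OF S[of n]] obtain K where K: "compact K" "\<And>x. x \<notin> K ==> (\<Sum>i<n. a i * cv (f i) (g i) x) = 0" by blast
  have "cmod (w x) < e" if "x \<notin> K" for x using n[of x] K(2)[OF that] by simp
  then show ?thesis using K(1) by blast
 qed
 ultimately show ?thesis unfolding C0_fun_def by blast
qed

end

context haar
begin

text \<open>With a selector for \<open>\<sigma>\<close> this identifies a Riemann sum with the
  integral of a step function, and sums over different partitions can be compared by estimating
  integrands.\<close>

lemma finite_range_integral:
 fixes h :: "'i => 'b::{banach, second_countable_topology}"
 assumes T: "T \<in> sets borel" "emeasure \<mu> T < \<infinity>" and \<sigma>: "finite (range \<sigma>)" "\<And>i. {t. \<sigma> t = i} \<in> sets borel"
 shows "integrable \<mu> (\<lambda>t. indicator T t *\<^sub>R h (\<sigma> t))"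
  and "(LI t. indicator T t *\<^sub>R h (\<sigma> t)) = (\<Sum>i\<in>range \<sigma>. measure \<mu> (T \<inter> {t. \<sigma> t = i}) *\<^sub>R h i)"
proof -
 have eq: "indicator T t *\<^sub>R h (\<sigma> t) = (\<Sum>i\<in>range \<sigma>. indicator (T \<inter> {t. \<sigma> t = i}) t *\<^sub>R h i)" for t
 proof -
  have "(\<Sum>i\<in>range \<sigma>. indicator (T \<inter> {t. \<sigma> t = i}) t *\<^sub>R h i) = (\<Sum>i\<in>range \<sigma>. if i = \<sigma> t then indicator T t *\<^sub>R h (\<sigma> t) else 0)"
   by (intro sum.cong) (auto simp: indicator_def)
  then show ?thesis using \<sigma>(1) by simp
 qed
 have m: "T \<inter> {t. \<sigma> t = i} \<in> sets \<mu>" for i using T \<sigma>(2) by auto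
 have fin: "emeasure \<mu> (T \<inter> {t. \<sigma> t = i}) < \<infinity>" for i
  using emeasure_mono[of "T \<inter> {t. \<sigma> t = i}" T \<mu>] T by (simp add: order_le_less_trans)
 have i: "integrable \<mu> (\<lambda>t. indicator (T \<inter> {t. \<sigma> t = i}) t *\<^sub>R h i)" for i
  by (rule integrable_indicator) (use m fin in auto)
 show "integrable \<mu> (\<lambda>t. indicator T t *\<^sub>R h (\<sigma> t))"
  unfolding eq by (intro Bochner_Integration.integrable_sum i)
 show "(LI t. indicator T t *\<^sub>R h (\<sigma> t)) = (\<Sum>i\<in>range \<sigma>. measure \<mu> (T \<inter> {t. \<sigma> t = i}) *\<^sub>R h i)"
  unfolding eq using i m fin by (subst Bochner_Integration.integral_sum) auto
qed

lemma Lp_norm_mono: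
 assumes "p > 0" "f \<in> Lp_fun p \<mu>" "g \<in> Lp_fun p \<mu>" "\<And>x. cmod (f x) \<le> cmod (g x)"
 shows "Lp_norm p \<mu> f \<le> Lp_norm p \<mu> g"
 unfolding Lp_norm_def using assms
 by (intro powr_mono2 integral_mono Lp_fun_integrable) auto

end

section \<open>Comparison of representations with atomic decompositions; products and bounded
  characters\<close>

context haar_p
begin

lemma Ap_representation_atomic:
 assumes "Ap_representation p \<mu> f g u"
 shows "atomic u (256 * (\<Sum>i. Lp_norm p \<mu> (f i) * Lp_norm q \<mu> (g i)))"
proof -
 have fg: "\<And>i. f i \<in> Lp_fun p \<mu>" "\<And>i. g i \<in> Lp_fun q \<mu>"
  and s: "summable (\<lambda>i. Lp_norm p \<mu> (f i) * Lp_norm q \<mu> (g i))"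
  and u: "\<And>x. (\<lambda>i. cv (f i) (g i) x) sums u x"
  using assms unfolding Ap_representation_def Let_def q_def[symmetric] convolution_tilde by auto
 have "atomic u (\<Sum>i. 256 * (Lp_norm p \<mu> (f i) * Lp_norm q \<mu> (g i)))"
  by (rule atomic_sums[OF atomic_cv[OF fg] summable_mult[OF s] u])
 then show ?thesis using s by (simp add: suminf_mult)
qed

lemma atomic_representation:
 assumes "atomic u c"
 obtains f g where "Ap_representation p \<mu> f g u" "(\<Sum>i. Lp_norm p \<mu> (f i) * Lp_norm q \<mu> (g i)) \<le> c"
proof -
 obtain a f g where w: "\<And>i::nat. f i \<in> Cc \<and> g i \<in> Cc \<and> Lp_norm p \<mu> (f i) \<le> 1 \<and> Lp_norm q \<mu> (g i) \<le> 1"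
  "summable (\<lambda>i. cmod (a i))" "(\<Sum>i. cmod (a i)) \<le> c" "\<And>x. (\<lambda>i. a i * cv (f i) (g i) x) sums u x"
  using assms unfolding atomic_def decomposition_def by blast
 define F where "F = (\<lambda>i x. a i * f i x)"
 have n: "Lp_norm p \<mu> (F i) * Lp_norm q \<mu> (g i) \<le> cmod (a i)" for i
 proof -
  have "Lp_norm p \<mu> (f i) * Lp_norm q \<mu> (g i) \<le> 1 * 1"
   using w(1)[of i] Lp_norm_nonneg by (intro mult_mono) auto
  from mult_left_mono[OF this, of "cmod (a i)"] show ?thesis
   unfolding F_def Lp_norm_scale[OF p0] by (simp add: mult.assoc)
 qed
 have s: "summable (\<lambda>i. Lp_norm p \<mu> (F i) * Lp_norm q \<mu> (g i))"
  by (rule summable_comparison_test'[OF w(2), of 0]) (use n Lp_norm_nonneg in auto)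
 have "(\<Sum>i. Lp_norm p \<mu> (F i) * Lp_norm q \<mu> (g i)) \<le> c"
  using suminf_le[OF n s w(2)] w(3) by linarith
 moreover have "Ap_representation p \<mu> F g u"
  unfolding Ap_representation_def Let_def q_def[symmetric] convolution_tilde
  using w(1) w(4) s by (auto simp: F_def cv_scale_left intro!: Lp_fun_scale Cc_Lp p0 q0)
 ultimately show thesis using that by blast
qed

text \<open>Every term of a defining representation splits into \<open>Cc\<close> atoms by
  \<open>atomic_cv\<close>. Conversely an atomic decomposition is a representation once its
  coefficients are absorbed in the first factors, and membership in \<open>C0_fun\<close> comes from
  \<open>atomic_C0\<close>.\<close>

lemma Ap_carrier: "u \<in> Ap \<longleftrightarrow> (\<exists>c. atomic u c)"
proof
 assume "u \<in> Ap"
 then obtain f g where "Ap_representation p \<mu> f g u" unfolding Ap_algebra_def by auto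
 then show "\<exists>c. atomic u c" using Ap_representation_atomic by blast
next
 assume "\<exists>c. atomic u c"
 then obtain c where c: "atomic u c" by blast
 then obtain f g where "Ap_representation p \<mu> f g u" using atomic_representation by blast
 then show "u \<in> Ap" using atomic_C0[OF c] unfolding Ap_algebra_def by auto
qed

lemma representation_sum_nonneg:
 assumes "Ap_representation p \<mu> f g u"
 shows "0 \<le> (\<Sum>i. Lp_norm p \<mu> (f i) * Lp_norm (p / (p - 1)) \<mu> (g i))"
 using assms Lp_norm_nonneg unfolding Ap_representation_def Let_def by (intro suminf_nonneg) auto

lemma Ap_norm_le:
 assumes "Ap_representation p \<mu> f g u"
 shows "Ap_norm p \<mu> u \<le> (\<Sum>i. Lp_norm p \<mu> (f i) * Lp_norm q \<mu> (g i))"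
 unfolding Ap_norm_def q_def
 by (rule cInf_lower) (use assms representation_sum_nonneg in \<open>auto intro!: bdd_belowI[of _ 0]\<close>)

lemma Ap_norm_nonneg:
 assumes "u \<in> Ap"
 shows "0 \<le> Ap_norm p \<mu> u"
 unfolding Ap_norm_def
 by (rule cInf_greatest) (use assms representation_sum_nonneg in \<open>auto simp: Ap_algebra_def\<close>)

lemma Ap_norm_less_representation:
 assumes "u \<in> Ap" "Ap_norm p \<mu> u < c"
 obtains f g where "Ap_representation p \<mu> f g u" "(\<Sum>i. Lp_norm p \<mu> (f i) * Lp_norm q \<mu> (g i)) < c"
proof -
 have "\<exists>y\<in>{\<Sum>i. Lp_norm p \<mu> (f i) * Lp_norm (p / (p - 1)) \<mu> (g i) |f g. Ap_representation p \<mu> f g u}. y < c"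
  using assms(2) unfolding Ap_norm_def
  by (subst cInf_less_iff[symmetric])
    (use assms(1) representation_sum_nonneg in \<open>auto simp: Ap_algebra_def intro!: bdd_belowI[of _ 0]\<close>)
 then show thesis using that unfolding q_def by blast
qed

lemma Ap_norm_atomic:
 assumes "u \<in> Ap" "Ap_norm p \<mu> u < c"
 shows "atomic u (256 * c)"
proof -
 obtain f g where fg: "Ap_representation p \<mu> f g u" "(\<Sum>i. Lp_norm p \<mu> (f i) * Lp_norm q \<mu> (g i)) < c"
  by (rule Ap_norm_less_representation[OF assms])
 show ?thesis by (rule atomic_mono[OF Ap_representation_atomic[OF fg(1)]]) (use fg(2) in simp)
qed

lemma cv_representation:
 assumes "f \<in> Lp_fun p \<mu>" "g \<in> Lp_fun q \<mu>"
 shows "cv f g \<in> Ap" "Ap_norm p \<mu> (cv f g) \<le> Lp_norm p \<mu> f * Lp_norm q \<mu> g"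
proof -
 show "cv f g \<in> Ap" using atomic_cv[OF assms] Ap_carrier by blast
 define F G :: "nat => 'g => complex" where "F = (\<lambda>i. if i = 0 then f else (\<lambda>_. 0))" and "G = (\<lambda>i. if i = 0 then g else (\<lambda>_. 0))"
 have 1: "(\<lambda>i. Lp_norm p \<mu> (F i) * Lp_norm q \<mu> (G i)) sums (\<Sum>i\<in>{0}. Lp_norm p \<mu> (F i) * Lp_norm q \<mu> (G i))"
  by (rule sums_finite) (auto simp: F_def Lp_norm_def)
 have 2: "(\<lambda>i. cv (F i) (G i) x) sums (\<Sum>i\<in>{0}. cv (F i) (G i) x)" for x
  by (rule sums_finite) (auto simp: F_def cv_def)
 have "Ap_representation p \<mu> F G (cv f g)"
  unfolding Ap_representation_def Let_def q_def[symmetric] convolution_tilde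
  using assms 1 2 by (auto simp: F_def G_def Lp_fun_zero sums_iff)
 from Ap_norm_le[OF this] show "Ap_norm p \<mu> (cv f g) \<le> Lp_norm p \<mu> f * Lp_norm q \<mu> g"
  using 1 by (simp add: sums_iff F_def G_def)
qed

text \<open>A bound for the product of two atoms: 2 * 2^p and 2 * 2^q estimate the two halves of the
  first Riemann sum after Young's inequality, and 1 estimates the series of corrections.\<close>

definition Kp :: real where "Kp = 2 * 2 powr p + 2 * 2 powr q + 1"

lemma Kp1: "1 \<le> Kp"
 unfolding Kp_def by simp

text \<open>
 With \<open>f\<^sub>t(y) = f(y) a(yt)\<close> and \<open>g\<^sub>t(z) = g(z) b(zt)\<close>, left invariance of the Haar measure gives that the
 product of \<open>f * g~\<close> and \<open>a * b~\<close> is the integral of \<open>f\<^sub>t * g\<^sub>t~\<close> over \<open>t\<close>.  Riemann sums of this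
 integral form a Cauchy sequence with respect to atomic decompositions.
\<close>

lemma atomic_mult_Cc:
 assumes f: "f \<in> Cc" and g: "g \<in> Cc" and a: "a \<in> Cc" and b: "b \<in> Cc"
  and nf: "Lp_norm p \<mu> f \<le> 1" and ng: "Lp_norm q \<mu> g \<le> 1" and na: "Lp_norm p \<mu> a \<le> 1" and nb: "Lp_norm q \<mu> b \<le> 1"
 shows "atomic (\<lambda>x. cv f g x * cv a b x) Kp"
proof -
 from CcE[OF f] obtain Kf where Kf: "compact Kf" "\<And>x. x \<notin> Kf ==> f x = 0" by blast
 from CcE[OF a] obtain Ka where Ka: "compact Ka" "\<And>x. x \<notin> Ka ==> a x = 0" by blast
 obtain Mg where Mg: "Mg > 0" "\<And>x. cmod (g x) \<le> Mg" using Cc_bounded[OF g] by blast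
 obtain Ma where Ma: "Ma > 0" "\<And>x. cmod (a x) \<le> Ma" using Cc_bounded[OF a] by blast
 obtain Mb where Mb: "Mb > 0" "\<And>x. cmod (b x) \<le> Mb" using Cc_bounded[OF b] by blast
 define M where "M = 1 + Mg + Ma + Mb"
 have M: "M \<ge> 1" "\<And>x. cmod (g x) \<le> M" "\<And>x. cmod (a x) \<le> M" "\<And>x. cmod (b x) \<le> M"
  unfolding M_def using Mg Ma Mb by (smt (verit))+
 \<comment> \<open>If f(y) a(yt) is nonzero for some y, then t lies in the compact set of products
   of inverses from \<open>Kf\<close> with elements of \<open>Ka\<close>; so only t in
   \<open>T\<close> contribute to the integral.\<close>
 define T where "T = (\<lambda>(x, y). x + y) ` (uminus ` Kf \<times> Ka)"
 have cT: "compact T" unfolding T_def by (intro compact_add compact_uminus Kf Ka)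
 have Tm: "T \<in> sets borel" "emeasure \<mu> T < \<infinity>" using compact_borel[OF cT] emeasure_compact[OF cT] by auto
 have Tt: "f y = 0 \<or> a (y + t) = 0" if "t \<notin> T" for y t
 proof (rule ccontr)
  assume "\<not> ?thesis"
  then have "y \<in> Kf" "y + t \<in> Ka" using Kf(2) Ka(2) by blast+
  moreover have "t = - y + (y + t)" by (simp add: add.assoc[symmetric])
  ultimately have "t \<in> T" unfolding T_def by (force intro!: image_eqI[of _ _ "(- y, y + t)"])
  then show False using that by blast
 qed
 define m where "m = measure \<mu> T"
 have m0: "m \<ge> 0" unfolding m_def by simp
 \<comment> \<open>The mesh is chosen for two purposes: the error of the first Riemann sum stays
   below 1 (third fact), and so does the sum of all later corrections (fourth fact).\<close>
 define \<delta> where "\<delta> = min 1 (1 / (8 * M * m + 1 + m))"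
 have \<delta>: "0 < \<delta>" "\<delta> \<le> 1" "\<delta> * m \<le> 1" "8 * M * m * \<delta> \<le> 1"
 proof -
  have d: "8 * M * m + 1 + m > 0" using m0 M(1) by (simp add: add_nonneg_pos add_pos_nonneg)
  show "0 < \<delta>" "\<delta> \<le> 1" unfolding \<delta>_def using d by auto
  have "\<delta> \<le> 1 / (8 * M * m + 1 + m)" unfolding \<delta>_def by simp
  then have e: "\<delta> * (8 * M * m + 1 + m) \<le> 1" using d by (simp add: field_simps)
  have "0 \<le> \<delta> * m" "0 \<le> \<delta> * (8 * M * m)" using \<open>0 < \<delta>\<close> m0 M(1) by auto
  then show "\<delta> * m \<le> 1" "8 * M * m * \<delta> \<le> 1" using e \<open>0 < \<delta>\<close> by (simp_all add: algebra_simps)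
 qed
 define \<epsilon> where "\<epsilon> = (\<lambda>n. \<delta> * (1/2::real) ^ n)"
 have \<epsilon>: "\<epsilon> n > 0" "\<epsilon> (Suc n) \<le> \<epsilon> n" for n unfolding \<epsilon>_def using \<delta> by auto
 have "\<exists>\<tau>. finite (range \<tau>) \<and> (\<forall>y. {t. \<tau> t = y} \<in> sets borel) \<and>
  (\<forall>t\<in>T. \<forall>y. cmod (a (y + t) - a (y + \<tau> t)) < \<epsilon> n \<and> cmod (b (y + t) - b (y + \<tau> t)) < \<epsilon> n)" for n
 proof -
  \<comment> \<open>The sample point t stands to the right of y in a(yt), hence uniform continuity
    under right translations.\<close>
  obtain V where V: "open V" "0 \<in> V" "\<And>v x. v \<in> V ==> cmod (a (x + v) - a x) < \<epsilon> n"
   using Cc_uniform_right[OF a \<epsilon>(1)[of n]] by blast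
  obtain W where W: "open W" "0 \<in> W" "\<And>v x. v \<in> W ==> cmod (b (x + v) - b x) < \<epsilon> n"
   using Cc_uniform_right[OF b \<epsilon>(1)[of n]] by blast
  have VW: "open (V \<inter> W)" "0 \<in> V \<inter> W" using V W by auto
  obtain \<tau> where \<tau>: "finite (range \<tau>)" "\<And>y. {t. \<tau> t = y} \<in> sets borel"
   "\<And>t. t \<in> T ==> - \<tau> t + t \<in> V \<inter> W" "\<And>t. t \<in> T ==> \<tau> t \<in> T"
   by (rule borel_selector[OF cT VW]) (rule that)
  have "cmod (a (y + t) - a (y + \<tau> t)) < \<epsilon> n \<and> cmod (b (y + t) - b (y + \<tau> t)) < \<epsilon> n" if "t \<in> T" for t y
  proof -
   have "y + \<tau> t + (- \<tau> t + t) = y + t" by (simp add: add.assoc[symmetric])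
   then show ?thesis using V(3)[of "- \<tau> t + t" "y + \<tau> t"] W(3)[of "- \<tau> t + t" "y + \<tau> t"] \<tau>(3)[OF that] by auto
  qed
  then show ?thesis using \<tau>(1,2) by (intro exI[of _ \<tau>]) auto
 qed
 then obtain \<tau> where \<tau>: "\<And>n. finite (range (\<tau> n))" "\<And>n y. {t. \<tau> n t = y} \<in> sets borel"
  "\<And>n t y. t \<in> T ==> cmod (a (y + t) - a (y + \<tau> n t)) < \<epsilon> n"
  "\<And>n t y. t \<in> T ==> cmod (b (y + t) - b (y + \<tau> n t)) < \<epsilon> n" by metis
 define F where "F = (\<lambda>s y. f y * a (y + s))"
 define G where "G = (\<lambda>s y. g y * b (y + s))"
 have ca: "continuous_on UNIV (\<lambda>y. a (y + s))" for s
  by (rule continuous_on_compose2[OF Cc_continuous[OF a]]) (auto intro!: continuous_intros)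
 have cb: "continuous_on UNIV (\<lambda>y. b (y + s))" for s
  by (rule continuous_on_compose2[OF Cc_continuous[OF b]]) (auto intro!: continuous_intros)
 have F: "F s \<in> Cc" and G: "G s \<in> Cc" for s
  unfolding F_def G_def by (intro Cc_mult f g ca cb)+
 have FL: "F s \<in> Lp_fun p \<mu>" and GL: "G s \<in> Lp_fun q \<mu>" for s
  by (intro Cc_Lp p0 q0 F G)+
 define S where "S = (\<lambda>n x. \<Sum>i\<in>range (\<tau> n). measure \<mu> (T \<inter> {t. \<tau> n t = i}) * cv (F i) (G i) x)"
 have Sint: "S n x = (LI t. indicator T t *\<^sub>R cv (F (\<tau> n t)) (G (\<tau> n t)) x)" for n x
  using finite_range_integral(2)[OF Tm \<tau>(1,2), of "\<lambda>i. cv (F i) (G i) x" n] by (simp add: S_def scaleR_conv_of_real)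

 have bound0: "atomic (S 0) (Kp - 1)"
 proof -
  have "atomic (S 0) (\<Sum>i\<in>range (\<tau> 0). cmod (complex_of_real (measure \<mu> (T \<inter> {t. \<tau> 0 t = i}))) * (Lp_norm p \<mu> (F i) * Lp_norm q \<mu> (G i)))"
   unfolding S_def by (intro atomic_sum atomic_scale atomic_Cc F G \<tau>) auto
  moreover have "(\<Sum>i\<in>range (\<tau> 0). cmod (complex_of_real (measure \<mu> (T \<inter> {t. \<tau> 0 t = i}))) * (Lp_norm p \<mu> (F i) * Lp_norm q \<mu> (G i)))
    \<le> (\<Sum>i\<in>range (\<tau> 0). measure \<mu> (T \<inter> {t. \<tau> 0 t = i}) * (Lp_norm p \<mu> (F i) powr p + Lp_norm q \<mu> (G i) powr q))"
  proof (intro sum_mono)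
   fix i
   have "Lp_norm p \<mu> (F i) * Lp_norm q \<mu> (G i) \<le> Lp_norm p \<mu> (F i) powr p / p + Lp_norm q \<mu> (G i) powr q / q"
    by (intro Youngs_inequality p1 q1 pq Lp_norm_nonneg)
   also have "\<dots> \<le> Lp_norm p \<mu> (F i) powr p / 1 + Lp_norm q \<mu> (G i) powr q / 1"
    using p1 q1 by (intro add_mono divide_left_mono) auto
   finally show "cmod (complex_of_real (measure \<mu> (T \<inter> {t. \<tau> 0 t = i}))) * (Lp_norm p \<mu> (F i) * Lp_norm q \<mu> (G i))
    \<le> measure \<mu> (T \<inter> {t. \<tau> 0 t = i}) * (Lp_norm p \<mu> (F i) powr p + Lp_norm q \<mu> (G i) powr q)"
    by (simp add: mult_left_mono)
  qed
  \<comment> \<open>The finite sum is moved under the integral over y. There the inner sum of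
    |k(yi)|^r is a Riemann sum for the integral of |k(yt)|^r over t, which is at most 1 by left
    invariance, for every y. The error adds at most 1, and 2^r comes from
    \<open>powr_norm_add_le\<close>.\<close>
  moreover have one: "(\<Sum>i\<in>range (\<tau> 0). measure \<mu> (T \<inter> {t. \<tau> 0 t = i}) * Lp_norm r \<mu> (\<lambda>y. h y * k (y + i)) powr r) \<le> 2 * 2 powr r"
   if r: "r > 1" and h: "h \<in> Cc" and k: "k \<in> Cc" and nh: "Lp_norm r \<mu> h \<le> 1" and nk: "Lp_norm r \<mu> k \<le> 1"
    and close: "\<And>t y. t \<in> T ==> cmod (k (y + t) - k (y + \<tau> 0 t)) < \<epsilon> 0" for r h k
  proof -
   have r0: "r > 0" using r by simp
   have hL: "h \<in> Lp_fun r \<mu>" and kL: "k \<in> Lp_fun r \<mu>" by (intro Cc_Lp r0 h k)+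
   have hk: "(\<lambda>y. h y * k (y + i)) \<in> Lp_fun r \<mu>" for i
    by (intro Cc_Lp r0 Cc_mult h continuous_on_compose2[OF Cc_continuous[OF k]]) (auto intro!: continuous_intros)
   have inner: "(\<Sum>i\<in>range (\<tau> 0). measure \<mu> (T \<inter> {t. \<tau> 0 t = i}) * cmod (k (y + i)) powr r) \<le> 2 * 2 powr r" for y
   proof -
    have kt: "integrable \<mu> (\<lambda>t. cmod (k (y + t)) powr r)"
     using integrable_translate[OF Lp_fun_integrable[OF kL], of y] .
    have iT: "integrable \<mu> (\<lambda>t. indicator T t *\<^sub>R (\<epsilon> 0 powr r))"
     using Tm by (intro integrable_indicator) auto
    have "(\<Sum>i\<in>range (\<tau> 0). measure \<mu> (T \<inter> {t. \<tau> 0 t = i}) * cmod (k (y + i)) powr r)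
      = (LI t. indicator T t *\<^sub>R cmod (k (y + \<tau> 0 t)) powr r)"
     using finite_range_integral(2)[OF Tm \<tau>(1,2), of "\<lambda>i. cmod (k (y + i)) powr r" 0] by simp
    also have "\<dots> \<le> (LI t. 2 powr r * (cmod (k (y + t)) powr r + indicator T t *\<^sub>R (\<epsilon> 0 powr r)))"
    proof (rule integral_mono)
     show "integrable \<mu> (\<lambda>t. indicator T t *\<^sub>R cmod (k (y + \<tau> 0 t)) powr r)"
      using finite_range_integral(1)[OF Tm \<tau>(1,2), of "\<lambda>i. cmod (k (y + i)) powr r" 0] .
     show "integrable \<mu> (\<lambda>t. 2 powr r * (cmod (k (y + t)) powr r + indicator T t *\<^sub>R (\<epsilon> 0 powr r)))"
      by (intro integrable_mult_right Bochner_Integration.integrable_add kt iT)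
     show "indicator T t *\<^sub>R cmod (k (y + \<tau> 0 t)) powr r \<le> 2 powr r * (cmod (k (y + t)) powr r + indicator T t *\<^sub>R (\<epsilon> 0 powr r))" for t
     proof (cases "t \<in> T")
      case True
      have "cmod (k (y + t) + (k (y + \<tau> 0 t) - k (y + t))) powr r \<le> 2 powr r * (cmod (k (y + t)) powr r + cmod (k (y + \<tau> 0 t) - k (y + t)) powr r)"
       by (rule powr_norm_add_le[OF r0])
      also have "\<dots> \<le> 2 powr r * (cmod (k (y + t)) powr r + \<epsilon> 0 powr r)"
       using close[OF True, of y] r0 by (intro mult_left_mono add_left_mono powr_mono2) (auto simp: norm_minus_commute)
      finally show ?thesis using True by simp
     qed simp
    qed
    also have "\<dots> = 2 powr r * ((LI t. cmod (k (y + t)) powr r) + m * \<epsilon> 0 powr r)"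
     using kt iT Tm by (simp add: Bochner_Integration.integral_add m_def)
    also have "\<dots> \<le> 2 powr r * (1 + 1)"
    proof (intro mult_left_mono add_mono)
     have "(LI t. cmod (k (y + t)) powr r) = Lp_norm r \<mu> k powr r"
      using integral_translate[of "\<lambda>t. cmod (k t) powr r" y] Lp_norm_powr[OF r0] by simp
     also have "\<dots> \<le> 1 powr r" using nk r0 Lp_norm_nonneg by (intro powr_mono2) auto
     finally show "(LI t. cmod (k (y + t)) powr r) \<le> 1" by simp
     have "\<epsilon> 0 powr r \<le> \<epsilon> 0 powr 1" using \<delta> r by (intro powr_mono') (auto simp: \<epsilon>_def)
     then have "\<epsilon> 0 powr r \<le> \<delta>" using \<delta> by (simp add: \<epsilon>_def)
     from mult_left_mono[OF this m0] show "m * \<epsilon> 0 powr r \<le> 1" using \<delta>(3) by (simp add: mult.commute)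
    qed auto
    finally show ?thesis by simp
   qed
   have "(\<Sum>i\<in>range (\<tau> 0). measure \<mu> (T \<inter> {t. \<tau> 0 t = i}) * Lp_norm r \<mu> (\<lambda>y. h y * k (y + i)) powr r)
    = (LI y. (\<Sum>i\<in>range (\<tau> 0). measure \<mu> (T \<inter> {t. \<tau> 0 t = i}) * cmod (h y * k (y + i)) powr r))"
    using Lp_fun_integrable[OF hk] by (simp add: Bochner_Integration.integral_sum Lp_norm_powr[OF r0])
   also have "\<dots> \<le> (LI y. cmod (h y) powr r * (2 * 2 powr r))"
   proof (rule integral_mono)
    show "integrable \<mu> (\<lambda>y. \<Sum>i\<in>range (\<tau> 0). measure \<mu> (T \<inter> {t. \<tau> 0 t = i}) * cmod (h y * k (y + i)) powr r)"
     using Lp_fun_integrable[OF hk] by (intro Bochner_Integration.integrable_sum integrable_mult_right)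
    show "integrable \<mu> (\<lambda>y. cmod (h y) powr r * (2 * 2 powr r))" using Lp_fun_integrable[OF hL] by simp
    show "(\<Sum>i\<in>range (\<tau> 0). measure \<mu> (T \<inter> {t. \<tau> 0 t = i}) * cmod (h y * k (y + i)) powr r) \<le> cmod (h y) powr r * (2 * 2 powr r)" for y
    proof -
     have "(\<Sum>i\<in>range (\<tau> 0). measure \<mu> (T \<inter> {t. \<tau> 0 t = i}) * cmod (h y * k (y + i)) powr r)
      = cmod (h y) powr r * (\<Sum>i\<in>range (\<tau> 0). measure \<mu> (T \<inter> {t. \<tau> 0 t = i}) * cmod (k (y + i)) powr r)"
      by (simp add: sum_distrib_left norm_mult powr_mult mult.left_commute)
     then show ?thesis using mult_left_mono[OF inner[of y], of "cmod (h y) powr r"] by simp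
    qed
   qed
   also have "\<dots> = Lp_norm r \<mu> h powr r * (2 * 2 powr r)" using Lp_norm_powr[OF r0] by simp
   also have "\<dots> \<le> 1 powr r * (2 * 2 powr r)"
    using nh r0 Lp_norm_nonneg by (intro mult_right_mono powr_mono2) auto
   finally show ?thesis by simp
  qed
  moreover have "(\<Sum>i\<in>range (\<tau> 0). measure \<mu> (T \<inter> {t. \<tau> 0 t = i}) * (Lp_norm p \<mu> (F i) powr p + Lp_norm q \<mu> (G i) powr q)) \<le> Kp - 1"
   using one[OF p1 f a nf na \<tau>(3)] one[OF q1 g b ng nb \<tau>(4)]
   unfolding Kp_def F_def G_def by (simp add: distrib_left sum.distrib)
  ultimately show ?thesis using atomic_mono by (meson order_trans)
 qed

 have step: "atomic (\<lambda>x. S (Suc n) x - S n x) (m * (4 * M * \<epsilon> n))" for n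
 proof -
  \<comment> \<open>The common refinement of two consecutive partitions; on each of its cells both
    sample points are constant.\<close>
  define \<sigma> where "\<sigma> = (\<lambda>t. (\<tau> n t, \<tau> (Suc n) t))"
  have "range \<sigma> \<subseteq> range (\<tau> n) \<times> range (\<tau> (Suc n))" unfolding \<sigma>_def by auto
  then have \<sigma>1: "finite (range \<sigma>)" using \<tau>(1) by (meson finite_SigmaI finite_subset)
  have \<sigma>2: "{t. \<sigma> t = i} \<in> sets borel" for i
  proof -
   have "{t. \<sigma> t = i} = {t. \<tau> n t = fst i} \<inter> {t. \<tau> (Suc n) t = snd i}" unfolding \<sigma>_def by (auto simp: prod_eq_iff)
   then show ?thesis using \<tau>(2) by auto
  qed
  define D where "D = (\<lambda>i x. cv (F (snd i)) (G (snd i)) x - cv (F (fst i)) (G (fst i)) x)"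
  have eq: "S (Suc n) x - S n x = (\<Sum>i\<in>range \<sigma>. complex_of_real (measure \<mu> (T \<inter> {t. \<sigma> t = i})) * D i x)" for x
  proof -
   have "S (Suc n) x - S n x = (LI t. indicator T t *\<^sub>R D (\<sigma> t) x)"
    unfolding Sint D_def \<sigma>_def fst_conv snd_conv scaleR_diff_right
    using finite_range_integral(1)[OF Tm \<tau>(1,2), of "\<lambda>i. cv (F i) (G i) x"]
    by (simp add: Bochner_Integration.integral_diff)
   then show ?thesis using finite_range_integral(2)[OF Tm \<sigma>1 \<sigma>2, of "\<lambda>i. D i x"] by (simp add: scaleR_conv_of_real)
  qed
  have at: "atomic (\<lambda>x. complex_of_real (measure \<mu> (T \<inter> {t. \<sigma> t = i})) * D i x) (measure \<mu> (T \<inter> {t. \<sigma> t = i}) * (4 * M * \<epsilon> n))" for i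
  \<comment> \<open>An empty cell has weight 0. Otherwise a point of the cell is close to both
    sample points and lets them be compared, at distance 2 \<epsilon> in each factor.\<close>
  proof (cases "T \<inter> {t. \<sigma> t = i} = {}")
   case True
   then show ?thesis using atomic_zero by simp
  next
   case False
   then obtain t where "t \<in> T" "\<sigma> t = i" by blast
   then have t: "t \<in> T" "\<tau> n t = fst i" "\<tau> (Suc n) t = snd i" unfolding \<sigma>_def by auto
   have close: "cmod (k (y + snd i) - k (y + fst i)) \<le> 2 * \<epsilon> n"
    if "\<And>n t y. t \<in> T ==> cmod (k (y + t) - k (y + \<tau> n t)) < \<epsilon> n" for k :: "'g => complex" and y
   proof -
    have "cmod (k (y + t) - k (y + fst i)) < \<epsilon> n" "cmod (k (y + t) - k (y + snd i)) < \<epsilon> (Suc n)"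
     using that[OF t(1), of y n] that[OF t(1), of y "Suc n"] t by auto
    moreover have "k (y + snd i) - k (y + fst i) = (k (y + t) - k (y + fst i)) - (k (y + t) - k (y + snd i))" by simp
    ultimately show ?thesis
     using norm_triangle_ineq4[of "k (y + t) - k (y + fst i)" "k (y + t) - k (y + snd i)"] \<epsilon>(2)[of n] by simp
   qed
   have Fd: "(\<lambda>y. F (snd i) y - F (fst i) y) \<in> Cc" and Gd: "(\<lambda>y. G (snd i) y - G (fst i) y) \<in> Cc"
    by (intro Cc_diff F G)+
   have nle: "Lp_norm r \<mu> h' \<le> c" if r: "r > 0" and h: "h \<in> Cc" and h': "h' \<in> Cc" and c: "c \<ge> 0"
    and nh: "Lp_norm r \<mu> h \<le> 1" and le: "\<And>y. cmod (h' y) \<le> cmod (h y) * c" for r h h' c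
   proof -
    have "Lp_norm r \<mu> h' \<le> Lp_norm r \<mu> (\<lambda>y. complex_of_real c * h y)"
     using le c by (intro Lp_norm_mono r Cc_Lp h' Cc_scale h) (auto simp: norm_mult mult.commute)
    also have "\<dots> \<le> c * 1" unfolding Lp_norm_scale[OF r] using nh c by (simp add: mult_left_le)
    finally show ?thesis by simp
   qed
   have M0: "M \<ge> 0" using M(1) by simp
   have e2: "2 * \<epsilon> n \<ge> 0" using \<epsilon>(1)[of n] by simp
   have nFd: "Lp_norm p \<mu> (\<lambda>y. F (snd i) y - F (fst i) y) \<le> 2 * \<epsilon> n"
    by (rule nle[OF p0 f Fd e2 nf])
      (use close[of a, OF \<tau>(3)] in \<open>simp add: F_def right_diff_distrib[symmetric] norm_mult mult_left_mono\<close>)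
   have nGd: "Lp_norm q \<mu> (\<lambda>y. G (snd i) y - G (fst i) y) \<le> 2 * \<epsilon> n"
    by (rule nle[OF q0 g Gd e2 ng])
      (use close[of b, OF \<tau>(4)] in \<open>simp add: G_def right_diff_distrib[symmetric] norm_mult mult_left_mono\<close>)
   have nF: "Lp_norm p \<mu> (F s) \<le> M" for s
    by (rule nle[OF p0 f F M0 nf]) (use M in \<open>simp add: F_def norm_mult mult_left_mono\<close>)
   have nG: "Lp_norm q \<mu> (G s) \<le> M" for s
    by (rule nle[OF q0 g G M0 ng]) (use M in \<open>simp add: G_def norm_mult mult_left_mono\<close>)
   have "D i x = cv (\<lambda>y. F (snd i) y - F (fst i) y) (G (snd i)) x + cv (F (fst i)) (\<lambda>y. G (snd i) y - G (fst i) y) x" for x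
   proof -
    have "cv (\<lambda>y. (F (snd i) y - F (fst i) y) + F (fst i) y) (G (snd i)) x
     = cv (\<lambda>y. F (snd i) y - F (fst i) y) (G (snd i)) x + cv (F (fst i)) (G (snd i)) x"
     by (intro cv_add_left_p FL GL Lp_fun_diff p0)
    moreover have "cv (F (fst i)) (\<lambda>y. (G (snd i) y - G (fst i) y) + G (fst i) y) x
     = cv (F (fst i)) (\<lambda>y. G (snd i) y - G (fst i) y) x + cv (F (fst i)) (G (fst i)) x"
     by (intro cv_add_right_p FL GL Lp_fun_diff q0)
    ultimately show ?thesis unfolding D_def by simp
   qed
   then have "D i = (\<lambda>x. cv (\<lambda>y. F (snd i) y - F (fst i) y) (G (snd i)) x + cv (F (fst i)) (\<lambda>y. G (snd i) y - G (fst i) y) x)"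
    by blast
   moreover have "atomic (\<lambda>x. cv (\<lambda>y. F (snd i) y - F (fst i) y) (G (snd i)) x + cv (F (fst i)) (\<lambda>y. G (snd i) y - G (fst i) y) x)
     (2 * \<epsilon> n * M + M * (2 * \<epsilon> n))"
    by (intro atomic_add atomic_Cc F G Fd Gd nF nG nFd nGd)
   ultimately have "atomic (D i) (4 * M * \<epsilon> n)" by (simp add: algebra_simps)
   from atomic_scale[OF this, of "complex_of_real (measure \<mu> (T \<inter> {t. \<sigma> t = i}))"] show ?thesis by simp
  qed
  have "atomic (\<lambda>x. S (Suc n) x - S n x) (\<Sum>i\<in>range \<sigma>. measure \<mu> (T \<inter> {t. \<sigma> t = i}) * (4 * M * \<epsilon> n))"
   unfolding eq by (intro atomic_sum at \<sigma>1)
  moreover have "(\<Sum>i\<in>range \<sigma>. measure \<mu> (T \<inter> {t. \<sigma> t = i}) * (4 * M * \<epsilon> n)) = m * (4 * M * \<epsilon> n)"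
   using finite_range_integral(2)[OF Tm \<sigma>1 \<sigma>2, of "\<lambda>i. 4 * M * \<epsilon> n"] Tm by (simp add: m_def)
  ultimately show ?thesis by simp
 qed

 have lim: "(\<lambda>n. S n x) \<longlonglongrightarrow> cv f g x * cv a b x" for x
 proof -
  define A where "A = (LI y. cmod (f y))"
  have fi: "integrable \<mu> (\<lambda>y. cmod (f y))" using Cc_integrable[OF f] by (rule integrable_norm)
  have cint: "integrable \<mu> (\<lambda>y. f' y * cnj (g' (- x + y)))" if "f' \<in> Cc" "g' \<in> Cc" for f' g'
   using cv_integrable[OF p1, of f' g'] that Cc_Lp p0 q0 unfolding q_def by blast
  have le: "cmod (cv f g x * cv a b x - S n x) \<le> A * (M * (m * (2 * M * \<epsilon> n)))" for n
  proof -
   \<comment> \<open>By left invariance cv a b x is the integral of a(yt) cnj(b(x^-1 y t)) over t,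
     for every y; \<open>R y\<close> is its Riemann sum. The dependence on y is only apparent in the
     limit, and this is what separates the product into its two factors.\<close>
   define R where "R = (\<lambda>y. \<Sum>i\<in>range (\<tau> n). complex_of_real (measure \<mu> (T \<inter> {t. \<tau> n t = i})) * (a (y + i) * cnj (b (- x + y + i))))"
   have S_eq: "S n x = (LI y. f y * cnj (g (- x + y)) * R y)"
    and S_int: "integrable \<mu> (\<lambda>y. f y * cnj (g (- x + y)) * R y)"
   proof -
    have e: "f y * cnj (g (- x + y)) * R y = (\<Sum>i\<in>range (\<tau> n). complex_of_real (measure \<mu> (T \<inter> {t. \<tau> n t = i})) * (F i y * cnj (G i (- x + y))))" for y
     unfolding R_def F_def G_def by (simp add: sum_distrib_left algebra_simps)
    show "integrable \<mu> (\<lambda>y. f y * cnj (g (- x + y)) * R y)"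
     unfolding e by (intro Bochner_Integration.integrable_sum integrable_mult_right cint F G)
    show "S n x = (LI y. f y * cnj (g (- x + y)) * R y)"
     unfolding e S_def cv_def using cint[OF F G] by (simp add: Bochner_Integration.integral_sum)
   qed
   have R: "cmod (cv a b x - R y) \<le> m * (2 * M * \<epsilon> n)" if y: "f y \<noteq> 0" for y
   proof -
    have "cv a b x = (LI t. a (y + t) * cnj (b (- x + (y + t))))"
     unfolding cv_def using integral_translate[of "\<lambda>t. a t * cnj (b (- x + t))" y] by simp
    also have "\<dots> = (LI t. indicator T t *\<^sub>R (a (y + t) * cnj (b (- x + y + t))))"
     using Tt[of _ y] y by (intro Bochner_Integration.integral_cong) (auto simp: indicator_def add.assoc)
    finally have 1: "cv a b x = (LI t. indicator T t *\<^sub>R (a (y + t) * cnj (b (- x + y + t))))" .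
    have i1: "integrable \<mu> (\<lambda>t. indicator T t *\<^sub>R (a (y + t) * cnj (b (- x + y + t))))"
    proof -
     have "integrable \<mu> (\<lambda>t. a (y + t) * cnj (b (- x + (y + t))))"
      using integrable_translate[OF cint[OF a b], of y] .
     moreover have "(\<lambda>t. a (y + t) * cnj (b (- x + (y + t)))) = (\<lambda>t. indicator T t *\<^sub>R (a (y + t) * cnj (b (- x + y + t))))"
      using Tt[of _ y] y by (intro ext) (auto simp: indicator_def add.assoc)
     ultimately show ?thesis by simp
    qed
    have 2: "R y = (LI t. indicator T t *\<^sub>R (a (y + \<tau> n t) * cnj (b (- x + y + \<tau> n t))))"
     unfolding R_def using finite_range_integral(2)[OF Tm \<tau>(1,2), of "\<lambda>i. a (y + i) * cnj (b (- x + y + i))" n]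
     by (simp add: scaleR_conv_of_real)
    have i2: "integrable \<mu> (\<lambda>t. indicator T t *\<^sub>R (a (y + \<tau> n t) * cnj (b (- x + y + \<tau> n t))))"
     using finite_range_integral(1)[OF Tm \<tau>(1,2), of "\<lambda>i. a (y + i) * cnj (b (- x + y + i))" n] .
    have "cmod (cv a b x - R y) = cmod (LI t. indicator T t *\<^sub>R (a (y + t) * cnj (b (- x + y + t))) - indicator T t *\<^sub>R (a (y + \<tau> n t) * cnj (b (- x + y + \<tau> n t))))"
     unfolding 1 2 using i1 i2 by (simp add: Bochner_Integration.integral_diff)
    also have "\<dots> \<le> (LI t. indicator T t *\<^sub>R (2 * M * \<epsilon> n))"
    proof (rule norm_integral_le)
     show "integrable \<mu> (\<lambda>t. indicator T t *\<^sub>R (2 * M * \<epsilon> n))" using Tm by (intro integrable_indicator) auto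
     fix t
     show "cmod (indicator T t *\<^sub>R (a (y + t) * cnj (b (- x + y + t))) - indicator T t *\<^sub>R (a (y + \<tau> n t) * cnj (b (- x + y + \<tau> n t))))
       \<le> indicator T t *\<^sub>R (2 * M * \<epsilon> n)"
     proof (cases "t \<in> T")
      case True
      have "cmod (a (y + t) * cnj (b (- x + y + t)) - a (y + \<tau> n t) * cnj (b (- x + y + \<tau> n t)))
       = cmod (a (y + t) * cnj (b (- x + y + t) - b (- x + y + \<tau> n t)) + (a (y + t) - a (y + \<tau> n t)) * cnj (b (- x + y + \<tau> n t)))"
       by (simp add: algebra_simps)
      also have "\<dots> \<le> cmod (a (y + t)) * cmod (b (- x + y + t) - b (- x + y + \<tau> n t)) + cmod (a (y + t) - a (y + \<tau> n t)) * cmod (b (- x + y + \<tau> n t))"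
       using norm_triangle_ineq by (metis complex_mod_cnj norm_mult)
      also have "\<dots> \<le> M * \<epsilon> n + \<epsilon> n * M"
       using \<tau>(3)[OF True, of y n] \<tau>(4)[OF True, of "- x + y" n] M \<epsilon>(1)[of n]
       by (intro add_mono mult_mono) (auto intro: less_imp_le)
      finally show ?thesis using True by simp
     qed simp
    qed (intro Bochner_Integration.integrable_diff i1 i2)
    also have "\<dots> = m * (2 * M * \<epsilon> n)" using Tm by (simp add: m_def)
    finally show ?thesis .
   qed
   have "cv f g x * cv a b x - S n x = (LI y. f y * cnj (g (- x + y)) * (cv a b x - R y))"
    unfolding S_eq cv_def[of f g] using S_int cint[OF f g]
    by (simp add: right_diff_distrib Bochner_Integration.integral_diff)
   also have "cmod \<dots> \<le> (LI y. cmod (f y) * (M * (m * (2 * M * \<epsilon> n))))"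
   proof (rule norm_integral_le)
    show "integrable \<mu> (\<lambda>y. f y * cnj (g (- x + y)) * (cv a b x - R y))"
     using S_int cint[OF f g] by (simp add: right_diff_distrib)
    show "integrable \<mu> (\<lambda>y. cmod (f y) * (M * (m * (2 * M * \<epsilon> n))))" using fi by simp
    show "cmod (f y * cnj (g (- x + y)) * (cv a b x - R y)) \<le> cmod (f y) * (M * (m * (2 * M * \<epsilon> n)))" for y
     using R[of y] M m0 \<epsilon>(1)[of n] by (cases "f y = 0") (auto simp: norm_mult mult.assoc intro!: mult_mono)
   qed
   also have "\<dots> = A * (M * (m * (2 * M * \<epsilon> n)))" by (simp add: A_def)
   finally show ?thesis .
  qed
  have "(\<lambda>n. A * (M * (m * (2 * M * \<epsilon> n)))) \<longlonglongrightarrow> A * (M * (m * (2 * M * (\<delta> * 0))))"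
   unfolding \<epsilon>_def by (intro tendsto_intros LIMSEQ_power_zero) auto
  then have "(\<lambda>n. A * (M * (m * (2 * M * \<epsilon> n)))) \<longlonglongrightarrow> 0" by simp
  then have "(\<lambda>n. cv f g x * cv a b x - S n x) \<longlonglongrightarrow> 0"
   by (rule Lim_null_comparison[OF always_eventually[OF allI[OF le]]])
  then have "(\<lambda>n. cv f g x * cv a b x - (cv f g x * cv a b x - S n x)) \<longlonglongrightarrow> cv f g x * cv a b x - 0"
   by (intro tendsto_diff tendsto_const)
  then show ?thesis by simp
 qed

 have "atomic (\<lambda>x. cv f g x * cv a b x - S 0 x) (\<Sum>n. (m * 4 * M * \<delta>) * (1/2) ^ n)"
 proof (rule atomic_sums)
  show "atomic (\<lambda>x. S (Suc n) x - S n x) ((m * 4 * M * \<delta>) * (1/2) ^ n)" for n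
   using step[of n] unfolding \<epsilon>_def by (simp add: mult.assoc)
  show "(\<lambda>n. S (Suc n) x - S n x) sums (cv f g x * cv a b x - S 0 x)" for x
   by (rule telescope_sums[OF lim])
 qed (rule half_powers)
 then have "atomic (\<lambda>x. cv f g x * cv a b x - S 0 x) (8 * M * m * \<delta>)" unfolding half_powers by (simp add: mult_ac)
 from atomic_add[OF bound0 this] have "atomic (\<lambda>x. cv f g x * cv a b x) (Kp - 1 + 8 * M * m * \<delta>)" by simp
 then show ?thesis using \<delta>(4) by (elim atomic_mono) simp
qed

lemma atomic_mult:
 assumes u: "atomic u c" and v: "atomic v d"
 shows "atomic (\<lambda>x. u x * v x) (Kp * c * d)"
proof -
 obtain a f g where w: "\<And>i::nat. f i \<in> Cc \<and> g i \<in> Cc \<and> Lp_norm p \<mu> (f i) \<le> 1 \<and> Lp_norm q \<mu> (g i) \<le> 1"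
  "summable (\<lambda>i. cmod (a i))" "(\<Sum>i. cmod (a i)) \<le> c" "\<And>x. (\<lambda>i. a i * cv (f i) (g i) x) sums u x"
  using u unfolding atomic_def decomposition_def by blast
 obtain a' f' g' where w': "\<And>i::nat. f' i \<in> Cc \<and> g' i \<in> Cc \<and> Lp_norm p \<mu> (f' i) \<le> 1 \<and> Lp_norm q \<mu> (g' i) \<le> 1"
  "summable (\<lambda>i. cmod (a' i))" "(\<Sum>i. cmod (a' i)) \<le> d" "\<And>x. (\<lambda>i. a' i * cv (f' i) (g' i) x) sums v x"
  using v unfolding atomic_def decomposition_def by blast
 have c0: "c \<ge> 0" and d0: "d \<ge> 0" using u v by (auto intro: atomic_nonneg)
 have inner: "atomic (\<lambda>x. cv (f i) (g i) x * v x) (Kp * d)" for i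
 proof -
  have "atomic (\<lambda>x. cv (f i) (g i) x * v x) (\<Sum>j. cmod (a' j) * Kp)"
  proof (rule atomic_sums)
   show "atomic (\<lambda>x. a' j * (cv (f i) (g i) x * cv (f' j) (g' j) x)) (cmod (a' j) * Kp)" for j
    using w(1) w'(1) by (intro atomic_scale atomic_mult_Cc) auto
   show "summable (\<lambda>j. cmod (a' j) * Kp)" using w'(2) by (rule summable_mult2)
   show "(\<lambda>j. a' j * (cv (f i) (g i) x * cv (f' j) (g' j) x)) sums (cv (f i) (g i) x * v x)" for x
    using sums_mult[OF w'(4)[of x], of "cv (f i) (g i) x"] by (simp add: mult_ac)
  qed
  moreover have "(\<Sum>j. cmod (a' j) * Kp) \<le> Kp * d"
   using w'(2,3) Kp1 by (subst suminf_mult2[symmetric]) (auto simp: mult.commute)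
  ultimately show ?thesis by (rule atomic_mono)
 qed
 have "atomic (\<lambda>x. u x * v x) (\<Sum>i. cmod (a i) * (Kp * d))"
 proof (rule atomic_sums)
  show "atomic (\<lambda>x. a i * (cv (f i) (g i) x * v x)) (cmod (a i) * (Kp * d))" for i
   by (intro atomic_scale inner)
  show "summable (\<lambda>j. cmod (a j) * (Kp * d))" using w(2) by (rule summable_mult2)
  show "(\<lambda>j. a j * (cv (f j) (g j) x * v x)) sums (u x * v x)" for x
   using sums_mult2[OF w(4)[of x], of "v x"] by (simp add: mult_ac)
 qed
 moreover have "(\<Sum>j. cmod (a j) * (Kp * d)) \<le> Kp * c * d"
 proof -
  have "(\<Sum>j. cmod (a j) * (Kp * d)) = (\<Sum>j. cmod (a j)) * (Kp * d)" using w(2) by (rule suminf_mult2[symmetric])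
  also have "\<dots> \<le> c * (Kp * d)" using w(3) Kp1 d0 by (intro mult_right_mono) auto
  finally show ?thesis by (simp add: mult_ac)
 qed
 ultimately show ?thesis by (rule atomic_mono)
qed

lemma Ap_ops [simp]:
 "vadd (Ap_algebra p \<mu>) u v = (\<lambda>x. u x + v x)" "vscale (Ap_algebra p \<mu>) c u = (\<lambda>x. c * u x)"
 "vmult (Ap_algebra p \<mu>) u v = (\<lambda>x. u x * v x)" "vnorm (Ap_algebra p \<mu>) = Ap_norm p \<mu>"
 unfolding Ap_algebra_def by auto

lemma Ap_closed_scale:
 assumes "u \<in> Ap"
 shows "(\<lambda>x. c * u x) \<in> Ap"
 using assms atomic_scale unfolding Ap_carrier by blast

lemma Ap_closed:
 assumes "u \<in> Ap" "v \<in> Ap"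
 shows "(\<lambda>x. u x + v x) \<in> Ap" "(\<lambda>x. u x * v x) \<in> Ap"
  "(\<lambda>x. u x - v x) \<in> Ap"
proof -
 obtain a b where ab: "atomic u a" "atomic v b" using assms unfolding Ap_carrier by blast
 show "(\<lambda>x. u x + v x) \<in> Ap" "(\<lambda>x. u x * v x) \<in> Ap"
  unfolding Ap_carrier using atomic_add[OF ab] atomic_mult[OF ab] by blast+
 show "(\<lambda>x. u x - v x) \<in> Ap"
  unfolding Ap_carrier using atomic_add[OF ab(1) atomic_scale[OF ab(2), of "-1"]] by auto
qed

lemma atomic_power:
 assumes "atomic u c"
 shows "atomic (\<lambda>x. u x ^ Suc n) ((Kp * c) ^ n * c)"
proof (induction n)
 case (Suc n)
 from atomic_mult[OF assms Suc] show ?case by (simp add: mult_ac)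
qed (use assms in simp)

text \<open>The quasi-inverse \<open>u + u\<^sup>2 + \<dots>\<close> of a small element shows that characters are bounded.\<close>

lemma Ap_character_bound:
 assumes \<psi>: "\<psi> \<in> characters (Ap_algebra p \<mu>)" and u: "atomic u c"
 shows "cmod (\<psi> u) \<le> Kp * c"
proof (rule ccontr)
 assume "\<not> ?thesis"
 then have lt: "Kp * c < cmod (\<psi> u)" by simp
 have lin: "\<psi> (\<lambda>x. a x + b x) = \<psi> a + \<psi> b" "\<psi> (\<lambda>x. a x * b x) = \<psi> a * \<psi> b" "\<psi> (\<lambda>x. z * a x) = z * \<psi> a"
  if "a \<in> Ap" "b \<in> Ap" for a b z
  using \<psi> that unfolding characters_def linear_functional_def by auto
 have c0: "c \<ge> 0" using u by (rule atomic_nonneg)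
 have pos: "cmod (\<psi> u) > 0" using lt c0 Kp1 by (smt (verit) mult_nonneg_nonneg)
 define v where "v = (\<lambda>x. 1 / \<psi> u * u x)"
 define d where "d = c / cmod (\<psi> u)"
 have v: "atomic v d" using atomic_scale[OF u, of "1 / \<psi> u"] unfolding v_def d_def by (simp add: norm_divide)
 have uc: "u \<in> Ap" and vc: "v \<in> Ap"
  unfolding Ap_carrier using u v by blast+
 have v1: "\<psi> v = 1" unfolding v_def using lin(3)[OF uc uc, of "1 / \<psi> u"] pos by auto
 have d0: "d \<ge> 0" and dK: "Kp * d < 1" unfolding d_def using c0 lt pos by (auto simp: field_simps)
 have d1: "d < 1"
 proof -
  have "1 * d \<le> Kp * d" by (intro mult_right_mono Kp1 d0)
  then show ?thesis using dK by simp
 qed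
 have vx: "cmod (v x) < 1" for x using atomic_bound[OF v, of x] d1 by simp
 define b where "b = (\<lambda>x. v x / (1 - v x))"
 have "atomic b (\<Sum>n. (Kp * d) ^ n * d)"
 proof (rule atomic_sums)
  show "atomic (\<lambda>x. v x ^ Suc n) ((Kp * d) ^ n * d)" for n by (rule atomic_power[OF v])
  show "summable (\<lambda>n. (Kp * d) ^ n * d)" using dK d0 Kp1 by (intro summable_mult2 summable_geometric) auto
  show "(\<lambda>n. v x ^ Suc n) sums b x" for x
   using sums_mult[OF geometric_sums[OF vx[of x]], of "v x"] unfolding b_def by simp
 qed
 then have bc: "b \<in> Ap" unfolding Ap_carrier by blast
 \<comment> \<open>Since \<psi> v = 1, applying \<psi> to this identity will give \<psi> b = 1 +
   \<psi> b. The series for \<open>b\<close> converges in the atomic sense because Kp * d < 1, which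
   is why the bound contains \<open>Kp\<close>.\<close>
 have "b = (\<lambda>x. v x + v x * b x)"
 proof
  fix x
  have "v x \<noteq> 1" using vx[of x] by auto
  then show "b x = v x + v x * b x" unfolding b_def by (simp add: field_simps)
 qed
 then have "\<psi> b = \<psi> (\<lambda>x. v x + v x * b x)" by simp
 also have "\<dots> = \<psi> v + \<psi> v * \<psi> b"
  using lin(1)[OF vc Ap_closed(2)[OF vc bc]] lin(2)[OF vc bc] by simp
 finally show False using v1 by simp
qed

lemma Ap_character_bounded:
 assumes \<psi>: "\<psi> \<in> characters (Ap_algebra p \<mu>)" and u: "u \<in> Ap"
 shows "cmod (\<psi> u) \<le> (256 * Kp) * Ap_norm p \<mu> u"
proof (rule field_le_epsilon)
 fix e :: real assume e: "e > 0"
 define d where "d = e / (256 * Kp)"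
 have d: "d > 0" using e Kp1 unfolding d_def by simp
 have "cmod (\<psi> u) \<le> Kp * (256 * (Ap_norm p \<mu> u + d))"
  by (rule Ap_character_bound[OF \<psi> Ap_norm_atomic[OF u]]) (use d in simp)
 also have "\<dots> = 256 * Kp * Ap_norm p \<mu> u + e" using Kp1 unfolding d_def by (simp add: field_simps)
 finally show "cmod (\<psi> u) \<le> (256 * Kp) * Ap_norm p \<mu> u + e" .
qed

end

section \<open>The spectrum of the Figa-Talamanca--Herz algebra\<close>

context haar_p
begin

lemma neighbourhood_difference:
 fixes x :: 'g
 assumes "open U" "x \<in> U"
 obtains N where "open N" "0 \<in> N" "\<And>c d. c \<in> N ==> d \<in> N ==> x + c + - d \<in> U"
proof -
 have "open ((\<lambda>z. x + fst z + - snd z) -` U)"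
  by (intro open_vimage assms continuous_intros)
 moreover have "(0, 0) \<in> (\<lambda>z. x + fst z + - snd z) -` U" using assms by simp
 ultimately obtain A B where AB: "open A" "open B" "(0, 0) \<in> A \<times> B" "A \<times> B \<subseteq> (\<lambda>z. x + fst z + - snd z) -` U"
  by (rule open_prod_elim)
 show thesis by (rule that[of "A \<inter> B"]) (use AB in auto)
qed

text \<open>For Borel sets the value is the measure of A \<inter> zB. The two lemmas that follow
  evaluate it when A lies in zB and when the two are disjoint.\<close>

lemma indicator_cv:
 "cv (indicator A) (indicator B) z = (LI y. indicator {y. y \<in> A \<and> - z + y \<in> B} y)"
 unfolding cv_def by (intro Bochner_Integration.integral_cong) (auto simp: indicator_def)

lemma indicator_cv_full:
 assumes "A \<in> sets borel" "\<And>y. y \<in> A ==> - z + y \<in> B"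
 shows "cv (indicator A) (indicator B) z = complex_of_real (measure \<mu> A)"
proof -
 have "{y. y \<in> A \<and> - z + y \<in> B} = A" using assms(2) by auto
 then have "cv (indicator A) (indicator B) z = (LI y. complex_of_real (indicator A y))"
  unfolding indicator_cv by (simp add: of_real_indicator)
 also have "\<dots> = complex_of_real (LI y. indicator A y)" by (rule integral_complex_of_real)
 finally show ?thesis using assms(1) by simp
qed

lemma indicator_cv_empty:
 assumes "\<And>y. y \<in> A ==> - z + y \<notin> B"
 shows "cv (indicator A) (indicator B) z = 0"
proof -
 have "indicator {y. y \<in> A \<and> - z + y \<in> B} = (\<lambda>y. 0 :: complex)" using assms by (auto simp: indicator_def)
 then show ?thesis unfolding indicator_cv by simp
qed

lemma indicator_norm:
 assumes "A \<in> sets borel" "emeasure \<mu> A < \<infinity>"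
 shows "Lp_norm r \<mu> (indicator A) = measure \<mu> A powr (1 / r)"
 unfolding Lp_norm_def indicator_Lp(2)[OF assms] ..

lemma small_compact:
 fixes N :: "'g set"
 assumes "open N" "0 \<in> N"
 obtains C V where "compact C" "C \<subseteq> N" "open V" "0 \<in> V" "V \<subseteq> C" "measure \<mu> C > 0"
proof -
 obtain V C where VC: "open V" "compact C" "(0::'g) \<in> V" "V \<subseteq> C" "C \<subseteq> N"
  using compact_neighbourhood[OF assms] by metis
 have "0 < emeasure \<mu> V" using emeasure_open_pos[of V] VC by blast
 also have "\<dots> \<le> emeasure \<mu> C" using VC compact_borel by (intro emeasure_mono) auto
 finally have "measure \<mu> C > 0"
  using emeasure_compact[OF VC(2)] by (simp add: measure_def enn2real_positive_iff)
 then show thesis using that VC by blast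
qed

lemma measure_translate: "A \<in> sets borel ==> measure \<mu> ((+) x ` A) = measure \<mu> A"
 unfolding measure_def by (simp add: emeasure_left_translate)

text \<open>Take A = xC and a compact D whose interior contains C. By the tube lemma A \<subseteq>
  zD for all z near x, so the normalised coefficient of the two indicators is constantly 1 there.
  Its norm is not controlled; compare \<open>Ap_peak\<close>.\<close>

lemma Ap_bump:
 fixes x :: 'g
 assumes "open U" "x \<in> U"
 obtains v W where "v \<in> Ap" "open W" "x \<in> W" "\<And>z. z \<in> W ==> v z = 1" "\<And>z. z \<notin> U ==> v z = 0"
proof -
 obtain N where N: "open N" "0 \<in> N" "\<And>c d. c \<in> N ==> d \<in> N ==> x + c + - d \<in> U"
  using neighbourhood_difference[OF assms] by blast
 obtain D V1 where D: "compact D" "D \<subseteq> N" "open V1" "0 \<in> V1" "V1 \<subseteq> D"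
  using small_compact[OF N(1,2)] by metis
 obtain C where C: "compact C" "C \<subseteq> V1" "measure \<mu> C > 0"
  using small_compact[OF D(3,4)] by metis
 define A where "A = (+) x ` C"
 have A: "compact A" unfolding A_def by (rule compact_left_translate[OF C(1)])
 have mA: "measure \<mu> A = measure \<mu> C" unfolding A_def by (rule measure_translate[OF compact_borel[OF C(1)]])
 define v where "v = (\<lambda>z. complex_of_real (1 / measure \<mu> C) * cv (indicator A) (indicator D) z)"
 have L: "(indicator A :: 'g => complex) \<in> Lp_fun p \<mu>" "(indicator D :: 'g => complex) \<in> Lp_fun q \<mu>"
  by (intro indicator_Lp compact_borel emeasure_compact A D)+
 have "continuous_on UNIV (\<lambda>z::'g \<times> 'g. - snd z + fst z)" by (intro continuous_intros)
 moreover have "- x + y \<in> V1" if "y \<in> A" for y using that C(2) unfolding A_def left_translate_image by auto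
 ultimately obtain W where W: "open W" "x \<in> W" "\<And>y z. y \<in> A ==> z \<in> W ==> - z + y \<in> V1"
  using open_tube_set[of "\<lambda>z::'g \<times> 'g. - snd z + fst z" A V1 x] A D(3) by auto
 show thesis
 proof (rule that[of v W])
  show "v \<in> Ap" unfolding v_def by (intro Ap_closed_scale cv_representation L)
  show "v z = 1" if "z \<in> W" for z
  proof -
   have "cv (indicator A) (indicator D) z = complex_of_real (measure \<mu> A)"
    by (rule indicator_cv_full[OF compact_borel[OF A]]) (use W(3)[OF _ that] D(5) in auto)
   then show ?thesis unfolding v_def mA using C(3) by simp
  qed
  show "v z = 0" if "z \<notin> U" for z
  proof -
   have "cv (indicator A) (indicator D) z = 0"
   proof (rule indicator_cv_empty)
    fix y assume y: "y \<in> A"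
    show "- z + y \<notin> D"
    proof
     assume d: "- z + y \<in> D"
     obtain c where c: "c \<in> C" "y = x + c" using y unfolding A_def by auto
     have "z = y + - (- z + y)" by (simp only: minus_add minus_minus add_minus_cancel)
     then have "z = x + c + - (- z + y)" using c by simp
     then show False using N(3)[of c "- z + y"] that c d C D by (metis subsetD)
    qed
   qed
   then show ?thesis unfolding v_def by simp
  qed
 qed (use W in auto)
qed

lemma Ap_peak:
 fixes x :: 'g
 assumes "open U" "x \<in> U"
 obtains v where "v \<in> Ap" "Ap_norm p \<mu> v \<le> 1" "v x = 1" "\<And>z. z \<notin> U ==> v z = 0"
  "\<And>z. \<exists>r\<ge>0. v z = complex_of_real r"
proof -
 obtain N where N: "open N" "0 \<in> N" "\<And>c d. c \<in> N ==> d \<in> N ==> x + c + - d \<in> U"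
  using neighbourhood_difference[OF assms] by blast
 obtain C where C: "compact C" "C \<subseteq> N" "measure \<mu> C > 0"
  using small_compact[OF N(1,2)] by metis
 define A where "A = (+) x ` C"
 have A: "compact A" unfolding A_def by (rule compact_left_translate[OF C(1)])
 have mA: "measure \<mu> A = measure \<mu> C" unfolding A_def by (rule measure_translate[OF compact_borel[OF C(1)]])
 define f where "f = (\<lambda>z. complex_of_real (1 / measure \<mu> C) * (indicator A z :: complex))"
 have L: "(indicator A :: 'g => complex) \<in> Lp_fun p \<mu>" "(indicator C :: 'g => complex) \<in> Lp_fun q \<mu>"
  by (intro indicator_Lp compact_borel emeasure_compact A C)+
 have fL: "f \<in> Lp_fun p \<mu>" unfolding f_def by (intro Lp_fun_scale L)
 have v: "cv f (indicator C) z = complex_of_real (1 / measure \<mu> C) * cv (indicator A) (indicator C) z" for z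
  unfolding f_def by (rule cv_scale_left)
 have nf: "Lp_norm p \<mu> f * Lp_norm q \<mu> (indicator C) = 1"
 proof -
  have "Lp_norm p \<mu> f * Lp_norm q \<mu> (indicator C) = (1 / measure \<mu> C) * (measure \<mu> C powr (1 / p) * measure \<mu> C powr (1 / q))"
   unfolding f_def Lp_norm_scale[OF p0] using C A mA
   by (simp add: indicator_norm[OF compact_borel[OF C(1)] emeasure_compact[OF C(1)]]
     indicator_norm[OF compact_borel[OF A] emeasure_compact[OF A]] norm_divide)
  also have "measure \<mu> C powr (1 / p) * measure \<mu> C powr (1 / q) = measure \<mu> C"
   using C(3) pq by (simp add: powr_add[symmetric])
  finally show ?thesis using C(3) by simp
 qed
 show thesis
 proof (rule that[of "cv f (indicator C)"])
  show "cv f (indicator C) \<in> Ap" by (intro cv_representation fL L)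
  show "Ap_norm p \<mu> (cv f (indicator C)) \<le> 1" using cv_representation(2)[OF fL L(2)] nf by simp
  have "cv (indicator A) (indicator C) x = complex_of_real (measure \<mu> A)"
   by (rule indicator_cv_full[OF compact_borel[OF A]]) (auto simp: A_def left_translate_image)
  then show "cv f (indicator C) x = 1" unfolding v mA using C(3) by simp
  show "cv f (indicator C) z = 0" if "z \<notin> U" for z
  proof -
   have "cv (indicator A) (indicator C) z = 0"
   proof (rule indicator_cv_empty)
    fix y assume y: "y \<in> A"
    show "- z + y \<notin> C"
    proof
     assume d: "- z + y \<in> C"
     obtain c where c: "c \<in> C" "y = x + c" using y unfolding A_def by auto
     have "z = y + - (- z + y)" by (simp only: minus_add minus_minus add_minus_cancel)
     then have "z = x + c + - (- z + y)" using c by simp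
     then show False using N(3)[of c "- z + y"] that c d C by (metis subsetD)
    qed
   qed
   then show ?thesis unfolding v by simp
  qed
  show "\<exists>r\<ge>0. cv f (indicator C) z = complex_of_real r" for z
  proof -
   have "cv (indicator A) (indicator C) z = (LI y. complex_of_real (indicator {y. y \<in> A \<and> - z + y \<in> C} y))"
    unfolding indicator_cv by (simp add: of_real_indicator)
   also have "\<dots> = complex_of_real (LI y. indicator {y. y \<in> A \<and> - z + y \<in> C} y)" by (rule integral_complex_of_real)
   finally have "cv f (indicator C) z = complex_of_real ((1 / measure \<mu> C) * (LI y. indicator {y. y \<in> A \<and> - z + y \<in> C} y))"
    unfolding v by simp
   then show ?thesis by (intro exI[of _ "(1 / measure \<mu> C) * (LI y. indicator {y. y \<in> A \<and> - z + y \<in> C} y)"]) auto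
  qed
 qed
qed

definition evaluation :: "'g => ('g => complex) => complex" where
 "evaluation x = (\<lambda>u. if u \<in> Ap then u x else 0)"

lemma evaluation_character: "evaluation x \<in> characters (Ap_algebra p \<mu>)"
proof -
 obtain v where "v \<in> Ap" "v x = 1"
  using Ap_peak[OF open_UNIV UNIV_I, of x] by metis
 then show ?thesis
  unfolding characters_def linear_functional_def evaluation_def using Ap_closed Ap_closed_scale
  by (auto intro!: bexI[of _ v])
qed

text \<open>The tails of an atomic decomposition have bounds tending to 0, so a bounded functional
  is determined by its values on atoms. It is stated for a general \<open>D\<close> because it is
  applied to a character and also to the difference of a character and a multiple of an
  evaluation.\<close>

lemma functional_zeroI:
 assumes add: "\<And>u v. u \<in> Ap ==> v \<in> Ap ==> D (\<lambda>x. u x + v x) = D u + D v"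
  and scale: "\<And>c u. u \<in> Ap ==> D (\<lambda>x. c * u x) = c * D u"
  and bound: "\<And>u c. atomic u c ==> cmod (D u) \<le> K * c"
  and zero: "\<And>f g. f \<in> Cc ==> g \<in> Cc ==> D (cv f g) = (0::complex)"
  and u: "u \<in> Ap"
 shows "D u = 0"
proof -
 obtain c where "atomic u c" using u unfolding Ap_carrier by blast
 then obtain a f g where w: "\<And>i::nat. f i \<in> Cc \<and> g i \<in> Cc \<and> Lp_norm p \<mu> (f i) \<le> 1 \<and> Lp_norm q \<mu> (g i) \<le> 1"
  "summable (\<lambda>i. cmod (a i))" "\<And>x. (\<lambda>i. a i * cv (f i) (g i) x) sums u x"
  unfolding atomic_def decomposition_def by blast
 define P where "P = (\<lambda>n x. \<Sum>i<n. a i * cv (f i) (g i) x)"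
 have at: "atomic (cv (f i) (g i)) (1 * 1)" for i using w(1) by (intro atomic_Cc) auto
 have Pn: "P n \<in> Ap \<and> D (P n) = 0" for n
 proof (induction n)
  case 0
  have "(\<lambda>x. 0) \<in> Ap" unfolding Ap_carrier using atomic_zero by blast
  moreover have "D (\<lambda>x. 0) = 0" using bound[OF atomic_zero] by simp
  ultimately show ?case unfolding P_def by simp
 next
  case (Suc n)
  have c: "cv (f n) (g n) \<in> Ap" unfolding Ap_carrier using at by blast
  have "P (Suc n) = (\<lambda>x. P n x + a n * cv (f n) (g n) x)" unfolding P_def by simp
  then show ?case using Suc Ap_closed(1)[OF _ Ap_closed_scale[OF c]] add[OF _ Ap_closed_scale[OF c]] scale[OF c] zero w(1) by simp
 qed
 have tail: "cmod (D u) \<le> K * (\<Sum>i. cmod (a (i + n)))" for n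
 proof -
  have s: "summable (\<lambda>i. cmod (a (i + n)))" using w(2) by (rule summable_ignore_initial_segment)
  have "decomposition (\<lambda>i. a (i + n)) (\<lambda>i. f (i + n)) (\<lambda>i. g (i + n)) (\<lambda>x. u x - P n x) (\<Sum>i. cmod (a (i + n)))"
   unfolding decomposition_def P_def using w s sums_split_initial_segment[OF w(3)] by auto
  then have A: "atomic (\<lambda>x. u x - P n x) (\<Sum>i. cmod (a (i + n)))" unfolding atomic_def by blast
  then have "(\<lambda>x. u x - P n x) \<in> Ap" unfolding Ap_carrier by blast
  then have "D (\<lambda>x. (u x - P n x) + P n x) = D (\<lambda>x. u x - P n x) + D (P n)" using Pn by (intro add) auto
  then have "D u = D (\<lambda>x. u x - P n x)" using Pn[of n] by simp
  then show ?thesis using bound[OF A] by simp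
 qed
 have "(\<lambda>n. K * (\<Sum>i. cmod (a (i + n)))) \<longlonglongrightarrow> K * 0"
 proof (intro tendsto_mult tendsto_const)
  show "(\<lambda>n. \<Sum>i. cmod (a (i + n))) \<longlonglongrightarrow> 0"
  proof (rule LIMSEQ_I)
   fix r :: real assume "r > 0"
   then show "\<exists>no. \<forall>n\<ge>no. norm ((\<Sum>i. cmod (a (i + n))) - 0) < r" using suminf_exist_split[OF _ w(2)] by simp
  qed
 qed
 then have "cmod (D u) \<le> K * 0" by (rule LIMSEQ_le_const) (use tail in auto)
 then show ?thesis by simp
qed

text \<open>Compactness produces a point x0 at which \<psi> is concentrated, and \<psi> then
  vanishes on functions that are 0 near x0. What remains is that a point is a set of synthesis:
  \<psi> must be determined by the value at x0. This is checked on coefficients of indicators of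
  compact sets, which by regularity differ little from functions that are 0 or constant near x0, and
  extended to L^p and L^q by density in one argument at a time.\<close>

theorem Ap_characters:
 assumes \<psi>: "\<psi> \<in> characters (Ap_algebra p \<mu>)"
 obtains x where "\<psi> = evaluation x"
proof -
 let ?A = "Ap"
 have padd: "\<psi> (\<lambda>x. a x + b x) = \<psi> a + \<psi> b" and pmult: "\<psi> (\<lambda>x. a x * b x) = \<psi> a * \<psi> b" and pscale: "\<psi> (\<lambda>x. z * a x) = z * \<psi> a"
  if "a \<in> ?A" "b \<in> ?A" for a b z
  using \<psi> that unfolding characters_def linear_functional_def by auto
 have pout: "\<psi> a = 0" if "a \<notin> ?A" for a using \<psi> that unfolding characters_def linear_functional_def by auto
 obtain u1 where u1: "u1 \<in> ?A" "\<psi> u1 \<noteq> 0" using \<psi> unfolding characters_def by auto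
 have pdiff: "\<psi> (\<lambda>x. a x - b x) = \<psi> a - \<psi> b" if "a \<in> ?A" "b \<in> ?A" for a b
  using padd[OF that(1) Ap_closed_scale[OF that(2)], of "-1"] pscale[OF that(2) that(2), of "-1"] by simp
 have p0': "\<psi> (\<lambda>x. 0) = 0" using pscale[OF u1(1) u1(1), of 0] by simp

 \<comment> \<open>An open set is dead if it misses the support of \<psi>. If every point had a dead
   neighbourhood, \<psi> would vanish.\<close>
 define dead where "dead = (\<lambda>U. \<forall>w\<in>?A. (\<forall>z. z \<notin> U --> w z = 0) --> \<psi> w = 0)"
 have "\<exists>x0. \<forall>U. open U --> x0 \<in> U --> \<not> dead U"
 proof (rule ccontr)
  assume "\<not> ?thesis"
  then have "\<forall>x. \<exists>U. open U \<and> x \<in> U \<and> dead U" by simp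
  then obtain U where U1: "\<And>x. open (U x)" "\<And>x. x \<in> U x" "\<And>x. dead (U x)"
   by metis
  have U: "\<And>x. open (U x)" "\<And>x. x \<in> U x" "\<And>x w. w \<in> ?A ==> (\<And>z. z \<notin> U x ==> w z = 0) ==> \<psi> w = 0"
   using U1 unfolding dead_def by (simp, simp, metis)
  have "\<forall>x. \<exists>v W. v \<in> ?A \<and> open W \<and> x \<in> W \<and> (\<forall>z\<in>W. v z = 1) \<and> (\<forall>z. z \<notin> U x --> v z = 0)"
  proof
   fix x
   obtain v W where "v \<in> ?A" "open W" "x \<in> W" "\<And>z. z \<in> W ==> v z = 1" "\<And>z. z \<notin> U x ==> v z = 0"
    by (rule Ap_bump[OF U(1,2)[of x]]) (rule that)
   then show "\<exists>v W. v \<in> ?A \<and> open W \<and> x \<in> W \<and> (\<forall>z\<in>W. v z = 1) \<and> (\<forall>z. z \<notin> U x --> v z = 0)"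
    by blast
  qed
  then obtain v W where v: "\<And>x. v x \<in> ?A" "\<And>x. open (W x)" "\<And>x. x \<in> W x" "\<And>x z. z \<in> W x ==> v x z = 1" "\<And>x z. z \<notin> U x ==> v x z = 0"
   by metis
  have z: "\<psi> (cv f g) = 0" if f: "f \<in> Cc" and g: "g \<in> Cc" for f g
  proof -
   have c: "cv f g \<in> ?A" using cv_representation(1) Cc_Lp p0 q0 f g by blast
   from CcE[OF cv_Cc[OF f g]] obtain K where K: "compact K" "\<And>x. x \<notin> K ==> cv f g x = 0" by blast
   have "K \<subseteq> (\<Union>x\<in>K. W x)" using v(3) by blast
   then obtain F where F: "F \<subseteq> K" "finite F" "K \<subseteq> (\<Union>x\<in>F. W x)"
    by (rule compactE_image[OF K(1) v(2)])
   \<comment> \<open>Subtracting r * v x clears W x from the support. The subtracted function lives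
     in the dead set U x, so the value of \<psi> is unchanged; after finitely many steps the
     function is 0. No partition of unity is needed for this.\<close>
   have "\<exists>r\<in>?A. \<psi> r = \<psi> (cv f g) \<and> (\<forall>z. cv f g z = 0 --> r z = 0) \<and> (\<forall>x\<in>F. \<forall>z\<in>W x. r z = 0)"
    using F(2)
   proof (induction F rule: finite_induct)
    case (insert x F)
    then obtain r where r: "r \<in> ?A" "\<psi> r = \<psi> (cv f g)" "\<And>z. cv f g z = 0 ==> r z = 0" "\<And>x z. x \<in> F ==> z \<in> W x ==> r z = 0"
     by blast
    have rv: "(\<lambda>z. r z * v x z) \<in> ?A" by (intro Ap_closed(2) r v)
    have "\<psi> (\<lambda>z. r z * v x z) = 0" by (rule U(3)[OF rv, of x]) (simp add: v(5))
    then have "\<psi> (\<lambda>z. r z - r z * v x z) = \<psi> (cv f g)" using pdiff[OF r(1) rv] r(2) by simp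
    then show ?case using Ap_closed(3)[OF r(1) rv] r(3,4) v(4)
     by (intro bexI[of _ "\<lambda>z. r z - r z * v x z"]) auto
   qed (use c in auto)
   then obtain r where r: "\<psi> r = \<psi> (cv f g)" "\<And>z. cv f g z = 0 ==> r z = 0" "\<And>x z. x \<in> F ==> z \<in> W x ==> r z = 0"
    by blast
   have "r z = 0" for z using r(2,3) K(2) F(3) by blast
   then have "r = (\<lambda>z. 0)" by auto
   then show ?thesis using r(1) p0' by simp
  qed
  have "\<psi> u1 = 0"
  proof (rule functional_zeroI[of \<psi> Kp, OF _ _ _ _ u1(1)])
   show "\<psi> (\<lambda>x. u x + v x) = \<psi> u + \<psi> v" if "u \<in> ?A" "v \<in> ?A" for u v by (rule padd[OF that])
   show "\<psi> (\<lambda>x. c * u x) = c * \<psi> u" if "u \<in> ?A" for u c by (rule pscale[OF that that])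
  qed (use Ap_character_bound[OF \<psi>] z in auto)
  then show False using u1 by simp
 qed
 then obtain x0 where alive: "\<And>U. open U ==> x0 \<in> U ==> \<exists>w\<in>?A. (\<forall>z. z \<notin> U --> w z = 0) \<and> \<psi> w \<noteq> 0"
  unfolding dead_def by auto

 \<comment> \<open>A function \<open>w\<close> supported in \<open>U\<close> with \<psi> w \<noteq>
   0 annihilates u, and \<psi> is multiplicative.\<close>
 have local: "\<psi> u = 0" if u: "u \<in> ?A" and U: "open U" "x0 \<in> U" "\<And>z. z \<in> U ==> u z = 0" for u U
 proof -
  obtain w where w: "w \<in> ?A" "\<And>z. z \<notin> U ==> w z = 0" "\<psi> w \<noteq> 0" using alive[OF U(1,2)] by blast
  have "u z * w z = 0" for z using U(3)[of z] w(2)[of z] by (cases "z \<in> U") auto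
  then have "(\<lambda>z. u z * w z) = (\<lambda>z. 0)" by (rule ext)
  then have "\<psi> u * \<psi> w = 0" using pmult[OF u w(1)] p0' by simp
  then show ?thesis using w(3) by simp
 qed
 obtain k W where k: "k \<in> ?A" "open W" "x0 \<in> W" "\<And>z. z \<in> W ==> k z = 1"
  using Ap_bump[OF open_UNIV UNIV_I, of x0] by metis
 \<comment> \<open>By locality, \<psi> takes this value at every member that is 1 near x0. That it
   is 1 appears only at the end, from \<kappa> = \<kappa>^2 and \<kappa> \<noteq> 0.\<close>
 define \<kappa> where "\<kappa> = \<psi> k"
 define D where "D = (\<lambda>f g. \<psi> (cv f g) - \<kappa> * cv f g x0)"
 define B where "B = Kp * 256 + cmod \<kappa>"
 have B0: "B > 0" unfolding B_def using Kp1 by (simp add: add_pos_nonneg)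
 have cA: "cv f g \<in> ?A" if "f \<in> Lp_fun p \<mu>" "g \<in> Lp_fun q \<mu>" for f g by (rule cv_representation(1)[OF that])
 have Dadd1: "D (\<lambda>y. f y + f' y) g = D f g + D f' g" if "f \<in> Lp_fun p \<mu>" "f' \<in> Lp_fun p \<mu>" "g \<in> Lp_fun q \<mu>" for f f' g
 proof -
  have "cv (\<lambda>y. f y + f' y) g = (\<lambda>x. cv f g x + cv f' g x)" using cv_add_left_p[OF that] by auto
  then show ?thesis unfolding D_def using padd[OF cA[OF that(1,3)] cA[OF that(2,3)]] by (simp add: algebra_simps)
 qed
 have Dadd2: "D f (\<lambda>y. g y + g' y) = D f g + D f g'" if "f \<in> Lp_fun p \<mu>" "g \<in> Lp_fun q \<mu>" "g' \<in> Lp_fun q \<mu>" for f g g'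
 proof -
  have "cv f (\<lambda>y. g y + g' y) = (\<lambda>x. cv f g x + cv f g' x)" using cv_add_right_p[OF that] by auto
  then show ?thesis unfolding D_def using padd[OF cA[OF that(1,2)] cA[OF that(1,3)]] by (simp add: algebra_simps)
 qed
 have Dscale1: "D (\<lambda>y. c * f y) g = c * D f g" if "f \<in> Lp_fun p \<mu>" "g \<in> Lp_fun q \<mu>" for c f g
 proof -
  have "cv (\<lambda>y. c * f y) g = (\<lambda>x. c * cv f g x)" using cv_scale_left by auto
  then show ?thesis unfolding D_def using pscale[OF cA[OF that] cA[OF that]] by (simp add: algebra_simps)
 qed
 have Dscale2: "D f (\<lambda>y. c * g y) = cnj c * D f g" if "f \<in> Lp_fun p \<mu>" "g \<in> Lp_fun q \<mu>" for c f g
 proof -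
  have "cv f (\<lambda>y. c * g y) = (\<lambda>x. cnj c * cv f g x)" using cv_scale_right by auto
  then show ?thesis unfolding D_def using pscale[OF cA[OF that] cA[OF that]] by (simp add: algebra_simps)
 qed
 have Dbound: "cmod (D f g) \<le> B * (Lp_norm p \<mu> f * Lp_norm q \<mu> g)" if "f \<in> Lp_fun p \<mu>" "g \<in> Lp_fun q \<mu>" for f g
 proof -
  have "cmod (\<psi> (cv f g)) \<le> Kp * (256 * (Lp_norm p \<mu> f * Lp_norm q \<mu> g))"
   by (rule Ap_character_bound[OF \<psi> atomic_cv[OF that]])
  moreover have "cmod (\<kappa> * cv f g x0) \<le> cmod \<kappa> * (Lp_norm p \<mu> f * Lp_norm q \<mu> g)"
   unfolding norm_mult by (intro mult_left_mono cv_bound_p that) auto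
  ultimately show ?thesis unfolding D_def B_def
   using norm_triangle_ineq4[of "\<psi> (cv f g)" "\<kappa> * cv f g x0"] by (simp add: algebra_simps)
 qed

 have D1: "D (indicator E) (indicator H) = 0" if E: "compact E" and H: "compact H" and dis: "\<And>y. y \<in> E ==> - x0 + y \<notin> H" for E H
 proof -
  have L: "(indicator E :: 'g => complex) \<in> Lp_fun p \<mu>" "(indicator H :: 'g => complex) \<in> Lp_fun q \<mu>"
   by (intro indicator_Lp compact_borel emeasure_compact E H)+
  have "continuous_on UNIV (\<lambda>z::'g \<times> 'g. - snd z + fst z)" by (intro continuous_intros)
  moreover have "open (- H)" using compact_imp_closed[OF H] by (simp add: open_Compl)
  ultimately obtain U where U: "open U" "x0 \<in> U" "\<And>y z. y \<in> E ==> z \<in> U ==> - z + y \<in> - H"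
   using open_tube_set[of "\<lambda>z::'g \<times> 'g. - snd z + fst z" E "- H" x0] E dis by auto
  have z: "cv (indicator E) (indicator H) z = 0" if "z \<in> U" for z
   by (rule indicator_cv_empty) (use U(3)[OF _ that] in auto)
  then have "\<psi> (cv (indicator E) (indicator H)) = 0" by (intro local[OF cA[OF L] U(1,2)])
  then show ?thesis unfolding D_def using z[OF U(2)] by simp
 qed
 have D2: "D (indicator E) (indicator P) = 0"
  if E: "compact E" and P: "open P" "emeasure \<mu> P < \<infinity>" and sub: "\<And>y. y \<in> E ==> - x0 + y \<in> P" for E P
 proof -
  have L: "(indicator E :: 'g => complex) \<in> Lp_fun p \<mu>" "(indicator P :: 'g => complex) \<in> Lp_fun q \<mu>"
   using P by (intro indicator_Lp compact_borel[OF E] emeasure_compact[OF E]; simp)+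
  have "continuous_on UNIV (\<lambda>z::'g \<times> 'g. - snd z + fst z)" by (intro continuous_intros)
  then obtain U where U: "open U" "x0 \<in> U" "\<And>y z. y \<in> E ==> z \<in> U ==> - z + y \<in> P"
   using open_tube_set[of "\<lambda>z::'g \<times> 'g. - snd z + fst z" E P x0] E P sub by auto
  have z: "cv (indicator E) (indicator P) z = complex_of_real (measure \<mu> E)" if "z \<in> U" for z
   by (rule indicator_cv_full[OF compact_borel[OF E]]) (use U(3)[OF _ that] in auto)
  have kE: "(\<lambda>z. complex_of_real (measure \<mu> E) * k z) \<in> ?A" by (rule Ap_closed_scale[OF k(1)])
  have "\<psi> (\<lambda>z. cv (indicator E) (indicator P) z - complex_of_real (measure \<mu> E) * k z) = 0"
   by (rule local[OF Ap_closed(3)[OF cA[OF L] kE], of "U \<inter> W"]) (use U k z in auto)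
  then have "\<psi> (cv (indicator E) (indicator P)) = complex_of_real (measure \<mu> E) * \<kappa>"
   using pdiff[OF cA[OF L] kE] pscale[OF k(1) k(1)] unfolding \<kappa>_def by simp
  then show ?thesis unfolding D_def using z[OF U(2)] by simp
 qed

 \<comment> \<open>\<open>D1\<close> covers disjoint sets and \<open>D2\<close> inclusion in an open
   set. In general C = E \<inter> x0 H is enclosed in an open Q with little excess: E - Q does not
   meet x0 H, H - P does not meet x0^-1 C, and C lies in x0 P. The leftover pieces have measure at
   most e and disappear with it.\<close>
 have D3: "D (indicator E) (indicator H) = 0" if E: "compact E" and H: "compact H" for E H
 proof -
  define C where "C = E \<inter> (+) x0 ` H"
  have C: "compact C" unfolding C_def using E compact_left_translate[OF H, of x0] by (simp add: compact_Int compact_imp_closed)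
  have CH: "- x0 + y \<in> H" if "y \<in> C" for y using that unfolding C_def left_translate_image by auto
  define n1 where "n1 = measure \<mu> H powr (1 / q)"
  define n2 where "n2 = measure \<mu> C powr (1 / p)"
  have est: "cmod (D (indicator E) (indicator H)) \<le> B * (e powr (1 / p) * n1 + n2 * e powr (1 / q))" if e: "e > 0" for e :: real
  proof -
   obtain Q where Q: "open Q" "C \<subseteq> Q" "emeasure \<mu> Q < \<infinity>" "emeasure \<mu> (Q - C) < ennreal e"
    by (rule outer_open[OF compact_borel[OF C] emeasure_compact[OF C] e])
   define P where "P = (+) (- x0) ` Q"
   have Pmem: "y \<in> P \<longleftrightarrow> x0 + y \<in> Q" for y unfolding P_def left_translate_image by simp
   have P: "open P"
   proof -
    have "P = (\<lambda>y. x0 + y) -` Q" using Pmem by auto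
    then show ?thesis using open_vimage[OF Q(1), of "\<lambda>y. x0 + y"] by (simp add: continuous_intros)
   qed
   have Pfin: "emeasure \<mu> P < \<infinity>" unfolding P_def using emeasure_left_translate[of Q] Q by simp
   have mQC: "measure \<mu> (E \<inter> Q - C) \<le> e" "E \<inter> Q - C \<in> sets borel" "emeasure \<mu> (E \<inter> Q - C) < \<infinity>"
   proof -
    show b: "E \<inter> Q - C \<in> sets borel" using E C Q compact_borel by auto
    have "emeasure \<mu> (E \<inter> Q - C) \<le> emeasure \<mu> (Q - C)" using C Q compact_borel by (intro emeasure_mono) auto
    then have l: "emeasure \<mu> (E \<inter> Q - C) < ennreal e" using Q(4) by simp
    then show "emeasure \<mu> (E \<inter> Q - C) < \<infinity>" by (simp add: order_less_trans)
    show "measure \<mu> (E \<inter> Q - C) \<le> e" unfolding measure_def using l e by (simp add: enn2real_leI less_imp_le)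
   qed
   have mPH: "measure \<mu> (P - H) \<le> e" "P - H \<in> sets borel" "emeasure \<mu> (P - H) < \<infinity>"
   proof -
    show b: "P - H \<in> sets borel" using H P compact_borel by auto
    have "P - H \<subseteq> (+) (- x0) ` (Q - C)" using Pmem unfolding C_def left_translate_image by auto
    then have "emeasure \<mu> (P - H) \<le> emeasure \<mu> ((+) (- x0) ` (Q - C))"
     using C Q compact_borel borel_translate[of "Q - C" "- x0"] by (intro emeasure_mono) auto
    also have "\<dots> = emeasure \<mu> (Q - C)" using C Q compact_borel by (intro emeasure_left_translate) auto
    finally have l: "emeasure \<mu> (P - H) < ennreal e" using Q(4) by simp
    then show "emeasure \<mu> (P - H) < \<infinity>" by (simp add: order_less_trans)
    show "measure \<mu> (P - H) \<le> e" unfolding measure_def using l e by (simp add: enn2real_leI less_imp_le)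
   qed
   have EQ: "compact (E - Q)" and HP: "compact (H - P)" using E H Q P by (simp_all add: compact_diff)
   have Lp: "(indicator X :: 'g => complex) \<in> Lp_fun r \<mu>" if "X \<in> sets borel" "emeasure \<mu> X < \<infinity>" for X r
    by (rule indicator_Lp[OF that])
   have LpC: "(indicator X :: 'g => complex) \<in> Lp_fun r \<mu>" if "compact X" for X r
    by (intro Lp compact_borel emeasure_compact that)
   have HPi: "H \<inter> P \<in> sets borel" "emeasure \<mu> (H \<inter> P) < \<infinity>"
   proof -
    show "H \<inter> P \<in> sets borel" using H P compact_borel by auto
    have "emeasure \<mu> (H \<inter> P) \<le> emeasure \<mu> H" using H compact_borel by (intro emeasure_mono) auto
    then show "emeasure \<mu> (H \<inter> P) < \<infinity>" using emeasure_compact[OF H] by simp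
   qed
   have CE: "C \<subseteq> E" unfolding C_def by auto
   have e1: "(indicator E :: 'g => complex) = (\<lambda>y. indicator (E - Q) y + (indicator C y + indicator (E \<inter> Q - C) y))"
    using CE Q(2) by (intro ext) (auto simp: indicator_def)
   have e2: "(indicator H :: 'g => complex) = (\<lambda>y. indicator (H - P) y + indicator (H \<inter> P) y)"
    by (intro ext) (auto simp: indicator_def)
   have e3: "(indicator P :: 'g => complex) = (\<lambda>y. indicator (H \<inter> P) y + indicator (P - H) y)"
    by (intro ext) (auto simp: indicator_def)
   have s1: "D (indicator E) (indicator H) = D (indicator (E - Q)) (indicator H) + (D (indicator C) (indicator H) + D (indicator (E \<inter> Q - C)) (indicator H))"
   proof -
    have "D (\<lambda>y. indicator (E - Q) y + (indicator C y + indicator (E \<inter> Q - C) y)) (indicator H)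
     = D (indicator (E - Q)) (indicator H) + D (\<lambda>y. indicator C y + indicator (E \<inter> Q - C) y) (indicator H)"
     by (intro Dadd1 Lp_fun_add(1) p0 LpC Lp mQC EQ C H)
    moreover have "D (\<lambda>y. indicator C y + indicator (E \<inter> Q - C) y) (indicator H)
     = D (indicator C) (indicator H) + D (indicator (E \<inter> Q - C)) (indicator H)"
     by (intro Dadd1 LpC Lp mQC C H)
    ultimately show ?thesis using e1 by simp
   qed
   have s2: "D (indicator C) (indicator H) = D (indicator C) (indicator (H - P)) + D (indicator C) (indicator (H \<inter> P))"
    by (subst e2, intro Dadd2 LpC Lp HPi HP C)
   have s3: "D (indicator C) (indicator P) = D (indicator C) (indicator (H \<inter> P)) + D (indicator C) (indicator (P - H))"
    by (subst e3, intro Dadd2 LpC Lp HPi mPH C)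
   have t1: "D (indicator (E - Q)) (indicator H) = 0"
    by (rule D1[OF EQ H]) (use Q(2) in \<open>auto simp: C_def left_translate_image\<close>)
   have t2: "D (indicator C) (indicator (H - P)) = 0"
    by (rule D1[OF C HP]) (use Q(2) in \<open>auto simp: Pmem add.assoc[symmetric]\<close>)
   have t3: "D (indicator C) (indicator P) = 0"
    by (rule D2[OF C P Pfin]) (use Q(2) in \<open>auto simp: Pmem add.assoc[symmetric]\<close>)
   have "D (indicator E) (indicator H) = D (indicator (E \<inter> Q - C)) (indicator H) - D (indicator C) (indicator (P - H))"
    using s1 s2 s3 t1 t2 t3 by (simp add: eq_neg_iff_add_eq_0)
   then have "cmod (D (indicator E) (indicator H)) \<le> cmod (D (indicator (E \<inter> Q - C)) (indicator H)) + cmod (D (indicator C) (indicator (P - H)))"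
    using norm_triangle_ineq4 by metis
   also have "\<dots> \<le> B * (Lp_norm p \<mu> (indicator (E \<inter> Q - C)) * Lp_norm q \<mu> (indicator H)) + B * (Lp_norm p \<mu> (indicator C) * Lp_norm q \<mu> (indicator (P - H)))"
    by (intro add_mono Dbound Lp LpC mQC mPH C H)
   also have "\<dots> \<le> B * (e powr (1 / p) * n1) + B * (n2 * e powr (1 / q))"
    unfolding n1_def n2_def using B0 mQC mPH H C p0 q0
    by (intro add_mono mult_left_mono mult_mono)
      (auto simp: indicator_norm indicator_norm[OF compact_borel[OF H] emeasure_compact[OF H]]
       indicator_norm[OF compact_borel[OF C] emeasure_compact[OF C]] intro!: powr_mono2)
   finally show ?thesis by (simp add: distrib_left)
  qed
  have "(\<lambda>n. B * ((1 / real (Suc n)) powr (1 / p) * n1 + n2 * (1 / real (Suc n)) powr (1 / q))) \<longlonglongrightarrow> B * (0 * n1 + n2 * 0)"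
  proof (intro tendsto_intros)
   have *: "(\<lambda>n. 1 / real (Suc n)) \<longlonglongrightarrow> 0" using LIMSEQ_inverse_real_of_nat by (simp add: inverse_eq_divide)
   show "(\<lambda>n. (1 / real (Suc n)) powr (1 / p)) \<longlonglongrightarrow> 0" using p0 by (intro tendsto_zero_powrI[OF *, where b="1/p"]) auto
   show "(\<lambda>n. (1 / real (Suc n)) powr (1 / q)) \<longlonglongrightarrow> 0" using q0 by (intro tendsto_zero_powrI[OF *, where b="1/q"]) auto
  qed
  then have "cmod (D (indicator E) (indicator H)) \<le> B * (0 * n1 + n2 * 0)"
   by (rule LIMSEQ_le_const) (use est in auto)
  then show ?thesis by simp
 qed

 have small: "\<exists>e>0. e powr (1 / r) * M < \<epsilon>" if "r > 0" "\<epsilon> > 0" "M \<ge> 0" for r M \<epsilon> :: real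
 proof -
  have "((\<epsilon> / (M + 1)) powr r) powr (1 / r) * M < \<epsilon>" using that by (simp add: powr_powr field_simps)
  moreover have "(\<epsilon> / (M + 1)) powr r > 0" using that by simp
  ultimately show ?thesis by blast
 qed
 have D4: "D f (indicator H) = 0" if H: "compact H" and f: "f \<in> Lp_fun p \<mu>" for f H
  using p0 f
 proof (induction rule: Lp_induct)
  case (indicator K)
  then show ?case using D3 H by blast
 next
  case (add f g)
  then show ?case using Dadd1 indicator_Lp[OF compact_borel[OF H] emeasure_compact[OF H]] by simp
 next
  case (scale c f)
  then show ?case using Dscale1 indicator_Lp[OF compact_borel[OF H] emeasure_compact[OF H]] by simp
 next
  case (limit f)
  have L: "(indicator H :: 'g => complex) \<in> Lp_fun q \<mu>" by (intro indicator_Lp compact_borel emeasure_compact H)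
  show ?case
  proof (rule ccontr)
   assume "D f (indicator H) \<noteq> 0"
   then have pos: "cmod (D f (indicator H)) > 0" by simp
   have M: "B * Lp_norm q \<mu> (indicator H) \<ge> 0" using B0 Lp_norm_nonneg by (simp add: less_imp_le)
   obtain e where e: "e > 0" "e powr (1 / p) * (B * Lp_norm q \<mu> (indicator H)) < cmod (D f (indicator H))"
    using small[OF p0 pos M] by blast
   obtain h where h: "h \<in> Lp_fun p \<mu>" "D h (indicator H) = 0" "(LI x. cmod (f x - h x) powr p) < e"
    using limit(2)[OF e(1)] by blast
   have fh: "(\<lambda>x. f x - h x) \<in> Lp_fun p \<mu>" by (intro Lp_fun_diff p0 limit h)
   have "D f (indicator H) = D (\<lambda>x. (f x - h x) + h x) (indicator H)" by simp
   also have "\<dots> = D (\<lambda>x. f x - h x) (indicator H)" using Dadd1[OF fh h(1) L] h(2) by simp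
   finally have "cmod (D f (indicator H)) \<le> B * (Lp_norm p \<mu> (\<lambda>x. f x - h x) * Lp_norm q \<mu> (indicator H))"
    using Dbound[OF fh L] by simp
   also have "\<dots> \<le> B * (e powr (1 / p) * Lp_norm q \<mu> (indicator H))"
    unfolding Lp_norm_def[of p] using B0 h(3) p0 Lp_norm_nonneg
    by (intro mult_left_mono mult_right_mono powr_mono2) auto
   finally show False using e(2) by (simp add: mult_ac)
  qed
 qed
 have D5: "D f g = 0" if f: "f \<in> Lp_fun p \<mu>" and g: "g \<in> Lp_fun q \<mu>" for f g
  using q0 g
 proof (induction rule: Lp_induct)
  case (indicator K)
  then show ?case using D4 f by blast
 next
  case (add g g')
  then show ?case using Dadd2 f by simp
 next
  case (scale c g)
  then show ?case using Dscale2 f by simp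
 next
  case (limit g)
  show ?case
  proof (rule ccontr)
   assume "D f g \<noteq> 0"
   then have pos: "cmod (D f g) > 0" by simp
   have M: "B * Lp_norm p \<mu> f \<ge> 0" using B0 Lp_norm_nonneg by (simp add: less_imp_le)
   obtain e where e: "e > 0" "e powr (1 / q) * (B * Lp_norm p \<mu> f) < cmod (D f g)"
    using small[OF q0 pos M] by blast
   obtain h where h: "h \<in> Lp_fun q \<mu>" "D f h = 0" "(LI x. cmod (g x - h x) powr q) < e"
    using limit(2)[OF e(1)] by blast
   have gh: "(\<lambda>x. g x - h x) \<in> Lp_fun q \<mu>" by (intro Lp_fun_diff q0 limit h)
   have "D f g = D f (\<lambda>x. (g x - h x) + h x)" by simp
   also have "\<dots> = D f (\<lambda>x. g x - h x)" using Dadd2[OF f gh h(1)] h(2) by simp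
   finally have "cmod (D f g) \<le> B * (Lp_norm p \<mu> f * Lp_norm q \<mu> (\<lambda>x. g x - h x))"
    using Dbound[OF f gh] by simp
   also have "\<dots> \<le> B * (Lp_norm p \<mu> f * e powr (1 / q))"
    unfolding Lp_norm_def[of q] using B0 h(3) q0 Lp_norm_nonneg
    by (intro mult_left_mono powr_mono2) auto
   finally show False using e(2) by (simp add: mult_ac)
  qed
 qed
 have eval: "\<psi> u = \<kappa> * u x0" if u: "u \<in> ?A" for u
 proof -
  have "\<psi> u - \<kappa> * u x0 = 0"
  proof (rule functional_zeroI[of "\<lambda>u. \<psi> u - \<kappa> * u x0" "Kp + cmod \<kappa>", OF _ _ _ _ u])
   show "\<psi> (\<lambda>x. u x + v x) - \<kappa> * (u x0 + v x0) = \<psi> u - \<kappa> * u x0 + (\<psi> v - \<kappa> * v x0)" if "u \<in> ?A" "v \<in> ?A" for u v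
    using padd[OF that] by (simp add: algebra_simps)
   show "\<psi> (\<lambda>x. c * u x) - \<kappa> * (c * u x0) = c * (\<psi> u - \<kappa> * u x0)" if "u \<in> ?A" for u c
    using pscale[OF that that] by (simp add: algebra_simps)
   show "cmod (\<psi> u - \<kappa> * u x0) \<le> (Kp + cmod \<kappa>) * c" if "atomic u c" for u c
    using Ap_character_bound[OF \<psi> that] mult_left_mono[OF atomic_bound[OF that, of x0], of "cmod \<kappa>"]
     norm_triangle_ineq4[of "\<psi> u" "\<kappa> * u x0"] by (simp add: norm_mult algebra_simps)
   show "\<psi> (cv f g) - \<kappa> * cv f g x0 = 0" if "f \<in> Cc" "g \<in> Cc" for f g
    using D5 Cc_Lp p0 q0 that unfolding D_def by blast
  qed
  then show ?thesis by simp
 qed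
 have "\<kappa> \<noteq> 0" using eval[OF u1(1)] u1(2) by auto
 moreover have "\<kappa> = \<kappa> * \<kappa>"
  using eval[OF Ap_closed(2)[OF k(1) k(1)]] pmult[OF k(1) k(1)] k(3,4) unfolding \<kappa>_def by simp
 ultimately have "\<kappa> = 1" by simp
 then have "\<psi> = evaluation x0" unfolding evaluation_def using eval pout by auto
 then show thesis using that by blast
qed

end

section \<open>Invariant means and Reiter's condition\<close>

context haar
begin

text \<open>Reiter's condition for L1, over finite sets in place of compact ones: left invariance of
  a mean and smallness on a set of point evaluations are both tested on finitely many group
  elements.\<close>

definition reiter :: bool where
 "reiter \<longleftrightarrow> (\<forall>S e. finite S --> e > 0 -->
   (\<exists>F::'g => real. (\<forall>x. 0 \<le> F x) \<and> integrable \<mu> F \<and> (LI x. F x) = 1 \<and>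
    (\<forall>s\<in>S. (LI x. \<bar>F (- s + x) - F x\<bar>) < e)))"

lemma reiterD:
 assumes "reiter" "finite S" "e > 0"
 obtains F :: "'g => real" where "\<And>x. 0 \<le> F x" "integrable \<mu> F" "(LI x. F x) = 1"
  "\<And>s. s \<in> S ==> (LI x. \<bar>F (- s + x) - F x\<bar>) < e"
 using assms unfolding reiter_def by metis

lemma locally_AE_always: "(\<And>x. P x) ==> locally_AE \<mu> P"
 unfolding locally_AE_def by auto

lemma locally_AE_mono: "locally_AE \<mu> P ==> (\<And>x. P x ==> Q x) ==> locally_AE \<mu> Q"
 unfolding locally_AE_def by (auto elim!: eventually_mono)

lemma locally_AE_conj: "locally_AE \<mu> P ==> locally_AE \<mu> Q ==> locally_AE \<mu> (\<lambda>x. P x \<and> Q x)"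
 unfolding locally_AE_def by fastforce

lemma Linf_funD:
 assumes "f \<in> Linf_fun \<mu>"
 shows "\<And>F. F \<in> sets borel ==> emeasure \<mu> F < \<infinity> ==> f \<in> borel_measurable (restrict_space \<mu> F)"
  and "\<exists>C. locally_AE \<mu> (\<lambda>x. cmod (f x) \<le> C)"
 using assms unfolding Linf_fun_def by auto

lemma Linf_fun_add:
 assumes "f \<in> Linf_fun \<mu>" "g \<in> Linf_fun \<mu>"
 shows "(\<lambda>x. f x + g x) \<in> Linf_fun \<mu>"
proof -
 obtain C C' where "locally_AE \<mu> (\<lambda>x. cmod (f x) \<le> C)" "locally_AE \<mu> (\<lambda>x. cmod (g x) \<le> C')"
  using Linf_funD(2) assms by meson
 then have "locally_AE \<mu> (\<lambda>x. cmod (f x) \<le> C \<and> cmod (g x) \<le> C')" by (rule locally_AE_conj)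
 then have "locally_AE \<mu> (\<lambda>x. cmod (f x + g x) \<le> C + C')"
  by (rule locally_AE_mono) (auto intro: norm_triangle_mono)
 then show ?thesis using Linf_funD(1)[OF assms(1)] Linf_funD(1)[OF assms(2)]
  unfolding Linf_fun_def by (auto intro!: borel_measurable_add)
qed

lemma Linf_fun_scale:
 assumes "f \<in> Linf_fun \<mu>"
 shows "(\<lambda>x. c * f x) \<in> Linf_fun \<mu>"
proof -
 obtain C where "locally_AE \<mu> (\<lambda>x. cmod (f x) \<le> C)" using Linf_funD(2) assms by meson
 then have "locally_AE \<mu> (\<lambda>x. cmod (c * f x) \<le> cmod c * C)"
  by (rule locally_AE_mono) (auto simp: norm_mult intro: mult_left_mono)
 then show ?thesis using Linf_funD(1)[OF assms] unfolding Linf_fun_def by auto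
qed

lemma Linf_fun_bounded:
 assumes "f \<in> borel_measurable borel" "\<And>x. cmod (f x) \<le> C"
 shows "f \<in> Linf_fun \<mu>"
proof -
 have "locally_AE \<mu> (\<lambda>x. cmod (f x) \<le> C)" by (rule locally_AE_always) (rule assms(2))
 then show ?thesis using assms(1) unfolding Linf_fun_def by (auto intro: measurable_restrict_space1)
qed

lemma Linf_equiv: "equiv (Linf_fun \<mu>) (Linf_rel \<mu>)"
proof (rule equivI)
 show "Linf_rel \<mu> \<subseteq> Linf_fun \<mu> \<times> Linf_fun \<mu>" unfolding Linf_rel_def by auto
 show "refl_on (Linf_fun \<mu>) (Linf_rel \<mu>)"
  unfolding refl_on_def Linf_rel_def by (auto intro: locally_AE_always)
 show "sym (Linf_rel \<mu>)" unfolding sym_def Linf_rel_def by (auto elim: locally_AE_mono)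
 show "trans (Linf_rel \<mu>)" unfolding trans_def Linf_rel_def
  by (auto elim: locally_AE_mono[OF locally_AE_conj])
qed

abbreviation Linf_class :: "('g => complex) => ('g => complex) set" where
 "Linf_class f \<equiv> Linf_rel \<mu> `` {f}"

lemma Linf_class_eq: "(f, g) \<in> Linf_rel \<mu> ==> Linf_class f = Linf_class g"
 by (rule equiv_class_eq[OF Linf_equiv])

lemma Linf_class_self: "f \<in> Linf_fun \<mu> ==> f \<in> Linf_class f"
 by (rule equiv_class_self[OF Linf_equiv])

lemma Linf_carrier: "vcarrier (Linf_space \<mu>) = Linf_fun \<mu> // Linf_rel \<mu>"
 unfolding Linf_space_def by simp

lemma Linf_class_carrier: "f \<in> Linf_fun \<mu> ==> Linf_class f \<in> vcarrier (Linf_space \<mu>)"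
 unfolding Linf_carrier by (rule quotientI)

lemma Linf_vadd:
 assumes "f \<in> Linf_fun \<mu>" "g \<in> Linf_fun \<mu>"
 shows "vadd (Linf_space \<mu>) (Linf_class f) (Linf_class g) = Linf_class (\<lambda>x. f x + g x)"
proof -
 have eq: "Linf_class (\<lambda>x. f' x + g' x) = Linf_class (\<lambda>x. f x + g x)" if "f' \<in> Linf_class f" "g' \<in> Linf_class g" for f' g'
 proof (rule Linf_class_eq)
  have a: "locally_AE \<mu> (\<lambda>x. f x = f' x \<and> g x = g' x)" and l: "f' \<in> Linf_fun \<mu>" "g' \<in> Linf_fun \<mu>"
   using that unfolding Linf_rel_def by (auto intro: locally_AE_conj)
  have "locally_AE \<mu> (\<lambda>x. f' x + g' x = f x + g x)" using a by (rule locally_AE_mono) simp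
  then show "(\<lambda>x. f' x + g' x, \<lambda>x. f x + g x) \<in> Linf_rel \<mu>"
   using Linf_fun_add[OF l] Linf_fun_add[OF assms] unfolding Linf_rel_def by simp
 qed
 have "vadd (Linf_space \<mu>) (Linf_class f) (Linf_class g) =
   (\<Union>f'\<in>Linf_class f. \<Union>g'\<in>Linf_class g. Linf_class (\<lambda>x. f' x + g' x))"
  unfolding Linf_space_def by simp
 also have "\<dots> = (\<Union>f'\<in>Linf_class f. \<Union>g'\<in>Linf_class g. Linf_class (\<lambda>x. f x + g x))"
  by (intro SUP_cong refl eq)
 also have "\<dots> = Linf_class (\<lambda>x. f x + g x)"
  using Linf_class_self[OF assms(1)] Linf_class_self[OF assms(2)] by blast
 finally show ?thesis .
qed

lemma Linf_vscale:
 assumes "f \<in> Linf_fun \<mu>"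
 shows "vscale (Linf_space \<mu>) c (Linf_class f) = Linf_class (\<lambda>x. c * f x)"
proof -
 have eq: "Linf_class (\<lambda>x. c * f' x) = Linf_class (\<lambda>x. c * f x)" if "f' \<in> Linf_class f" for f'
 proof (rule Linf_class_eq)
  have a: "locally_AE \<mu> (\<lambda>x. f x = f' x)" and l: "f' \<in> Linf_fun \<mu>"
   using that unfolding Linf_rel_def by auto
  have "locally_AE \<mu> (\<lambda>x. c * f' x = c * f x)" using a by (rule locally_AE_mono) simp
  then show "(\<lambda>x. c * f' x, \<lambda>x. c * f x) \<in> Linf_rel \<mu>"
   using Linf_fun_scale[OF l] Linf_fun_scale[OF assms] unfolding Linf_rel_def by simp
 qed
 have "vscale (Linf_space \<mu>) c (Linf_class f) = (\<Union>f'\<in>Linf_class f. Linf_class (\<lambda>x. c * f' x))"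
  unfolding Linf_space_def by simp
 also have "\<dots> = (\<Union>f'\<in>Linf_class f. Linf_class (\<lambda>x. c * f x))"
  by (intro SUP_cong refl eq)
 also have "\<dots> = Linf_class (\<lambda>x. c * f x)" using Linf_class_self[OF assms] by blast
 finally show ?thesis .
qed

text \<open>Uniform continuity controls the difference pointwise, and for v in a compact
  neighbourhood all the supports stay in one compact set \<open>T\<close>.\<close>

lemma Cc_translation_continuous:
 assumes f: "f \<in> Cc" and e: "e > 0"
 obtains V where "open V" "0 \<in> V" "\<And>v. v \<in> V ==> (LI y. cmod (f (v + y) - f y)) < e"
proof -
 from CcE[OF f] obtain K where K: "compact K" "\<And>x. x \<notin> K ==> f x = 0" by blast
 obtain W C where W: "open W" "compact C" "(0::'g) \<in> W" "W \<subseteq> C"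
  using compact_neighbourhood[OF open_UNIV UNIV_I, of 0] by metis
 define T where "T = K \<union> (\<lambda>(x, y). x + y) ` (uminus ` C \<times> K)"
 have T: "compact T" unfolding T_def by (intro compact_Un K compact_add compact_uminus W)
 define d where "d = e / (measure \<mu> T + 1)"
 have mT: "measure \<mu> T + 1 > 0" by (simp add: add_nonneg_pos)
 have d: "d > 0" unfolding d_def using e mT by simp
 obtain V where V: "open V" "0 \<in> V" "\<And>v x. v \<in> V ==> cmod (f (v + x) - f x) < d"
  using Cc_uniform_left[OF f d] by blast
 show thesis
 proof (rule that[of "V \<inter> W"])
  fix v assume v: "v \<in> V \<inter> W"
  have i: "integrable \<mu> (\<lambda>y. f (v + y) - f y)"
   by (intro Bochner_Integration.integrable_diff Cc_integrable Cc_translate f)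
  have "(LI y. cmod (f (v + y) - f y)) \<le> (LI y. indicator T y *\<^sub>R d)"
  proof (rule integral_mono)
   show "integrable \<mu> (\<lambda>y. cmod (f (v + y) - f y))" using i by (rule integrable_norm)
   show "integrable \<mu> (\<lambda>y. indicator T y *\<^sub>R d)"
    using compact_borel[OF T] emeasure_compact[OF T] by (intro integrable_indicator) auto
   show "cmod (f (v + y) - f y) \<le> indicator T y *\<^sub>R d" for y
   proof (cases "y \<in> T")
    case True
    then show ?thesis using V(3)[of v y] v by simp
   next
    case False
    have "v + y \<notin> K"
    proof
     assume "v + y \<in> K"
     moreover have "y = - v + (v + y)" by (simp add: add.assoc[symmetric])
     ultimately have "y \<in> T" unfolding T_def using v W(4) by (force intro!: image_eqI[of _ _ "(- v, v + y)"])
     then show False using False by blast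
    qed
    moreover have "y \<notin> K" using False unfolding T_def by blast
    ultimately show ?thesis using K(2) d by simp
   qed
  qed
  also have "\<dots> = measure \<mu> T * d" using compact_borel[OF T] by simp
  also have "\<dots> < e" unfolding d_def using e mT by (simp add: field_simps)
  finally show "(LI y. cmod (f (v + y) - f y)) < e" .
 qed (use V W in auto)
qed

lemma Cc_unit_mass:
 fixes U :: "'g set"
 assumes "open U" "0 \<in> U"
 obtains h :: "'g => real" where "(\<lambda>x. complex_of_real (h x)) \<in> Cc" "\<And>x. 0 \<le> h x" "(LI x. h x) = 1"
  "\<And>x. x \<notin> U ==> h x = 0"
proof -
 obtain V C where VC: "open V" "compact C" "(0::'g) \<in> V" "V \<subseteq> C" "C \<subseteq> U"
  using compact_neighbourhood[OF assms] by metis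
 obtain h :: "'g => real" where h: "(\<lambda>x. complex_of_real (h x)) \<in> Cc" "\<And>x. 0 \<le> h x" "\<And>x. h x \<le> 1"
  "\<And>x. x \<in> C ==> h x = 1" "\<And>x. x \<notin> U ==> h x = 0"
  using Urysohn_Cc[OF VC(2) assms(1) VC(5)] by metis
 have hi: "integrable \<mu> h" using Cc_integrable[OF h(1)] by (simp add: complex_of_real_integrable_eq)
 have "0 < emeasure \<mu> V" using emeasure_open_pos[of V] VC by blast
 also have "\<dots> \<le> emeasure \<mu> C" using VC compact_borel by (intro emeasure_mono) auto
 finally have "measure \<mu> C > 0"
  using emeasure_compact[OF VC(2)] by (simp add: measure_def enn2real_positive_iff)
 moreover have "measure \<mu> C = (LI x. indicator C x)" using compact_borel[OF VC(2)] by simp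
 moreover have "(LI x. indicator C x) \<le> (LI x. h x)"
  using compact_borel[OF VC(2)] emeasure_compact[OF VC(2)] h(2,4)
  by (intro integral_mono hi integrable_real_indicator) (auto split: split_indicator)
 ultimately have pos: "(LI x. h x) > 0" by linarith
 define c where "c = 1 / (LI x. h x)"
 have c: "c > 0" unfolding c_def using pos by simp
 show thesis
 proof (rule that[of "\<lambda>x. c * h x"])
  show "(\<lambda>x. complex_of_real (c * h x)) \<in> Cc" using Cc_scale[OF h(1), of "complex_of_real c"] by simp
  show "(LI x. c * h x) = 1" unfolding c_def using pos by simp
 qed (use c h in auto)
qed

text \<open>
 If Reiter's condition fails, the Hahn--Banach theorem yields functionals \<open>\<Lambda>\<^sub>s\<close> on \<open>L\<^sup>1\<close> with
 \<open>\<Sum>s. \<Lambda>\<^sub>s (L\<^sub>s F - F) \<ge> e \<integral> F\<close> for all \<open>F \<ge> 0\<close>.  Applied to the translates of one continuous \<open>F\<close> they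
 give bounded continuous functions \<open>h\<^sub>s(x) = \<Lambda>\<^sub>s(L\<^sub>x F)\<close> that contradict the invariance of the mean;
 this replaces the duality of \<open>L\<^sup>1\<close> and \<open>L\<^sup>\<infinity>\<close>.
\<close>

lemma amenable_imp_reiter:
 assumes "amenable_group \<mu>"
 shows "reiter"
proof (rule ccontr)
 assume "\<not> reiter"
 then obtain S e where S: "finite S" "e > 0" and
  no: "\<And>F::'g => real. (\<And>x. 0 \<le> F x) ==> integrable \<mu> F ==> (LI x. F x) = 1 ==>
   \<exists>s\<in>S. (LI x. \<bar>F (- s + x) - F x\<bar>) \<ge> e"
  unfolding reiter_def by (metis not_le)
 \<comment> \<open>\<open>V\<close> is a direct sum of copies of L1 indexed by \<open>S\<close>,
   realised as functions on pairs, and \<open>pV\<close> is its norm. \<open>G\<close> sends F to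
   the family of the differences L_s F - F, so that the failure of Reiter's condition reads pV (G F)
   \<ge> e \<integral> F on the cone \<open>K\<close>.\<close>
 define V where "V = {w :: 'g \<times> 'g => real. \<forall>s\<in>S. integrable \<mu> (\<lambda>y. w (s, y))}"
 define pV where "pV = (\<lambda>w :: 'g \<times> 'g => real. \<Sum>s\<in>S. \<integral>y. \<bar>w (s, y)\<bar> \<partial>\<mu>)"
 define G where "G = (\<lambda>F (s, y). if s \<in> S then F (- s + y) - F y else (0::real))"
 define K where "K = {F :: 'g => real. (\<forall>x. 0 \<le> F x) \<and> integrable \<mu> F}"
 have Va: "(\<lambda>x. f x + g x) \<in> V" if "f \<in> V" "g \<in> V" for f g using that unfolding V_def by auto
 have Vs: "(\<lambda>x. c * f x) \<in> V" if "f \<in> V" for c f using that unfolding V_def by auto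
 have p_add: "pV (\<lambda>x. f x + g x) \<le> pV f + pV g" if "f \<in> V" "g \<in> V" for f g
 proof -
  have "(LI y. \<bar>f (s, y) + g (s, y)\<bar>) \<le> (LI y. \<bar>f (s, y)\<bar>) + (LI y. \<bar>g (s, y)\<bar>)" if s: "s \<in> S" for s
  proof -
   have i: "integrable \<mu> (\<lambda>y. f (s, y))" "integrable \<mu> (\<lambda>y. g (s, y))" using \<open>f \<in> V\<close> \<open>g \<in> V\<close> s unfolding V_def by auto
   have "(LI y. \<bar>f (s, y) + g (s, y)\<bar>) \<le> (LI y. \<bar>f (s, y)\<bar> + \<bar>g (s, y)\<bar>)"
    using i by (intro integral_mono) (auto intro: abs_triangle_ineq)
   then show ?thesis using i by simp
  qed
  then show ?thesis unfolding pV_def sum.distrib[symmetric] by (intro sum_mono) auto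
 qed
 have p_scale: "pV (\<lambda>x. c * f x) = \<bar>c\<bar> * pV f" for c f
  unfolding pV_def by (simp add: abs_mult sum_distrib_left)
 have p_nonneg: "pV f \<ge> 0" for f unfolding pV_def by (intro sum_nonneg) auto
 have GV: "G F \<in> V" if "integrable \<mu> F" for F
  using that integrable_translate[OF that] unfolding V_def G_def by auto
 have G_add: "G (\<lambda>x. F x + F' x) = (\<lambda>z. G F z + G F' z)" for F F' unfolding G_def by auto
 have G_scale: "G (\<lambda>x. c * F x) = (\<lambda>z. c * G F z)" for c F unfolding G_def by (auto simp: algebra_simps)
 have pG: "pV (G F) \<ge> e * (LI x. F x)" if F: "F \<in> K" for F
 proof (cases "(LI x. F x) = 0")
  case True
  then show ?thesis using p_nonneg by simp
 next
  case False
  define t where "t = (LI x. F x)"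
  have F': "\<And>x. 0 \<le> F x" "integrable \<mu> F" using F unfolding K_def by auto
  have t: "t > 0" unfolding t_def using False F' by (simp add: less_le)
  have "\<exists>s\<in>S. (LI x. \<bar>F (- s + x) / t - F x / t\<bar>) \<ge> e"
   by (rule no) (use F' t in \<open>auto simp: t_def[symmetric]\<close>)
  then obtain s where s: "s \<in> S" "(LI x. \<bar>F (- s + x) / t - F x / t\<bar>) \<ge> e" by blast
  have "(LI x. \<bar>F (- s + x) / t - F x / t\<bar>) = (LI x. \<bar>F (- s + x) - F x\<bar> / t)"
   using t by (simp add: diff_divide_distrib[symmetric])
  then have "e * t \<le> (LI x. \<bar>F (- s + x) - F x\<bar>)" using s(2) t by (simp add: field_simps)
  also have "\<dots> = (LI y. \<bar>G F (s, y)\<bar>)" using s(1) unfolding G_def by simp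
  also have "\<dots> \<le> pV (G F)" unfolding pV_def by (rule member_le_sum[OF s(1)]) (use S in auto)
  finally show ?thesis unfolding t_def .
 qed
 \<comment> \<open>A linear functional below \<open>Q\<close> has both required properties: F = 0
   gives Q \<le> pV and thus boundedness, while w = - G F gives the lower bound on G F. That
   \<open>Q\<close> is finite is the estimate \<open>low\<close>.\<close>
 define Q where "Q = (\<lambda>w. INF F\<in>K. pV (\<lambda>z. w z + G F z) - e * (LI x. F x))"
 have K0: "(\<lambda>x. 0) \<in> K" unfolding K_def by auto
 have low: "- pV w \<le> pV (\<lambda>z. w z + G F z) - e * (LI x. F x)" if "w \<in> V" "F \<in> K" for w F
 proof -
  have g: "G F \<in> V" using GV that unfolding K_def by auto
  have "pV (\<lambda>z. (w z + G F z) + (-1) * w z) \<le> pV (\<lambda>z. w z + G F z) + pV (\<lambda>z. (-1) * w z)"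
   by (intro p_add Va Vs that g)
  moreover have "pV (\<lambda>z. (-1) * w z) = pV w" using p_scale[of "-1" w] by simp
  ultimately show ?thesis using pG[OF that(2)] by simp
 qed
 have bdd: "bdd_below ((\<lambda>F. pV (\<lambda>z. w z + G F z) - e * (LI x. F x)) ` K)" if "w \<in> V" for w
  using low[OF that] by (intro bdd_belowI[of _ "- pV w"]) auto
 have Qle: "Q w \<le> pV (\<lambda>z. w z + G F z) - e * (LI x. F x)" if "w \<in> V" "F \<in> K" for w F
  unfolding Q_def using that bdd by (auto intro: cINF_lower)
 have Qge: "c \<le> Q w" if "\<And>F. F \<in> K ==> c \<le> pV (\<lambda>z. w z + G F z) - e * (LI x. F x)" for w c
  unfolding Q_def using that K0 by (auto intro!: cINF_greatest)
 have "sublinear_on V Q"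
  unfolding sublinear_on_def
 proof (intro conjI ballI allI impI)
  fix f g assume fg: "f \<in> V" "g \<in> V"
  have *: "Q (\<lambda>x. f x + g x) \<le> (pV (\<lambda>z. f z + G F z) - e * (LI x. F x)) + (pV (\<lambda>z. g z + G F' z) - e * (LI x. F' x))"
   if F: "F \<in> K" "F' \<in> K" for F F'
  proof -
   have i: "integrable \<mu> F" "integrable \<mu> F'" using F unfolding K_def by auto
   have "(\<lambda>x. F x + F' x) \<in> K" using F unfolding K_def by auto
   from Qle[OF Va[OF fg] this] have "Q (\<lambda>x. f x + g x) \<le> pV (\<lambda>z. (f z + g z) + (G F z + G F' z)) - e * ((LI x. F x) + (LI x. F' x))"
    unfolding G_add using i by simp
   also have "(\<lambda>z. (f z + g z) + (G F z + G F' z)) = (\<lambda>z. (f z + G F z) + (g z + G F' z))" by auto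
   also have "pV \<dots> \<le> pV (\<lambda>z. f z + G F z) + pV (\<lambda>z. g z + G F' z)"
    by (intro p_add Va fg GV i)
   finally show ?thesis by (simp add: algebra_simps)
  qed
  have "Q (\<lambda>x. f x + g x) - Q f \<le> Q g"
  proof (rule Qge)
   fix F' assume F': "F' \<in> K"
   have "Q (\<lambda>x. f x + g x) - (pV (\<lambda>z. g z + G F' z) - e * (LI x. F' x)) \<le> Q f"
    by (rule Qge) (use *[OF _ F'] in \<open>simp add: algebra_simps\<close>)
   then show "Q (\<lambda>x. f x + g x) - Q f \<le> pV (\<lambda>z. g z + G F' z) - e * (LI x. F' x)" by linarith
  qed
  then show "Q (\<lambda>x. f x + g x) \<le> Q f + Q g" by linarith
 next
  fix c :: real and f assume c: "c > 0" and f: "f \<in> V"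
  have "Q (\<lambda>x. c * f x) / c \<le> Q f"
  proof (rule Qge)
   fix F assume F: "F \<in> K"
   have "(\<lambda>x. c * F x) \<in> K" using F c unfolding K_def by auto
   from Qle[OF Vs[OF f] this, of c] have "Q (\<lambda>x. c * f x) \<le> pV (\<lambda>z. c * (f z + G F z)) - e * (c * (LI x. F x))"
    unfolding G_scale by (simp add: distrib_left)
   also have "\<dots> = c * (pV (\<lambda>z. f z + G F z) - e * (LI x. F x))"
    unfolding p_scale using c by (simp add: algebra_simps)
   finally show "Q (\<lambda>x. c * f x) / c \<le> pV (\<lambda>z. f z + G F z) - e * (LI x. F x)"
    using c by (simp add: field_simps)
  qed
  then show "Q (\<lambda>x. c * f x) \<le> c * Q f" using c by (simp add: field_simps)
 qed
 then obtain \<Lambda> where L: "\<And>f g. f \<in> V ==> g \<in> V ==> \<Lambda> (\<lambda>x. f x + g x) = \<Lambda> f + \<Lambda> g"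
  "\<And>c f. f \<in> V ==> \<Lambda> (\<lambda>x. c * f x) = c * \<Lambda> f" "\<And>f. f \<in> V ==> \<Lambda> f \<le> Q f"
  using dominated_linear_functional[of V Q, OF _ Va Vs] by blast
 have Lp: "\<bar>\<Lambda> w\<bar> \<le> pV w" if "w \<in> V" for w
 proof -
  have "\<Lambda> w \<le> pV w" if "w \<in> V" for w
  proof -
   have "G (\<lambda>x. 0) = (\<lambda>z. 0)" unfolding G_def by auto
   then show ?thesis using L(3)[OF that] Qle[OF that K0] by simp
  qed
  from this[OF that] this[OF Vs[OF that, of "-1"]] show ?thesis
   using L(2)[OF that, of "-1"] p_scale[of "-1" w] by simp
 qed
 have LG: "\<Lambda> (G F) \<ge> e * (LI x. F x)" if F: "F \<in> K" for F
 proof -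
  have g: "G F \<in> V" using GV F unfolding K_def by auto
  have "\<Lambda> (\<lambda>z. (-1) * G F z) \<le> pV (\<lambda>z. (-1) * G F z + G F z) - e * (LI x. F x)"
   using L(3)[OF Vs[OF g]] Qle[OF Vs[OF g] F] by (meson order_trans)
  then show ?thesis using L(2)[OF g, of "-1"] by (simp add: pV_def)
 qed
 obtain h0 :: "'g => real" where h0: "(\<lambda>x. complex_of_real (h0 x)) \<in> Cc" "\<And>x. 0 \<le> h0 x" "(LI x. h0 x) = 1"
  using Cc_unit_mass[OF open_UNIV UNIV_I] by metis
 have h0i: "integrable \<mu> h0" using Cc_integrable[OF h0(1)] by (simp add: complex_of_real_integrable_eq)
 define \<iota> :: "'g => ('g => real) => 'g \<times> 'g => real"
  where "\<iota> = (\<lambda>s f (s', y). if s' = s then f y else 0)"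
 have iV: "\<iota> s f \<in> V" if f: "integrable \<mu> f" for s f
  unfolding V_def \<iota>_def
 proof (intro CollectI ballI)
  fix s' show "integrable \<mu> (\<lambda>y. case (s', y) of (s', y) => if s' = s then f y else 0)"
   using f by (cases "s' = s") auto
 qed
 have pi: "pV (\<iota> s f) = (LI y. \<bar>f y\<bar>)" if "s \<in> S" for s f
 proof -
  have "pV (\<iota> s f) = (\<Sum>s'\<in>S. if s' = s then (LI y. \<bar>f y\<bar>) else 0)"
   unfolding pV_def \<iota>_def by (intro sum.cong) auto
  then show ?thesis using S that by simp
 qed
 define h where "h = (\<lambda>s x. \<Lambda> (\<iota> s (\<lambda>y. h0 (- x + y))))"
 have ti: "integrable \<mu> (\<lambda>y. h0 (- x + y))" for x by (rule integrable_translate[OF h0i])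
 have hb: "\<bar>h s x\<bar> \<le> 1" if s: "s \<in> S" for s x
 proof -
  have "\<bar>h s x\<bar> \<le> (LI y. \<bar>h0 (- x + y)\<bar>)"
   unfolding h_def using Lp[OF iV[OF ti]] pi[OF s] by metis
  then show ?thesis using h0(2,3) integral_translate[of h0 "- x"] by simp
 qed
 have hc: "continuous_on UNIV (\<lambda>x. h s x)" if s: "s \<in> S" for s
  unfolding continuous_on_def
 proof (intro ballI)
  fix x
  show "(h s \<longlongrightarrow> h s x) (at x within UNIV)"
  proof (rule tendstoI)
   fix d :: real assume d: "d > 0"
   obtain W where W: "open W" "0 \<in> W" "\<And>v. v \<in> W ==> (LI y. cmod (complex_of_real (h0 (v + y)) - complex_of_real (h0 y))) < d"
    using Cc_translation_continuous[OF h0(1) d] by blast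
   have "open ((\<lambda>x'. - x' + x) -` W)" by (intro open_vimage W) (auto intro!: continuous_intros)
   moreover have "x \<in> (\<lambda>x'. - x' + x) -` W" using W(2) by simp
   ultimately have ev: "\<forall>\<^sub>F x' in at x. - x' + x \<in> W"
    unfolding eventually_at_topological by (intro exI[of _ "(\<lambda>x'. - x' + x) -` W"]) auto
   show "\<forall>\<^sub>F x' in at x within UNIV. dist (h s x') (h s x) < d"
    using ev
   proof eventually_elim
    case (elim x')
    have i2: "integrable \<mu> (\<lambda>y. h0 (- x' + y) - h0 (- x + y))" by (intro Bochner_Integration.integrable_diff ti)
    have "\<iota> s (\<lambda>y. h0 (- x' + y)) = (\<lambda>z. \<iota> s (\<lambda>y. h0 (- x' + y) - h0 (- x + y)) z + \<iota> s (\<lambda>y. h0 (- x + y)) z)"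
     unfolding \<iota>_def by auto
    then have "h s x' - h s x = \<Lambda> (\<iota> s (\<lambda>y. h0 (- x' + y) - h0 (- x + y)))"
     unfolding h_def using L(1)[OF iV[OF i2] iV[OF ti]] by simp
    then have "\<bar>h s x' - h s x\<bar> \<le> (LI y. \<bar>h0 (- x' + y) - h0 (- x + y)\<bar>)"
     using Lp[OF iV[OF i2], of s] pi[OF s] by simp
    also have "\<dots> = (LI y. \<bar>h0 ((- x' + x) + y) - h0 y\<bar>)"
     using integral_translate[of "\<lambda>y. \<bar>h0 ((- x' + x) + y) - h0 y\<bar>" "- x"]
     by (simp add: add.assoc)
    also have "\<dots> < d" using W(3)[OF elim] by (simp flip: of_real_diff)
    finally show ?case by (simp add: dist_real_def)
   qed
  qed
 qed
 \<comment> \<open>L_s L_x = L_sx, so applying \<Lambda> to G of the translate of h0 by x yields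
   differences of the functions \<open>h s\<close> at sx and x.\<close>
 have key: "(\<Sum>s\<in>S. h s (s + x) - h s x) \<ge> e" for x
 proof -
  have eq: "G (\<lambda>y. h0 (- x + y)) = (\<lambda>z. \<Sum>s\<in>S. \<iota> s (\<lambda>y. h0 (- (s + x) + y) - h0 (- x + y)) z)"
  proof
   fix z :: "'g \<times> 'g"
   obtain s y where z: "z = (s, y)" by (cases z)
   have "(\<Sum>s'\<in>S. \<iota> s' (\<lambda>y. h0 (- (s' + x) + y) - h0 (- x + y)) z) = (\<Sum>s'\<in>S. if s' = s then h0 (- (s + x) + y) - h0 (- x + y) else 0)"
    unfolding z \<iota>_def by (intro sum.cong) auto
   then show "G (\<lambda>y. h0 (- x + y)) z = (\<Sum>s\<in>S. \<iota> s (\<lambda>y. h0 (- (s + x) + y) - h0 (- x + y)) z)"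
   proof -
    have "- (s + x) + y = - x + (- s + y)" by (simp only: minus_add add.assoc)
    then show ?thesis using S(1)
     \<open>(\<Sum>s'\<in>S. \<iota> s' (\<lambda>y. h0 (- (s' + x) + y) - h0 (- x + y)) z) = _\<close> unfolding z G_def by simp
   qed
  qed
  have "(\<lambda>z. \<Sum>s\<in>T. \<iota> s (\<lambda>y. h0 (- (s + x) + y) - h0 (- x + y)) z) \<in> V \<and>
    \<Lambda> (\<lambda>z. \<Sum>s\<in>T. \<iota> s (\<lambda>y. h0 (- (s + x) + y) - h0 (- x + y)) z) = (\<Sum>s\<in>T. h s (s + x) - h s x)"
   if "finite T" for T using that
  proof (induction T rule: finite_induct)
   case empty
   have "(\<lambda>z. 0) \<in> V" unfolding V_def by auto
   then show ?case using L(2)[of "\<lambda>z. 0" 0] by simp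
  next
   case (insert s T)
   have i2: "integrable \<mu> (\<lambda>y. h0 (- (s + x) + y) - h0 (- x + y))" by (intro Bochner_Integration.integrable_diff ti)
   have "\<iota> s (\<lambda>y. h0 (- (s + x) + y)) = (\<lambda>z. \<iota> s (\<lambda>y. h0 (- (s + x) + y) - h0 (- x + y)) z + \<iota> s (\<lambda>y. h0 (- x + y)) z)"
    unfolding \<iota>_def by auto
   then have "\<Lambda> (\<iota> s (\<lambda>y. h0 (- (s + x) + y) - h0 (- x + y))) = h s (s + x) - h s x"
    unfolding h_def using L(1)[OF iV[OF i2] iV[OF ti]] by simp
   then show ?case using insert L(1)[OF iV[OF i2, of s], of "\<lambda>z. \<Sum>s\<in>T. \<iota> s (\<lambda>y. h0 (- (s + x) + y) - h0 (- x + y)) z"]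
     Va[OF iV[OF i2, of s]] by simp
  qed
  from this[OF S(1)] have "\<Lambda> (G (\<lambda>y. h0 (- x + y))) = (\<Sum>s\<in>S. h s (s + x) - h s x)" unfolding eq by blast
  moreover have "(\<lambda>y. h0 (- x + y)) \<in> K" using ti h0(2) unfolding K_def by auto
  ultimately show ?thesis using LG[of "\<lambda>y. h0 (- x + y)"] integral_translate[of h0 "- x"] h0(3) by simp
 qed

 obtain m where m: "m \<in> vcarrier (dual (Linf_space \<mu>))"
  and mpos: "\<And>f. f \<in> Linf_fun \<mu> ==> locally_AE \<mu> (\<lambda>x. f x \<in> \<real>\<^sub>\<ge>\<^sub>0) ==> m (Linf_class f) \<in> \<real>\<^sub>\<ge>\<^sub>0"
  and m1: "m (Linf_class (\<lambda>_. 1)) = 1"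
  and minv: "\<And>x f. f \<in> Linf_fun \<mu> ==> m (Linf_class (left_translate x f)) = m (Linf_class f)"
  using assms unfolding amenable_group_def by blast
 have lin: "linear_functional (Linf_space \<mu>) m" using m unfolding dual_def by auto
 have madd: "m (Linf_class (\<lambda>x. f x + g x)) = m (Linf_class f) + m (Linf_class g)" if "f \<in> Linf_fun \<mu>" "g \<in> Linf_fun \<mu>" for f g
  using lin Linf_vadd[OF that] Linf_class_carrier[OF that(1)] Linf_class_carrier[OF that(2)]
  unfolding linear_functional_def by metis
 have mscale: "m (Linf_class (\<lambda>x. c * f x)) = c * m (Linf_class f)" if "f \<in> Linf_fun \<mu>" for f c
  using lin Linf_vscale[OF that] Linf_class_carrier[OF that] unfolding linear_functional_def by metis
 have one: "(\<lambda>_. 1) \<in> Linf_fun \<mu>" by (rule Linf_fun_bounded[of _ 1]) auto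
 define H where "H = (\<lambda>s x. complex_of_real (h s x))"
 have H: "H s \<in> Linf_fun \<mu>" if "s \<in> S" for s
  unfolding H_def using hb[OF that] hc[OF that]
  by (intro Linf_fun_bounded[of _ 1] continuous_borel continuous_intros) auto
 have H': "(\<lambda>x. H s (t + x)) \<in> Linf_fun \<mu>" if "s \<in> S" for s t
  unfolding H_def using hb[OF that]
  by (intro Linf_fun_bounded[of _ 1] continuous_borel continuous_intros continuous_on_compose2[OF hc[OF that]]) auto
 have Hd: "(\<lambda>x. H s (s + x) + (-1) * H s x) \<in> Linf_fun \<mu>" if "s \<in> S" for s
  by (intro Linf_fun_add Linf_fun_scale H H' that)
 have "(\<lambda>x. \<Sum>s\<in>T. H s (s + x) + (-1) * H s x) \<in> Linf_fun \<mu> \<and> m (Linf_class (\<lambda>x. \<Sum>s\<in>T. H s (s + x) + (-1) * H s x)) = 0"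
  if "finite T" "T \<subseteq> S" for T using that
 proof (induction T rule: finite_induct)
  case empty
  have "(\<lambda>x. 0) \<in> Linf_fun \<mu>" by (rule Linf_fun_bounded[of _ 0]) auto
  then show ?case using mscale[of "\<lambda>x. 0" 0] by simp
 next
  case (insert s T)
  then have s: "s \<in> S" by auto
  have "m (Linf_class (\<lambda>x. H s (s + x))) = m (Linf_class (H s))"
   using minv[OF H[OF s], of "- s"] unfolding left_translate_def by simp
  then have "m (Linf_class (\<lambda>x. H s (s + x) + (-1) * H s x)) = 0"
   using madd[OF H'[OF s] Linf_fun_scale[OF H[OF s]], of s "-1"] mscale[OF H[OF s], of "-1"] by simp
  then show ?case using insert madd[OF Hd[OF s], of "\<lambda>x. \<Sum>s\<in>T. H s (s + x) + (-1) * H s x"]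
   Linf_fun_add[OF Hd[OF s], of "\<lambda>x. \<Sum>s\<in>T. H s (s + x) + (-1) * H s x"] by simp
 qed
 from this[OF S(1) order_refl] have
  T: "(\<lambda>x. \<Sum>s\<in>S. H s (s + x) + (-1) * H s x) \<in> Linf_fun \<mu>" "m (Linf_class (\<lambda>x. \<Sum>s\<in>S. H s (s + x) + (-1) * H s x)) = 0"
  by blast+
 \<comment> \<open>A nonnegative function whose mean would be - e, since the translation differences
   have mean 0.\<close>
 define R where "R = (\<lambda>x. (\<Sum>s\<in>S. H s (s + x) + (-1) * H s x) + (- complex_of_real e) * 1)"
 have Rf: "R \<in> Linf_fun \<mu>" unfolding R_def by (intro Linf_fun_add T Linf_fun_scale one)
 have Rx: "R x = complex_of_real ((\<Sum>s\<in>S. h s (s + x) - h s x) - e)" for x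
  unfolding R_def H_def by simp
 have "R x \<in> \<real>\<^sub>\<ge>\<^sub>0" for x unfolding Rx nonneg_Reals_of_real_iff using key[of x] by simp
 then have "m (Linf_class R) \<in> \<real>\<^sub>\<ge>\<^sub>0" by (intro mpos Rf locally_AE_always)
 moreover have "m (Linf_class R) = - complex_of_real e"
  unfolding R_def using madd[OF T(1) Linf_fun_scale[OF one], of "- complex_of_real e"] T(2) mscale[OF one, of "- complex_of_real e"] m1
  by simp
 ultimately show False using S(2) by (simp add: complex_nonneg_Reals_iff)
qed

end

section \<open>Reiter's condition implies weak amenability of the Figa-Talamanca--Herz
  algebra\<close>

context haar_p
begin

text \<open>The coefficient of F^(1/p) and F^(1/q), both of norm 1. Its value at x is the integral
  of F^(1/p) (L_x F)^(1/q), which is at most 1 by Young's inequality and at least the integral of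
  min F (L_x F), that is 1 - ||L_x F - F|| / 2.\<close>

lemma reiter_unit:
 assumes r: "reiter" and X: "finite X" and e: "e > 0"
 obtains u where "u \<in> Ap" "Ap_norm p \<mu> u \<le> 1" "\<And>x. x \<in> X ==> cmod (u x - 1) < e"
proof -
 obtain F :: "'g => real" where F: "\<And>x. 0 \<le> F x" "integrable \<mu> F" "(LI x. F x) = 1"
  "\<And>s. s \<in> X ==> (LI x. \<bar>F (- s + x) - F x\<bar>) < e" by (rule reiterD[OF r X e]) (rule that)
 define f where "f = (\<lambda>x. complex_of_real (F x powr (1 / p)))"
 define g where "g = (\<lambda>x. complex_of_real (F x powr (1 / q)))"
 have Fm[measurable]: "F \<in> borel_measurable borel" using borel_measurable_integrable[OF F(2)] by simp
 have fp: "cmod (f x) powr p = F x" and gq: "cmod (g x) powr q = F x" for x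
  unfolding f_def g_def using F(1)[of x] p0 q0 by (simp_all add: powr_powr)
 have fL: "f \<in> Lp_fun p \<mu>" unfolding Lp_fun_def mem_Collect_eq fp using F(2) by (simp add: f_def)
 have gL: "g \<in> Lp_fun q \<mu>" unfolding Lp_fun_def mem_Collect_eq gq using F(2) by (simp add: g_def)
 have nf: "Lp_norm p \<mu> f = 1" and ng: "Lp_norm q \<mu> g = 1"
  unfolding Lp_norm_def fp gq F(3) by simp_all
 show thesis
 proof (rule that[of "cv f g"])
  show "cv f g \<in> Ap" by (rule cv_representation[OF fL gL])
  show "Ap_norm p \<mu> (cv f g) \<le> 1" using cv_representation(2)[OF fL gL] nf ng by simp
  fix x assume x: "x \<in> X"
  define k where "k = (\<lambda>y. F y powr (1 / p) * F (- x + y) powr (1 / q))"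
  have cint: "integrable \<mu> (\<lambda>y. f y * cnj (g (- x + y)))" using cv_integrable[OF p1 fL] gL unfolding q_def by blast
  have eq: "f y * cnj (g (- x + y)) = complex_of_real (k y)" for y unfolding f_def g_def k_def by simp
  have ki: "integrable \<mu> k" using cint unfolding eq by (simp add: complex_of_real_integrable_eq)
  have Ft: "integrable \<mu> (\<lambda>y. F (- x + y))" by (rule integrable_translate[OF F(2)])
  have Ft1: "(LI y. F (- x + y)) = 1" using integral_translate[of F "- x"] F(3) by simp
  have cvk: "cv f g x = complex_of_real (LI y. k y)" unfolding cv_def eq by (rule integral_complex_of_real)
  have "(LI y. k y) \<le> (LI y. F y / p + F (- x + y) / q)"
  proof (rule integral_mono[OF ki])
   show "integrable \<mu> (\<lambda>y. F y / p + F (- x + y) / q)" using F(2) Ft by auto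
   show "k y \<le> F y / p + F (- x + y) / q" for y
    using Youngs_inequality[OF p1 q1 pq, of "F y powr (1 / p)" "F (- x + y) powr (1 / q)"] F(1) p0 q0
    unfolding k_def by (simp add: powr_powr)
  qed
  also have "\<dots> = 1" using F(2,3) Ft Ft1 pq by simp
  finally have up: "(LI y. k y) \<le> 1" .
  have "1 - (LI y. \<bar>F (- x + y) - F y\<bar>) / 2 = (LI y. (F y + F (- x + y) - \<bar>F (- x + y) - F y\<bar>) / 2)"
   using F(2,3) Ft Ft1 by simp
  also have "\<dots> \<le> (LI y. k y)"
  proof (rule integral_mono[OF _ ki])
   show "integrable \<mu> (\<lambda>y. (F y + F (- x + y) - \<bar>F (- x + y) - F y\<bar>) / 2)" using F(2) Ft by auto
   show "(F y + F (- x + y) - \<bar>F (- x + y) - F y\<bar>) / 2 \<le> k y" for y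
   proof -
    define a b c where "a = F y" and "b = F (- x + y)" and "c = min a b"
    have nn: "a \<ge> 0" "b \<ge> 0" "c \<ge> 0" unfolding a_def b_def c_def using F(1) by auto
    have "c = c powr (1 / p) * c powr (1 / q)" using nn pq by (simp add: powr_add[symmetric])
    also have "\<dots> \<le> a powr (1 / p) * b powr (1 / q)"
     using nn p0 q0 by (intro mult_mono powr_mono2) (auto simp: c_def)
    finally have "c \<le> k y" unfolding k_def a_def b_def .
    moreover have "(a + b - \<bar>b - a\<bar>) / 2 = c" unfolding c_def by (auto simp: min_def abs_if)
    ultimately show ?thesis unfolding a_def b_def by simp
   qed
  qed
  finally have "\<bar>(LI y. k y) - 1\<bar> \<le> (LI y. \<bar>F (- x + y) - F y\<bar>) / 2" using up by simp
  then have "\<bar>(LI y. k y) - 1\<bar> < e" using F(4)[OF x] e by linarith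
  then show "cmod (cv f g x - 1) < e" unfolding cvk by (metis norm_of_real of_real_1 of_real_diff)
 qed
qed

text \<open>All characters are evaluations, so a may be an element that is nearly 1 at the finitely
  many points concerned, and b a peak at the point of \<phi> that vanishes at the others. For \<phi>
  = 0 one takes b = 0.\<close>

lemma reiter_imp_Delta_weak_amenable:
 assumes r: "reiter" and phi: "\<phi> \<in> characters (Ap_algebra p \<mu>) \<union> {\<lambda>_. 0}"
 shows "Delta_weak_amenable (Ap_algebra p \<mu>) \<phi>"
proof (rule Delta_weak_amenableI[OF _ _ phi])
 let ?A = "Ap"
 show "0 \<le> vnorm (Ap_algebra p \<mu>) u" if "u \<in> ?A" for u using Ap_norm_nonneg[OF that] by simp
 show "\<exists>C. \<forall>u\<in>?A. cmod (\<psi> u) \<le> C * vnorm (Ap_algebra p \<mu>) u" if "\<psi> \<in> characters (Ap_algebra p \<mu>)" for \<psi>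
  using Ap_character_bounded[OF that] by auto
 fix S :: "(('g => complex) => complex) set" and e :: real
 assume S: "finite S" "S \<subseteq> characters (Ap_algebra p \<mu>) - {\<phi>}" and e: "0 < e"
 have "\<forall>\<psi>\<in>S. \<exists>x. \<psi> = evaluation x" using S(2) Ap_characters by blast
 then obtain pt where pt: "\<And>\<psi>. \<psi> \<in> S ==> \<psi> = evaluation (pt \<psi>)" by metis
 define X where "X = pt ` S"
 have X: "finite X" unfolding X_def using S by simp
 have zA: "(\<lambda>x. 0) \<in> ?A" unfolding Ap_carrier using atomic_zero by blast
 have zn: "Ap_norm p \<mu> (\<lambda>x. 0) \<le> 1"
  using cv_representation(2)[OF Lp_fun_zero Lp_fun_zero] by (simp add: cv_def Lp_norm_def)
 show "\<exists>a b. a \<in> ?A \<and> b \<in> ?A \<and> vnorm (Ap_algebra p \<mu>) a \<le> 1 \<and> vnorm (Ap_algebra p \<mu>) b \<le> 1 \<and>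
  cmod (\<phi> a - \<phi> b) < e \<and> (\<forall>\<psi>\<in>S. cmod (\<psi> a - \<psi> b - 1) < e)"
 proof (cases "\<phi> \<in> characters (Ap_algebra p \<mu>)")
  case True
  then obtain x0 where x0: "\<phi> = evaluation x0" using Ap_characters by blast
  have x0X: "x0 \<notin> X" using S(2) pt x0 unfolding X_def by blast
  have "open (- X)" using X finite_imp_closed[of X] by (simp add: open_Compl)
  then obtain b where b: "b \<in> ?A" "Ap_norm p \<mu> b \<le> 1" "b x0 = 1" "\<And>z. z \<in> X ==> b z = 0"
   using Ap_peak[of "- X" x0] x0X by (metis ComplD ComplI)
  obtain a where a: "a \<in> ?A" "Ap_norm p \<mu> a \<le> 1" "\<And>x. x \<in> insert x0 X ==> cmod (a x - 1) < e"
   using reiter_unit[OF r _ e, of "insert x0 X"] X by (metis finite_insert)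
  have "cmod (\<phi> a - \<phi> b) < e" unfolding x0 evaluation_def using a b by simp
  moreover have "cmod (\<psi> a - \<psi> b - 1) < e" if "\<psi> \<in> S" for \<psi>
  proof -
   have "pt \<psi> \<in> X" unfolding X_def using that by simp
   then show ?thesis using a b pt[OF that] by (metis (no_types, lifting) diff_zero evaluation_def insertCI)
  qed
  ultimately show ?thesis using a b by (intro exI[of _ a] exI[of _ b]) simp
 next
  case False
  then have phi0: "\<phi> = (\<lambda>_. 0)" using phi by blast
  obtain a where a: "a \<in> ?A" "Ap_norm p \<mu> a \<le> 1" "\<And>x. x \<in> X ==> cmod (a x - 1) < e"
   using reiter_unit[OF r X e] by blast
  have "cmod (\<psi> a - \<psi> (\<lambda>x. 0) - 1) < e" if "\<psi> \<in> S" for \<psi>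
  proof -
   have "pt \<psi> \<in> X" unfolding X_def using that by simp
   then show ?thesis using a zA pt[OF that] by (metis (no_types, lifting) diff_zero evaluation_def)
  qed
  then show ?thesis using a zA zn phi0 e by (intro exI[of _ a] exI[of _ "\<lambda>x. 0"]) simp
 qed
qed

end

section \<open>Reiter's condition yields an invariant mean\<close>

context haar
begin

lemma AE_translate:
 assumes "AE y in \<mu>. P y"
 shows "AE y in \<mu>. P (x + y)"
proof -
 obtain N where N: "{y \<in> space \<mu>. \<not> P y} \<subseteq> N" "N \<in> sets \<mu>" "emeasure \<mu> N = 0" using AE_E[OF assms] by metis
 show ?thesis
 proof (rule AE_I)
  show "{y \<in> space \<mu>. \<not> P (x + y)} \<subseteq> (+) (- x) ` N" using N(1) unfolding left_translate_image by auto
  show "emeasure \<mu> ((+) (- x) ` N) = 0" using emeasure_left_translate[of N "- x"] N by simp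
  show "(+) (- x) ` N \<in> sets \<mu>" using borel_translate[of N "- x"] N by simp
 qed
qed

text \<open>The set where F is nonzero is the union of the sets |F| \<ge> 1/(n+1), each of finite
  measure, and on such sets local statements are statements almost everywhere.\<close>

lemma locally_AE_support:
 fixes F :: "'g => real"
 assumes F: "integrable \<mu> F" and P: "locally_AE \<mu> P"
 shows "AE x in \<mu>. F x \<noteq> 0 --> P x"
proof -
 have Fm[measurable]: "F \<in> borel_measurable borel" using borel_measurable_integrable[OF F] by simp
 have "AE x in \<mu>. x \<in> {x. 1 / real (Suc n) \<le> \<bar>F x\<bar>} --> P x" for n
 proof -
  have m: "{x. 1 / real (Suc n) \<le> \<bar>F x\<bar>} \<in> sets borel" by measurable
  have "integrable \<mu> (\<lambda>x. indicator {x. 1 / real (Suc n) \<le> \<bar>F x\<bar>} x :: real)"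
  proof (rule Bochner_Integration.integrable_bound)
   show "integrable \<mu> (\<lambda>x. real (Suc n) * \<bar>F x\<bar>)" using F by (intro integrable_mult_right) auto
   show "AE x in \<mu>. norm (indicator {x. 1 / real (Suc n) \<le> \<bar>F x\<bar>} x :: real) \<le> norm (real (Suc n) * \<bar>F x\<bar>)"
    by (intro always_eventually allI) (auto simp: indicator_def field_simps)
  qed (use m in simp)
  then have "emeasure \<mu> {x. 1 / real (Suc n) \<le> \<bar>F x\<bar>} < \<infinity>" using m by (simp add: integrable_indicator_iff)
  then show ?thesis using P[unfolded locally_AE_def, rule_format, of "{x. 1 / real (Suc n) \<le> \<bar>F x\<bar>}"] m by simp
 qed
 then have "AE x in \<mu>. \<forall>n. x \<in> {x. 1 / real (Suc n) \<le> \<bar>F x\<bar>} --> P x"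
  by (subst AE_all_countable) (rule allI)
 then show ?thesis
 proof (rule eventually_mono)
  fix x assume *: "\<forall>n. x \<in> {x. 1 / real (Suc n) \<le> \<bar>F x\<bar>} --> P x"
  show "F x \<noteq> 0 --> P x"
  proof
   assume "F x \<noteq> 0"
   then obtain n where "1 / real (Suc n) < \<bar>F x\<bar>" using nat_approx_posE[of "\<bar>F x\<bar>"] by auto
   then show "P x" using * by (auto intro: less_imp_le)
  qed
 qed
qed

text \<open>The pairing between bounded and integrable functions. As h is known to be measurable
  only on sets of finite measure, the product is measurable as a limit of its restrictions to the
  sets |F| \<ge> 1/(n+1).\<close>

lemma Linf_times_L1:
 fixes F :: "'g => real"
 assumes h: "h \<in> Linf_fun \<mu>" and F: "integrable \<mu> F"
 shows "integrable \<mu> (\<lambda>x. h x * complex_of_real (F x))"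
  and "0 \<le> C ==> locally_AE \<mu> (\<lambda>x. cmod (h x) \<le> C) ==> cmod (LI x. h x * complex_of_real (F x)) \<le> C * (LI x. \<bar>F x\<bar>)"
proof -
 have Fm[measurable]: "F \<in> borel_measurable borel" using borel_measurable_integrable[OF F] by simp
 define A where "A = (\<lambda>n. {x. 1 / real (Suc n) \<le> \<bar>F x\<bar>})"
 have Am: "A n \<in> sets borel" for n unfolding A_def by measurable
 have Af: "emeasure \<mu> (A n) < \<infinity>" for n
 proof -
  have "integrable \<mu> (\<lambda>x. indicator (A n) x :: real)"
  proof (rule Bochner_Integration.integrable_bound)
   show "integrable \<mu> (\<lambda>x. real (Suc n) * \<bar>F x\<bar>)" using F by (intro integrable_mult_right) auto
   show "AE x in \<mu>. norm (indicator (A n) x :: real) \<le> norm (real (Suc n) * \<bar>F x\<bar>)"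
    unfolding A_def by (intro always_eventually allI) (auto simp: indicator_def field_simps)
  qed (use Am in simp)
  then show ?thesis using Am by (simp add: integrable_indicator_iff)
 qed
 have "h \<in> borel_measurable (restrict_space \<mu> (A n))" for n using Linf_funD(1)[OF h Am Af] .
 then have "(\<lambda>x. indicator (A n) x *\<^sub>R h x) \<in> borel_measurable \<mu>" for n
  using Am by (subst (asm) borel_measurable_restrict_space_iff) auto
 then have hA: "(\<lambda>x. indicator (A n) x *\<^sub>R h x) \<in> borel_measurable borel" for n by simp
 have m1: "(\<lambda>x. (indicator (A n) x *\<^sub>R h x) * complex_of_real (F x)) \<in> borel_measurable borel" for n
  by (intro borel_measurable_times hA) simp
 have m: "(\<lambda>x. h x * complex_of_real (F x)) \<in> borel_measurable borel"
 proof (rule borel_measurable_LIMSEQ_metric[OF m1])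
  fix x
  show "(\<lambda>n. (indicator (A n) x *\<^sub>R h x) * complex_of_real (F x)) \<longlonglongrightarrow> h x * complex_of_real (F x)"
  proof (cases "F x = 0")
   case False
   then obtain N where N: "1 / real (Suc N) < \<bar>F x\<bar>" using nat_approx_posE[of "\<bar>F x\<bar>"] by auto
   have "\<forall>\<^sub>F n in sequentially. (indicator (A n) x *\<^sub>R h x) * complex_of_real (F x) = h x * complex_of_real (F x)"
   proof (rule eventually_mono[OF eventually_ge_at_top[of N]])
    fix n assume "N \<le> n"
    then have "1 / real (Suc n) \<le> 1 / real (Suc N)" by (simp add: field_simps)
    then have "x \<in> A n" unfolding A_def using N by simp
    then show "(indicator (A n) x *\<^sub>R h x) * complex_of_real (F x) = h x * complex_of_real (F x)" by simp
   qed
   then show ?thesis by (rule tendsto_eventually)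
  qed simp
 qed
 have bnd: "AE x in \<mu>. cmod (h x * complex_of_real (F x)) \<le> C * \<bar>F x\<bar>" if C: "locally_AE \<mu> (\<lambda>x. cmod (h x) \<le> C)" for C
  using locally_AE_support[OF F C] by eventually_elim (auto simp: norm_mult intro: mult_right_mono)
 obtain C0 where "locally_AE \<mu> (\<lambda>x. cmod (h x) \<le> C0)" using Linf_funD(2)[OF h] by blast
 then have C0: "locally_AE \<mu> (\<lambda>x. cmod (h x) \<le> \<bar>C0\<bar>)" by (rule locally_AE_mono) linarith
 show i: "integrable \<mu> (\<lambda>x. h x * complex_of_real (F x))"
 proof (rule Bochner_Integration.integrable_bound)
  show "integrable \<mu> (\<lambda>x. \<bar>C0\<bar> * \<bar>F x\<bar>)" using F by (intro integrable_mult_right) auto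
  show "AE x in \<mu>. norm (h x * complex_of_real (F x)) \<le> norm (\<bar>C0\<bar> * \<bar>F x\<bar>)" using bnd[OF C0] by simp
 qed (use m in simp)
 show "cmod (LI x. h x * complex_of_real (F x)) \<le> C * (LI x. \<bar>F x\<bar>)"
  if C: "0 \<le> C" "locally_AE \<mu> (\<lambda>x. cmod (h x) \<le> C)"
 proof -
  have "cmod (LI x. h x * complex_of_real (F x)) \<le> (LI x. cmod (h x * complex_of_real (F x)))"
   by (rule integral_norm_bound)
  also have "\<dots> \<le> (LI x. C * \<bar>F x\<bar>)"
   using F i bnd[OF C(2)] by (intro integral_mono_AE integrable_norm integrable_mult_right) auto
  finally show ?thesis by simp
 qed
qed

lemma Linf_integral_cong:
 fixes F :: "'g => real"
 assumes hh: "(h, h') \<in> Linf_rel \<mu>" and F: "integrable \<mu> F"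
 shows "(LI x. h x * complex_of_real (F x)) = (LI x. h' x * complex_of_real (F x))"
proof (rule integral_cong_AE)
 have l: "h \<in> Linf_fun \<mu>" "h' \<in> Linf_fun \<mu>" "locally_AE \<mu> (\<lambda>x. h x = h' x)" using hh unfolding Linf_rel_def by auto
 show "(\<lambda>x. h x * complex_of_real (F x)) \<in> borel_measurable \<mu>" "(\<lambda>x. h' x * complex_of_real (F x)) \<in> borel_measurable \<mu>"
  using Linf_times_L1(1)[OF l(1) F] Linf_times_L1(1)[OF l(2) F] by (auto dest: borel_measurable_integrable)
 show "AE x in \<mu>. h x * complex_of_real (F x) = h' x * complex_of_real (F x)"
  using locally_AE_support[OF F l(3)] by eventually_elim auto
qed

lemma locally_AE_translate:
 assumes "locally_AE \<mu> P"
 shows "locally_AE \<mu> (\<lambda>y. P (- x + y))"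
 unfolding locally_AE_def
proof (intro ballI impI)
 fix F assume F: "F \<in> sets \<mu>" "emeasure \<mu> F < \<infinity>"
 have "AE y in \<mu>. y \<in> (+) (- x) ` F --> P y"
  using assms F borel_translate[of F "- x"] emeasure_left_translate[of F "- x"] unfolding locally_AE_def by simp
 then have "AE y in \<mu>. - x + y \<in> (+) (- x) ` F --> P (- x + y)" by (rule AE_translate)
 then show "AE y in \<mu>. y \<in> F --> P (- x + y)" by eventually_elim auto
qed

lemma Linf_fun_translate:
 assumes h: "h \<in> Linf_fun \<mu>"
 shows "left_translate x h \<in> Linf_fun \<mu>"
 unfolding Linf_fun_def
proof (intro CollectI conjI ballI impI)
 obtain C where "locally_AE \<mu> (\<lambda>x. cmod (h x) \<le> C)" using Linf_funD(2)[OF h] by blast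
 from locally_AE_translate[OF this, of x] show "\<exists>C. locally_AE \<mu> (\<lambda>y. cmod (left_translate x h y) \<le> C)"
  unfolding left_translate_def by blast
 fix F assume F: "F \<in> sets \<mu>" "emeasure \<mu> F < \<infinity>"
 define F' where "F' = (+) (- x) ` F"
 have F': "F' \<in> sets borel" "emeasure \<mu> F' < \<infinity>"
  unfolding F'_def using F borel_translate[of F "- x"] emeasure_left_translate[of F "- x"] by auto
 have "(\<lambda>y. indicator F' y *\<^sub>R h y) \<in> borel_measurable borel"
  using Linf_funD(1)[OF h F'] F' by (subst (asm) borel_measurable_restrict_space_iff) auto
 then have "(\<lambda>y. indicator F' (- x + y) *\<^sub>R h (- x + y)) \<in> borel_measurable borel"
  by (rule measurable_translate)
 moreover have "indicator F' (- x + y) = (indicator F y :: real)" for y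
  unfolding F'_def by (auto simp: indicator_def left_translate_image)
 ultimately show "left_translate x h \<in> borel_measurable (restrict_space \<mu> F)"
  using F by (subst borel_measurable_restrict_space_iff) (auto simp: left_translate_def)
qed

text \<open>Almost invariant densities F define the functionals h \<mapsto> \<integral> h F, and a
  pointwise limit of these is the mean. It is first constructed on functions and then passed to
  classes by choosing representatives.\<close>

lemma reiter_imp_amenable:
 assumes r: "reiter"
 shows "amenable_group \<mu>"
proof -
 define good where "good = {F :: 'g => real. (\<forall>x. 0 \<le> F x) \<and> integrable \<mu> F \<and> (LI x. F x) = 1}"
 define I where "I = (\<lambda>(F :: 'g => real) h. if F \<in> good \<and> h \<in> Linf_fun \<mu> then (LI x. h x * complex_of_real (F x)) else 0)"
 \<comment> \<open>The coordinates \<open>Inl h\<close> record the functional itself. The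
   coordinates \<open>Inr (x, h)\<close> record its defect of invariance, so that invariance of the
   limit becomes one of the prescribed values in \<open>pointwise_limit\<close>.\<close>
 define \<Phi> where "\<Phi> = (\<lambda>F d. case d of Inl h => I F h | Inr (x, h) => I F (left_translate x h) - I F h)"
 define ess where "ess = (\<lambda>h. SOME C. 0 \<le> C \<and> (h \<in> Linf_fun \<mu> --> locally_AE \<mu> (\<lambda>x. cmod (h x) \<le> C)))"
 have ess: "0 \<le> ess h \<and> (h \<in> Linf_fun \<mu> --> locally_AE \<mu> (\<lambda>x. cmod (h x) \<le> ess h))" for h :: "'g => complex"
  unfolding ess_def
 proof (rule someI_ex, cases "h \<in> Linf_fun \<mu>")
  case True
  then obtain C where "locally_AE \<mu> (\<lambda>x. cmod (h x) \<le> C)" using Linf_funD(2) by blast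
  then have "locally_AE \<mu> (\<lambda>x. cmod (h x) \<le> \<bar>C\<bar>)" by (rule locally_AE_mono) linarith
  then show "\<exists>C\<ge>0. h \<in> Linf_fun \<mu> --> locally_AE \<mu> (\<lambda>x. cmod (h x) \<le> C)" by (intro exI[of _ "\<bar>C\<bar>"]) auto
 qed auto
 have Ib: "cmod (I F h) \<le> C" if "0 \<le> C" "h \<in> Linf_fun \<mu> ==> locally_AE \<mu> (\<lambda>x. cmod (h x) \<le> C)" for F h C
  using that Linf_times_L1(2)[of h F C] unfolding I_def good_def by auto
 have Ie: "cmod (I F h) \<le> ess h" for F h using Ib ess by blast
 have bd: "cmod (\<Phi> F d) \<le> (case d of Inl h => ess h | Inr (x, h) => ess (left_translate x h) + ess h)" for F d
  unfolding \<Phi>_def using Ie order_trans[OF norm_triangle_ineq4 add_mono[OF Ie Ie]]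
  by (auto split: sum.splits prod.splits)
 define A :: "(('g => complex) + 'g \<times> ('g => complex)) set"
  where "A = insert (Inl (\<lambda>_. 1)) (Inr ` (UNIV \<times> Linf_fun \<mu>))"
 define L where "L = (\<lambda>d :: ('g => complex) + 'g \<times> ('g => complex). case d of Inl h => (1::complex) | Inr _ => 0)"
 have one: "(\<lambda>_. 1) \<in> Linf_fun \<mu>" by (rule Linf_fun_bounded[of _ 1]) auto
 have approx: "\<exists>F. \<forall>s\<in>S. cmod (\<Phi> F s - L s) < e" if S: "finite S" "S \<subseteq> A" and e: "0 < e" for S e
 proof -
  define X where "X = {(x, h). Inr (x, h) \<in> S}"
  have X: "finite X"
  proof -
   have "X = Inr -` S" unfolding X_def by auto
   then show ?thesis using finite_vimageI[OF S(1), of Inr] by simp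
  qed
  define M where "M = (\<Sum>(x, h)\<in>X. ess h) + 1"
  have ess_le: "ess h < M" if "(x, h) \<in> X" for x h
  proof -
   have "(case (x, h) of (x, h) => ess h) \<le> (\<Sum>(x, h)\<in>X. ess h)"
    by (rule member_le_sum[OF that _ X]) (use ess in auto)
   then show ?thesis unfolding M_def by simp
  qed
  have M: "M > 0" unfolding M_def using ess by (intro add_nonneg_pos sum_nonneg) auto
  \<comment> \<open>A translation of h by x turns into a translation of F by the inverse under the
    integral; hence Reiter's condition is applied at - x.\<close>
  obtain F :: "'g => real" where F: "\<And>x. 0 \<le> F x" "integrable \<mu> F" "(LI x. F x) = 1"
   "\<And>s. s \<in> (\<lambda>z. - fst z) ` X ==> (LI x. \<bar>F (- s + x) - F x\<bar>) < e / M"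
   by (rule reiterD[OF r finite_imageI[OF X], of "e / M" "\<lambda>z. - fst z"]) (use e M in simp, rule that)
  have g: "F \<in> good" unfolding good_def using F by auto
  have "cmod (\<Phi> F s - L s) < e" if s: "s \<in> S" for s
  proof (cases s)
   case (Inl h)
   then have "h = (\<lambda>_. 1)" using s S(2) unfolding A_def by auto
   then have "\<Phi> F s = 1" unfolding \<Phi>_def Inl I_def using g one F(3) by (simp add: integral_complex_of_real)
   then show ?thesis unfolding L_def Inl using e by simp
  next
   case (Inr z)
   obtain x h where z: "z = (x, h)" by (cases z)
   have h: "h \<in> Linf_fun \<mu>" and X': "(x, h) \<in> X" using s S(2) unfolding Inr z A_def X_def by auto
   have Ft: "integrable \<mu> (\<lambda>y. F (x + y))" by (rule integrable_translate[OF F(2)])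
   have "I F (left_translate x h) = (LI y. h y * complex_of_real (F (x + y)))"
    unfolding I_def using g Linf_fun_translate[OF h]
     integral_translate[of "\<lambda>y. left_translate x h y * complex_of_real (F y)" x]
    by (simp add: left_translate_def)
   then have "I F (left_translate x h) - I F h = (LI y. h y * complex_of_real (F (x + y)) - h y * complex_of_real (F y))"
    using Linf_times_L1(1)[OF h Ft] Linf_times_L1(1)[OF h F(2)] g h unfolding I_def
    by (simp add: Bochner_Integration.integral_diff)
   also have "\<dots> = (LI y. h y * complex_of_real (F (x + y) - F y))" by (simp add: right_diff_distrib)
   finally have "\<Phi> F s - L s = (LI y. h y * complex_of_real (F (x + y) - F y))"
    unfolding \<Phi>_def L_def Inr z by simp
   then have "cmod (\<Phi> F s - L s) \<le> ess h * (LI y. \<bar>F (x + y) - F y\<bar>)"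
    using Linf_times_L1(2)[OF h Bochner_Integration.integrable_diff[OF Ft F(2)]] ess h by simp
   also have "\<dots> \<le> M * (LI y. \<bar>F (x + y) - F y\<bar>)"
    using ess_le[OF X'] by (intro mult_right_mono) auto
   also have "(LI y. \<bar>F (x + y) - F y\<bar>) < e / M"
    using F(4)[of "- x"] X' by force
   finally show ?thesis using M by (simp add: field_simps)
  qed
  then show ?thesis by blast
 qed
 obtain U M where U: "U \<noteq> bot" and M: "\<And>d. ((\<lambda>F. \<Phi> F d) \<longlongrightarrow> M d) U" and MA: "\<And>s. s \<in> A ==> M s = L s"
  by (rule pointwise_limit[of \<Phi> _ A L, OF bd approx]) (assumption+, rule that)
 define N where "N = (\<lambda>h. M (Inl h))"
 have N: "((\<lambda>F. I F h) \<longlongrightarrow> N h) U" for h using M[of "Inl h"] unfolding N_def \<Phi>_def by simp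
 have uniq: "a = b" if "((\<lambda>F. f F) \<longlongrightarrow> a) U" "((\<lambda>F. f F) \<longlongrightarrow> b) U" for a b :: complex and f
  using tendsto_unique[OF U that] .
 have Nadd: "N (\<lambda>x. f x + g x) = N f + N g" if "f \<in> Linf_fun \<mu>" "g \<in> Linf_fun \<mu>" for f g
 proof (rule uniq[OF N])
  have "I F (\<lambda>x. f x + g x) = I F f + I F g" for F
   using Linf_times_L1(1)[OF that(1), of F] Linf_times_L1(1)[OF that(2), of F] that Linf_fun_add[OF that]
   unfolding I_def good_def by (auto simp: distrib_right Bochner_Integration.integral_add)
  then show "((\<lambda>F. I F (\<lambda>x. f x + g x)) \<longlongrightarrow> N f + N g) U" using tendsto_add[OF N[of f] N[of g]] by simp
 qed
 have Nscale: "N (\<lambda>x. c * f x) = c * N f" if "f \<in> Linf_fun \<mu>" for c f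
 proof (rule uniq[OF N])
  have "I F (\<lambda>x. c * f x) = c * I F f" for F
   using that Linf_fun_scale[OF that, of c] unfolding I_def by (auto simp: mult.assoc)
  then show "((\<lambda>F. I F (\<lambda>x. c * f x)) \<longlongrightarrow> c * N f) U" using tendsto_mult_left[OF N[of f], of c] by simp
 qed
 have Ncong: "N f = N g" if "(f, g) \<in> Linf_rel \<mu>" for f g
 proof (rule uniq[OF N])
  have "I F f = I F g" for F
   using Linf_integral_cong[OF that, of F] that unfolding I_def good_def Linf_rel_def by auto
  then show "((\<lambda>F. I F f) \<longlongrightarrow> N g) U" using N[of g] by simp
 qed
 have Nbound: "cmod (N f) \<le> C" if "0 \<le> C" "locally_AE \<mu> (\<lambda>x. cmod (f x) \<le> C)" for f C
 proof (rule tendsto_upperbound[OF tendsto_norm[OF N] _ U])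
  show "\<forall>\<^sub>F F in U. cmod (I F f) \<le> C" using Ib that by (intro always_eventually) auto
 qed
 have Npos: "N f \<in> \<real>\<^sub>\<ge>\<^sub>0" if f: "f \<in> Linf_fun \<mu>" "locally_AE \<mu> (\<lambda>x. f x \<in> \<real>\<^sub>\<ge>\<^sub>0)" for f
 proof -
  have "I F f \<in> \<real>\<^sub>\<ge>\<^sub>0" for F
  proof (cases "F \<in> good")
   case True
   then have F: "integrable \<mu> F" "\<And>x. 0 \<le> F x" unfolding good_def by auto
   have i: "integrable \<mu> (\<lambda>x. f x * complex_of_real (F x))" by (rule Linf_times_L1(1)[OF f(1) F(1)])
   have ae: "AE x in \<mu>. Re (f x * complex_of_real (F x)) \<ge> 0 \<and> Im (f x * complex_of_real (F x)) = 0"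
    using locally_AE_support[OF F(1) f(2)]
    by eventually_elim (use F(2) in \<open>auto simp: complex_nonneg_Reals_iff\<close>)
   have "Re (I F f) = (LI x. Re (f x * complex_of_real (F x)))" "Im (I F f) = (LI x. Im (f x * complex_of_real (F x)))"
    using True f(1) i unfolding I_def by (simp_all only: integral_Re integral_Im if_True simp_thms)
   moreover have "(LI x. Re (f x * complex_of_real (F x))) \<ge> 0"
    using ae by (intro integral_nonneg_AE) auto
   moreover have "(LI x. Im (f x * complex_of_real (F x))) = 0"
    using ae by (intro integral_eq_zero_AE) auto
   ultimately show ?thesis by (simp add: complex_nonneg_Reals_iff)
  qed (simp add: I_def)
  then have "\<forall>F. Re (I F f) \<ge> 0 \<and> Im (I F f) = 0" by (simp add: complex_nonneg_Reals_iff)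
  then have "0 \<le> Re (N f)" "Im (N f) = 0"
   using tendsto_lowerbound[OF tendsto_Re[OF N[of f]] _ U, of 0] tendsto_unique[OF U tendsto_Im[OF N[of f]], of 0]
   by (auto intro: always_eventually)
  then show ?thesis by (simp add: complex_nonneg_Reals_iff)
 qed
 have Ninv: "N (left_translate x f) = N f" if "f \<in> Linf_fun \<mu>" for x f
 proof -
  have "Inr (x, f) \<in> A" unfolding A_def using that by auto
  then have "((\<lambda>F. I F (left_translate x f) - I F f) \<longlongrightarrow> 0) U"
   using M[of "Inr (x, f)"] MA unfolding \<Phi>_def L_def by simp
  moreover have "((\<lambda>F. I F (left_translate x f) - I F f) \<longlongrightarrow> N (left_translate x f) - N f) U"
   by (intro tendsto_diff N)
  ultimately have "N (left_translate x f) - N f = 0" using uniq by metis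
  then show ?thesis by simp
 qed
 have N1: "N (\<lambda>_. 1) = 1" using MA[of "Inl (\<lambda>_. 1)"] unfolding N_def A_def L_def by simp
 define m where "m = (\<lambda>C. if C \<in> vcarrier (Linf_space \<mu>) then N (SOME f. f \<in> C) else 0)"
 have mcl: "m (Linf_class f) = N f" if f: "f \<in> Linf_fun \<mu>" for f
 proof -
  have "(SOME g. g \<in> Linf_class f) \<in> Linf_class f" by (rule someI[of "\<lambda>g. g \<in> Linf_class f", OF Linf_class_self[OF f]])
  then have "N f = N (SOME g. g \<in> Linf_class f)" by (intro Ncong) simp
  then show ?thesis unfolding m_def using Linf_class_carrier[OF f] by simp
 qed
 have rep: "\<exists>f\<in>Linf_fun \<mu>. C = Linf_class f" if "C \<in> vcarrier (Linf_space \<mu>)" for C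
  using that unfolding Linf_carrier quotient_def by auto
 have lin: "linear_functional (Linf_space \<mu>) m"
  unfolding linear_functional_def
 proof (intro conjI allI ballI impI)
  fix C assume "C \<notin> vcarrier (Linf_space \<mu>)" then show "m C = 0" unfolding m_def by simp
 next
  fix C D assume "C \<in> vcarrier (Linf_space \<mu>)" "D \<in> vcarrier (Linf_space \<mu>)"
  then obtain f g where fg: "f \<in> Linf_fun \<mu>" "C = Linf_class f" "g \<in> Linf_fun \<mu>" "D = Linf_class g" using rep by meson
  show "m (vadd (Linf_space \<mu>) C D) = m C + m D"
   unfolding fg Linf_vadd[OF fg(1,3)] mcl[OF fg(1)] mcl[OF fg(3)] mcl[OF Linf_fun_add[OF fg(1,3)]] by (rule Nadd[OF fg(1,3)])
 next
  fix c C assume "C \<in> vcarrier (Linf_space \<mu>)"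
  then obtain f where fg: "f \<in> Linf_fun \<mu>" "C = Linf_class f" using rep by meson
  show "m (vscale (Linf_space \<mu>) c C) = c * m C"
   unfolding fg Linf_vscale[OF fg(1)] mcl[OF fg(1)] mcl[OF Linf_fun_scale[OF fg(1)]] by (rule Nscale[OF fg(1)])
 qed
 have "cmod (m C) \<le> 1 * vnorm (Linf_space \<mu>) C" if C: "C \<in> vcarrier (Linf_space \<mu>)" for C
 proof -
  obtain f where f: "f \<in> Linf_fun \<mu>" "C = Linf_class f" using rep[OF C] by blast
  define E where "E = (\<lambda>f::'g => complex. Inf {C. 0 \<le> C \<and> locally_AE \<mu> (\<lambda>x. cmod (f x) \<le> C)})"
  have Eg: "E g = E f" if "g \<in> C" for g
  proof -
   have eq: "locally_AE \<mu> (\<lambda>x. f x = g x)" using that unfolding f(2) Linf_rel_def by auto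
   have "locally_AE \<mu> (\<lambda>x. cmod (f x) \<le> D) \<longleftrightarrow> locally_AE \<mu> (\<lambda>x. cmod (g x) \<le> D)" for D
   proof
    assume "locally_AE \<mu> (\<lambda>x. cmod (f x) \<le> D)"
    from locally_AE_conj[OF eq this] show "locally_AE \<mu> (\<lambda>x. cmod (g x) \<le> D)" by (rule locally_AE_mono) auto
   next
    assume "locally_AE \<mu> (\<lambda>x. cmod (g x) \<le> D)"
    from locally_AE_conj[OF eq this] show "locally_AE \<mu> (\<lambda>x. cmod (f x) \<le> D)" by (rule locally_AE_mono) auto
   qed
   then show ?thesis unfolding E_def by simp
  qed
  have "f \<in> C" using Linf_class_self[OF f(1)] f(2) by simp
  then have "(\<lambda>_. E f) ` C = {E f}" by (rule image_constant)
  moreover have "E ` C = (\<lambda>_. E f) ` C" by (rule image_cong[OF refl Eg])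
  ultimately have "E ` C = {E f}" by simp
  then have vn: "vnorm (Linf_space \<mu>) C = E f" unfolding Linf_space_def E_def[symmetric] by simp
  have "cmod (N f) \<le> E f" unfolding E_def
  proof (rule cInf_greatest)
   have "ess f \<in> {C. 0 \<le> C \<and> locally_AE \<mu> (\<lambda>x. cmod (f x) \<le> C)}" using ess[of f] f(1) by simp
   then show "{C. 0 \<le> C \<and> locally_AE \<mu> (\<lambda>x. cmod (f x) \<le> C)} \<noteq> {}" by auto
   fix C assume "C \<in> {C. 0 \<le> C \<and> locally_AE \<mu> (\<lambda>x. cmod (f x) \<le> C)}"
   then show "cmod (N f) \<le> C" using Nbound by simp
  qed
  then show ?thesis unfolding vn using mcl[OF f(1)] f(2) by simp
 qed
 then have "m \<in> vcarrier (dual (Linf_space \<mu>))" unfolding dual_def using lin by (auto intro!: exI[of _ 1])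
 then show ?thesis unfolding amenable_group_def
  using Npos Ninv N1 one Linf_fun_translate by (intro bexI[of _ m]) (auto simp: mcl)
qed

end

text \<open>For \<alpha> \<le> \<beta> the right-hand side equals (\<beta> - \<alpha>) b + 2
  \<alpha> sqrt (a b), and Young's inequality for b and sqrt (a b) gives the claim; the other case
  is symmetric. The square is the measure of near-equality that replaces Clarkson's inequalities and
  treats all exponents alike.\<close>

lemma Young_refined:
 fixes a b \<alpha> \<beta> :: real
 assumes ab: "a \<ge> 0" "b \<ge> 0" and w: "\<alpha> > 0" "\<beta> > 0" "\<alpha> + \<beta> = 1"
 shows "a powr \<alpha> * b powr \<beta> \<le> \<alpha> * a + \<beta> * b - min \<alpha> \<beta> * (sqrt a - sqrt b)\<^sup>2"
proof -
 have main: "a powr \<alpha> * b powr \<beta> \<le> \<alpha> * a + \<beta> * b - \<alpha> * (sqrt a - sqrt b)\<^sup>2"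
  if ab: "a > 0" "b > 0" and w: "\<alpha> > 0" "\<alpha> \<le> \<beta>" "\<alpha> + \<beta> = 1" for a b \<alpha> \<beta> :: real
 proof -
  have 1: "b powr (\<beta> - \<alpha>) * sqrt (a * b) powr (2 * \<alpha>) \<le> (\<beta> - \<alpha>) * b + (2 * \<alpha>) * sqrt (a * b)"
   by (rule Youngs_inequality_0) (use ab w in auto)
  have 2: "sqrt (a * b) powr (2 * \<alpha>) = a powr \<alpha> * b powr \<alpha>"
   using ab by (simp add: powr_half_sqrt[symmetric] powr_powr powr_mult)
  have 3: "b powr (\<beta> - \<alpha>) * (a powr \<alpha> * b powr \<alpha>) = a powr \<alpha> * b powr \<beta>"
   using ab by (simp add: powr_diff)
  have 4: "(sqrt a - sqrt b)\<^sup>2 = a + b - 2 * sqrt (a * b)"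
   using ab by (simp add: power2_diff real_sqrt_mult)
  show ?thesis using 1 unfolding 2 3 4 by (simp add: algebra_simps)
 qed
 show ?thesis
 proof (cases "a = 0 \<or> b = 0")
  case True
  then show ?thesis
  proof
   assume "a = 0"
   moreover have "min \<alpha> \<beta> * b \<le> \<beta> * b" using ab by (intro mult_right_mono) auto
   ultimately show ?thesis using ab by simp
  next
   assume "b = 0"
   moreover have "min \<alpha> \<beta> * a \<le> \<alpha> * a" using ab by (intro mult_right_mono) auto
   ultimately show ?thesis using ab by simp
  qed
 next
  case False
  then have pos: "a > 0" "b > 0" using ab by auto
  show ?thesis
  proof (cases "\<alpha> \<le> \<beta>")
   case True
   then show ?thesis using main[OF pos w(1) True w(3)] by (simp add: min_def)
  next
   case False
   then show ?thesis using main[OF pos(2,1) w(2), of \<alpha>] w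
    by (simp add: min_def power2_commute[of "sqrt a"] algebra_simps)
  qed
 qed
qed

section \<open>Averages over finite sets of translations, and Reiter's condition from weak
  amenability\<close>

context haar_p
begin

definition avg :: "'g set => ('g => complex) => 'g => complex" where
 "avg T f = (\<lambda>y. (1 / of_nat (card T)) * (\<Sum>s\<in>T. f (s + y)))"

lemma avg_Lp:
 assumes "finite T" "f \<in> Lp_fun p \<mu>"
 shows "avg T f \<in> Lp_fun p \<mu>"
 unfolding avg_def by (intro Lp_fun_scale Lp_fun_sum p0 Lp_fun_translate assms)

text \<open>A left translation of the coefficient acts on its first factor only, so averages of
  members of \<open>Ap\<close> are controlled by averages in L^p.\<close>

lemma avg_cv:
 assumes T: "finite T" and f: "f \<in> Lp_fun p \<mu>" and g: "g \<in> Lp_fun q \<mu>"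
 shows "avg T (cv f g) = cv (avg T f) g"
proof
 fix x
 have "cv (\<lambda>y. \<Sum>s\<in>T. f (s + y)) g x = (\<Sum>s\<in>T. cv (\<lambda>y. f (s + y)) g x)"
  using T
 proof (induction T rule: finite_induct)
  case (insert s T)
  have "(\<lambda>y. \<Sum>s\<in>T. f (s + y)) \<in> Lp_fun p \<mu>" by (intro Lp_fun_sum p0 Lp_fun_translate f insert)
  from cv_add_left_p[OF Lp_fun_translate[OF f, of s] this g] show ?case using insert by simp
 qed (simp add: cv_def)
 then show "avg T (cv f g) x = cv (avg T f) g x"
  unfolding avg_def cv_scale_left cv_left_translate by simp
qed

lemma avg_power_cv:
 assumes T: "finite T" and f: "f \<in> Lp_fun p \<mu>" and g: "g \<in> Lp_fun q \<mu>"
 shows "(avg T ^^ k) f \<in> Lp_fun p \<mu> \<and> (avg T ^^ k) (cv f g) = cv ((avg T ^^ k) f) g"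
 by (induction k) (use f avg_Lp[OF T] avg_cv[OF T _ g] in auto)

lemma avg_sums:
 assumes "\<And>x. (\<lambda>i. w i x) sums u x"
 shows "(\<lambda>i. (avg T ^^ k) (w i) x) sums (avg T ^^ k) u x"
proof (induction k arbitrary: x)
 case (Suc k)
 show ?case unfolding funpow.simps o_def avg_def[of T "(avg T ^^ k) _"]
  by (intro sums_mult sums_sum Suc)
qed (use assms in simp)

lemma avg_add: "avg T (\<lambda>x. u x + v x) = (\<lambda>x. avg T u x + avg T v x)"
 unfolding avg_def by (auto simp: sum.distrib distrib_left)

lemma avg_scale: "avg T (\<lambda>x. c * u x) = (\<lambda>x. c * avg T u x)"
 unfolding avg_def by (auto simp: sum_distrib_left mult.left_commute)

lemma avg_power_add: "(avg T ^^ k) (\<lambda>x. u x + v x) = (\<lambda>x. (avg T ^^ k) u x + (avg T ^^ k) v x)"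
 by (induction k) (auto simp: avg_add)

lemma avg_power_scale: "(avg T ^^ k) (\<lambda>x. c * u x) = (\<lambda>x. c * (avg T ^^ k) u x)"
 by (induction k) (auto simp: avg_scale)

text \<open>
 If averaging over \<open>T\<close> were a strict contraction of \<open>L\<^sup>p\<close>, the functionals \<open>u \<mapsto> (A\<^sup>k u)(x)\<close>, which are
 convex combinations of point evaluations, would tend to \<open>0\<close> in norm, although \<open>m\<close> is nearly \<open>1\<close> on them.
\<close>

lemma averaging_not_contractive:
 assumes am: "Delta_weak_amenable (Ap_algebra p \<mu>) \<phi>"
  and phi: "\<phi> \<in> characters (Ap_algebra p \<mu>) \<union> {\<lambda>_. 0}"
  and T: "finite T" "T \<noteq> {}" and \<rho>: "0 < \<rho>" "\<rho> < 1"
 obtains f where "f \<in> Lp_fun p \<mu>"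
  "\<rho> * (LI x. cmod (f x) powr p) < (LI x. cmod (avg T f x) powr p)"
proof (rule ccontr)
 assume "\<not> thesis"
 then have contr: "(LI x. cmod (avg T f x) powr p) \<le> \<rho> * (LI x. cmod (f x) powr p)" if "f \<in> Lp_fun p \<mu>" for f
  using that \<open>\<And>f. f \<in> Lp_fun p \<mu> ==> _ ==> thesis\<close> by (meson not_le)
 let ?A = "Ap"
 define r where "r = \<rho> powr (1 / p)"
 have r: "0 < r" "r < 1" unfolding r_def using \<rho> p0 powr_less_mono2[of "1 / p" \<rho> 1] by auto
 have step: "Lp_norm p \<mu> (avg T f) \<le> r * Lp_norm p \<mu> f" if "f \<in> Lp_fun p \<mu>" for f
 proof -
  have "Lp_norm p \<mu> (avg T f) \<le> (\<rho> * (LI x. cmod (f x) powr p)) powr (1 / p)"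
   unfolding Lp_norm_def using contr[OF that] p0 by (intro powr_mono2) auto
  also have "\<dots> = r * Lp_norm p \<mu> f" unfolding Lp_norm_def r_def using \<rho> by (simp add: powr_mult)
  finally show ?thesis .
 qed
 have stepk: "Lp_norm p \<mu> ((avg T ^^ k) f) \<le> r ^ k * Lp_norm p \<mu> f" if f: "f \<in> Lp_fun p \<mu>" for f k
 proof (induction k)
  case (Suc k)
  have "Lp_norm p \<mu> (avg T ((avg T ^^ k) f)) \<le> r * Lp_norm p \<mu> ((avg T ^^ k) f)"
   using step avg_power_cv[OF T(1) f Lp_fun_zero] by blast
  also have "\<dots> \<le> r * (r ^ k * Lp_norm p \<mu> f)" using r by (intro mult_left_mono Suc) auto
  finally show ?case by simp
 qed simp
 have Ab: "cmod ((avg T ^^ k) u x) \<le> r ^ k * c" if u: "u \<in> ?A" and c: "Ap_norm p \<mu> u < c" for u k x c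
 proof -
  obtain f g where rep: "Ap_representation p \<mu> f g u" "(\<Sum>i. Lp_norm p \<mu> (f i) * Lp_norm q \<mu> (g i)) < c"
   by (rule Ap_norm_less_representation[OF u c])
  then have fg: "\<And>i. f i \<in> Lp_fun p \<mu>" "\<And>i. g i \<in> Lp_fun q \<mu>"
   and s: "summable (\<lambda>i. Lp_norm p \<mu> (f i) * Lp_norm q \<mu> (g i))"
   and us: "\<And>x. (\<lambda>i. cv (f i) (g i) x) sums u x"
   unfolding Ap_representation_def Let_def q_def[symmetric] convolution_tilde by auto
  have b: "cmod ((avg T ^^ k) (cv (f i) (g i)) x) \<le> r ^ k * (Lp_norm p \<mu> (f i) * Lp_norm q \<mu> (g i))" for i
  proof -
   have "cmod ((avg T ^^ k) (cv (f i) (g i)) x) \<le> Lp_norm p \<mu> ((avg T ^^ k) (f i)) * Lp_norm q \<mu> (g i)"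
    using avg_power_cv[OF T(1) fg(1)[of i] fg(2)[of i], of k] cv_bound_p fg(2) by metis
   also have "\<dots> \<le> (r ^ k * Lp_norm p \<mu> (f i)) * Lp_norm q \<mu> (g i)"
    by (intro mult_right_mono stepk fg Lp_norm_nonneg)
   finally show ?thesis by (simp add: mult.assoc)
  qed
  have s1: "summable (\<lambda>i. r ^ k * (Lp_norm p \<mu> (f i) * Lp_norm q \<mu> (g i)))" by (rule summable_mult[OF s])
  have s2: "summable (\<lambda>i. cmod ((avg T ^^ k) (cv (f i) (g i)) x))"
   by (rule summable_comparison_test'[OF s1, of 0]) (use b in auto)
  have "cmod ((avg T ^^ k) u x) \<le> (\<Sum>i. cmod ((avg T ^^ k) (cv (f i) (g i)) x))"
   using summable_norm[OF s2] sums_unique[OF avg_sums[of "\<lambda>i. cv (f i) (g i)", OF us]] by simp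
  also have "\<dots> \<le> r ^ k * (\<Sum>i. Lp_norm p \<mu> (f i) * Lp_norm q \<mu> (g i))"
   using suminf_le[OF b s2 s1] s by (simp add: suminf_mult)
  also have "\<dots> \<le> r ^ k * c" using r rep(2) by (intro mult_left_mono) auto
  finally show ?thesis .
 qed
 have Ab1: "cmod ((avg T ^^ k) u x) \<le> r ^ k * Ap_norm p \<mu> u" if "u \<in> ?A" for u k x
 proof (rule field_le_epsilon)
  fix e :: real assume e: "e > 0"
  have "cmod ((avg T ^^ k) u x) \<le> r ^ k * (Ap_norm p \<mu> u + e)" by (rule Ab[OF that]) (use e in simp)
  also have "r ^ k * (Ap_norm p \<mu> u + e) \<le> r ^ k * Ap_norm p \<mu> u + e"
   using r e by (simp add: distrib_left mult_left_le_one_le power_le_one)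
  finally show "cmod ((avg T ^^ k) u x) \<le> r ^ k * Ap_norm p \<mu> u + e" .
 qed
 \<comment> \<open>The evaluation at x after k averages. By \<open>Ab1\<close> its dual norm is at
   most r^k, and it is a convex combination of evaluations, on which \<open>m\<close> is
   known.\<close>
 define E where "E = (\<lambda>k x u. if u \<in> ?A then (avg T ^^ k) u x else 0)"
 have Elin: "linear_functional (Ap_algebra p \<mu>) (E k x)" for k x
  unfolding linear_functional_def E_def using Ap_closed Ap_closed_scale
  by (auto simp: avg_power_add avg_power_scale)
 have Edual: "E k x \<in> vcarrier (dual (Ap_algebra p \<mu>))" for k x
  unfolding dual_def using Elin Ab1 by (auto simp: E_def intro!: exI[of _ "r ^ k"])
 have Enorm: "vnorm (dual (Ap_algebra p \<mu>)) (E k x) \<le> r ^ k" for k x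
 proof -
  have z: "(\<lambda>x. 0) \<in> ?A" "Ap_norm p \<mu> (\<lambda>x. 0) \<le> 1"
   using cv_representation[OF Lp_fun_zero Lp_fun_zero] by (simp_all add: cv_def Lp_norm_def)
  have "Sup {cmod (E k x u) |u. u \<in> Ap \<and> vnorm (Ap_algebra p \<mu>) u \<le> 1} \<le> r ^ k"
  proof (rule cSup_least)
   show "{cmod (E k x u) |u. u \<in> Ap \<and> vnorm (Ap_algebra p \<mu>) u \<le> 1} \<noteq> {}" using z by auto
   fix t assume "t \<in> {cmod (E k x u) |u. u \<in> Ap \<and> vnorm (Ap_algebra p \<mu>) u \<le> 1}"
   then obtain u where u: "u \<in> ?A" "Ap_norm p \<mu> u \<le> 1" "t = cmod (E k x u)" by auto
   have "t \<le> r ^ k * Ap_norm p \<mu> u" using Ab1[OF u(1)] u unfolding E_def by simp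
   also have "\<dots> \<le> r ^ k * 1" using u r by (intro mult_left_mono) auto
   finally show "t \<le> r ^ k" by simp
  qed
  then show ?thesis unfolding dual_def by simp
 qed
 obtain m where m: "m \<in> vcarrier (dual (dual (Ap_algebra p \<mu>)))" "m \<phi> = 0"
  "\<And>a \<psi>. a \<in> ?A ==> \<phi> a = 0 ==> \<psi> \<in> characters (Ap_algebra p \<mu>) ==> m (dual_act (Ap_algebra p \<mu>) \<psi> a) = \<psi> a"
  using am unfolding Delta_weak_amenable_def by blast
 have mlin: "linear_functional (dual (Ap_algebra p \<mu>)) m" using m(1) unfolding dual_def[of "dual _"] by auto
 obtain C where C: "\<And>F. F \<in> vcarrier (dual (Ap_algebra p \<mu>)) ==> cmod (m F) \<le> C * vnorm (dual (Ap_algebra p \<mu>)) F"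
  using m(1) unfolding dual_def[of "dual _"] by auto
 have madd: "m (\<lambda>u. F u + G u) = m F + m G" and mscale: "m (\<lambda>u. c * F u) = c * m F"
  if "F \<in> vcarrier (dual (Ap_algebra p \<mu>))" "G \<in> vcarrier (dual (Ap_algebra p \<mu>))" for F G c
  using mlin that unfolding linear_functional_def dual_def by auto
 have ev0: "E 0 x = evaluation x" for x unfolding E_def evaluation_def by auto
 have m_eval: "m (evaluation x) = 1" if ne: "evaluation x \<noteq> \<phi>" for x
 proof -
  have "\<exists>a\<in>?A. \<phi> a = 0 \<and> a x = 1"
  proof (cases "\<phi> \<in> characters (Ap_algebra p \<mu>)")
   case True
   then obtain y where y: "\<phi> = evaluation y" using Ap_characters by blast
   have xy: "x \<in> - {y}" using ne y by auto
   have "open (- {y})" by (simp add: open_Compl)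
   then obtain v where "v \<in> ?A" "v x = 1" "\<And>z. z \<notin> - {y} ==> v z = 0" using Ap_peak[OF _ xy] by metis
   then show ?thesis unfolding y evaluation_def by (intro bexI[of _ v]) auto
  next
   case False
   then have "\<phi> = (\<lambda>_. 0)" using phi by blast
   moreover obtain v where "v \<in> ?A" "v x = 1" using Ap_peak[OF open_UNIV UNIV_I, of x] by metis
   ultimately show ?thesis by auto
  qed
  then obtain a where a: "a \<in> ?A" "\<phi> a = 0" "a x = 1" by blast
  have e1: "evaluation x a = 1" unfolding evaluation_def using a by simp
  have "m (dual_act (Ap_algebra p \<mu>) (evaluation x) a) = 1" using m(3)[OF a(1,2) evaluation_character] e1 by simp
  moreover have "dual_act (Ap_algebra p \<mu>) (evaluation x) a = evaluation x"
   using dual_act_character[OF evaluation_character a(1), of x] e1 by simp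
  ultimately show ?thesis by simp
 qed
 \<comment> \<open>\<open>m\<close> is 1 at every evaluation except possibly \<phi>, where it is 0.
   A nonnegative member that is 1 at the point of \<phi> thus dominates the defect |m (evaluation x)
   - 1|. Averaging preserves this domination, and the averages of u0 themselves tend to 0.\<close>
 obtain u0 where u0: "u0 \<in> ?A" "\<And>x. evaluation x = \<phi> ==> u0 x = 1" "\<And>z. \<exists>t\<ge>0. u0 z = complex_of_real t"
 proof (cases "\<exists>y. evaluation y = \<phi>")
  case True
  then obtain y where y: "evaluation y = \<phi>" by blast
  obtain v where v: "v \<in> ?A" "Ap_norm p \<mu> v \<le> 1" "v y = 1" "\<And>z. z \<notin> UNIV ==> v z = 0"
   "\<And>z. \<exists>t\<ge>0. v z = complex_of_real t"
   by (rule Ap_peak[OF open_UNIV UNIV_I, of y]) (rule that)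
  have "v x = 1" if "evaluation x = \<phi>" for x
  proof -
   have "evaluation x v = evaluation y v" using that y by simp
   then show ?thesis using v(1,3) unfolding evaluation_def by simp
  qed
  then show thesis by (rule that[OF v(1) _ v(5)])
 next
  case False
  have "(\<lambda>x. 0) \<in> ?A" unfolding Ap_carrier using atomic_zero by blast
  then show thesis using that[of "\<lambda>x. 0"] False by force
 qed
 define N where "N = card T"
 have N: "N > 0" unfolding N_def using T by (simp add: card_gt_0_iff)
 have key: "cmod (m (E k x) - 1) \<le> Re ((avg T ^^ k) u0 x)" for k x
 proof (induction k arbitrary: x)
  case 0
  show ?case
  proof (cases "evaluation x = \<phi>")
   case True
   then show ?thesis using m(2) u0(2)[OF True] by (simp add: ev0)
  next
   case False
   obtain t where "t \<ge> 0" "u0 x = complex_of_real t" using u0(3) by blast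
   then show ?thesis using m_eval[OF False] by (simp add: ev0)
  qed
 next
  case (Suc k)
  have sumdual: "(\<lambda>u. \<Sum>s\<in>S. E k (s + x) u) \<in> vcarrier (dual (Ap_algebra p \<mu>)) \<and> m (\<lambda>u. \<Sum>s\<in>S. E k (s + x) u) = (\<Sum>s\<in>S. m (E k (s + x)))"
   if "finite S" for S using that
  proof (induction S rule: finite_induct)
   case empty
   show ?case using zero_in_dual[of "Ap_algebra p \<mu>"] mscale[OF zero_in_dual zero_in_dual, of 0] by simp
  next
   case (insert s S)
   define G where "G = (\<lambda>u. \<Sum>s\<in>S. E k (s + x) u)"
   have G: "G \<in> vcarrier (dual (Ap_algebra p \<mu>))" "m G = (\<Sum>s\<in>S. m (E k (s + x)))" using insert unfolding G_def by auto
   obtain D where D: "\<And>u. u \<in> ?A ==> cmod (G u) \<le> D * Ap_norm p \<mu> u" using G(1) unfolding dual_def by auto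
   have "cmod (E k (s + x) u + G u) \<le> (r ^ k + D) * Ap_norm p \<mu> u" if "u \<in> ?A" for u
    using D[OF that] Ab1[OF that, of k "s + x"] that norm_triangle_ineq[of "E k (s + x) u" "G u"]
    unfolding E_def by (simp add: distrib_right)
   then have "\<exists>D. \<forall>u\<in>?A. cmod (E k (s + x) u + G u) \<le> D * Ap_norm p \<mu> u" by blast
   moreover have "linear_functional (Ap_algebra p \<mu>) (\<lambda>u. E k (s + x) u + G u)"
    using Elin[of k "s + x"] G(1) unfolding dual_def linear_functional_def by (simp add: algebra_simps)
   ultimately have "(\<lambda>u. E k (s + x) u + G u) \<in> vcarrier (dual (Ap_algebra p \<mu>))" unfolding dual_def by simp
   moreover have "m (\<lambda>u. E k (s + x) u + G u) = m (E k (s + x)) + m G" by (rule madd[OF Edual G(1)])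
   ultimately show ?case using insert(1,2) G(2) unfolding G_def by simp
  qed
  have "E (Suc k) x = (\<lambda>u. (1 / of_nat N) * (\<Sum>s\<in>T. E k (s + x) u))"
  proof
   fix u
   have "avg T ((avg T ^^ k) u) x = (1 / of_nat N) * (\<Sum>s\<in>T. (avg T ^^ k) u (s + x))" unfolding avg_def N_def ..
   then show "E (Suc k) x u = (1 / of_nat N) * (\<Sum>s\<in>T. E k (s + x) u)" unfolding E_def by simp
  qed
  then have "m (E (Suc k) x) = (1 / of_nat N) * (\<Sum>s\<in>T. m (E k (s + x)))"
   using sumdual[OF T(1)] mscale[of "\<lambda>u. \<Sum>s\<in>T. E k (s + x) u" "\<lambda>u. \<Sum>s\<in>T. E k (s + x) u" "1 / of_nat N"] by simp
  then have "m (E (Suc k) x) - 1 = (1 / of_nat N) * (\<Sum>s\<in>T. m (E k (s + x)) - 1)"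
   using N by (simp add: sum_subtractf field_simps N_def[symmetric])
  then have "cmod (m (E (Suc k) x) - 1) = (1 / real N) * cmod (\<Sum>s\<in>T. m (E k (s + x)) - 1)"
   by (simp add: norm_divide)
  also have "\<dots> \<le> (1 / real N) * (\<Sum>s\<in>T. Re ((avg T ^^ k) u0 (s + x)))"
   by (intro mult_left_mono order_trans[OF norm_sum sum_mono] Suc) auto
  also have "\<dots> = Re (avg T ((avg T ^^ k) u0) x)"
   unfolding avg_def[of T "(avg T ^^ k) u0"] N_def[symmetric] by (simp add: Re_divide_of_nat)
  finally show ?case by simp
 qed
 \<comment> \<open>From 1 \<le> |z| + |z - 1| with z = m (E k 0): the first term is small because E
   k 0 has small norm, the second because the average of u0 is small.\<close>
 have "1 \<le> r ^ k * (\<bar>C\<bar> + Ap_norm p \<mu> u0)" for k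
 proof -
  have n0: "vnorm (dual (Ap_algebra p \<mu>)) (E k 0) \<ge> 0"
  proof -
   have "cmod (E k 0 (\<lambda>x. 0)) \<le> vnorm (dual (Ap_algebra p \<mu>)) (E k 0)"
    using cv_representation[OF Lp_fun_zero Lp_fun_zero] Ap_norm_nonneg
    by (intro dual_le_norm Edual) (simp_all add: cv_def Lp_norm_def)
   then show ?thesis using norm_ge_zero order_trans by blast
  qed
  have "cmod (m (E k 0)) \<le> C * vnorm (dual (Ap_algebra p \<mu>)) (E k 0)" by (rule C[OF Edual])
  also have "\<dots> \<le> \<bar>C\<bar> * r ^ k" using n0 Enorm by (intro mult_mono) auto
  finally have 1: "cmod (m (E k 0)) \<le> \<bar>C\<bar> * r ^ k" .
  have 2: "cmod (m (E k 0) - 1) \<le> r ^ k * Ap_norm p \<mu> u0"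
   using key[of k 0] Ab1[OF u0(1), of k 0] complex_Re_le_cmod[of "(avg T ^^ k) u0 0"] by linarith
  have "1 \<le> cmod (m (E k 0)) + cmod (m (E k 0) - 1)"
   using norm_triangle_ineq4[of "m (E k 0)" "m (E k 0) - 1"] by simp
  then show ?thesis using 1 2 by (simp add: algebra_simps)
 qed
 moreover have "(\<lambda>k. r ^ k * (\<bar>C\<bar> + Ap_norm p \<mu> u0)) \<longlonglongrightarrow> 0 * (\<bar>C\<bar> + Ap_norm p \<mu> u0)"
  using r by (intro tendsto_mult tendsto_const LIMSEQ_power_zero) auto
 ultimately have "1 \<le> 0 * (\<bar>C\<bar> + Ap_norm p \<mu> u0)" by (intro LIMSEQ_le_const) auto
 then show False by simp
qed

text \<open>Let f be nonnegative with its norm nearly preserved by an average, and let D be the p-th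
  power of the average and B_s that of the translate of f by s. The refined Young inequality bounds
  the integrals of (sqrt D - sqrt B_s)^2 by the loss of norm. Hence all B_s are close to D in L1,
  therefore to each other, and B_0 normalised is the required density.\<close>

lemma Delta_weak_amenable_imp_reiter:
 assumes am: "Delta_weak_amenable (Ap_algebra p \<mu>) \<phi>"
  and phi: "\<phi> \<in> characters (Ap_algebra p \<mu>) \<union> {\<lambda>_. 0}"
 shows "reiter"
 unfolding reiter_def
proof (intro allI impI)
 fix X :: "'g set" and e :: real assume X: "finite X" and e: "e > 0"
 \<comment> \<open>The inverses match the translation - s + x in \<open>reiter\<close>, and the
   identity is included so that the untranslated power B 0 is among the functions compared.\<close>
 define T where "T = insert 0 (uminus ` X)"
 have T: "finite T" "T \<noteq> {}" unfolding T_def using X by auto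
 define N where "N = real (card T)"
 have N: "N \<ge> 1" unfolding N_def using T by (simp add: Suc_le_eq card_gt_0_iff)
 define c where "c = min (1 / q) (1 / p)"
 have c: "c > 0" unfolding c_def using p0 q0 by simp
 \<comment> \<open>The final estimate is (N d / c) / \<eta> + 4 \<eta>. With \<eta> = e / 16 the
   second term is e / 4, and the choice of d below makes the first at most e / 4; the bound 1 / 2
   keeps the contraction factor 1 - d positive.\<close>
 define \<eta> where "\<eta> = e / 16"
 have \<eta>: "\<eta> > 0" unfolding \<eta>_def using e by simp
 define d where "d = min (1/2) (c * \<eta> * e / (4 * N))"
 have d: "0 < d" "d \<le> 1/2" "d \<le> c * \<eta> * e / (4 * N)" unfolding d_def using c \<eta> e N by auto
 obtain f0 where f0: "f0 \<in> Lp_fun p \<mu>"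
  "(1 - d) * (LI x. cmod (f0 x) powr p) < (LI x. cmod (avg T f0 x) powr p)"
  by (rule averaging_not_contractive[OF am phi T, of "1 - d"]) (use d in auto)
 \<comment> \<open>Passing to the modulus keeps the norm of f0 and can only enlarge its average
   pointwise, so the lower bound on the norm of the average survives.\<close>
 define f where "f = (\<lambda>x. complex_of_real (cmod (f0 x)))"
 have f0m[measurable]: "f0 \<in> borel_measurable borel" by (rule Lp_fun_measurable[OF f0(1)])
 have f: "f \<in> Lp_fun p \<mu>" using f0(1) unfolding f_def Lp_fun_def by simp
 define I where "I = (LI x. cmod (f0 x) powr p)"
 define t where "t = (\<lambda>y. (1 / N) * (\<Sum>s\<in>T. cmod (f0 (s + y))))"
 have t0: "t y \<ge> 0" for y unfolding t_def using N by (intro mult_nonneg_nonneg sum_nonneg) auto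
 have tavg: "avg T f y = complex_of_real (t y)" for y unfolding avg_def f_def t_def N_def by simp
 define D where "D = (\<lambda>y. t y powr p)"
 define B where "B = (\<lambda>s y. cmod (f0 (s + y)) powr p)"
 have D0: "D y \<ge> 0" and B0: "B s y \<ge> 0" for s y unfolding D_def B_def by auto
 have Bi: "integrable \<mu> (B s)" and BI: "(LI y. B s y) = I" for s
  unfolding B_def I_def using integrable_translate[OF Lp_fun_integrable[OF f0(1)], of s]
   integral_translate[of "\<lambda>y. cmod (f0 y) powr p" s] by auto
 have Di: "integrable \<mu> D"
  using Lp_fun_integrable[OF avg_Lp[OF T(1) f]] t0 unfolding tavg D_def by simp
 have DI: "(1 - d) * I < (LI y. D y)"
 proof -
  have "(LI x. cmod (avg T f0 x) powr p) \<le> (LI y. D y)"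
  proof (rule integral_mono[OF Lp_fun_integrable[OF avg_Lp[OF T(1) f0(1)]] Di])
   fix y
   have "cmod (avg T f0 y) \<le> t y"
    unfolding avg_def t_def N_def norm_mult by (intro mult_mono norm_sum) (auto simp: norm_divide)
   then show "cmod (avg T f0 y) powr p \<le> D y" unfolding D_def using p0 by (intro powr_mono2) auto
  qed
  then show ?thesis using f0(2) unfolding I_def by simp
 qed
 \<comment> \<open>D = t^(p-1) t, and t is the average of the |f0(sy)|. The refined inequality with
   weights 1/q and 1/p is applied to each t^(p-1) |f0(sy)| = D^(1/q) B_s^(1/p); after averaging over
   \<open>T\<close> the part D/q cancels.\<close>
 have defect: "(c / N) * (\<Sum>s\<in>T. (sqrt (D y) - sqrt (B s y))\<^sup>2) \<le> (1 / p) * ((1 / N) * (\<Sum>s\<in>T. B s y) - D y)" for y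
 proof -
  have Y: "t y powr (p - 1) * cmod (f0 (s + y)) \<le> (1 / q) * D y + (1 / p) * B s y - c * (sqrt (D y) - sqrt (B s y))\<^sup>2" for s
  proof -
   have "D y powr (1 / q) * B s y powr (1 / p) \<le> (1 / q) * D y + (1 / p) * B s y - min (1 / q) (1 / p) * (sqrt (D y) - sqrt (B s y))\<^sup>2"
    by (rule Young_refined[OF D0 B0]) (use p0 q0 pq in auto)
   moreover have "D y powr (1 / q) = t y powr (p - 1)"
    unfolding D_def q_def using p1 by (simp add: powr_powr)
   moreover have "B s y powr (1 / p) = cmod (f0 (s + y))" unfolding B_def using p0 by (simp add: powr_powr)
   ultimately show ?thesis unfolding c_def by simp
  qed
  have "D y = t y powr (p - 1) * t y"
   unfolding D_def using t0[of y] p1 by (cases "t y = 0") (auto simp: powr_diff)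
  also have "\<dots> = (1 / N) * (\<Sum>s\<in>T. t y powr (p - 1) * cmod (f0 (s + y)))"
   by (subst (2) t_def) (simp add: sum_distrib_left)
  also have "\<dots> \<le> (1 / N) * (\<Sum>s\<in>T. (1 / q) * D y + (1 / p) * B s y - c * (sqrt (D y) - sqrt (B s y))\<^sup>2)"
   using N by (intro mult_left_mono sum_mono Y) auto
  also have "\<dots> = (1 / q) * D y + (1 / p) * ((1 / N) * (\<Sum>s\<in>T. B s y)) - (c / N) * (\<Sum>s\<in>T. (sqrt (D y) - sqrt (B s y))\<^sup>2)"
  proof -
   have *: "(\<Sum>s\<in>T. (1 / q) * D y + (1 / p) * B s y - c * (sqrt (D y) - sqrt (B s y))\<^sup>2)
    = N * ((1 / q) * D y) + (1 / p) * (\<Sum>s\<in>T. B s y) - c * (\<Sum>s\<in>T. (sqrt (D y) - sqrt (B s y))\<^sup>2)"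
    by (simp add: sum.distrib sum_subtractf sum_distrib_left N_def)
   have r: "(1 / N) * (N * x + y - z) = x + (1 / N) * y - (1 / N) * z" for x y z using N by (simp add: field_simps)
   show ?thesis unfolding * r by simp
  qed
  finally have "D y \<le> (1 / q) * D y + (1 / p) * ((1 / N) * (\<Sum>s\<in>T. B s y)) - (c / N) * (\<Sum>s\<in>T. (sqrt (D y) - sqrt (B s y))\<^sup>2)" .
  moreover have "(1 / p + 1 / q) * D y = D y" unfolding pq by simp
  then have "(1 / q) * D y = D y - (1 / p) * D y" unfolding distrib_right by linarith
  ultimately show ?thesis by (simp add: right_diff_distrib)
 qed
 have tm: "t \<in> borel_measurable borel"
 proof -
  have "(\<lambda>y. f0 (s + y)) \<in> borel_measurable borel" for s by (rule measurable_translate[OF f0m])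
  then show ?thesis unfolding t_def by measurable
 qed
 then have Dm[measurable]: "D \<in> borel_measurable borel" unfolding D_def by measurable
 have Bm[measurable]: "B s \<in> borel_measurable borel" for s using borel_measurable_integrable[OF Bi] by simp
 define R where "R = (\<lambda>s y. (sqrt (D y) - sqrt (B s y))\<^sup>2)"
 have Rle: "R s y \<le> 2 * (D y + B s y)" for s y
 proof -
  have "(sqrt (D y) - sqrt (B s y))\<^sup>2 + (sqrt (D y) + sqrt (B s y))\<^sup>2 = 2 * (D y + B s y)"
   using D0 B0 by (simp add: power2_diff power2_sum)
  then show ?thesis unfolding R_def using zero_le_power2[of "sqrt (D y) + sqrt (B s y)"] by linarith
 qed
 have Ri: "integrable \<mu> (R s)" for s
 proof (rule Bochner_Integration.integrable_bound)
  show "integrable \<mu> (\<lambda>y. 2 * (D y + B s y))" using Di Bi by auto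
  show "R s \<in> borel_measurable \<mu>" unfolding R_def by simp
  show "AE y in \<mu>. norm (R s y) \<le> norm (2 * (D y + B s y))"
   using Rle D0 B0 by (intro always_eventually allI) (simp add: R_def)
 qed
 have IR: "(c / N) * (\<Sum>s\<in>T. \<integral>y. R s y \<partial>\<mu>) \<le> (1 / p) * (I - (LI y. D y))"
 proof -
  have "(LI y. (c / N) * (\<Sum>s\<in>T. R s y)) \<le> (LI y. (1 / p) * ((1 / N) * (\<Sum>s\<in>T. B s y) - D y))"
   using defect Ri Bi Di unfolding R_def[symmetric]
   by (intro integral_mono integrable_mult_right Bochner_Integration.integrable_sum Bochner_Integration.integrable_diff) (auto simp: R_def)
  moreover have "(LI y. (c / N) * (\<Sum>s\<in>T. R s y)) = (c / N) * (\<Sum>s\<in>T. \<integral>y. R s y \<partial>\<mu>)"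
   using Ri by (simp add: Bochner_Integration.integral_sum)
  moreover have "(LI y. (1 / p) * ((1 / N) * (\<Sum>s\<in>T. B s y) - D y)) = (1 / p) * (I - (LI y. D y))"
  proof -
   have "(LI y. (1 / N) * (\<Sum>s\<in>T. B s y) - D y) = (1 / N) * (\<Sum>s\<in>T. \<integral>y. B s y \<partial>\<mu>) - (LI y. D y)"
    using Bi Di by (subst Bochner_Integration.integral_diff) (auto simp: Bochner_Integration.integral_sum intro!: integrable_mult_right Bochner_Integration.integrable_sum)
   then show ?thesis using N by (simp add: BI N_def[symmetric])
  qed
  ultimately show ?thesis by (simp only:)
 qed
 have R0: "(LI y. R s y) \<ge> 0" for s by (intro integral_nonneg_AE always_eventually) (auto simp: R_def)
 have DI': "(LI y. D y) \<le> I"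
 proof -
  have "0 \<le> (c / N) * (\<Sum>s\<in>T. \<integral>y. R s y \<partial>\<mu>)" using c N R0 by (intro mult_nonneg_nonneg sum_nonneg) auto
  then have "0 \<le> (1 / p) * (I - (LI y. D y))" using IR by simp
  then show ?thesis using p0 by (simp add: zero_le_divide_iff)
 qed
 have I: "I > 0"
 proof -
  have "(1 - d) * I < I" using DI DI' by simp
  then show ?thesis using d by (simp add: algebra_simps zero_less_mult_iff)
 qed
 have RI: "(LI y. R s y) \<le> (N * d / c) * I" if s: "s \<in> T" for s
 proof -
  have "(c / N) * (LI y. R s y) \<le> (c / N) * (\<Sum>s\<in>T. \<integral>y. R s y \<partial>\<mu>)"
   using c N T(1) R0 s by (intro mult_left_mono member_le_sum) auto
  also have "\<dots> \<le> (1 / p) * (I - (LI y. D y))" by (rule IR)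
  also have "\<dots> \<le> 1 * (d * I)" using DI DI' p1 by (intro mult_mono) (auto simp: algebra_simps)
  finally show ?thesis using c N by (simp add: field_simps)
 qed
 have close: "(LI y. \<bar>D y - B s y\<bar>) \<le> ((N * d / c) / (2 * \<eta>) + 2 * \<eta>) * I" if s: "s \<in> T" for s
 proof -
  \<comment> \<open>|u^2 - v^2| = |u - v| (u + v), split by the arithmetic-geometric inequality with
    weight \<eta>: the square difference is small, and the other term has only a small
    coefficient.\<close>
  have pw: "\<bar>D y - B s y\<bar> \<le> R s y / (2 * \<eta>) + \<eta> * (D y + B s y)" for y
  proof -
   define u v where "u = sqrt (D y)" and "v = sqrt (B s y)"
   have uv: "u \<ge> 0" "v \<ge> 0" "D y = u\<^sup>2" "B s y = v\<^sup>2" unfolding u_def v_def using D0 B0 by auto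
   have "\<bar>D y - B s y\<bar> = \<bar>u - v\<bar> * (u + v)"
    using uv by (simp add: power2_eq_square square_diff_square_factored abs_mult mult.commute)
   moreover have "(\<bar>u - v\<bar> - \<eta> * (u + v))\<^sup>2 = (u - v)\<^sup>2 + \<eta>\<^sup>2 * (u + v)\<^sup>2 - 2 * \<eta> * (\<bar>u - v\<bar> * (u + v))"
    unfolding power2_diff[of "\<bar>u - v\<bar>"] power_mult_distrib power2_abs by simp
   then have "2 * \<eta> * (\<bar>u - v\<bar> * (u + v)) \<le> (u - v)\<^sup>2 + \<eta>\<^sup>2 * (u + v)\<^sup>2"
    using zero_le_power2[of "\<bar>u - v\<bar> - \<eta> * (u + v)"] by linarith
   then have "\<bar>u - v\<bar> * (u + v) \<le> ((u - v)\<^sup>2 + \<eta>\<^sup>2 * (u + v)\<^sup>2) / (2 * \<eta>)" using \<eta> by (simp add: field_simps)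
   moreover have "((u - v)\<^sup>2 + \<eta>\<^sup>2 * (u + v)\<^sup>2) / (2 * \<eta>) = (u - v)\<^sup>2 / (2 * \<eta>) + \<eta> * ((u + v)\<^sup>2 / 2)"
    using \<eta> by (simp add: field_simps power2_eq_square)
   moreover have "(u + v)\<^sup>2 / 2 \<le> u\<^sup>2 + v\<^sup>2"
    using zero_le_power2[of "u - v"] by (simp add: power2_diff power2_sum)
   then have "\<eta> * ((u + v)\<^sup>2 / 2) \<le> \<eta> * (u\<^sup>2 + v\<^sup>2)" using \<eta> by (intro mult_left_mono) auto
   moreover have Rs: "R s y = (u - v)\<^sup>2" unfolding R_def u_def v_def ..
   ultimately show ?thesis unfolding Rs uv(3,4) by linarith
  qed
  have "(LI y. \<bar>D y - B s y\<bar>) \<le> (LI y. R s y / (2 * \<eta>) + \<eta> * (D y + B s y))"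
   using Di Bi Ri pw by (intro integral_mono) auto
  also have "\<dots> = (LI y. R s y) / (2 * \<eta>) + \<eta> * ((LI y. D y) + I)"
   using Di Bi Ri BI by simp
  also have "\<dots> \<le> ((N * d / c) * I) / (2 * \<eta>) + \<eta> * (I + I)"
   using RI[OF s] DI' \<eta> by (intro add_mono divide_right_mono mult_left_mono) auto
  finally show ?thesis by (simp add: algebra_simps)
 qed
 have Nd: "N * d / c \<le> \<eta> * e / 4"
 proof -
  have "d * (4 * N) \<le> c * \<eta> * e" using d(3) N by (simp add: field_simps)
  then show ?thesis using c by (simp add: field_simps)
 qed
 show "\<exists>F::'g => real. (\<forall>x. 0 \<le> F x) \<and> integrable \<mu> F \<and> (LI x. F x) = 1 \<and>
    (\<forall>s\<in>X. (LI x. \<bar>F (- s + x) - F x\<bar>) < e)"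
 proof (intro exI[of _ "\<lambda>y. B 0 y / I"] conjI allI ballI)
  show "0 \<le> B 0 x / I" for x using B0 I by simp
  show "integrable \<mu> (\<lambda>y. B 0 y / I)" using Bi by simp
  show "(LI y. B 0 y / I) = 1" using BI I by simp
  fix s assume s: "s \<in> X"
  have sT: "- s \<in> T" "0 \<in> T" unfolding T_def using s by auto
  have "(LI y. \<bar>B 0 (- s + y) / I - B 0 y / I\<bar>) = (LI y. \<bar>B (- s) y - B 0 y\<bar>) / I"
   using I by (simp add: B_def diff_divide_distrib[symmetric])
  also have "(LI y. \<bar>B (- s) y - B 0 y\<bar>) \<le> (LI y. \<bar>D y - B (- s) y\<bar> + \<bar>D y - B 0 y\<bar>)"
   using Di Bi by (intro integral_mono) auto
  also have "\<dots> = (LI y. \<bar>D y - B (- s) y\<bar>) + (LI y. \<bar>D y - B 0 y\<bar>)" using Di Bi by simp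
  also have "\<dots> \<le> 2 * (((N * d / c) / (2 * \<eta>) + 2 * \<eta>) * I)" using close[OF sT(1)] close[OF sT(2)] by simp
  also have "\<dots> / I = (N * d / c) / \<eta> + 4 * \<eta>" using I by (simp add: field_simps)
  also have "\<dots> \<le> e / 4 + 4 * \<eta>" using divide_right_mono[OF Nd, of \<eta>] \<eta> by simp
  also have "\<dots> < e" unfolding \<eta>_def using e by simp
  finally show "(LI y. \<bar>B 0 (- s + y) / I - B 0 y / I\<bar>) < e" using I by (simp add: divide_right_mono)
 qed
qed

end

section \<open>Convolution of integrable functions\<close>

text \<open>
 The Borel sets of a product may be strictly larger than the product of the Borel sets, so that
 Fubini's theorem for Borel functions on the product needs the inner regularity of the measures.
\<close>

locale finite_radon = finite_measure \<nu> for \<nu> :: "'a::t2_space measure" +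
 assumes sets_radon [simp, measurable_cong]: "sets \<nu> = sets borel"
  and inner_radon: "\<And>A e. A \<in> sets borel ==> (e::real) > 0 ==> \<exists>K. compact K \<and> K \<subseteq> A \<and> measure \<nu> (A - K) < e"
begin

lemma space_radon [simp]: "space \<nu> = UNIV"
 using sets_eq_imp_space_eq[OF sets_radon] by simp

lemma inner_gt:
 assumes "A \<in> sets borel" "c < measure \<nu> A"
 obtains K where "compact K" "K \<subseteq> A" "c < measure \<nu> K"
proof -
 obtain K where K: "compact K" "K \<subseteq> A" "measure \<nu> (A - K) < measure \<nu> A - c"
  using inner_radon[OF assms(1), of "measure \<nu> A - c"] assms(2) by auto
 have "K \<in> sets borel" using K(1) by (simp add: borel_closed compact_imp_closed)
 then have "measure \<nu> (A - K) = measure \<nu> A - measure \<nu> K" using K assms(1) by (intro finite_measure_Diff) auto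
 then show thesis using that K by simp
qed

lemma section_open: "open E ==> open {y :: 'a. (y, x :: 'b::t2_space) \<in> E}"
proof -
 assume E: "open E"
 have "{y. (y, x) \<in> E} = (\<lambda>y. (y, x)) -` E" by auto
 then show ?thesis using open_vimage[OF E, of "\<lambda>y. (y, x)"] by (simp add: continuous_intros)
qed

lemma section_borel: "E \<in> sets borel ==> {y :: 'a. (y, x :: 'b::t2_space) \<in> E} \<in> sets borel"
proof -
 assume E: "E \<in> sets borel"
 have m: "(\<lambda>y. (y, x)) \<in> measurable (borel :: 'a measure) (borel :: ('a \<times> 'b) measure)"
  by (rule borel_measurable_continuous_onI) (intro continuous_intros)
 have "{y. (y, x) \<in> E} = (\<lambda>y. (y, x)) -` E \<inter> space borel" by auto
 then show ?thesis using measurable_sets[OF m E] by simp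
qed

text \<open>A compact subset of one section lies in all nearby sections by the tube lemma. This
  gives Borel measurability of section measures without any reference to the product
  \<sigma>-algebra.\<close>

lemma section_lower_semicontinuous:
 fixes E :: "('a \<times> 'b::t2_space) set"
 assumes E: "open E"
 shows "open {x. c < measure \<nu> {y. (y, x) \<in> E}}"
proof (subst open_subopen, intro ballI)
 fix x assume "x \<in> {x. c < measure \<nu> {y. (y, x) \<in> E}}"
 then have c: "c < measure \<nu> {y. (y, x) \<in> E}" by simp
 obtain K where K: "compact K" "K \<subseteq> {y. (y, x) \<in> E}" "c < measure \<nu> K"
  using inner_gt[OF borel_open[OF section_open[OF E]] c] by blast
 obtain V where V: "open V" "x \<in> V" "\<And>y v. y \<in> K ==> v \<in> V ==> (y, v) \<in> E"
  using compact_tube[OF K(1) E, of x] K(2) by blast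
 have "c < measure \<nu> {y. (y, v) \<in> E}" if "v \<in> V" for v
 proof -
  have "measure \<nu> K \<le> measure \<nu> {y. (y, v) \<in> E}"
   using V(3) that section_open[OF E] by (intro finite_measure_mono) auto
  then show ?thesis using K(3) by simp
 qed
 then show "\<exists>T. open T \<and> x \<in> T \<and> T \<subseteq> {x. c < measure \<nu> {y. (y, x) \<in> E}}"
  using V by (intro exI[of _ V]) auto
qed

lemma section_measurable_open:
 fixes E :: "('a \<times> 'b::t2_space) set"
 assumes E: "open E"
 shows "(\<lambda>x. measure \<nu> {y. (y, x) \<in> E}) \<in> borel_measurable borel"
 by (rule borel_measurableI_greater) (use section_lower_semicontinuous[OF E] in simp)

end

text \<open>
 Rectangles lie in the product \<open>\<sigma>\<close>-algebra. A countable union of rectangles inside \<open>E\<close> whose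
 iterated integral is maximal has almost everywhere full sections: otherwise a compact part of the
 exceptional set could be covered by finitely many further rectangles inside \<open>E\<close>.
\<close>

lemma radon_Fubini_open_le:
 fixes E :: "('a::t2_space \<times> 'b::t2_space) set"
 assumes "finite_radon \<rho>" "finite_radon \<nu>" and E: "open E"
 shows "(\<integral>x. measure \<rho> {y. (y, x) \<in> E} \<partial>\<nu>) \<le> (\<integral>y. measure \<nu> {x. (y, x) \<in> E} \<partial>\<rho>)"
proof -
 interpret l: finite_radon \<rho> by fact
 interpret n: finite_radon \<nu> by fact
 interpret pair_sigma_finite \<nu> \<rho> ..
 define h where "h = (\<lambda>x. measure \<rho> {y. (y, x) \<in> E})"
 define h' where "h' = (\<lambda>y. measure \<nu> {x. (y, x) \<in> E})"
 have hm[measurable]: "h \<in> borel_measurable borel" unfolding h_def by (rule l.section_measurable_open[OF E])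
 have "{z. (snd z, fst z) \<in> E} = (\<lambda>z. (snd z, fst z)) -` E" by auto
 then have E': "open {z. (snd z, fst z) \<in> E}"
  using open_vimage[OF E, of "\<lambda>z. (snd z, fst z)"] by (simp add: continuous_intros)
 have h'm[measurable]: "h' \<in> borel_measurable borel"
  using n.section_measurable_open[OF E'] unfolding h'_def by simp
 have hi: "integrable \<nu> h" unfolding h_def using hm[unfolded h_def] l.finite_measure_mono[of _ UNIV]
  by (intro n.integrable_const_bound[of _ "measure \<rho> UNIV"]) auto
 have h'i: "integrable \<rho> h'" unfolding h'_def using h'm[unfolded h'_def] n.finite_measure_mono[of _ UNIV]
  by (intro l.integrable_const_bound[of _ "measure \<nu> UNIV"]) auto
 have open1: "{x. (y, x) \<in> E} \<in> sets \<nu>" for y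
  using open_vimage[OF E, of "\<lambda>x. (y, x)"] by (simp add: vimage_def continuous_intros)
 define \<R> where "\<R> = {R \<in> sets (\<nu> \<Otimes>\<^sub>M \<rho>). \<forall>x y. (x, y) \<in> R --> (y, x) \<in> E}"
 define k where "k = (\<lambda>(R :: ('b \<times> 'a) set) x. measure \<rho> (Pair x -` R))"
 have ki: "integrable \<nu> (k R)" if "R \<in> \<R>" for R
  unfolding k_def using l.measurable_emeasure_Pair[of R \<nu>] that l.finite_measure_mono[of _ UNIV]
  by (intro n.integrable_const_bound[of _ "measure \<rho> UNIV"]) (auto simp: \<R>_def measure_def)
 have le: "(\<integral>x. k R x \<partial>\<nu>) \<le> (\<integral>y. h' y \<partial>\<rho>)" if R: "R \<in> \<R>" for R
 proof -
  have Rm: "R \<in> sets (\<nu> \<Otimes>\<^sub>M \<rho>)" using R unfolding \<R>_def by simp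
  have "ennreal (\<integral>x. k R x \<partial>\<nu>) = (\<integral>\<^sup>+x. ennreal (k R x) \<partial>\<nu>)"
   by (rule nn_integral_eq_integral[OF ki[OF R], symmetric]) (simp add: k_def)
  also have "\<dots> = (\<integral>\<^sup>+y. emeasure \<nu> ((\<lambda>x. (x, y)) -` R) \<partial>\<rho>)"
   unfolding k_def l.emeasure_eq_measure[symmetric] using l.emeasure_pair_measure_alt[OF Rm] emeasure_pair_measure_alt2[OF Rm] by simp
  also have "\<dots> \<le> (\<integral>\<^sup>+y. ennreal (h' y) \<partial>\<rho>)"
   unfolding h'_def n.emeasure_eq_measure[symmetric]
   by (intro nn_integral_mono emeasure_mono open1) (use R in \<open>auto simp: \<R>_def\<close>)
  also have "\<dots> = ennreal (\<integral>y. h' y \<partial>\<rho>)" by (rule nn_integral_eq_integral[OF h'i]) (simp add: h'_def)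
  finally show ?thesis by (rule iffD1[OF ennreal_le_iff, rotated]) (simp add: h'_def)
 qed
 define s where "s = (SUP R\<in>\<R>. \<integral>x. k R x \<partial>\<nu>)"
 have ne: "\<R> \<noteq> {}" unfolding \<R>_def by blast
 have bd: "bdd_above ((\<lambda>R. \<integral>x. k R x \<partial>\<nu>) ` \<R>)" using le by (intro bdd_aboveI2)
 have "\<forall>n. \<exists>R\<in>\<R>. s - 1 / real (Suc n) < (\<integral>x. k R x \<partial>\<nu>)"
 proof
  fix n
  have "s - 1 / real (Suc n) < s" by simp
  then show "\<exists>R\<in>\<R>. s - 1 / real (Suc n) < (\<integral>x. k R x \<partial>\<nu>)" using less_cSUP_iff[OF ne bd] unfolding s_def by blast
 qed
 then obtain Q where Q: "\<And>n. Q n \<in> \<R>" "\<And>n. s - 1 / real (Suc n) < (\<integral>x. k (Q n) x \<partial>\<nu>)" by metis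
 define P where "P = (\<Union>n. Q n)"
 have P: "P \<in> \<R>" using Q(1) unfolding P_def \<R>_def by auto
 have mono: "k R x \<le> k R' x" if "R \<subseteq> R'" "R' \<in> \<R>" for R R' x
  unfolding k_def using that sets_Pair1[of R' \<nu> \<rho> x] by (intro l.finite_measure_mono) (auto simp: \<R>_def)
 have s: "s \<le> (\<integral>x. k P x \<partial>\<nu>)"
 proof (rule field_le_epsilon)
  fix e :: real assume "e > 0"
  then obtain n where "inverse (real (Suc n)) < e" using reals_Archimedean by blast
  moreover have "(\<integral>x. k (Q n) x \<partial>\<nu>) \<le> (\<integral>x. k P x \<partial>\<nu>)"
   by (intro integral_mono ki Q P mono) (auto simp: P_def)
  ultimately show "s \<le> (\<integral>x. k P x \<partial>\<nu>) + e" using Q(2)[of n] by (simp add: inverse_eq_divide)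
 qed
 have km: "k P \<in> borel_measurable \<nu>" using ki[OF P] by simp
 have null: "AE x in \<nu>. \<not> (k P x < q \<and> q < h x)" for q
 proof -
  define B where "B = {x. k P x < q \<and> q < h x}"
  have Bm: "B \<in> sets borel"
   using km unfolding B_def by (simp cong: measurable_cong_sets)
  have "measure \<nu> B \<le> 0"
  proof (rule ccontr)
   assume "\<not> ?thesis"
   then obtain C where C: "compact C" "C \<subseteq> B" "0 < measure \<nu> C" using n.inner_gt[OF Bm, of 0] by auto
   have "\<exists>K W. compact K \<and> open W \<and> x \<in> W \<and> q < measure \<rho> K \<and> (\<forall>y\<in>K. \<forall>v\<in>W. (y, v) \<in> E)" if "x \<in> C" for x
   proof -
    have c: "q < measure \<rho> {y. (y, x) \<in> E}" using that C(2) unfolding B_def h_def by auto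
    obtain K where K: "compact K" "K \<subseteq> {y. (y, x) \<in> E}" "q < measure \<rho> K"
     using l.inner_gt[OF borel_open[OF l.section_open[OF E]] c] by blast
    obtain V where V: "open V" "x \<in> V" "\<And>y v. y \<in> K ==> v \<in> V ==> (y, v) \<in> E"
     using compact_tube[OF K(1) E, of x] K(2) by blast
    show ?thesis by (intro exI[of _ K] exI[of _ V]) (use K V in auto)
   qed
   then obtain K W where KW: "\<And>x. x \<in> C ==> compact (K x) \<and> open (W x) \<and> x \<in> W x \<and> q < measure \<rho> (K x) \<and> (\<forall>y\<in>K x. \<forall>v\<in>W x. (y, v) \<in> E)"
    by metis
   have op: "\<And>x. x \<in> C ==> open (W x)" and cov: "C \<subseteq> (\<Union>x\<in>C. W x)" using KW by auto
   obtain F where F: "F \<subseteq> C" "finite F" "C \<subseteq> (\<Union>x\<in>F. W x)" by (rule compactE_image[OF C(1) op cov])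
   have Cm: "C \<in> sets borel" using C(1) by (simp add: borel_closed compact_imp_closed)
   \<comment> \<open>Adding the rectangle W x \<times> K x to \<open>P\<close> cannot raise the
     maximal integral s, yet on C \<inter> W x it lifts the section measure from below q to above
     q.\<close>
   have z: "measure \<nu> (C \<inter> W x) = 0" if "x \<in> F" for x
   proof -
    have x: "x \<in> C" using that F(1) by blast
    define R where "R = P \<union> W x \<times> K x"
    have "W x \<times> K x \<in> sets (\<nu> \<Otimes>\<^sub>M \<rho>)"
     using KW[OF x] by (intro pair_measureI) (auto simp: borel_closed compact_imp_closed)
    then have R: "R \<in> \<R>" using P KW[OF x] unfolding \<R>_def R_def by auto
    have "(\<integral>x. k R x \<partial>\<nu>) \<le> s" unfolding s_def by (rule cSUP_upper[OF R bd])
    then have "(\<integral>x. k R x - k P x \<partial>\<nu>) \<le> 0" using s ki[OF R] ki[OF P] by simp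
    moreover have nn: "0 \<le> k R x' - k P x'" for x' using mono[OF _ R, of P x'] unfolding R_def by simp
    moreover have "0 \<le> (\<integral>x. k R x - k P x \<partial>\<nu>)" using nn by (intro integral_nonneg_AE) simp
    ultimately have ae: "AE x' in \<nu>. k R x' - k P x' = 0"
     using integral_nonneg_eq_0_iff_AE[OF Bochner_Integration.integrable_diff[OF ki[OF R] ki[OF P]]] by simp
    have lt: "k P x' < k R x'" if x': "x' \<in> C \<inter> W x" for x'
    proof -
     have "Pair x' -` R \<in> sets \<rho>" using R sets_Pair1[of R \<nu> \<rho> x'] unfolding \<R>_def by simp
     then have "measure \<rho> (K x) \<le> k R x'" unfolding k_def by (rule l.finite_measure_mono[rotated]) (use x' in \<open>auto simp: R_def\<close>)
     then show ?thesis using KW[OF x] x' C(2) unfolding B_def by auto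
    qed
    from ae have "AE x' in \<nu>. x' \<notin> C \<inter> W x" by eventually_elim (use lt in force)
    moreover have "C \<inter> W x \<in> sets \<nu>" using Cm KW[OF x] by simp
    ultimately have "C \<inter> W x \<in> null_sets \<nu>" by (rule iffD2[OF AE_iff_null_sets, rotated])
    then show ?thesis by (rule measure_eq_0_null_sets)
   qed
   have "C = (\<Union>x\<in>F. C \<inter> W x)" using F(3) by auto
   then have "measure \<nu> C \<le> (\<Sum>x\<in>F. measure \<nu> (C \<inter> W x))"
    using n.finite_measure_subadditive_finite[OF F(2), of "\<lambda>x. C \<inter> W x"] Cm F(1) KW by fastforce
   then show False using C(3) z by simp
  qed
  then have "B \<in> null_sets \<nu>" using Bm by (auto simp: null_sets_def n.emeasure_eq_measure measure_le_0_iff)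
  then show ?thesis using AE_not_in[of B \<nu>] unfolding B_def by simp
 qed
 have "AE x in \<nu>. \<forall>q\<in>\<rat>. \<not> (k P x < q \<and> q < h x)" using null by (simp add: AE_ball_countable countable_rat)
 then have "AE x in \<nu>. h x \<le> k P x"
  by eventually_elim (metis Rats_dense_in_real not_le)
 then have "(\<integral>x. h x \<partial>\<nu>) \<le> (\<integral>x. k P x \<partial>\<nu>)" by (rule integral_mono_AE[OF hi ki[OF P]])
 also have "\<dots> \<le> (\<integral>y. h' y \<partial>\<rho>)" by (rule le[OF P])
 finally show ?thesis unfolding h_def h'_def .
qed

lemma radon_Fubini_open:
 fixes E :: "('a::t2_space \<times> 'b::t2_space) set"
 assumes l: "finite_radon \<rho>" and n: "finite_radon \<nu>" and E: "open E"
 shows "(\<integral>x. measure \<rho> {y. (y, x) \<in> E} \<partial>\<nu>) = (\<integral>y. measure \<nu> {x. (y, x) \<in> E} \<partial>\<rho>)"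
proof (rule antisym)
 have "{z. (snd z, fst z) \<in> E} = (\<lambda>z. (snd z, fst z)) -` E" by auto
 then have E': "open {z. (snd z, fst z) \<in> E}"
  using open_vimage[OF E, of "\<lambda>z. (snd z, fst z)"] by (simp add: continuous_intros)
 from radon_Fubini_open_le[OF n l E']
 show "(\<integral>y. measure \<nu> {x. (y, x) \<in> E} \<partial>\<rho>) \<le> (\<integral>x. measure \<rho> {y. (y, x) \<in> E} \<partial>\<nu>)" by simp
qed (rule radon_Fubini_open_le[OF assms])

text \<open>The open sets are stable under intersection and generate the Borel sets of the product,
  so the claim spreads from them through disjoint unions and complements; for complements the
  finiteness of both measures is used.\<close>

lemma radon_Fubini_set:
 fixes E :: "('a::t2_space \<times> 'b::t2_space) set"
 assumes l: "finite_radon \<rho>" and n: "finite_radon \<nu>" and E: "E \<in> sets borel"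
 shows "(\<lambda>x. emeasure \<rho> {y. (y, x) \<in> E}) \<in> borel_measurable borel"
  "(\<lambda>y. emeasure \<nu> {x. (y, x) \<in> E}) \<in> borel_measurable borel"
  "(\<integral>\<^sup>+x. emeasure \<rho> {y. (y, x) \<in> E} \<partial>\<nu>) = (\<integral>\<^sup>+y. emeasure \<nu> {x. (y, x) \<in> E} \<partial>\<rho>)"
proof -
 interpret l: finite_radon \<rho> by fact
 interpret n: finite_radon \<nu> by fact
 have sw: "(\<lambda>z. (snd z, fst z)) \<in> measurable (borel :: ('b \<times> 'a) measure) (borel :: ('a \<times> 'b) measure)"
  by (rule borel_measurable_continuous_onI) (intro continuous_intros)
 have sec1: "{y. (y, x) \<in> A} \<in> sets borel" if "A \<in> sets borel" for A :: "('a \<times> 'b) set" and x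
  by (rule l.section_borel[OF that])
 have sec2: "{x. (y, x) \<in> A} \<in> sets borel" if "A \<in> sets borel" for A :: "('a \<times> 'b) set" and y
 proof -
  have "{z. (snd z, fst z) \<in> A} \<in> sets borel"
   using measurable_sets[OF sw that] by (simp add: vimage_def)
  from n.section_borel[OF this, of y] show ?thesis by simp
 qed
 have st: "Int_stable {S :: ('a \<times> 'b) set. open S}" unfolding Int_stable_def by auto
 have pw: "{S :: ('a \<times> 'b) set. open S} \<subseteq> Pow UNIV" by auto
 have Es: "E \<in> sigma_sets UNIV {S. open S}" using E unfolding borel_def by simp
 from st pw Es have "(\<lambda>x. emeasure \<rho> {y. (y, x) \<in> E}) \<in> borel_measurable borel \<and>
  (\<lambda>y. emeasure \<nu> {x. (y, x) \<in> E}) \<in> borel_measurable borel \<and>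
  (\<integral>\<^sup>+x. emeasure \<rho> {y. (y, x) \<in> E} \<partial>\<nu>) = (\<integral>\<^sup>+y. emeasure \<nu> {x. (y, x) \<in> E} \<partial>\<rho>)"
 proof (induction rule: sigma_sets_induct_disjoint)
  case (basic E)
  then have E: "open E" by simp
  have E': "open {z. (snd z, fst z) \<in> E}"
  proof -
   have "{z. (snd z, fst z) \<in> E} = (\<lambda>z. (snd z, fst z)) -` E" by auto
   then show ?thesis using open_vimage[OF E, of "\<lambda>z. (snd z, fst z)"] by (simp add: continuous_intros)
  qed
  have m1: "(\<lambda>x. measure \<rho> {y. (y, x) \<in> E}) \<in> borel_measurable borel" by (rule l.section_measurable_open[OF E])
  have m2: "(\<lambda>y. measure \<nu> {x. (y, x) \<in> E}) \<in> borel_measurable borel" using n.section_measurable_open[OF E'] by simp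
  have i1: "integrable \<nu> (\<lambda>x. measure \<rho> {y. (y, x) \<in> E})"
   using m1 l.finite_measure_mono[of _ UNIV] by (intro n.integrable_const_bound[of _ "measure \<rho> UNIV"]) auto
  have i2: "integrable \<rho> (\<lambda>y. measure \<nu> {x. (y, x) \<in> E})"
   using m2 n.finite_measure_mono[of _ UNIV] by (intro l.integrable_const_bound[of _ "measure \<nu> UNIV"]) auto
  show ?case
   unfolding l.emeasure_eq_measure n.emeasure_eq_measure
   using m1 m2 radon_Fubini_open[OF l n E] nn_integral_eq_integral[OF i1] nn_integral_eq_integral[OF i2] by auto
 next
  case empty
  show ?case by simp
 next
  case (compl A)
  then have A: "A \<in> sets borel" unfolding borel_def by simp
  have e1: "emeasure \<rho> {y. (y, x) \<in> UNIV - A} = emeasure \<rho> UNIV - emeasure \<rho> {y. (y, x) \<in> A}" for x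
  proof -
   have "{y. (y, x) \<in> UNIV - A} = space \<rho> - {y. (y, x) \<in> A}" by auto
   then show ?thesis using emeasure_compl[of "{y. (y, x) \<in> A}" \<rho>] sec1[OF A] by simp
  qed
  have e2: "emeasure \<nu> {x. (y, x) \<in> UNIV - A} = emeasure \<nu> UNIV - emeasure \<nu> {x. (y, x) \<in> A}" for y
  proof -
   have "{x. (y, x) \<in> UNIV - A} = space \<nu> - {x. (y, x) \<in> A}" by auto
   then show ?thesis using emeasure_compl[of "{x. (y, x) \<in> A}" \<nu>] sec2[OF A] by simp
  qed
  have f1: "(\<integral>\<^sup>+x. emeasure \<rho> {y. (y, x) \<in> A} \<partial>\<nu>) \<noteq> \<infinity>"
  proof -
   have "(\<integral>\<^sup>+x. emeasure \<rho> {y. (y, x) \<in> A} \<partial>\<nu>) \<le> (\<integral>\<^sup>+x. emeasure \<rho> UNIV \<partial>\<nu>)"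
    by (intro nn_integral_mono emeasure_mono) auto
   also have "\<dots> < \<infinity>" by (simp add: ennreal_mult_less_top l.emeasure_eq_measure n.emeasure_eq_measure)
   finally show ?thesis by simp
  qed
  have "(\<integral>\<^sup>+x. emeasure \<rho> {y. (y, x) \<in> UNIV - A} \<partial>\<nu>) = emeasure \<rho> UNIV * emeasure \<nu> UNIV - (\<integral>\<^sup>+x. emeasure \<rho> {y. (y, x) \<in> A} \<partial>\<nu>)"
   unfolding e1 using compl f1 by (subst nn_integral_diff) (auto intro!: always_eventually emeasure_mono)
  moreover have "(\<integral>\<^sup>+y. emeasure \<nu> {x. (y, x) \<in> UNIV - A} \<partial>\<rho>) = emeasure \<nu> UNIV * emeasure \<rho> UNIV - (\<integral>\<^sup>+y. emeasure \<nu> {x. (y, x) \<in> A} \<partial>\<rho>)"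
   unfolding e2 using compl f1 by (subst nn_integral_diff) (auto intro!: always_eventually emeasure_mono)
  ultimately show ?case using compl unfolding e1 e2 by (auto simp: mult.commute)
 next
  case (union A)
  have A: "A i \<in> sets borel" for i using union(2) unfolding borel_def by auto
  have dis1: "disjoint_family (\<lambda>i. {y. (y, x) \<in> A i})" for x using union(1) unfolding disjoint_family_on_def by auto
  have dis2: "disjoint_family (\<lambda>i. {x. (y, x) \<in> A i})" for y using union(1) unfolding disjoint_family_on_def by auto
  have e1: "emeasure \<rho> {y. (y, x) \<in> (\<Union>i. A i)} = (\<Sum>i. emeasure \<rho> {y. (y, x) \<in> A i})" for x
  proof -
   have "{y. (y, x) \<in> (\<Union>i. A i)} = (\<Union>i. {y. (y, x) \<in> A i})" by auto
   then show ?thesis using suminf_emeasure[of "\<lambda>i. {y. (y, x) \<in> A i}" \<rho>] dis1[of x] sec1[OF A] by (simp add: image_subset_iff)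
  qed
  have e2: "emeasure \<nu> {x. (y, x) \<in> (\<Union>i. A i)} = (\<Sum>i. emeasure \<nu> {x. (y, x) \<in> A i})" for y
  proof -
   have "{x. (y, x) \<in> (\<Union>i. A i)} = (\<Union>i. {x. (y, x) \<in> A i})" by auto
   then show ?thesis using suminf_emeasure[of "\<lambda>i. {x. (y, x) \<in> A i}" \<nu>] dis2[of y] sec2[OF A] by (simp add: image_subset_iff)
  qed
  have m1: "(\<lambda>x. emeasure \<rho> {y. (y, x) \<in> A i}) \<in> borel_measurable borel" for i using union(3) by blast
  have m2: "(\<lambda>y. emeasure \<nu> {x. (y, x) \<in> A i}) \<in> borel_measurable borel" for i using union(3) by blast
  have "(\<integral>\<^sup>+x. (\<Sum>i. emeasure \<rho> {y. (y, x) \<in> A i}) \<partial>\<nu>) = (\<integral>\<^sup>+y. (\<Sum>i. emeasure \<nu> {x. (y, x) \<in> A i}) \<partial>\<rho>)"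
   using nn_integral_suminf[of "\<lambda>i x. emeasure \<rho> {y. (y, x) \<in> A i}" \<nu>] nn_integral_suminf[of "\<lambda>i y. emeasure \<nu> {x. (y, x) \<in> A i}" \<rho>] m1 m2 union(3) by (simp cong: measurable_cong_sets)
  then show ?case unfolding e1 e2 using m1 m2 by (auto intro!: borel_measurable_suminf)
 qed
 then show "(\<lambda>x. emeasure \<rho> {y. (y, x) \<in> E}) \<in> borel_measurable borel"
  "(\<lambda>y. emeasure \<nu> {x. (y, x) \<in> E}) \<in> borel_measurable borel"
  "(\<integral>\<^sup>+x. emeasure \<rho> {y. (y, x) \<in> E} \<partial>\<nu>) = (\<integral>\<^sup>+y. emeasure \<nu> {x. (y, x) \<in> E} \<partial>\<rho>)" by blast+
qed

lemma radon_Fubini: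
 fixes k :: "'a::t2_space \<times> 'b::t2_space => ennreal"
 assumes l: "finite_radon \<rho>" and n: "finite_radon \<nu>" and k: "k \<in> borel_measurable borel"
 shows "(\<lambda>x. \<integral>\<^sup>+y. k (y, x) \<partial>\<rho>) \<in> borel_measurable borel \<and> (\<lambda>y. \<integral>\<^sup>+x. k (y, x) \<partial>\<nu>) \<in> borel_measurable borel \<and>
  (\<integral>\<^sup>+x. (\<integral>\<^sup>+y. k (y, x) \<partial>\<rho>) \<partial>\<nu>) = (\<integral>\<^sup>+y. (\<integral>\<^sup>+x. k (y, x) \<partial>\<nu>) \<partial>\<rho>)"
 using k
proof (induction rule: borel_measurable_induct)
 interpret l: finite_radon \<rho> by fact
 interpret n: finite_radon \<nu> by fact
 have sl: "sets \<rho> = sets borel" "sets \<nu> = sets borel" by simp_all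
 have ml: "measurable \<rho> M = measurable borel M" and mn: "measurable \<nu> M = measurable borel M" for M
  by (rule measurable_cong_sets; simp)+
 have p1: "(\<lambda>y. (y, x)) \<in> measurable (borel :: 'a measure) (borel :: ('a \<times> 'b) measure)" for x
  by (rule borel_measurable_continuous_onI) (intro continuous_intros)
 have p2: "(\<lambda>x. (y, x)) \<in> measurable (borel :: 'b measure) (borel :: ('a \<times> 'b) measure)" for y
  by (rule borel_measurable_continuous_onI) (intro continuous_intros)
 {
  case (cong f g)
  then have "f = g" by auto
  then show ?case using cong by simp
 next
  case (set E)
  then have E: "E \<in> sets borel" by simp
  have "indicator E (y, x) = (indicator {y. (y, x) \<in> E} y :: ennreal)"
   "indicator E (y, x) = (indicator {x. (y, x) \<in> E} x :: ennreal)" for x y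
   by (auto simp: indicator_def)
  moreover have "{x. (y, x) \<in> E} \<in> sets borel" for y
   using measurable_sets[OF p2 E, of y] by (simp add: vimage_def)
  ultimately have "(\<integral>\<^sup>+y. indicator E (y, x) \<partial>\<rho>) = emeasure \<rho> {y. (y, x) \<in> E}"
   "(\<integral>\<^sup>+x. indicator E (y, x) \<partial>\<nu>) = emeasure \<nu> {x. (y, x) \<in> E}" for x y
   using l.section_borel[OF E, of x] nn_integral_indicator[of "{y. (y, x) \<in> E}" \<rho>]
    nn_integral_indicator[of "{x. (y, x) \<in> E}" \<nu>] by (simp_all only: sl simp_thms)
  then show ?case using radon_Fubini_set[OF l n E] by simp
 next
  case (mult u c)
  have "(\<lambda>y. u (y, x)) \<in> borel_measurable \<rho>" "(\<lambda>x. u (y, x)) \<in> borel_measurable \<nu>" for x y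
   unfolding ml mn using mult(2) measurable_compose[OF p1] measurable_compose[OF p2] by auto
  then show ?case using mult(3,4) by (auto simp: nn_integral_cmult ml mn)
 next
  case (add u v)
  have "(\<lambda>y. u (y, x)) \<in> borel_measurable \<rho>" "(\<lambda>x. u (y, x)) \<in> borel_measurable \<nu>"
   "(\<lambda>y. v (y, x)) \<in> borel_measurable \<rho>" "(\<lambda>x. v (y, x)) \<in> borel_measurable \<nu>" for x y
   unfolding ml mn using add(1,3) measurable_compose[OF p1] measurable_compose[OF p2] by auto
  then show ?case using add by (auto simp: nn_integral_add ml mn)
 next
  case (seq U)
  have m: "(\<lambda>y. U i (y, x)) \<in> borel_measurable \<rho>" "(\<lambda>x. U i (y, x)) \<in> borel_measurable \<nu>" for x y i
   unfolding ml mn by (rule measurable_compose[OF p1 seq(1)], rule measurable_compose[OF p2 seq(1)])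
  have inc: "incseq (\<lambda>i y. U i (y, x))" "incseq (\<lambda>i x. U i (y, x))" for x y
   using seq(3) unfolding incseq_def le_fun_def by auto
  have e1: "(\<integral>\<^sup>+y. (SUP i. U i) (y, x) \<partial>\<rho>) = (SUP i. \<integral>\<^sup>+y. U i (y, x) \<partial>\<rho>)" for x
   using nn_integral_monotone_convergence_SUP[OF inc(1)[of x] m(1)] by (simp add: SUP_apply image_comp)
  have e2: "(\<integral>\<^sup>+x. (SUP i. U i) (y, x) \<partial>\<nu>) = (SUP i. \<integral>\<^sup>+x. U i (y, x) \<partial>\<nu>)" for y
   using nn_integral_monotone_convergence_SUP[OF inc(2)[of y] m(2)] by (simp add: SUP_apply image_comp)
  have mm: "(\<lambda>x. \<integral>\<^sup>+y. U i (y, x) \<partial>\<rho>) \<in> borel_measurable borel" "(\<lambda>y. \<integral>\<^sup>+x. U i (y, x) \<partial>\<nu>) \<in> borel_measurable borel" for i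
   using seq.IH by auto
  have inc2: "incseq (\<lambda>i x. \<integral>\<^sup>+y. U i (y, x) \<partial>\<rho>)" "incseq (\<lambda>i y. \<integral>\<^sup>+x. U i (y, x) \<partial>\<nu>)"
   using inc unfolding incseq_def le_fun_def by (auto intro!: nn_integral_mono)
  have "(\<integral>\<^sup>+x. (SUP i. \<integral>\<^sup>+y. U i (y, x) \<partial>\<rho>) \<partial>\<nu>) = (SUP i. \<integral>\<^sup>+x. (\<integral>\<^sup>+y. U i (y, x) \<partial>\<rho>) \<partial>\<nu>)"
   by (rule nn_integral_monotone_convergence_SUP[OF inc2(1)]) (simp add: mn mm)
  also have "\<dots> = (SUP i. \<integral>\<^sup>+y. (\<integral>\<^sup>+x. U i (y, x) \<partial>\<nu>) \<partial>\<rho>)" using seq.IH by (intro SUP_cong) auto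
  also have "\<dots> = (\<integral>\<^sup>+y. (SUP i. \<integral>\<^sup>+x. U i (y, x) \<partial>\<nu>) \<partial>\<rho>)"
   by (rule nn_integral_monotone_convergence_SUP[OF inc2(2), symmetric]) (simp add: ml mm)
  finally show ?case unfolding e1 e2 using mm by (auto intro!: borel_measurable_SUP)
 }
qed

section \<open>Convolution with respect to Haar measure\<close>

context haar
begin

text \<open>On D n the density lies between 1/(n+1) and n: the lower bound makes \<mu>(D n) finite,
  so that \<open>inner_compact\<close> applies, and the upper bound carries its estimate over to the
  density measure. The D n exhaust the set where f is positive.\<close>

lemma density_radon:
 assumes f: "integrable \<mu> f" "\<And>x. 0 \<le> f x"
 shows "finite_radon (density \<mu> (\<lambda>x. ennreal (f x)))"
proof -
 define \<nu> where "\<nu> = density \<mu> (\<lambda>x. ennreal (f x))"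
 have fm[measurable]: "f \<in> borel_measurable borel" using borel_measurable_integrable[OF f(1)] by simp
 have fin: "(\<integral>\<^sup>+x. ennreal (f x) \<partial>\<mu>) < \<infinity>"
  using nn_integral_eq_integral[OF f(1)] f(2) by simp
 have em: "emeasure \<nu> A = (\<integral>\<^sup>+x. ennreal (f x) * indicator A x \<partial>\<mu>)" if "A \<in> sets borel" for A
  unfolding \<nu>_def using that by (subst emeasure_density) auto
 have sets_\<nu>[simp]: "sets \<nu> = sets borel" unfolding \<nu>_def by simp
 interpret finite_measure \<nu>
 proof
  show "emeasure \<nu> (space \<nu>) \<noteq> \<infinity>" using em[of UNIV] fin unfolding \<nu>_def by simp
 qed
 have inner: "\<exists>K. compact K \<and> K \<subseteq> A \<and> measure \<nu> (A - K) < e" if A[measurable]: "A \<in> sets borel" and e: "(e::real) > 0" for A e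
 proof -
  define D where "D = (\<lambda>n. A \<inter> {x. 1 / (real n + 1) \<le> f x \<and> f x \<le> real n})"
  have Dm[measurable]: "D n \<in> sets borel" for n unfolding D_def by measurable
  have inc: "incseq D"
  proof (rule incseq_SucI)
   fix n
   have "1 / (real (Suc n) + 1) \<le> 1 / (real n + 1)" by (simp add: field_simps)
   then show "D n \<subseteq> D (Suc n)" unfolding D_def by auto
  qed
  have Un: "(\<Union>n. D n) = A \<inter> {x. 0 < f x}"
  proof (intro equalityI subsetI)
   fix x assume "x \<in> A \<inter> {x. 0 < f x}"
   then have x: "x \<in> A" "0 < f x" by auto
   obtain n1 n2 :: nat where n: "inverse (real (Suc n1)) < f x" "f x < real n2"
    using reals_Archimedean[OF x(2)] reals_Archimedean2 by blast
   define n where "n = max n1 n2"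
   have "1 / (real n + 1) \<le> inverse (real (Suc n1))" unfolding n_def by (simp add: field_simps)
   then have "x \<in> D n" unfolding D_def using n x unfolding n_def by auto
   then show "x \<in> (\<Union>n. D n)" by blast
  qed (auto simp: D_def intro: less_le_trans[of _ "1 / (real n + 1)" for n])
  have "(\<lambda>n. measure \<nu> (D n)) \<longlonglongrightarrow> measure \<nu> (\<Union>n. D n)"
   by (rule finite_Lim_measure_incseq) (use inc in auto)
  then have "eventually (\<lambda>n. measure \<nu> (\<Union>n. D n) - e / 2 < measure \<nu> (D n)) sequentially"
   using e by (intro order_tendstoD) auto
  then obtain n where n: "measure \<nu> (\<Union>n. D n) - e / 2 < measure \<nu> (D n)" using eventually_happens by force
  have "emeasure \<mu> (D n) = (\<integral>\<^sup>+x. indicator (D n) x \<partial>\<mu>)" by simp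
  also have "\<dots> \<le> (\<integral>\<^sup>+x. ennreal (real n + 1) * ennreal (f x) \<partial>\<mu>)"
  proof (intro nn_integral_mono)
   fix x
   have "1 \<le> (real n + 1) * f x" if "x \<in> D n" using that unfolding D_def by (simp add: field_simps)
   then show "indicator (D n) x \<le> ennreal (real n + 1) * ennreal (f x)"
    using f(2)[of x] ennreal_leI[of 1 "(real n + 1) * f x"] by (auto simp: indicator_def ennreal_mult simp del: ennreal_plus)
  qed
  also have "\<dots> < \<infinity>" using fin by (simp add: nn_integral_cmult ennreal_mult_less_top)
  finally have Df: "emeasure \<mu> (D n) < \<infinity>" .
  define d where "d = e / (2 * (real n + 1))"
  have d: "d > 0" unfolding d_def using e by simp
  obtain K where K: "compact K" "K \<subseteq> D n" "emeasure \<mu> (D n - K) < ennreal d"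
   by (rule inner_compact[OF Dm Df d]) (rule that)
  have Km[measurable]: "K \<in> sets borel" by (rule compact_borel[OF K(1)])
  have "emeasure \<nu> (D n - K) \<le> (\<integral>\<^sup>+x. ennreal (real n) * indicator (D n - K) x \<partial>\<mu>)"
   by (subst em) (auto intro!: nn_integral_mono ennreal_leI simp: indicator_def D_def)
  also have "\<dots> = ennreal (real n) * emeasure \<mu> (D n - K)" by (simp add: nn_integral_cmult)
  also have "\<dots> \<le> ennreal (real n) * ennreal d" using K(3) by (intro mult_left_mono) auto
  also have "\<dots> = ennreal (real n * d)" using d by (simp add: ennreal_mult)
  finally have "measure \<nu> (D n - K) \<le> real n * d" using d by (simp add: emeasure_eq_measure)
  also have "\<dots> < e / 2" unfolding d_def using e by (simp add: field_simps)
  finally have m1: "measure \<nu> (D n - K) < e / 2" .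
  have "emeasure \<nu> (A \<inter> {x. f x = 0}) = 0"
   by (subst em) (auto simp: nn_integral_0_iff_AE indicator_def)
  then have m2: "measure \<nu> (A \<inter> {x. f x = 0}) = 0" by (simp add: measure_def)
  have "A - K \<subseteq> (A \<inter> {x. f x = 0}) \<union> (((\<Union>n. D n) - D n) \<union> (D n - K))"
   unfolding Un using f(2) K(2) by (auto simp: less_le)
  then have "measure \<nu> (A - K) \<le> measure \<nu> ((A \<inter> {x. f x = 0}) \<union> (((\<Union>n. D n) - D n) \<union> (D n - K)))"
   by (intro finite_measure_mono) auto
  also have "\<dots> \<le> measure \<nu> (A \<inter> {x. f x = 0}) + (measure \<nu> ((\<Union>n. D n) - D n) + measure \<nu> (D n - K))"
   by (intro order_trans[OF measure_Un_le] add_mono measure_Un_le) auto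
  also have "measure \<nu> ((\<Union>n. D n) - D n) = measure \<nu> (\<Union>n. D n) - measure \<nu> (D n)"
   by (intro finite_measure_Diff) auto
  finally have "measure \<nu> (A - K) < e" using n m1 m2 by simp
  then show ?thesis using K(1,2) unfolding D_def by blast
 qed
 show ?thesis unfolding \<nu>_def[symmetric]
 proof
  show "sets \<nu> = sets borel" by simp
  show "\<exists>K. compact K \<and> K \<subseteq> A \<and> measure \<nu> (A - K) < e" if "A \<in> sets borel" "0 < e" for A e
   by (rule inner[OF that])
 qed
qed

text \<open>By Chebyshev's inequality the sets |f| \<ge> 1/(n+1) have finite measure, and
  \<open>sigma_compact_cover\<close> covers each by countably many compact sets. This makes up for
  \<mu> not being \<sigma>-finite.\<close>

lemma integrable_sigma_compact:
 fixes f :: "'g => real"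
 assumes f: "integrable \<mu> f"
 shows "\<exists>K :: nat => 'g set. (\<forall>n. compact (K n)) \<and> (\<forall>x. x \<notin> (\<Union>n. K n) --> f x = 0)"
proof -
 have fm[measurable]: "f \<in> borel_measurable borel" using borel_measurable_integrable[OF f] by simp
 define A where "A = (\<lambda>n. {x. 1 / (real n + 1) \<le> \<bar>f x\<bar>})"
 have "\<exists>K::nat => 'g set. (\<forall>m. compact (K m)) \<and> A n \<subseteq> (\<Union>m. K m)" for n
 proof -
  have Am: "A n \<in> sets borel" unfolding A_def by measurable
  have "(\<integral>\<^sup>+x. ennreal \<bar>f x\<bar> \<partial>\<mu>) < \<infinity>" using nn_integral_eq_integral[OF integrable_abs[OF f]] by simp
  moreover have "emeasure \<mu> (A n) \<le> (\<integral>\<^sup>+x. ennreal (real n + 1) * ennreal \<bar>f x\<bar> \<partial>\<mu>)"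
  proof -
   have "emeasure \<mu> (A n) = (\<integral>\<^sup>+x. indicator (A n) x \<partial>\<mu>)" using Am by simp
   also have "\<dots> \<le> (\<integral>\<^sup>+x. ennreal (real n + 1) * ennreal \<bar>f x\<bar> \<partial>\<mu>)"
   proof (intro nn_integral_mono)
    fix x
    have "1 \<le> (real n + 1) * \<bar>f x\<bar>" if "x \<in> A n" using that unfolding A_def by (simp add: field_simps)
    then show "indicator (A n) x \<le> ennreal (real n + 1) * ennreal \<bar>f x\<bar>"
     using ennreal_leI[of 1 "(real n + 1) * \<bar>f x\<bar>"] by (auto simp: indicator_def ennreal_mult simp del: ennreal_plus)
   qed
   finally show ?thesis .
  qed
  ultimately have "emeasure \<mu> (A n) < \<infinity>"
   by (simp add: nn_integral_cmult ennreal_mult_less_top order_le_less_trans)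
  from sigma_compact_cover[OF Am this] show ?thesis by metis
 qed
 then have "\<forall>n. \<exists>K::nat => 'g set. (\<forall>m. compact (K m)) \<and> A n \<subseteq> (\<Union>m. K m)" by (rule allI)
 from choice[OF this] obtain K :: "nat => nat => 'g set" where "\<forall>n. (\<forall>m. compact (K n m)) \<and> A n \<subseteq> (\<Union>m. K n m)" by (rule exE)
 then have K: "\<And>n m. compact (K n m)" "\<And>n. A n \<subseteq> (\<Union>m. K n m)" by auto
 show ?thesis
 proof (intro exI[of _ "\<lambda>i. K (fst (prod_decode i)) (snd (prod_decode i))"] conjI allI impI)
  fix x assume x: "x \<notin> (\<Union>i. K (fst (prod_decode i)) (snd (prod_decode i)))"
  show "f x = 0"
  proof (rule ccontr)
   assume "f x \<noteq> 0"
   then obtain n where "inverse (real (Suc n)) < \<bar>f x\<bar>" using reals_Archimedean[of "\<bar>f x\<bar>"] by auto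
   then have "x \<in> A n" unfolding A_def by (simp add: inverse_eq_divide add.commute)
   then obtain m where "x \<in> K n m" using K(2) by blast
   then have "x \<in> K (fst (prod_decode (prod_encode (n, m)))) (snd (prod_decode (prod_encode (n, m))))" by simp
   then show False using x by blast
  qed
 qed (rule K(1))
qed

definition conv_nn :: "('g => real) => ('g => real) => 'g => ennreal" where
 "conv_nn f g = (\<lambda>x. \<integral>\<^sup>+y. ennreal (f y) * ennreal (g (- y + x)) \<partial>\<mu>)"

lemma reflect_translate_measurable:
 fixes x :: 'g
 assumes "g \<in> borel_measurable borel"
 shows "(\<lambda>y. g (- y + x)) \<in> borel_measurable borel"
proof -
 have "(\<lambda>y. - y + x) \<in> measurable borel (borel :: 'g measure)"
  by (intro borel_measurable_continuous_onI continuous_intros)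
 from measurable_compose[OF this assms] show ?thesis .
qed

text \<open>Fubini is applied to the finite measure with density f and to \<mu> restricted to a
  compact set K n. The convolution vanishes outside the union of the K n, as f and g live on
  \<sigma>-compact sets, and monotone convergence removes the restriction.\<close>

lemma conv_nn:
 assumes f: "integrable \<mu> f" "\<And>x. 0 \<le> f x" and g: "integrable \<mu> g" "\<And>x. 0 \<le> g x"
 shows "conv_nn f g \<in> borel_measurable borel"
  and "(\<integral>\<^sup>+x. conv_nn f g x \<partial>\<mu>) \<le> ennreal ((LI x. f x) * (LI x. g x))"
proof -
 have fm[measurable]: "f \<in> borel_measurable borel" using borel_measurable_integrable[OF f(1)] by simp
 have gm[measurable]: "g \<in> borel_measurable borel" using borel_measurable_integrable[OF g(1)] by simp
 define \<rho> where "\<rho> = density \<mu> (\<lambda>x. ennreal (f x))"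
 have \<rho>: "finite_radon \<rho>" unfolding \<rho>_def by (rule density_radon[OF f])
 have sub: "(\<lambda>(y, x). - y + x) \<in> measurable (borel :: ('g \<times> 'g) measure) (borel :: 'g measure)"
  unfolding split_beta by (intro borel_measurable_continuous_onI continuous_intros)
 define k where "k = (\<lambda>(y, x). ennreal (g (- y + x)))"
 have km: "k \<in> borel_measurable borel"
  using measurable_compose[OF sub, of "\<lambda>z. ennreal (g z)" borel] unfolding k_def by (simp add: split_beta)
 have conv: "conv_nn f g = (\<lambda>x. \<integral>\<^sup>+y. k (y, x) \<partial>\<rho>)"
  unfolding conv_nn_def \<rho>_def k_def
  using reflect_translate_measurable[OF gm] by (intro ext) (subst nn_integral_density, auto)
 note Fub = radon_Fubini[OF \<rho> _ km]
 show m[measurable]: "conv_nn f g \<in> borel_measurable borel" unfolding conv using Fub[OF \<rho>] by blast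
 from integrable_sigma_compact[OF f(1)]
 obtain C :: "nat => 'g set" where "(\<forall>n. compact (C n)) \<and> (\<forall>x. x \<notin> (\<Union>n. C n) --> f x = 0)" by (rule exE)
 then have C: "\<And>n. compact (C n)" "\<And>x. x \<notin> (\<Union>n. C n) ==> f x = 0" by blast+
 from integrable_sigma_compact[OF g(1)]
 obtain D :: "nat => 'g set" where "(\<forall>n. compact (D n)) \<and> (\<forall>x. x \<notin> (\<Union>n. D n) --> g x = 0)" by (rule exE)
 then have D: "\<And>n. compact (D n)" "\<And>x. x \<notin> (\<Union>n. D n) ==> g x = 0" by blast+
 define E where "E = (\<lambda>i. (\<lambda>(x, y). x + y) ` (C (fst (prod_decode i)) \<times> D (snd (prod_decode i))))"
 define K where "K = (\<lambda>n::nat. \<Union>i\<le>n. E i)"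
 have K: "compact (K n)" for n unfolding K_def E_def using C(1) D(1) by (intro compact_UN compact_add) auto
 have Km[measurable]: "K n \<in> sets borel" for n by (rule compact_borel[OF K])
 have zero: "conv_nn f g x = 0" if x: "x \<notin> (\<Union>n. K n)" for x
 proof -
  have "f y = 0 \<or> g (- y + x) = 0" for y
  proof (rule ccontr)
   assume "\<not> ?thesis"
   then obtain n m where nm: "y \<in> C n" "- y + x \<in> D m" using C(2) D(2) by blast
   then have "y + (- y + x) \<in> E (prod_encode (n, m))" unfolding E_def by force
   then have "x \<in> E (prod_encode (n, m))" by simp
   then show False using x unfolding K_def by blast
  qed
  then have "ennreal (f y) * ennreal (g (- y + x)) = 0" for y by (metis ennreal_0 mult_zero_left mult_zero_right)
  then show ?thesis unfolding conv_nn_def by (simp del: mult_eq_0_iff)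
 qed
 have part: "(\<integral>\<^sup>+x. conv_nn f g x * indicator (K n) x \<partial>\<mu>) \<le> ennreal ((LI x. f x) * (LI x. g x))" for n
 proof -
  define \<nu> where "\<nu> = density \<mu> (\<lambda>x. ennreal (indicator (K n) x))"
  have \<nu>: "finite_radon \<nu>"
   unfolding \<nu>_def by (intro density_radon integrable_real_indicator) (auto simp: emeasure_compact[OF K, simplified])
  have "(\<integral>\<^sup>+x. conv_nn f g x * indicator (K n) x \<partial>\<mu>) = (\<integral>\<^sup>+x. conv_nn f g x \<partial>\<nu>)"
   unfolding \<nu>_def by (subst nn_integral_density) (auto simp: mult.commute ennreal_indicator)
  also have "\<dots> = (\<integral>\<^sup>+y. (\<integral>\<^sup>+x. k (y, x) \<partial>\<nu>) \<partial>\<rho>)" unfolding conv using Fub[OF \<nu>] by blast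
  also have "\<dots> \<le> (\<integral>\<^sup>+y. ennreal (LI x. g x) \<partial>\<rho>)"
  proof (intro nn_integral_mono)
   fix y
   have gt: "(\<lambda>x. ennreal (g (- y + x))) \<in> borel_measurable borel" using measurable_translate[OF gm] by simp
   have "(\<integral>\<^sup>+x. k (y, x) \<partial>\<nu>) = (\<integral>\<^sup>+x. ennreal (indicator (K n) x) * ennreal (g (- y + x)) \<partial>\<mu>)"
    unfolding \<nu>_def k_def using gt by (subst nn_integral_density) auto
   also have "\<dots> \<le> (\<integral>\<^sup>+x. ennreal (g (- y + x)) \<partial>\<mu>)" by (intro nn_integral_mono) (auto simp: indicator_def)
   also have "\<dots> = ennreal (LI x. g x)"
    using nn_integral_translate[of "\<lambda>x. ennreal (g x)" "- y"] nn_integral_eq_integral[OF g(1)] g(2) by simp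
   finally show "(\<integral>\<^sup>+x. k (y, x) \<partial>\<nu>) \<le> ennreal (LI x. g x)" .
  qed
  also have "\<dots> = (\<integral>\<^sup>+y. ennreal (f y) * ennreal (LI x. g x) \<partial>\<mu>)" unfolding \<rho>_def by (subst nn_integral_density) auto
  also have "\<dots> = ennreal ((LI x. f x) * (LI x. g x))"
   using nn_integral_eq_integral[OF f(1)] f(2) g(2) by (simp add: nn_integral_multc ennreal_mult)
  finally show ?thesis .
 qed
 have inc: "incseq (\<lambda>n x. conv_nn f g x * indicator (K n) x)"
  unfolding incseq_def le_fun_def by (auto simp: K_def indicator_def)
 have sup: "conv_nn f g x = (SUP n. conv_nn f g x * indicator (K n) x)" for x
 proof (cases "x \<in> (\<Union>n. K n)")
  case True
  then obtain n where "x \<in> K n" by blast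
  then have "conv_nn f g x \<le> (SUP n. conv_nn f g x * indicator (K n) x)" by (intro SUP_upper2[of n]) auto
  moreover have "(SUP n. conv_nn f g x * indicator (K n) x) \<le> conv_nn f g x" by (intro SUP_least) (auto simp: indicator_def)
  ultimately show ?thesis by (rule antisym)
 qed (simp add: zero)
 have "(\<integral>\<^sup>+x. conv_nn f g x \<partial>\<mu>) = (\<integral>\<^sup>+x. (SUP n. conv_nn f g x * indicator (K n) x) \<partial>\<mu>)"
  by (rule nn_integral_cong) (rule sup)
 also have "\<dots> = (SUP n. \<integral>\<^sup>+x. conv_nn f g x * indicator (K n) x \<partial>\<mu>)"
  by (rule nn_integral_monotone_convergence_SUP[OF inc]) simp
 also have "\<dots> \<le> ennreal ((LI x. f x) * (LI x. g x))" by (rule SUP_least) (rule part)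
 finally show "(\<integral>\<^sup>+x. conv_nn f g x \<partial>\<mu>) \<le> ennreal ((LI x. f x) * (LI x. g x))" .
qed

end

text \<open>The nonnegative parts of a complex number in the directions 1, i, -1 and -i, indexed so
  that \<open>cpart_sum\<close> can use powers of the imaginary unit. The last clause also absorbs
  the indices above 3, which do not occur in that sum.\<close>

fun cpart :: "nat => complex => real" where
 "cpart 0 z = max 0 (Re z)"
| "cpart (Suc 0) z = max 0 (Im z)"
| "cpart (Suc (Suc 0)) z = max 0 (- Re z)"
| "cpart (Suc (Suc (Suc n))) z = max 0 (- Im z)"

lemma cpart_nonneg: "0 \<le> cpart i z"
 by (cases "(i, z)" rule: cpart.cases) auto

lemma cpart_le: "cpart i z \<le> cmod z"
 by (cases "(i, z)" rule: cpart.cases) (use abs_Re_le_cmod[of z] abs_Im_le_cmod[of z] in \<open>auto simp: abs_le_iff\<close>)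

lemma cpart_measurable [measurable]: "cpart i \<in> borel_measurable borel"
proof -
 consider "i = 0" | "i = Suc 0" | "i = Suc (Suc 0)" | n where "i = Suc (Suc (Suc n))"
  by (cases "(i, 0::complex)" rule: cpart.cases) auto
 then show ?thesis
 proof cases
  case 1
  then have "cpart i = (\<lambda>z. max 0 (Re z))" by (intro ext) simp
  then show ?thesis by simp
 next
  case 2
  then have "cpart i = (\<lambda>z. max 0 (Im z))" by (intro ext) simp
  then show ?thesis by simp
 next
  case 3
  then have "cpart i = (\<lambda>z. max 0 (- Re z))" by (intro ext) simp
  then show ?thesis by simp
 next
  case (4 n)
  then have "cpart i = (\<lambda>z. max 0 (- Im z))" by (intro ext) simp
  then show ?thesis by simp
 qed
qed

lemma cpart_sum: "z = (\<Sum>i<4. \<i> ^ i * complex_of_real (cpart i z))"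
 by (simp add: eval_nat_numeral complex_eq_iff max_def)

context haar
begin

abbreviation L1_norm :: "('g => complex) => real" where
 "L1_norm f \<equiv> \<integral>x. cmod (f x) \<partial>\<mu>"

lemma L1_borel: "integrable \<mu> f ==> f \<in> borel_measurable borel" for f :: "'g => complex"
 using borel_measurable_integrable[of \<mu> f] by simp

text \<open>The delicate point is measurability, since the Bochner integral has the default value 0
  where it diverges. On the set where the convolution of the moduli is finite, the convolution is a
  combination of the sixteen convolutions of nonnegative parts, which are measurable by
  \<open>conv_nn\<close>.\<close>

lemma L1_convolution:
 assumes f: "integrable \<mu> f" and g: "integrable \<mu> g"
 shows "integrable \<mu> (convolution \<mu> f g)"
  and "L1_norm (convolution \<mu> f g) \<le> L1_norm f * L1_norm g"
  and "AE x in \<mu>. integrable \<mu> (\<lambda>y. f y * g (- y + x))"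
proof -
 have fm[measurable]: "f \<in> borel_measurable borel" by (rule L1_borel[OF f])
 have gm[measurable]: "g \<in> borel_measurable borel" by (rule L1_borel[OF g])
 define N where "N = conv_nn (\<lambda>x. cmod (f x)) (\<lambda>x. cmod (g x))"
 note nn = conv_nn[OF integrable_norm[OF f] norm_ge_zero integrable_norm[OF g] norm_ge_zero, folded N_def]
 have Nm[measurable]: "N \<in> borel_measurable borel" by (rule nn(1))
 have im: "(\<lambda>y. f y * g (- y + x)) \<in> borel_measurable borel" for x
  using reflect_translate_measurable[OF gm, of x] by measurable
 have N: "N x = (\<integral>\<^sup>+y. ennreal (cmod (f y * g (- y + x))) \<partial>\<mu>)" for x
  unfolding N_def conv_nn_def by (simp add: norm_mult ennreal_mult)
 have iff: "integrable \<mu> (\<lambda>y. f y * g (- y + x)) \<longleftrightarrow> N x < \<infinity>" for x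
  unfolding integrable_iff_bounded N using im by simp
 have "AE x in \<mu>. N x \<noteq> \<infinity>"
  by (rule nn_integral_noteq_infinite) (use nn(2) in \<open>auto simp: top_unique\<close>)
 then show "AE x in \<mu>. integrable \<mu> (\<lambda>y. f y * g (- y + x))" by eventually_elim (simp add: iff less_top)
 have pi: "integrable \<mu> (\<lambda>x. cpart i (h x))" if h: "integrable \<mu> h" for i and h :: "'g => complex"
  using L1_borel[OF h] cpart_le[of i] cpart_nonneg[of i]
  by (intro Bochner_Integration.integrable_bound[OF integrable_norm[OF h]]) auto
 define \<Phi> where "\<Phi> = (\<lambda>i j. conv_nn (\<lambda>x. cpart i (f x)) (\<lambda>x. cpart j (g x)))"
 have \<Phi>m[measurable]: "\<Phi> i j \<in> borel_measurable borel" for i j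
  unfolding \<Phi>_def by (intro conv_nn pi f g cpart_nonneg)
 have eq: "convolution \<mu> f g = (\<lambda>x. if N x < \<infinity> then \<Sum>i<4. \<Sum>j<4. \<i> ^ i * \<i> ^ j * complex_of_real (enn2real (\<Phi> i j x)) else 0)"
 proof (intro ext)
  fix x
  show "convolution \<mu> f g x = (if N x < \<infinity> then \<Sum>i<4. \<Sum>j<4. \<i> ^ i * \<i> ^ j * complex_of_real (enn2real (\<Phi> i j x)) else 0)"
  proof (cases "N x < \<infinity>")
   case True
   then have int: "integrable \<mu> (\<lambda>y. f y * g (- y + x))" by (simp add: iff)
   have gx: "(\<lambda>y. g (- y + x)) \<in> borel_measurable borel" by (rule reflect_translate_measurable[OF gm])
   have ij: "integrable \<mu> (\<lambda>y. cpart i (f y) * cpart j (g (- y + x)))" for i j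
   proof (rule Bochner_Integration.integrable_bound[OF integrable_norm[OF int]])
    show "(\<lambda>y. cpart i (f y) * cpart j (g (- y + x))) \<in> borel_measurable \<mu>" using gx by simp
    show "AE y in \<mu>. norm (cpart i (f y) * cpart j (g (- y + x))) \<le> norm (cmod (f y * g (- y + x)))"
     by (intro always_eventually allI) (simp add: norm_mult abs_mult cpart_nonneg mult_mono cpart_le)
   qed
   have "convolution \<mu> f g x = (LI y. (\<Sum>i<4. \<Sum>j<4. \<i> ^ i * \<i> ^ j * complex_of_real (cpart i (f y) * cpart j (g (- y + x)))))"
    unfolding convolution_def
   proof (intro Bochner_Integration.integral_cong refl)
    fix y
    have "f y * g (- y + x) = (\<Sum>i<4. \<i> ^ i * complex_of_real (cpart i (f y))) * (\<Sum>j<4. \<i> ^ j * complex_of_real (cpart j (g (- y + x))))"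
     using cpart_sum[of "f y"] cpart_sum[of "g (- y + x)"] by simp
    then show "f y * g (- y + x) = (\<Sum>i<4. \<Sum>j<4. \<i> ^ i * \<i> ^ j * complex_of_real (cpart i (f y) * cpart j (g (- y + x))))"
     by (simp add: sum_product mult_ac)
   qed
   also have "\<dots> = (\<Sum>i<4. \<Sum>j<4. \<i> ^ i * \<i> ^ j * complex_of_real (LI y. cpart i (f y) * cpart j (g (- y + x))))"
    using ij by (simp add: Bochner_Integration.integral_sum Bochner_Integration.integrable_sum del: of_real_mult)
   also have "\<dots> = (\<Sum>i<4. \<Sum>j<4. \<i> ^ i * \<i> ^ j * complex_of_real (enn2real (\<Phi> i j x)))"
   proof -
    have "(LI y. cpart i (f y) * cpart j (g (- y + x))) = enn2real (\<Phi> i j x)" for i j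
     unfolding \<Phi>_def conv_nn_def using ij[of i j]
     by (subst integral_eq_nn_integral) (auto simp: cpart_nonneg ennreal_mult borel_measurable_integrable)
    then show ?thesis by simp
   qed
   finally show ?thesis using True by simp
  next
   case False
   then have "\<not> integrable \<mu> (\<lambda>y. f y * g (- y + x))" by (simp add: iff)
   then show ?thesis using False unfolding convolution_def by (simp add: not_integrable_integral_eq)
  qed
 qed
 have cm: "convolution \<mu> f g \<in> borel_measurable borel" unfolding eq by measurable
 have le: "ennreal (cmod (convolution \<mu> f g x)) \<le> N x" for x
 proof (cases "N x < \<infinity>")
  case True
  then have "integrable \<mu> (\<lambda>y. f y * g (- y + x))" by (simp add: iff)
  from integral_norm_bound_ennreal[OF this] show ?thesis unfolding convolution_def N by simp
 qed (simp add: less_top[symmetric])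
 have bd: "(\<integral>\<^sup>+x. ennreal (cmod (convolution \<mu> f g x)) \<partial>\<mu>) \<le> ennreal (L1_norm f * L1_norm g)"
  using nn_integral_mono[of \<mu> "\<lambda>x. ennreal (cmod (convolution \<mu> f g x))" N] le nn(2) by (meson order_trans)
 show int: "integrable \<mu> (convolution \<mu> f g)"
  by (rule integrableI_bounded) (use cm bd in \<open>auto intro: order_le_less_trans\<close>)
 show "L1_norm (convolution \<mu> f g) \<le> L1_norm f * L1_norm g"
  using bd nn_integral_eq_integral[OF integrable_norm[OF int]] by (simp add: ennreal_le_iff)
qed

lemma convolution_linear_right:
 assumes "integrable \<mu> f" "integrable \<mu> g" "integrable \<mu> g'"
 shows "AE x in \<mu>. convolution \<mu> f (\<lambda>y. g y + c * g' y) x = convolution \<mu> f g x + c * convolution \<mu> f g' x"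
 using L1_convolution(3)[OF assms(1,2)] L1_convolution(3)[OF assms(1,3)]
proof eventually_elim
 case (elim x)
 have "(\<lambda>y. f y * (g (- y + x) + c * g' (- y + x))) = (\<lambda>y. f y * g (- y + x) + c * (f y * g' (- y + x)))"
  by (simp add: algebra_simps)
 then show ?case unfolding convolution_def using elim by simp
qed

lemma L1_norm_zero_AE: "integrable \<mu> f ==> L1_norm f \<le> 0 ==> AE x in \<mu>. f x = 0"
 using integral_nonneg_eq_0_iff_AE[OF integrable_norm[of \<mu> f]] by (simp add: antisym)

lemma L1_norm_cong: "integrable \<mu> f ==> integrable \<mu> g ==> AE x in \<mu>. f x = g x ==> L1_norm f = L1_norm g"
 by (intro integral_cong_AE) auto

text \<open>A change of f on a null set changes no value. A change of g passes through the
  reflection y \<mapsto> - y + x, whose effect on null sets has not been examined; the norm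
  inequality, applied to the difference of g and g', avoids the question.\<close>

lemma convolution_cong_AE:
 assumes f: "integrable \<mu> f" "integrable \<mu> f'" and g: "integrable \<mu> g" "integrable \<mu> g'"
  and ff: "AE x in \<mu>. f x = f' x" and gg: "AE x in \<mu>. g x = g' x"
 shows "AE x in \<mu>. convolution \<mu> f g x = convolution \<mu> f' g' x"
proof -
 have eq: "convolution \<mu> f g = convolution \<mu> f' g"
  unfolding convolution_def
 proof (intro ext integral_cong_AE)
  fix x
  have "(\<lambda>y. g (- y + x)) \<in> borel_measurable borel" by (rule reflect_translate_measurable[OF L1_borel[OF g(1)]])
  then show "(\<lambda>y. f y * g (- y + x)) \<in> borel_measurable \<mu>" "(\<lambda>y. f' y * g (- y + x)) \<in> borel_measurable \<mu>"
   using L1_borel[OF f(1)] L1_borel[OF f(2)] by auto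
  show "AE y in \<mu>. f y * g (- y + x) = f' y * g (- y + x)" using ff by eventually_elim simp
 qed
 define d where "d = (\<lambda>y. g y + (-1) * g' y)"
 have d: "integrable \<mu> d" unfolding d_def using g by simp
 have "L1_norm d = 0"
  by (subst integral_cong_AE[of _ _ "\<lambda>_. 0"]) (use d gg in \<open>auto simp: d_def\<close>)
 then have "L1_norm (convolution \<mu> f' d) \<le> 0" using L1_convolution(2)[OF f(2) d] by simp
 then have "AE x in \<mu>. convolution \<mu> f' d x = 0" by (rule L1_norm_zero_AE[OF L1_convolution(1)[OF f(2) d]])
 with convolution_linear_right[OF f(2) g, of "-1", folded d_def] show ?thesis
  unfolding eq by eventually_elim simp
qed

end

section \<open>The group algebra and its characters\<close>

context haar
begin

lemma L1_equiv: "equiv (L1_fun \<mu>) (L1_rel \<mu>)"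
proof (rule equivI)
 show "L1_rel \<mu> \<subseteq> L1_fun \<mu> \<times> L1_fun \<mu>" unfolding L1_rel_def by auto
 show "refl_on (L1_fun \<mu>) (L1_rel \<mu>)" unfolding refl_on_def L1_rel_def by auto
 show "sym (L1_rel \<mu>)" unfolding sym_def L1_rel_def by (auto elim: eventually_mono)
 show "trans (L1_rel \<mu>)" unfolding trans_def L1_rel_def by (auto elim: eventually_elim2)
qed

abbreviation L1_class :: "('g => complex) => ('g => complex) set" where
 "L1_class f \<equiv> L1_rel \<mu> `` {f}"

lemma L1_class_eq: "integrable \<mu> f ==> integrable \<mu> g ==> AE x in \<mu>. f x = g x ==> L1_class f = L1_class g"
 by (rule equiv_class_eq[OF L1_equiv]) (simp add: L1_rel_def L1_fun_def)

lemma L1_class_self: "integrable \<mu> f ==> f \<in> L1_class f"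
 by (rule equiv_class_self[OF L1_equiv]) (simp add: L1_fun_def)

lemma L1_classD: "f' \<in> L1_class f ==> integrable \<mu> f' \<and> (AE x in \<mu>. f x = f' x)"
 unfolding L1_rel_def L1_fun_def by simp

lemma L1_class_carrier: "integrable \<mu> f ==> L1_class f \<in> vcarrier (L1_algebra \<mu>)"
 unfolding L1_algebra_def by (auto intro: quotientI simp: L1_fun_def)

lemma L1_carrierE:
 assumes "F \<in> vcarrier (L1_algebra \<mu>)"
 obtains f where "integrable \<mu> f" "F = L1_class f"
 using assms unfolding L1_algebra_def by (auto elim!: quotientE simp: L1_fun_def)

lemma L1_class_binary:
 assumes "integrable \<mu> f" "integrable \<mu> g"
  and "\<And>f' g'. f' \<in> L1_class f ==> g' \<in> L1_class g ==> L1_class (h f' g') = L1_class (h f g)"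
 shows "(\<Union>f'\<in>L1_class f. \<Union>g'\<in>L1_class g. L1_class (h f' g')) = L1_class (h f g)"
proof -
 have "(\<Union>f'\<in>L1_class f. \<Union>g'\<in>L1_class g. L1_class (h f' g')) = (\<Union>f'\<in>L1_class f. \<Union>g'\<in>L1_class g. L1_class (h f g))"
  by (intro SUP_cong refl assms(3))
 also have "\<dots> = L1_class (h f g)" using L1_class_self[OF assms(1)] L1_class_self[OF assms(2)] by blast
 finally show ?thesis .
qed

lemma L1_vadd:
 assumes "integrable \<mu> f" "integrable \<mu> g"
 shows "vadd (L1_algebra \<mu>) (L1_class f) (L1_class g) = L1_class (\<lambda>x. f x + g x)"
proof -
 have "L1_class (\<lambda>x. f' x + g' x) = L1_class (\<lambda>x. f x + g x)" if "f' \<in> L1_class f" "g' \<in> L1_class g" for f' g'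
 proof (rule L1_class_eq)
  show "integrable \<mu> (\<lambda>x. f' x + g' x)" "integrable \<mu> (\<lambda>x. f x + g x)"
   using assms that[THEN L1_classD] by auto
  have "AE x in \<mu>. f x = f' x" "AE x in \<mu>. g x = g' x" using that[THEN L1_classD] by auto
  then show "AE x in \<mu>. f' x + g' x = f x + g x" by eventually_elim simp
 qed
 from L1_class_binary[OF assms, of "\<lambda>f g x. f x + g x", OF this] show ?thesis unfolding L1_algebra_def by simp
qed

lemma L1_vmult:
 assumes "integrable \<mu> f" "integrable \<mu> g"
 shows "vmult (L1_algebra \<mu>) (L1_class f) (L1_class g) = L1_class (convolution \<mu> f g)"
proof -
 have "L1_class (convolution \<mu> f' g') = L1_class (convolution \<mu> f g)" if "f' \<in> L1_class f" "g' \<in> L1_class g" for f' g'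
 proof (rule L1_class_eq)
  have i: "integrable \<mu> f'" "integrable \<mu> g'" using that[THEN L1_classD] by auto
  show "integrable \<mu> (convolution \<mu> f' g')" "integrable \<mu> (convolution \<mu> f g)"
   using L1_convolution(1) assms i by auto
  have "AE x in \<mu>. f' x = f x" "AE x in \<mu>. g' x = g x" using that[THEN L1_classD] by (auto elim: eventually_mono)
  from convolution_cong_AE[OF i(1) assms(1) i(2) assms(2) this]
  show "AE x in \<mu>. convolution \<mu> f' g' x = convolution \<mu> f g x" .
 qed
 from L1_class_binary[OF assms, of "convolution \<mu>", OF this] show ?thesis unfolding L1_algebra_def by simp
qed

lemma L1_vscale:
 assumes "integrable \<mu> f"
 shows "vscale (L1_algebra \<mu>) c (L1_class f) = L1_class (\<lambda>x. c * f x)"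
proof -
 have "L1_class (\<lambda>x. c * f' x) = L1_class (\<lambda>x. c * f x)" if "f' \<in> L1_class f" "g' \<in> L1_class f" for f' g'
 proof (rule L1_class_eq)
  show "integrable \<mu> (\<lambda>x. c * f' x)" "integrable \<mu> (\<lambda>x. c * f x)"
   using assms that[THEN L1_classD] by auto
  have "AE x in \<mu>. f x = f' x" using that[THEN L1_classD] by auto
  then show "AE x in \<mu>. c * f' x = c * f x" by eventually_elim simp
 qed
 then have "(\<Union>f'\<in>L1_class f. L1_class (\<lambda>x. c * f' x)) = (\<Union>f'\<in>L1_class f. L1_class (\<lambda>x. c * f x))"
  by (intro SUP_cong refl)
 also have "\<dots> = L1_class (\<lambda>x. c * f x)" using L1_class_self[OF assms] by blast
 finally show ?thesis unfolding L1_algebra_def by simp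
qed

lemma L1_vnorm:
 assumes "integrable \<mu> f"
 shows "vnorm (L1_algebra \<mu>) (L1_class f) = L1_norm f"
proof -
 have "(\<lambda>f. L1_norm f) ` L1_class f = {L1_norm f}"
 proof (intro equalityI subsetI)
  fix r assume "r \<in> (\<lambda>f. L1_norm f) ` L1_class f"
  then obtain f' where f': "f' \<in> L1_class f" "r = L1_norm f'" by blast
  have "L1_norm f = L1_norm f'" using L1_classD[OF f'(1)] by (intro L1_norm_cong[OF assms]) auto
  then show "r \<in> {L1_norm f}" using f'(2) by simp
 qed (use L1_class_self[OF assms] in auto)
 then show ?thesis unfolding L1_algebra_def by simp
qed

text \<open>A multiplicative functional on functions; its second clause lets it descend to classes.
  The zero functional is included, so nonvanishing is always stated separately.\<close>

definition L1_mult :: "(('g => complex) => complex) => bool" where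
 "L1_mult F \<longleftrightarrow>
   (\<forall>f g c. integrable \<mu> f --> integrable \<mu> g --> F (\<lambda>x. f x + c * g x) = F f + c * F g) \<and>
   (\<forall>f g. integrable \<mu> f --> integrable \<mu> g --> (AE x in \<mu>. f x = g x) --> F f = F g) \<and>
   (\<forall>f g. integrable \<mu> f --> integrable \<mu> g --> F (convolution \<mu> f g) = F f * F g)"

lemma L1_mult_character:
 assumes "\<psi> \<in> characters (L1_algebra \<mu>)"
 shows "L1_mult (\<lambda>f. \<psi> (L1_class f))" and "\<exists>f. integrable \<mu> f \<and> \<psi> (L1_class f) \<noteq> 0"
proof -
 note c = assms[unfolded characters_def linear_functional_def, simplified]
 have add: "\<psi> (L1_class (\<lambda>x. f x + c * g x)) = \<psi> (L1_class f) + c * \<psi> (L1_class g)"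
  if "integrable \<mu> f" "integrable \<mu> g" for f g c
 proof -
  have ig: "integrable \<mu> (\<lambda>x. c * g x)" using that by simp
  have "\<psi> (L1_class (\<lambda>x. f x + c * g x)) = \<psi> (L1_class f) + \<psi> (L1_class (\<lambda>x. c * g x))"
   using c L1_class_carrier[OF that(1)] L1_class_carrier[OF ig] unfolding L1_vadd[OF that(1) ig, symmetric] by blast
  moreover have "\<psi> (L1_class (\<lambda>x. c * g x)) = c * \<psi> (L1_class g)"
   using c L1_class_carrier[OF that(2)] unfolding L1_vscale[OF that(2), symmetric] by blast
  ultimately show ?thesis by simp
 qed
 have mult: "\<psi> (L1_class (convolution \<mu> f g)) = \<psi> (L1_class f) * \<psi> (L1_class g)"
  if "integrable \<mu> f" "integrable \<mu> g" for f g
  using c L1_class_carrier[OF that(1)] L1_class_carrier[OF that(2)] unfolding L1_vmult[OF that, symmetric] by blast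
 show "L1_mult (\<lambda>f. \<psi> (L1_class f))"
  unfolding L1_mult_def
  by (intro conjI allI impI add mult arg_cong[where f = \<psi>] L1_class_eq)
 show "\<exists>f. integrable \<mu> f \<and> \<psi> (L1_class f) \<noteq> 0"
 proof -
  obtain x where x: "x \<in> vcarrier (L1_algebra \<mu>)" "\<psi> x \<noteq> 0" using c by blast
  show ?thesis by (rule L1_carrierE[OF x(1)]) (use x(2) in blast)
 qed
qed

lemma L1_norm_sum:
 assumes "finite I" "\<And>i. i \<in> I ==> integrable \<mu> (f i)"
 shows "L1_norm (\<lambda>x. \<Sum>i\<in>I. c i * f i x) \<le> (\<Sum>i\<in>I. cmod (c i) * L1_norm (f i))"
proof -
 have "L1_norm (\<lambda>x. \<Sum>i\<in>I. c i * f i x) \<le> (LI x. (\<Sum>i\<in>I. cmod (c i) * cmod (f i x)))"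
  using assms(2) by (intro integral_mono integrable_norm Bochner_Integration.integrable_sum sum_norm_le) (auto simp: norm_mult)
 also have "\<dots> = (\<Sum>i\<in>I. cmod (c i) * L1_norm (f i))" using assms by (simp add: Bochner_Integration.integral_sum)
 finally show ?thesis .
qed

text \<open>The Riesz-Fischer argument, for absolutely convergent series only, which is the form in
  which the geometric series of \<open>L1_mult_bound\<close> uses completeness.\<close>

lemma L1_complete:
 fixes a :: "nat => 'g => complex"
 assumes a: "\<And>n. integrable \<mu> (a n)" and s: "summable (\<lambda>n. L1_norm (a n))"
 obtains b where "integrable \<mu> b" "(\<lambda>N. L1_norm (\<lambda>x. b x - (\<Sum>n<N. a n x))) \<longlonglongrightarrow> 0"
proof -
 have "(\<integral>\<^sup>+x. (\<Sum>n. ennreal (cmod (a n x))) \<partial>\<mu>) = (\<Sum>n. \<integral>\<^sup>+x. ennreal (cmod (a n x)) \<partial>\<mu>)"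
  using L1_borel[OF a] by (intro nn_integral_suminf) auto
 also have "\<dots> = (\<Sum>n. ennreal (L1_norm (a n)))" using nn_integral_eq_integral[OF integrable_norm[OF a]] by simp
 also have "\<dots> = ennreal (\<Sum>n. L1_norm (a n))" by (intro suminf_ennreal2 s) simp
 finally have "(\<integral>\<^sup>+x. (\<Sum>n. ennreal (cmod (a n x))) \<partial>\<mu>) \<noteq> \<infinity>" by simp
 then have "AE x in \<mu>. (\<Sum>n. ennreal (cmod (a n x))) \<noteq> \<infinity>"
  using L1_borel[OF a] by (intro nn_integral_noteq_infinite) auto
 then have sx: "AE x in \<mu>. summable (\<lambda>n. cmod (a n x))"
  by eventually_elim (rule summable_suminf_not_top, auto)
 define b where "b = (\<lambda>x. \<Sum>n. a n x)"
 have b: "integrable \<mu> b" unfolding b_def by (rule integrable_suminf[OF a sx s])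
 have le: "L1_norm (\<lambda>x. b x - (\<Sum>n<N. a n x)) \<le> (\<Sum>n. L1_norm (a (n + N)))" for N
 proof -
  have sN: "AE x in \<mu>. summable (\<lambda>n. cmod (a (n + N) x))" using sx
   by eventually_elim (subst summable_iff_shift)
  have sN': "AE x in \<mu>. summable (\<lambda>n. norm (cmod (a (n + N) x)))" using sN by simp
  have s': "summable (\<lambda>n. L1_norm (a (n + N)))" using s by (subst summable_iff_shift)
  have s'': "summable (\<lambda>n. \<integral>x. norm (cmod (a (n + N) x)) \<partial>\<mu>)" using s' by simp
  note int = integrable_suminf[OF integrable_norm[OF a] sN' s'']
  have "L1_norm (\<lambda>x. b x - (\<Sum>n<N. a n x)) \<le> (LI x. (\<Sum>n. cmod (a (n + N) x)))"
  proof (rule integral_mono_AE)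
   show "integrable \<mu> (\<lambda>x. cmod (b x - (\<Sum>n<N. a n x)))" using a b by (intro integrable_norm) auto
   show "integrable \<mu> (\<lambda>x. \<Sum>n. cmod (a (n + N) x))" by (rule int)
   show "AE x in \<mu>. cmod (b x - (\<Sum>n<N. a n x)) \<le> (\<Sum>n. cmod (a (n + N) x))"
    using sx sN
   proof eventually_elim
    case (elim x)
    have "b x - (\<Sum>n<N. a n x) = (\<Sum>n. a (n + N) x)"
     unfolding b_def by (rule suminf_minus_initial_segment[symmetric]) (rule summable_norm_cancel[OF elim(1)])
    then show ?case using summable_norm[OF elim(2)] by simp
   qed
  qed
  also have "\<dots> = (\<Sum>n. L1_norm (a (n + N)))"
   by (rule integral_suminf[OF integrable_norm[OF a] sN' s''])
  finally show ?thesis .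
 qed
 have "(\<lambda>N. \<Sum>n. L1_norm (a (n + N))) \<longlonglongrightarrow> 0"
  using tendsto_diff[OF tendsto_const summable_LIMSEQ[OF s], of "\<Sum>n. L1_norm (a n)"]
  by (simp add: suminf_minus_initial_segment[OF s])
 then have "(\<lambda>N. L1_norm (\<lambda>x. b x - (\<Sum>n<N. a n x))) \<longlonglongrightarrow> 0"
  by (rule tendsto_sandwich[OF always_eventually always_eventually tendsto_const, rotated 2]) (use le in auto)
 with b show thesis by (rule that)
qed

context
 fixes F
 assumes F: "L1_mult F"
begin

lemma L1_mult_linear: "integrable \<mu> f ==> integrable \<mu> g ==> F (\<lambda>x. f x + c * g x) = F f + c * F g"
 and L1_mult_cong: "integrable \<mu> f ==> integrable \<mu> g ==> AE x in \<mu>. f x = g x ==> F f = F g"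
 and L1_mult_mult: "integrable \<mu> f ==> integrable \<mu> g ==> F (convolution \<mu> f g) = F f * F g"
 using F unfolding L1_mult_def by blast+

lemma L1_mult_zero: "F (\<lambda>x. 0) = 0"
 using L1_mult_linear[of "\<lambda>x. 0" "\<lambda>x. 0" "-1"] by simp

lemma L1_mult_scale: "integrable \<mu> g ==> F (\<lambda>x. c * g x) = c * F g"
 using L1_mult_linear[of "\<lambda>x. 0" g c] L1_mult_zero by simp

lemma L1_mult_diff: "integrable \<mu> f ==> integrable \<mu> g ==> F (\<lambda>x. f x - g x) = F f - F g"
 using L1_mult_linear[of f g "-1"] by simp

lemma L1_mult_sum:
 "finite I ==> (\<And>i. i \<in> I ==> integrable \<mu> (f i)) ==> F (\<lambda>x. \<Sum>i\<in>I. c i * f i x) = (\<Sum>i\<in>I. c i * F (f i))"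
proof (induction I rule: finite_induct)
 case empty
 show ?case by (simp add: L1_mult_zero)
next
 case (insert i I)
 have "F (\<lambda>x. \<Sum>i\<in>insert i I. c i * f i x) = F (\<lambda>x. (\<Sum>i\<in>I. c i * f i x) + c i * f i x)"
  using insert by (simp add: add.commute)
 also have "\<dots> = F (\<lambda>x. \<Sum>i\<in>I. c i * f i x) + c i * F (f i)"
  by (rule L1_mult_linear) (use insert in auto)
 finally show ?case using insert by (simp add: add.commute)
qed

text \<open>
 If \<open>F k = 1\<close> and \<open>k\<close> has norm less than \<open>1\<close>, then \<open>b = k + k * k + \<dots>\<close> converges
 and satisfies \<open>k * b = b - k\<close>, which \<open>F\<close> sends to \<open>F b = F b - 1\<close>.
\<close>

lemma L1_mult_bound:
 assumes f: "integrable \<mu> f"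
 shows "cmod (F f) \<le> L1_norm f"
proof (rule ccontr)
 assume "\<not> ?thesis"
 then have lt: "L1_norm f < cmod (F f)" by simp
 have F0: "cmod (F f) > 0" by (rule le_less_trans[OF _ lt]) simp
 define k where "k = (\<lambda>x. inverse (F f) * f x)"
 define r where "r = L1_norm k"
 have k: "integrable \<mu> k" unfolding k_def using f by simp
 have Fk: "F k = 1" unfolding k_def using F0 by (simp add: L1_mult_scale[OF f])
 have "r = L1_norm f / cmod (F f)" unfolding r_def k_def by (simp add: norm_mult norm_inverse divide_inverse mult.commute)
 then have r: "0 \<le> r" "r < 1" using lt F0 by (auto simp: r_def)
 define a where "a = rec_nat k (\<lambda>_. convolution \<mu> k)"
 have a0: "a 0 = k" and aS: "a (Suc n) = convolution \<mu> k (a n)" for n unfolding a_def by simp_all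
 have ai: "integrable \<mu> (a n)" for n by (induction n) (auto simp: a0 aS k L1_convolution(1))
 have an: "L1_norm (a n) \<le> r ^ Suc n" for n
 proof (induction n)
  case 0
  show ?case by (simp add: a0 r_def)
 next
  case (Suc n)
  have "L1_norm (a (Suc n)) \<le> r * L1_norm (a n)" unfolding aS r_def by (rule L1_convolution(2)[OF k ai])
  also have "\<dots> \<le> r * r ^ Suc n" using Suc r by (intro mult_left_mono) auto
  finally show ?case by simp
 qed
 have "summable (\<lambda>n. L1_norm (a n))"
  by (rule summable_comparison_test[of _ "\<lambda>n. r * r ^ n"]) (use an r in \<open>auto intro!: exI[of _ 0] summable_mult summable_geometric\<close>)
 from L1_complete[OF ai this] obtain b where b: "integrable \<mu> b" "(\<lambda>N. L1_norm (\<lambda>x. b x - (\<Sum>n<N. a n x))) \<longlonglongrightarrow> 0" .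
 define s where "s = (\<lambda>N x. \<Sum>n<N. a n x)"
 have si: "integrable \<mu> (s N)" for N unfolding s_def using ai by simp
 \<comment> \<open>Convolution with k shifts the series by one place, so that the first term k is
   missing. The identity holds almost everywhere only, since convolution is additive only where the
   integrals converge.\<close>
 have cs: "AE x in \<mu>. convolution \<mu> k (s N) x = s (Suc N) x - k x" for N
 proof (induction N)
  case 0
  show ?case unfolding s_def convolution_def by (simp add: a0)
 next
  case (Suc N)
  have "s (Suc N) = (\<lambda>x. s N x + 1 * a N x)" unfolding s_def by simp
  with convolution_linear_right[OF k si ai, of N 1 N] Suc show ?case
   by (auto elim!: eventually_elim2 simp: s_def aS)
 qed
 have ckb: "integrable \<mu> (convolution \<mu> k b)" by (rule L1_convolution(1)[OF k b(1)])
 have le: "L1_norm (\<lambda>x. convolution \<mu> k b x - (b x - k x)) \<le> L1_norm (\<lambda>x. b x - s N x) + L1_norm (\<lambda>x. b x - s (Suc N) x)" for N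
 proof -
  define d where "d = (\<lambda>x. b x + (-1) * s N x)"
  have d: "integrable \<mu> d" unfolding d_def using b si by simp
  have "AE x in \<mu>. convolution \<mu> k b x - (b x - k x) = convolution \<mu> k d x - (b x - s (Suc N) x)"
   using convolution_linear_right[OF k b(1) si, of "-1" N, folded d_def] cs[of N] by eventually_elim simp
  then have "L1_norm (\<lambda>x. convolution \<mu> k b x - (b x - k x)) = L1_norm (\<lambda>x. convolution \<mu> k d x - (b x - s (Suc N) x))"
   by (intro L1_norm_cong) (use ckb b k si L1_convolution(1)[OF k d] in auto)
  also have "\<dots> \<le> (LI x. cmod (convolution \<mu> k d x) + cmod (b x - s (Suc N) x))"
   using b si L1_convolution(1)[OF k d] by (intro integral_mono norm_triangle_ineq4) auto
  also have "\<dots> = L1_norm (convolution \<mu> k d) + L1_norm (\<lambda>x. b x - s (Suc N) x)"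
   using b si L1_convolution(1)[OF k d] by simp
  also have "L1_norm (convolution \<mu> k d) \<le> r * L1_norm d" unfolding r_def by (rule L1_convolution(2)[OF k d])
  also have "\<dots> \<le> 1 * L1_norm d" using r by (intro mult_right_mono) auto
  finally show ?thesis by (simp add: d_def)
 qed
 have "(\<lambda>N. L1_norm (\<lambda>x. b x - s N x) + L1_norm (\<lambda>x. b x - s (Suc N) x)) \<longlonglongrightarrow> 0 + 0"
  using b(2) unfolding s_def by (intro tendsto_add) (auto intro: LIMSEQ_Suc simp del: sum.lessThan_Suc)
 then have "L1_norm (\<lambda>x. convolution \<mu> k b x - (b x - k x)) \<le> 0 + 0"
  by (rule LIMSEQ_le_const) (use le in auto)
 then have "AE x in \<mu>. convolution \<mu> k b x - (b x - k x) = 0"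
  by (intro L1_norm_zero_AE) (use ckb b k in auto)
 then have "F (convolution \<mu> k b) = F (\<lambda>x. b x - k x)"
  by (intro L1_mult_cong) (use ckb b k in auto)
 then show False using Fk by (simp add: L1_mult_mult[OF k b(1)] L1_mult_diff[OF b(1) k])
qed

lemma L1_mult_dist:
 assumes "integrable \<mu> f" "integrable \<mu> g"
 shows "cmod (F f - F g) \<le> L1_norm (\<lambda>x. f x - g x)"
 using L1_mult_bound[of "\<lambda>x. f x - g x"] L1_mult_diff[OF assms] assms by simp

end

lemma Cc_dense_L1:
 assumes "integrable \<mu> f" "e > 0"
 obtains h where "h \<in> Cc" "integrable \<mu> h" "L1_norm (\<lambda>x. f x - h x) < e"
proof -
 have "f \<in> Lp_fun 1 \<mu>" unfolding Lp_fun_def using assms(1) L1_borel[OF assms(1)] by simp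
 from Cc_dense[OF _ this assms(2)] obtain h where "h \<in> Cc" "(LI x. cmod (f x - h x) powr 1) < e" by auto
 then show thesis using that[of h] Cc_integrable by simp
qed

lemma L1_mult_nonzero_Cc:
 assumes F: "L1_mult F" and f: "integrable \<mu> f" "F f \<noteq> 0"
 obtains h where "h \<in> Cc" "F h \<noteq> 0"
proof -
 obtain h where h: "h \<in> Cc" "integrable \<mu> h" "L1_norm (\<lambda>x. f x - h x) < cmod (F f)"
  by (rule Cc_dense_L1[OF f(1), of "cmod (F f)"]) (use f in auto)
 have "F h \<noteq> 0" using L1_mult_dist[OF F f(1) h(2)] h(3) by auto
 with h(1) show thesis by (rule that)
qed

lemma L1_norm_compact_le:
 assumes k: "integrable \<mu> k" and T: "compact T" and d: "\<And>x. cmod (k x) \<le> d" "\<And>x. x \<notin> T ==> k x = 0"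
 shows "L1_norm k \<le> d * measure \<mu> T"
proof -
 have "L1_norm k \<le> (LI x. indicator T x *\<^sub>R d)"
  using compact_borel[OF T] emeasure_compact[OF T] d
  by (intro integral_mono integrable_norm[OF k] integrable_indicator) (auto simp: indicator_def)
 also have "\<dots> = d * measure \<mu> T" using compact_borel[OF T] by simp
 finally show ?thesis .
qed

lemma convolution_integrable_Cc:
 assumes f: "integrable \<mu> f" and g: "g \<in> Cc"
 shows "integrable \<mu> (\<lambda>y. f y * g (- y + x))"
proof -
 obtain M where M: "M > 0" "\<And>x. cmod (g x) \<le> M" using Cc_bounded[OF g] by blast
 show ?thesis
 proof (rule Bochner_Integration.integrable_bound[of _ "\<lambda>y. M * cmod (f y)"])
  show "integrable \<mu> (\<lambda>y. M * cmod (f y))" using f by simp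
  show "(\<lambda>y. f y * g (- y + x)) \<in> borel_measurable \<mu>"
   using L1_borel[OF f] reflect_translate_measurable[OF L1_borel[OF Cc_integrable[OF g]], of x] by simp
  show "AE y in \<mu>. norm (f y * g (- y + x)) \<le> norm (M * cmod (f y))"
  proof (intro always_eventually allI)
   fix y
   have "cmod (f y) * cmod (g (- y + x)) \<le> cmod (f y) * M" using M(2) by (intro mult_left_mono) auto
   then show "norm (f y * g (- y + x)) \<le> norm (M * cmod (f y))" using M(1) by (simp add: norm_mult abs_mult mult.commute)
  qed
 qed
qed

text \<open>With total mass 1, k * h - h is the k-average of the differences L_y h - h.
  \<open>U\<close> consists of y for which these are uniformly small and for which the supports stay
  in the compact set \<open>T\<close>, so that a uniform bound becomes a bound in L1.\<close>

lemma approximate_unit_nbhd: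
 assumes h: "h \<in> Cc" and d: "d > 0"
 shows "\<exists>U. open U \<and> 0 \<in> U \<and> (\<forall>k. (\<lambda>x. complex_of_real (k x)) \<in> Cc --> (\<forall>x. 0 \<le> k x) --> (LI x. k x) = 1 -->
   (\<forall>x. x \<notin> U --> k x = 0) --> L1_norm (\<lambda>x. convolution \<mu> (\<lambda>x. complex_of_real (k x)) h x - h x) \<le> d)"
proof -
 from CcE[OF h] obtain K where K: "compact K" "\<And>x. x \<notin> K ==> h x = 0" by blast
 obtain W C where W: "open W" "compact C" "(0::'g) \<in> W" "W \<subseteq> C"
  using compact_neighbourhood[OF open_UNIV UNIV_I, of 0] by metis
 define T where "T = K \<union> (\<lambda>(x, y). x + y) ` (C \<times> K)"
 have T: "compact T" unfolding T_def by (intro compact_Un K compact_add W)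
 define \<delta> where "\<delta> = d / (measure \<mu> T + 1)"
 have mT: "measure \<mu> T + 1 > 0" by (simp add: add_nonneg_pos)
 have \<delta>: "\<delta> > 0" unfolding \<delta>_def using d mT by simp
 obtain V where V: "open V" "0 \<in> V" "\<And>v x. v \<in> V ==> cmod (h (v + x) - h x) < \<delta>"
  using Cc_uniform_left[OF h \<delta>] by blast
 have op: "open (uminus -` V)" by (rule open_vimage[OF V(1)]) (intro continuous_intros)
 show ?thesis
 proof (intro exI[of _ "W \<inter> uminus -` V"] conjI allI impI)
  show "open (W \<inter> uminus -` V)" "0 \<in> W \<inter> uminus -` V" using W V op by auto
  fix k :: "'g => real"
  assume kC: "(\<lambda>x. complex_of_real (k x)) \<in> Cc" and k0: "\<forall>x. 0 \<le> k x" and k1: "(LI x. k x) = 1"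
   and kU: "\<forall>x. x \<notin> W \<inter> uminus -` V --> k x = 0"
  define e where "e = (\<lambda>x. complex_of_real (k x))"
  have ei: "integrable \<mu> e" unfolding e_def by (rule Cc_integrable[OF kC])
  have ki: "integrable \<mu> k" using integrable_Re[OF ei] unfolding e_def by simp
  have hi: "integrable \<mu> h" by (rule Cc_integrable[OF h])
  have ci: "integrable \<mu> (convolution \<mu> e h)" by (rule L1_convolution(1)[OF ei hi])
  have i1: "integrable \<mu> (\<lambda>y. e y * h (- y + x))" for x by (rule convolution_integrable_Cc[OF ei h])
  have diff: "convolution \<mu> e h x - h x = (LI y. e y * (h (- y + x) - h x))" for x
  proof -
   have "(LI y. e y) = 1" unfolding e_def using k1 by simp
   then have "h x = (LI y. e y * h x)" by simp
   then have "convolution \<mu> e h x - h x = (LI y. e y * h (- y + x)) - (LI y. e y * h x)" unfolding convolution_def by simp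
   also have "\<dots> = (LI y. e y * (h (- y + x) - h x))"
    using i1 ei by (subst Bochner_Integration.integral_diff[symmetric]) (auto simp: right_diff_distrib)
   finally show ?thesis .
  qed
  have "L1_norm (\<lambda>x. convolution \<mu> e h x - h x) \<le> \<delta> * measure \<mu> T"
  proof (rule L1_norm_compact_le[OF _ T])
   show "integrable \<mu> (\<lambda>x. convolution \<mu> e h x - h x)" using ci hi by simp
   show "cmod (convolution \<mu> e h x - h x) \<le> \<delta>" for x
   proof -
    have "cmod (convolution \<mu> e h x - h x) \<le> (LI y. k y * \<delta>)"
     unfolding diff
    proof (rule norm_integral_le)
     show "integrable \<mu> (\<lambda>y. e y * (h (- y + x) - h x))"
      unfolding right_diff_distrib by (intro Bochner_Integration.integrable_diff i1 integrable_mult_left ei)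
     show "integrable \<mu> (\<lambda>y. k y * \<delta>)" using ki by simp
     show "norm (e y * (h (- y + x) - h x)) \<le> k y * \<delta>" for y
     proof (cases "y \<in> W \<inter> uminus -` V")
      case True
      then have "k y * cmod (h (- y + x) - h x) \<le> k y * \<delta>"
       using V(3)[of "- y" x] k0 by (intro mult_left_mono) auto
      then show ?thesis using k0 by (simp add: e_def norm_mult)
     next
      case False
      then show ?thesis using kU by (simp add: e_def)
     qed
    qed
    then show ?thesis using k1 by simp
   qed
   show "convolution \<mu> e h x - h x = 0" if "x \<notin> T" for x
   proof -
    have z: "e y * (h (- y + x) - h x) = 0" for y
    proof (cases "y \<in> C")
     case True
     have "- y + x \<notin> K"
     proof
      assume "- y + x \<in> K"
      then have "y + (- y + x) \<in> T" unfolding T_def using True by force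
      then show False using that by simp
     qed
     then show ?thesis using K(2) that unfolding T_def by simp
    next
     case False
     then show ?thesis using kU W unfolding e_def by auto
    qed
    show ?thesis by (simp only: diff z Bochner_Integration.integral_zero)
   qed
  qed
  also have "\<dots> \<le> \<delta> * (measure \<mu> T + 1)" using \<delta> by (intro mult_left_mono) auto
  also have "\<dots> = d" unfolding \<delta>_def using mT by simp
  finally show "L1_norm (\<lambda>x. convolution \<mu> (\<lambda>x. complex_of_real (k x)) h x - h x) \<le> d" unfolding e_def .
 qed
qed

lemma approximate_unit:
 assumes H: "finite H" "H \<subseteq> Cc" and d: "d > 0"
 obtains e where "e \<in> Cc" "integrable \<mu> e" "L1_norm e = 1" "\<And>h. h \<in> H ==> L1_norm (\<lambda>x. convolution \<mu> e h x - h x) \<le> d"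
proof -
 have "\<forall>h. \<exists>U. h \<in> H --> open U \<and> 0 \<in> U \<and> (\<forall>k. (\<lambda>x. complex_of_real (k x)) \<in> Cc --> (\<forall>x. 0 \<le> k x) --> (LI x. k x) = 1 -->
   (\<forall>x. x \<notin> U --> k x = 0) --> L1_norm (\<lambda>x. convolution \<mu> (\<lambda>x. complex_of_real (k x)) h x - h x) \<le> d)"
  using approximate_unit_nbhd[OF _ d] H(2) by (meson subsetD)
 from choice[OF this] obtain U where U: "\<forall>h. h \<in> H --> open (U h) \<and> 0 \<in> U h \<and> (\<forall>k. (\<lambda>x. complex_of_real (k x)) \<in> Cc --> (\<forall>x. 0 \<le> k x) --> (LI x. k x) = 1 -->
   (\<forall>x. x \<notin> U h --> k x = 0) --> L1_norm (\<lambda>x. convolution \<mu> (\<lambda>x. complex_of_real (k x)) h x - h x) \<le> d)" by (rule exE)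
 have op: "open (\<Inter>h\<in>H. U h)" "0 \<in> (\<Inter>h\<in>H. U h)" using U H(1) by (auto intro!: open_INT)
 obtain k :: "'g => real" where k: "(\<lambda>x. complex_of_real (k x)) \<in> Cc" "\<And>x. 0 \<le> k x" "(LI x. k x) = 1"
  "\<And>x. x \<notin> (\<Inter>h\<in>H. U h) ==> k x = 0" by (rule Cc_unit_mass[OF op]) (rule that)
 show thesis
 proof (rule that)
  show "(\<lambda>x. complex_of_real (k x)) \<in> Cc" "integrable \<mu> (\<lambda>x. complex_of_real (k x))" using k(1) Cc_integrable by auto
  show "L1_norm (\<lambda>x. complex_of_real (k x)) = 1" using k(2,3) by simp
  fix h assume h: "h \<in> H"
  have "\<forall>x. x \<notin> U h --> k x = 0" using k(4) h by blast
  then show "L1_norm (\<lambda>x. convolution \<mu> (\<lambda>x. complex_of_real (k x)) h x - h x) \<le> d"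
   using U[rule_format, OF h] k(1,2,3) by blast
 qed
qed

end

section \<open>Translation factors of characters of the group algebra\<close>

context haar
begin

lemma left_translate_L1:
 assumes "integrable \<mu> f"
 shows "integrable \<mu> (left_translate x f)" "L1_norm (left_translate x f) = L1_norm f"
 using integrable_translate[OF assms, of "- x"] integral_translate[of "\<lambda>y. cmod (f y)" "- x"]
 unfolding left_translate_def by auto

lemma convolution_left_translate:
 "convolution \<mu> (left_translate x f) g = left_translate x (convolution \<mu> f g)"
proof
 fix z
 have "convolution \<mu> (left_translate x f) g z = (LI y. f (- x + (x + y)) * g (- (x + y) + z))"
  unfolding convolution_def left_translate_def
  using integral_translate[of "\<lambda>y. f (- x + y) * g (- y + z)" x] by simp
 then show "convolution \<mu> (left_translate x f) g z = left_translate x (convolution \<mu> f g) z"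
  unfolding convolution_def left_translate_def by (simp add: diff_conv_add_uminus minus_add add.assoc del: add_uminus_conv_diff)
qed

lemma left_translate_diff:
 "left_translate x (\<lambda>y. f y - g y) = (\<lambda>y. left_translate x f y - left_translate x g y)"
 unfolding left_translate_def by simp

text \<open>Fix h with F h \<noteq> 0. If e * h is close to h in L1, then F e * F h is close to F h
  and division by F h brings F e close to 1. The tolerance \<open>d\<close> accounts for the sizes
  of the finitely many F h.\<close>

lemma L1_mult_approximate_unit:
 assumes S: "finite S" "\<And>F. F \<in> S ==> L1_mult F" "\<And>F. F \<in> S ==> \<exists>f. integrable \<mu> f \<and> F f \<noteq> 0" and \<epsilon>: "\<epsilon> > 0"
 obtains e where "e \<in> Cc" "integrable \<mu> e" "L1_norm e = 1" "\<And>F. F \<in> S ==> cmod (F e - 1) \<le> \<epsilon>"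
proof -
 have "\<forall>F. \<exists>h. F \<in> S --> h \<in> Cc \<and> F h \<noteq> 0"
 proof
  fix F
  show "\<exists>h. F \<in> S --> h \<in> Cc \<and> F h \<noteq> 0"
  proof (cases "F \<in> S")
   case True
   then obtain f where f: "integrable \<mu> f" "F f \<noteq> 0" using S(3) by blast
   show ?thesis by (rule L1_mult_nonzero_Cc[OF S(2)[OF True] f]) blast
  qed simp
 qed
 from choice[OF this] obtain h where h: "\<forall>F. F \<in> S --> h F \<in> Cc \<and> F (h F) \<noteq> 0" by (rule exE)
 define d where "d = Min (insert 1 ((\<lambda>F. \<epsilon> * cmod (F (h F))) ` S))"
 have d: "d > 0" unfolding d_def using S(1) h \<epsilon> by simp
 have dle: "d \<le> \<epsilon> * cmod (F (h F))" if "F \<in> S" for F unfolding d_def using S(1) that by (intro Min_le) auto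
 have H: "finite (h ` S)" "h ` S \<subseteq> Cc" using S(1) h by auto
 show thesis
 proof (rule approximate_unit[OF H d])
  fix e assume e: "e \<in> Cc" "integrable \<mu> e" "L1_norm e = 1"
   and eh: "\<And>k. k \<in> h ` S ==> L1_norm (\<lambda>x. convolution \<mu> e k x - k x) \<le> d"
  have "cmod (F e - 1) \<le> \<epsilon>" if Fs: "F \<in> S" for F
  proof -
   have hF: "integrable \<mu> (h F)" "F (h F) \<noteq> 0" using h Fs Cc_integrable by auto
   have "cmod (F (convolution \<mu> e (h F)) - F (h F)) \<le> L1_norm (\<lambda>x. convolution \<mu> e (h F) x - h F x)"
    by (rule L1_mult_dist[OF S(2)[OF Fs] L1_convolution(1)[OF e(2) hF(1)] hF(1)])
   also have "\<dots> \<le> \<epsilon> * cmod (F (h F))" using eh[of "h F"] dle[OF Fs] Fs by simp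
   finally have "cmod ((F e - 1) * F (h F)) \<le> \<epsilon> * cmod (F (h F))"
    by (simp add: L1_mult_mult[OF S(2)[OF Fs] e(2) hF(1)] left_diff_distrib)
   then show ?thesis using hF(2) by (simp add: norm_mult)
  qed
  with e show thesis by (rule that)
 qed
qed

text \<open>For an approximate unit e, L_x (e * h) = (L_x e) * h shows that F (L_x h) is close to F
  (L_x e) F h. The factor F (L_x e) is common to f and g, so the ratio of F (L_x h) to F h is the
  same for both.\<close>

lemma L1_mult_translate_commute:
 assumes F: "L1_mult F" and f: "f \<in> Cc" and g: "g \<in> Cc"
 shows "F (left_translate x f) * F g = F (left_translate x g) * F f"
proof -
 have fi: "integrable \<mu> f" and gi: "integrable \<mu> g" using f g Cc_integrable by auto
 have "cmod (F (left_translate x f) * F g - F (left_translate x g) * F f) \<le> d * (cmod (F g) + cmod (F f))" if d: "d > 0" for d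
 proof -
  have fg: "finite {f, g}" "{f, g} \<subseteq> Cc" using f g by auto
  obtain e where e: "e \<in> Cc" "integrable \<mu> e" "\<And>h. h \<in> {f, g} ==> L1_norm (\<lambda>x. convolution \<mu> e h x - h x) \<le> d"
   by (rule approximate_unit[OF fg d]) blast
  have ap: "cmod (F (left_translate x h) - F (left_translate x e) * F h) \<le> d" if h: "h \<in> {f, g}" for h
  proof -
   have hi: "integrable \<mu> h" using h fi gi by auto
   have c: "integrable \<mu> (convolution \<mu> e h)" by (rule L1_convolution(1)[OF e(2) hi])
   have "F (left_translate x e) * F h = F (left_translate x (convolution \<mu> e h))"
    using L1_mult_mult[OF F left_translate_L1(1)[OF e(2)] hi] by (simp add: convolution_left_translate)
   then have "cmod (F (left_translate x h) - F (left_translate x e) * F h) =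
     cmod (F (left_translate x (convolution \<mu> e h)) - F (left_translate x h))" by (simp add: norm_minus_commute)
   also have "\<dots> \<le> L1_norm (left_translate x (\<lambda>y. convolution \<mu> e h y - h y))"
    unfolding left_translate_diff by (rule L1_mult_dist[OF F left_translate_L1(1)[OF c] left_translate_L1(1)[OF hi]])
   also have "\<dots> \<le> d" using e(3)[OF h] left_translate_L1(2)[of "\<lambda>y. convolution \<mu> e h y - h y"] c hi by simp
   finally show ?thesis .
  qed
  have "F (left_translate x f) * F g - F (left_translate x g) * F f =
    (F (left_translate x f) - F (left_translate x e) * F f) * F g - (F (left_translate x g) - F (left_translate x e) * F g) * F f"
   by (simp add: algebra_simps)
  also have "cmod \<dots> \<le> d * cmod (F g) + d * cmod (F f)"
   by (rule order_trans[OF norm_triangle_ineq4]) (auto simp: norm_mult intro!: add_mono mult_right_mono ap)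
  finally show ?thesis by (simp add: distrib_left)
 qed
 note bd = this
 have "cmod (F (left_translate x f) * F g - F (left_translate x g) * F f) \<le> 0"
 proof (rule field_le_epsilon)
  fix e :: real assume e: "e > 0"
  have p: "cmod (F g) + cmod (F f) + 1 > 0" by (simp add: add_nonneg_pos)
  have "cmod (F (left_translate x f) * F g - F (left_translate x g) * F f) \<le> e / (cmod (F g) + cmod (F f) + 1) * (cmod (F g) + cmod (F f))"
   by (rule bd) (use e p in simp)
  also have "\<dots> \<le> e / (cmod (F g) + cmod (F f) + 1) * (cmod (F g) + cmod (F f) + 1)" using e p by (intro mult_left_mono) auto
  also have "\<dots> = e" using p by simp
  finally show "cmod (F (left_translate x f) * F g - F (left_translate x g) * F f) \<le> 0 + e" by simp
 qed
 then show ?thesis by simp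
qed

text \<open>The factor is defined by one test function and is independent of it by the commutation
  above. Iterated translates keep their norm, so a factor of modulus above 1 would make F unbounded;
  the inverse element gives the opposite inequality.\<close>

lemma L1_mult_translation_character:
 assumes F: "L1_mult F" and F0: "integrable \<mu> f0" "F f0 \<noteq> 0"
 obtains \<xi> where "\<And>x f. integrable \<mu> f ==> F (left_translate x f) = \<xi> x * F f" "\<And>x. cmod (\<xi> x) = 1"
proof -
 obtain h0 where h0: "h0 \<in> Cc" "F h0 \<noteq> 0" by (rule L1_mult_nonzero_Cc[OF F F0])
 define \<xi> where "\<xi> = (\<lambda>x. F (left_translate x h0) / F h0)"
 have Cc: "F (left_translate x f) = \<xi> x * F f" if "f \<in> Cc" for x f
  using L1_mult_translate_commute[OF F that h0(1), of x] h0(2) unfolding \<xi>_def by (simp add: field_simps)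
 have tr: "F (left_translate x f) = \<xi> x * F f" if f: "integrable \<mu> f" for x f
 proof -
  have "cmod (F (left_translate x f) - \<xi> x * F f) \<le> 0"
  proof (rule field_le_epsilon)
   fix e :: real assume e: "e > 0"
   define d where "d = e / (1 + cmod (\<xi> x))"
   have p: "1 + cmod (\<xi> x) > 0" by (simp add: add_pos_nonneg)
   have d: "d > 0" unfolding d_def using e p by simp
   obtain h where h: "h \<in> Cc" "integrable \<mu> h" "L1_norm (\<lambda>x. f x - h x) < d" by (rule Cc_dense_L1[OF f d])
   have "F (left_translate x f) - \<xi> x * F f = (F (left_translate x f) - F (left_translate x h)) - \<xi> x * (F f - F h)"
    using Cc[OF h(1)] by (simp add: algebra_simps)
   also have "cmod \<dots> \<le> cmod (F (left_translate x f) - F (left_translate x h)) + cmod (\<xi> x) * cmod (F f - F h)"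
    by (rule order_trans[OF norm_triangle_ineq4]) (simp add: norm_mult)
   also have "\<dots> \<le> L1_norm (left_translate x (\<lambda>y. f y - h y)) + cmod (\<xi> x) * L1_norm (\<lambda>y. f y - h y)"
    unfolding left_translate_diff using f h(2) left_translate_L1(1)
    by (intro add_mono mult_left_mono L1_mult_dist[OF F]) auto
   also have "\<dots> = (1 + cmod (\<xi> x)) * L1_norm (\<lambda>y. f y - h y)"
    using left_translate_L1(2)[of "\<lambda>y. f y - h y" x] f h(2) by (simp add: distrib_right)
   also have "\<dots> \<le> (1 + cmod (\<xi> x)) * d" using h(3) p by (intro mult_left_mono) auto
   also have "\<dots> = e" unfolding d_def using p by simp
   finally show "cmod (F (left_translate x f) - \<xi> x * F f) \<le> 0 + e" by simp
  qed
  then show ?thesis by simp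
 qed
 have hi: "integrable \<mu> h0" by (rule Cc_integrable[OF h0(1)])
 have it: "integrable \<mu> ((left_translate x ^^ n) h0) \<and> L1_norm ((left_translate x ^^ n) h0) = L1_norm h0 \<and>
   F ((left_translate x ^^ n) h0) = \<xi> x ^ n * F h0" for n x
  by (induction n) (auto simp: hi left_translate_L1 tr)
 have le1: "cmod (\<xi> x) \<le> 1" for x
 proof (rule ccontr)
  assume "\<not> ?thesis"
  then obtain n where n: "L1_norm h0 / cmod (F h0) < cmod (\<xi> x) ^ n" using real_arch_pow[of "cmod (\<xi> x)"] by auto
  have "cmod (\<xi> x) ^ n * cmod (F h0) \<le> L1_norm h0"
   using L1_mult_bound[OF F, of "(left_translate x ^^ n) h0"] it[of n x] by (simp add: norm_mult norm_power)
  then show False using n h0(2) by (simp add: field_simps)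
 qed
 have "cmod (\<xi> x) = 1" for x
 proof -
  have "left_translate (- x) (left_translate x h0) = h0" unfolding left_translate_def by simp
  then have "\<xi> (- x) * \<xi> x * F h0 = F h0" using tr[OF left_translate_L1(1)[OF hi], of "- x" x] tr[OF hi, of x] by simp
  then have "cmod (\<xi> (- x)) * cmod (\<xi> x) = 1" using h0(2) by (simp flip: norm_mult)
  moreover have "cmod (\<xi> (- x)) * cmod (\<xi> x) \<le> 1 * cmod (\<xi> x)" using le1 by (intro mult_right_mono) auto
  ultimately show ?thesis using le1[of x] by simp
 qed
 with tr show thesis by (rule that)
qed

text \<open>f * g is the integral of f(y) L_y g over y, and a selector replaces y by finitely many
  values. These values lie in the support set \<open>K\<close>, so that the approximating sum stays
  within the same compact set \<open>C\<close>. Translation factors thereby determine a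
  functional.\<close>

lemma convolution_Riemann_sum:
 assumes f: "f \<in> Cc" and g: "g \<in> Cc" and d: "d > 0"
 obtains T :: "'g set" and w where "finite T" "L1_norm (\<lambda>x. convolution \<mu> f g x - (\<Sum>t\<in>T. w t * left_translate t g x)) \<le> d"
proof -
 from CcE[OF f] obtain K where K: "compact K" "\<And>x. x \<notin> K ==> f x = 0" by blast
 from CcE[OF g] obtain L where L: "compact L" "\<And>x. x \<notin> L ==> g x = 0" by blast
 have fi: "integrable \<mu> f" and gi: "integrable \<mu> g" using f g Cc_integrable by auto
 define C where "C = (\<lambda>(x, y). x + y) ` (K \<times> L)"
 have C: "compact C" unfolding C_def by (intro compact_add K L)
 define \<delta> where "\<delta> = d / ((L1_norm f + 1) * (measure \<mu> C + 1))"
 have p: "L1_norm f + 1 > 0" "measure \<mu> C + 1 > 0" by (simp_all add: add_nonneg_pos)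
 have \<delta>: "\<delta> > 0" unfolding \<delta>_def using d p by simp
 obtain V where V: "open V" "0 \<in> V" "\<And>v x. v \<in> V ==> cmod (g (v + x) - g x) < \<delta>"
  using Cc_uniform_left[OF g \<delta>] by blast
 have op: "open (uminus -` V)" by (rule open_vimage[OF V(1)]) (intro continuous_intros)
 have V0: "0 \<in> uminus -` V" using V(2) by simp
 obtain \<tau> where \<tau>: "finite (range \<tau>)" "\<And>y. {t. \<tau> t = y} \<in> sets borel"
  "\<And>t. t \<in> K ==> - \<tau> t + t \<in> uminus -` V" "\<And>t. t \<in> K ==> \<tau> t \<in> K"
  by (rule borel_selector[OF K(1) op V0]) blast
 define w where "w = (\<lambda>t. \<integral>y. indicator {y. \<tau> y = t} y *\<^sub>R f y \<partial>\<mu>)"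
 have wi: "integrable \<mu> (\<lambda>y. indicator {y. \<tau> y = t} y *\<^sub>R f y)" for t
  by (rule integrable_mult_indicator[OF _ fi]) (use \<tau>(2) in simp)
 have step: "f y * g (- \<tau> y + x) = (\<Sum>t\<in>range \<tau>. (indicator {y. \<tau> y = t} y *\<^sub>R f y) * g (- t + x))" for x y
 proof -
  have "(\<Sum>t\<in>range \<tau>. (indicator {y. \<tau> y = t} y *\<^sub>R f y) * g (- t + x)) = (\<Sum>t\<in>range \<tau>. if t = \<tau> y then f y * g (- \<tau> y + x) else 0)"
   by (intro sum.cong) (auto simp: indicator_def)
  then show ?thesis using \<tau>(1) by simp
 qed
 have i2: "integrable \<mu> (\<lambda>y. f y * g (- \<tau> y + x))" for x
  unfolding step using wi by (intro Bochner_Integration.integrable_sum integrable_mult_left) auto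
 have sum: "(\<Sum>t\<in>range \<tau>. w t * left_translate t g x) = (LI y. f y * g (- \<tau> y + x))" for x
  unfolding step w_def left_translate_def
  by (subst Bochner_Integration.integral_sum, rule integrable_mult_left, rule wi) (simp only: integral_mult_left_zero)
 have i1: "integrable \<mu> (\<lambda>y. f y * g (- y + x))" for x by (rule convolution_integrable_Cc[OF fi g])
 have diff: "convolution \<mu> f g x - (\<Sum>t\<in>range \<tau>. w t * left_translate t g x) = (LI y. f y * (g (- y + x) - g (- \<tau> y + x)))" for x
  unfolding sum convolution_def using i1 i2
  by (subst Bochner_Integration.integral_diff[symmetric]) (auto simp: right_diff_distrib)
 have "L1_norm (\<lambda>x. convolution \<mu> f g x - (\<Sum>t\<in>range \<tau>. w t * left_translate t g x)) \<le> (L1_norm f * \<delta>) * measure \<mu> C"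
 proof (rule L1_norm_compact_le[OF _ C])
  show "integrable \<mu> (\<lambda>x. convolution \<mu> f g x - (\<Sum>t\<in>range \<tau>. w t * left_translate t g x))"
   using L1_convolution(1)[OF fi gi] left_translate_L1(1)[OF gi]
   by (intro Bochner_Integration.integrable_diff Bochner_Integration.integrable_sum integrable_mult_right) auto
  show "cmod (convolution \<mu> f g x - (\<Sum>t\<in>range \<tau>. w t * left_translate t g x)) \<le> L1_norm f * \<delta>" for x
  proof -
   have "cmod (convolution \<mu> f g x - (\<Sum>t\<in>range \<tau>. w t * left_translate t g x)) \<le> (LI y. cmod (f y) * \<delta>)"
    unfolding diff
   proof (rule norm_integral_le)
    show "integrable \<mu> (\<lambda>y. f y * (g (- y + x) - g (- \<tau> y + x)))"
     using i1 i2 unfolding right_diff_distrib by (rule Bochner_Integration.integrable_diff)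
    show "integrable \<mu> (\<lambda>y. cmod (f y) * \<delta>)" using fi by simp
    show "norm (f y * (g (- y + x) - g (- \<tau> y + x))) \<le> cmod (f y) * \<delta>" for y
    proof (cases "y \<in> K")
     case True
     have "- (- \<tau> y + y) + (- \<tau> y + x) = - y + x" by (simp add: minus_add add.assoc)
     then have "cmod (g (- y + x) - g (- \<tau> y + x)) < \<delta>"
      using V(3)[of "- (- \<tau> y + y)" "- \<tau> y + x"] \<tau>(3)[OF True] by simp
     then show ?thesis by (auto simp: norm_mult intro!: mult_left_mono)
    qed (simp add: K(2))
   qed
   then show ?thesis by simp
  qed
  show "convolution \<mu> f g x - (\<Sum>t\<in>range \<tau>. w t * left_translate t g x) = 0" if "x \<notin> C" for x
  proof -
   have z: "g (- y + x) = 0" if y: "y \<in> K" for y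
   proof (rule L(2), rule notI)
    assume "- y + x \<in> L"
    then have "y + (- y + x) \<in> C" unfolding C_def using y by force
    then show False using \<open>x \<notin> C\<close> by simp
   qed
   have z': "f y * (g (- y + x) - g (- \<tau> y + x)) = 0" for y
    using z[of y] z[of "\<tau> y"] \<tau>(4)[of y] K(2)[of y] by (cases "y \<in> K") auto
   show ?thesis by (simp only: diff z' Bochner_Integration.integral_zero)
  qed
 qed
 also have "\<dots> \<le> ((L1_norm f + 1) * \<delta>) * (measure \<mu> C + 1)" using \<delta> by (intro mult_mono) auto
 also have "\<dots> = d"
 proof -
  have "a * (d / (a * b)) * b = d" if "a > 0" "b > 0" for a b :: real using that by simp
  from this[OF p] show ?thesis unfolding \<delta>_def .
 qed
 finally show thesis by (rule that[OF \<tau>(1)])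
qed

text \<open>Approximating h * g by translates of g gives X h * X g close to W * X g with a number W
  that depends only on the common factor \<xi>. A test function g with |X g| \<ge> 1/2 for both
  functionals allows division, and both values at h are close to W.\<close>

lemma L1_mult_eqI:
 assumes F: "L1_mult F" "integrable \<mu> f0" "F f0 \<noteq> 0" and H: "L1_mult H" "integrable \<mu> h0" "H h0 \<noteq> 0"
  and \<xi>F: "\<And>x f. integrable \<mu> f ==> F (left_translate x f) = \<xi> x * F f"
  and \<xi>H: "\<And>x f. integrable \<mu> f ==> H (left_translate x f) = \<xi> x * H f"
  and f: "integrable \<mu> f"
 shows "F f = H f"
proof -
 have "\<exists>f. integrable \<mu> f \<and> X f \<noteq> 0" "L1_mult X" if "X \<in> {F, H}" for X using F H that by blast+
 then obtain g where g: "g \<in> Cc" "integrable \<mu> g" "\<And>X. X \<in> {F, H} ==> cmod (X g - 1) \<le> 1 / 2"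
  using L1_mult_approximate_unit[of "{F, H}" "1 / 2" thesis] by (simp add: that)
 have nz: "cmod (X g) \<ge> 1 / 2" if "X \<in> {F, H}" for X
  using g(3)[OF that] norm_triangle_ineq4[of "X g" "X g - 1"] by simp
 have Cc: "F h = H h" if h: "h \<in> Cc" for h
 proof -
  have hi: "integrable \<mu> h" by (rule Cc_integrable[OF h])
  have "cmod (F h - H h) \<le> 0"
  proof (rule field_le_epsilon)
   fix e :: real assume e: "e > 0"
   then have e4: "e / 4 > 0" by simp
   obtain T w where T: "finite T" "L1_norm (\<lambda>x. convolution \<mu> h g x - (\<Sum>t\<in>T. w t * left_translate t g x)) \<le> e / 4"
    by (rule convolution_Riemann_sum[OF h g(1) e4])
   define W where "W = (\<Sum>t\<in>T. w t * \<xi> t)"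
   have ap: "cmod (X h - W) \<le> e / 2" if X: "X \<in> {F, H}" for X
   proof -
    have XM: "L1_mult X" using X F H by blast
    have tr: "X (left_translate x g) = \<xi> x * X g" for x using X \<xi>F[OF g(2)] \<xi>H[OF g(2)] by blast
    have si: "integrable \<mu> (\<lambda>x. \<Sum>t\<in>T. w t * left_translate t g x)"
     using left_translate_L1(1)[OF g(2)] by (intro Bochner_Integration.integrable_sum integrable_mult_right) auto
    have "X (\<lambda>x. \<Sum>t\<in>T. w t * left_translate t g x) = (\<Sum>t\<in>T. w t * X (left_translate t g))"
     by (rule L1_mult_sum[OF XM T(1)]) (rule left_translate_L1(1)[OF g(2)])
    also have "\<dots> = W * X g" unfolding W_def tr by (simp add: sum_distrib_right mult.assoc)
    finally have "cmod (X h * X g - W * X g) \<le> e / 4"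
     using L1_mult_dist[OF XM L1_convolution(1)[OF hi g(2)] si] T(2) by (simp add: L1_mult_mult[OF XM hi g(2)])
    then have "cmod (X h - W) * cmod (X g) \<le> e / 4" by (simp add: norm_mult flip: left_diff_distrib)
    moreover have "cmod (X h - W) * (1 / 2) \<le> cmod (X h - W) * cmod (X g)" using nz[OF X] by (intro mult_left_mono) auto
    ultimately show ?thesis by simp
   qed
   show "cmod (F h - H h) \<le> 0 + e"
    using ap[of F] ap[of H] norm_triangle_ineq4[of "F h - W" "H h - W"] by simp
  qed
  then show ?thesis by simp
 qed
 have "cmod (F f - H f) \<le> 0"
 proof (rule field_le_epsilon)
  fix e :: real assume e: "e > 0"
  then have e2: "e / 2 > 0" by simp
  obtain h where h: "h \<in> Cc" "integrable \<mu> h" "L1_norm (\<lambda>x. f x - h x) < e / 2" by (rule Cc_dense_L1[OF f e2])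
  show "cmod (F f - H f) \<le> 0 + e"
   using L1_mult_dist[OF F(1) f h(2)] L1_mult_dist[OF H(1) f h(2)] h(3) Cc[OF h(1)]
    norm_triangle_ineq4[of "F f - F h" "H f - H h"] by simp
 qed
 then show ?thesis by simp
qed

text \<open>
 Averaging the translates of \<open>f\<close>, weighted by the powers of \<open>cnj (\<xi> x)\<close>, fixes the value of
 the character with translation factor \<open>\<xi>\<close> and makes every other value small.
\<close>

lemma L1_mult_average:
 assumes F: "L1_mult \<Phi>" and f: "integrable \<mu> f" and \<xi>: "\<And>f. integrable \<mu> f ==> \<Phi> (left_translate x f) = c * \<Phi> f" "cmod c = 1"
  and \<delta>: "\<delta> > 0" and z: "cmod z = 1" "z \<noteq> c"
 obtains r where "integrable \<mu> r" "L1_norm r \<le> L1_norm f" "\<Phi> r = \<Phi> f"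
  "\<And>F z'. L1_mult F ==> cmod z' = 1 ==> (\<And>f. integrable \<mu> f ==> F (left_translate x f) = z' * F f) ==> cmod (F r) \<le> cmod (F f)"
  "\<And>F. L1_mult F ==> (\<And>f. integrable \<mu> f ==> F (left_translate x f) = z * F f) ==> cmod (F r) < \<delta>"
proof -
 have cc: "cnj c * c = 1" using \<xi>(2) by (simp add: complex_norm_square[symmetric] mult.commute)
 define u where "u = cnj c * z"
 have u1: "u \<noteq> 1"
 proof
  assume "u = 1"
  then have "c * (cnj c * z) = c" unfolding u_def by simp
  moreover have "c * (cnj c * z) = (cnj c * c) * z" by (simp only: mult_ac)
  ultimately show False using z(2) unfolding cc by simp
 qed
 \<comment> \<open>Since u \<noteq> 1 has modulus 1, the geometric sum is bounded by 2 / |u - 1| for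
   every number of terms; dividing by a large n makes the mean small. The successor taken next keeps
   n positive.\<close>
 obtain n0 :: nat where n0: "2 / cmod (u - 1) * L1_norm f / \<delta> < real n0" using reals_Archimedean2 by blast
 define n where "n = Suc n0"
 have n: "2 / cmod (u - 1) * L1_norm f < \<delta> * real n"
 proof -
  have "2 / cmod (u - 1) * L1_norm f < \<delta> * real n0" using n0 \<delta> by (simp only: pos_divide_less_eq mult.commute)
  also have "\<dots> \<le> \<delta> * real n" unfolding n_def using \<delta> by (intro mult_left_mono) auto
  finally show ?thesis .
 qed
 have it: "integrable \<mu> ((left_translate x ^^ j) f) \<and> L1_norm ((left_translate x ^^ j) f) = L1_norm f" for j
  by (induction j) (auto simp: f left_translate_L1)
 define r where "r = (\<lambda>y. \<Sum>j<n. (cnj c ^ j / of_nat n) * (left_translate x ^^ j) f y)"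
 have ri: "integrable \<mu> r" unfolding r_def using it by (intro Bochner_Integration.integrable_sum integrable_mult_right) auto
 have "L1_norm r \<le> (\<Sum>j<n. cmod (cnj c ^ j / of_nat n) * L1_norm ((left_translate x ^^ j) f))"
  unfolding r_def by (rule L1_norm_sum) (use it in auto)
 also have "\<dots> = (\<Sum>j<n. (1 / real n) * L1_norm f)" using it \<xi>(2) by (simp add: norm_divide norm_power)
 also have "\<dots> = L1_norm f" unfolding n_def by simp
 finally have rn: "L1_norm r \<le> L1_norm f" .
 have val: "F r = (\<Sum>j<n. (cnj c * z') ^ j) / of_nat n * F f"
  if "L1_mult F" and tr: "\<And>f. integrable \<mu> f ==> F (left_translate x f) = z' * F f" for F z'
 proof -
  have j: "F ((left_translate x ^^ j) f) = z' ^ j * F f" for j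
   by (induction j) (use it tr in auto)
  have "F r = (\<Sum>j<n. (cnj c ^ j / of_nat n) * F ((left_translate x ^^ j) f))"
   unfolding r_def by (rule L1_mult_sum[OF that(1)]) (use it in auto)
  also have "\<dots> = (\<Sum>j<n. (cnj c * z') ^ j / of_nat n * F f)" unfolding j by (simp add: power_mult_distrib mult.assoc)
  finally show ?thesis by (simp add: sum_distrib_right sum_divide_distrib)
 qed
 show thesis
 proof (rule that[OF ri rn])
  have "n > 0" unfolding n_def by simp
  then show "\<Phi> r = \<Phi> f" using val[OF F \<xi>(1)] by (simp add: cc)
  show "cmod (F r) \<le> cmod (F f)" if "L1_mult F" "cmod z' = 1" "\<And>f. integrable \<mu> f ==> F (left_translate x f) = z' * F f" for F z'
  proof -
   have "cmod (\<Sum>j<n. (cnj c * z') ^ j) \<le> (\<Sum>j<n. 1)" by (rule sum_norm_le) (simp add: norm_power norm_mult \<xi>(2) that(2))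
   then have "cmod ((\<Sum>j<n. (cnj c * z') ^ j) / of_nat n) \<le> 1" using \<open>n > 0\<close> by (simp add: norm_divide)
   then have "cmod ((\<Sum>j<n. (cnj c * z') ^ j) / of_nat n) * cmod (F f) \<le> 1 * cmod (F f)" by (intro mult_right_mono) auto
   then have "cmod ((\<Sum>j<n. (cnj c * z') ^ j) / of_nat n * F f) \<le> cmod (F f)" by (simp only: norm_mult mult_1_left)
   then show ?thesis by (subst val[OF that(1,3)])
  qed
  show "cmod (F r) < \<delta>" if "L1_mult F" "\<And>f. integrable \<mu> f ==> F (left_translate x f) = z * F f" for F
  proof -
   have "cmod (u ^ n - 1) \<le> 2" using norm_triangle_ineq4[of "u ^ n" 1] by (simp add: u_def norm_power norm_mult \<xi>(2) z(1))
   then have "cmod (\<Sum>j<n. u ^ j) \<le> 2 / cmod (u - 1)" unfolding geometric_sum[OF u1] by (simp add: norm_divide divide_right_mono)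
   then have "cmod (\<Sum>j<n. u ^ j) * cmod (F f) \<le> 2 / cmod (u - 1) * L1_norm f"
    using L1_mult_bound[OF that(1) f] by (intro mult_mono) auto
   also note n
   finally have "cmod (\<Sum>j<n. u ^ j) * cmod (F f) / real n < \<delta>" by (simp add: n_def divide_less_eq)
   then show ?thesis using val[OF that] unfolding u_def by (simp add: norm_mult norm_divide)
  qed
 qed
qed

text \<open>The characters are treated one after another, each at a point where its factor differs
  from \<xi>. An average made for one of them does not enlarge the values of the others, so what has
  become small remains small.\<close>

lemma L1_mult_separate:
 assumes \<Phi>: "L1_mult \<Phi>" "\<And>x f. integrable \<mu> f ==> \<Phi> (left_translate x f) = \<xi> x * \<Phi> f" "\<And>x. cmod (\<xi> x) = 1"
  and e: "integrable \<mu> e" and \<delta>: "\<delta> > 0" and S: "finite S"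
  and SF: "\<And>F. F \<in> S ==> L1_mult F \<and> (\<forall>x f. integrable \<mu> f --> F (left_translate x f) = X F x * F f) \<and> (\<forall>x. cmod (X F x) = 1) \<and> (\<exists>x. X F x \<noteq> \<xi> x)"
 shows "\<exists>r. integrable \<mu> r \<and> L1_norm r \<le> L1_norm e \<and> \<Phi> r = \<Phi> e \<and> (\<forall>F\<in>S. cmod (F r) < \<delta>)"
 using S SF
proof (induction S rule: finite_induct)
 case empty
 then show ?case using e by auto
next
 case (insert F S)
 have "\<exists>r. integrable \<mu> r \<and> L1_norm r \<le> L1_norm e \<and> \<Phi> r = \<Phi> e \<and> (\<forall>F\<in>S. cmod (F r) < \<delta>)"
  by (rule insert.IH) (rule insert.prems, simp)
 then obtain f where f: "integrable \<mu> f" "L1_norm f \<le> L1_norm e" "\<Phi> f = \<Phi> e" "\<And>F. F \<in> S ==> cmod (F f) < \<delta>" by blast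
 note Fp = insert.prems[OF insertI1]
 obtain x where x: "X F x \<noteq> \<xi> x" using Fp by blast
 have "cmod (X F x) = 1" using Fp by blast
 show ?case
 proof (rule L1_mult_average[OF \<Phi>(1) f(1) \<Phi>(2) \<Phi>(3) \<delta> \<open>cmod (X F x) = 1\<close> x])
  fix r assume r: "integrable \<mu> r" "L1_norm r \<le> L1_norm f" "\<Phi> r = \<Phi> f"
   and r1: "\<And>F z'. L1_mult F ==> cmod z' = 1 ==> (\<And>f. integrable \<mu> f ==> F (left_translate x f) = z' * F f) ==> cmod (F r) \<le> cmod (F f)"
   and r2: "\<And>F'. L1_mult F' ==> (\<And>f. integrable \<mu> f ==> F' (left_translate x f) = X F x * F' f) ==> cmod (F' r) < \<delta>"
  have "cmod (F' r) < \<delta>" if F': "F' \<in> insert F S" for F'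
  proof (cases "F' = F")
   case True
   show ?thesis unfolding True by (rule r2) (use Fp in blast)+
  next
   case False
   then have F'S: "F' \<in> S" using F' by simp
   have "cmod (F' r) \<le> cmod (F' f)" by (rule r1[of F' "X F' x"]) (use insert.prems[OF F'] in blast)+
   then show ?thesis using f(4)[OF F'S] by simp
  qed
  then show ?case using r f(2,3) by (intro exI[of _ r]) auto
 qed
qed

text \<open>In the criterion, a is the class of an approximate unit e and b that of the averaged
  function r, with r = 0 if \<phi> = 0. For a character other than \<phi> the errors of e and of r
  are each at most \<epsilon> / 3.\<close>

lemma L1_Delta_weak_amenable:
 assumes phi: "\<phi> \<in> characters (L1_algebra \<mu>) \<union> {\<lambda>_. 0}"
 shows "Delta_weak_amenable (L1_algebra \<mu>) \<phi>"
proof (rule Delta_weak_amenableI[OF _ _ phi])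
 let ?A = "L1_algebra \<mu>"
 show "0 \<le> vnorm ?A x" if x: "x \<in> vcarrier ?A" for x
  by (rule L1_carrierE[OF x]) (simp add: L1_vnorm)
 show "\<exists>C. \<forall>x\<in>vcarrier ?A. cmod (\<psi> x) \<le> C * vnorm ?A x" if psi: "\<psi> \<in> characters ?A" for \<psi>
 proof (intro exI[of _ 1] ballI)
  fix x assume x: "x \<in> vcarrier ?A"
  show "cmod (\<psi> x) \<le> 1 * vnorm ?A x"
  proof (rule L1_carrierE[OF x])
   fix f assume f: "integrable \<mu> f" "x = L1_class f"
   show "cmod (\<psi> x) \<le> 1 * vnorm ?A x"
    using L1_mult_bound[OF L1_mult_character(1)[OF psi] f(1)] by (simp add: f(2) L1_vnorm[OF f(1)])
  qed
 qed
 fix S and \<epsilon> :: real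
 assume S: "finite S" "S \<subseteq> characters ?A - {\<phi>}" and \<epsilon>: "\<epsilon> > 0"
 define lift where "lift = (\<lambda>\<psi> f. \<psi> (L1_class f) :: complex)"
 have lm: "L1_mult (lift \<psi>)" and ln: "\<exists>f. integrable \<mu> f \<and> lift \<psi> f \<noteq> 0" if "\<psi> \<in> characters ?A" for \<psi>
  unfolding lift_def using L1_mult_character[OF that] by blast+
 have \<epsilon>2: "\<epsilon> / 3 > 0" using \<epsilon> by simp
 have fin: "finite (lift ` S)" using S(1) by simp
 obtain e where e: "integrable \<mu> e" "L1_norm e = 1" "\<And>F. F \<in> lift ` S ==> cmod (F e - 1) \<le> \<epsilon> / 3"
  by (rule L1_mult_approximate_unit[OF fin _ _ \<epsilon>2]) (use S(2) lm ln in blast)+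
 have "\<exists>r. integrable \<mu> r \<and> L1_norm r \<le> 1 \<and> \<phi> (L1_class r) = \<phi> (L1_class e) \<and> (\<forall>F\<in>lift ` S. cmod (F r) < \<epsilon> / 3)"
 proof (cases "\<phi> \<in> characters ?A")
  case False
  then have "\<phi> = (\<lambda>_. 0)" using phi by blast
  moreover have "cmod (F (\<lambda>x. 0)) < \<epsilon> / 3" if F: "F \<in> lift ` S" for F
  proof -
   have "L1_mult F" using F S(2) lm by blast
   then show ?thesis using \<epsilon>2 by (simp add: L1_mult_zero)
  qed
  ultimately show ?thesis by (intro exI[of _ "\<lambda>x. 0"] conjI ballI) auto
 next
  case True
  have tr: "\<exists>\<xi>. (\<forall>x f. integrable \<mu> f --> lift \<psi> (left_translate x f) = \<xi> x * lift \<psi> f) \<and> (\<forall>x. cmod (\<xi> x) = 1)"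
   if psi: "\<psi> \<in> characters ?A" for \<psi>
  proof -
   obtain f where f: "integrable \<mu> f" "lift \<psi> f \<noteq> 0" using ln[OF psi] by blast
   show ?thesis by (rule L1_mult_translation_character[OF lm[OF psi] f]) blast
  qed
  obtain \<xi> where \<xi>: "\<forall>x f. integrable \<mu> f --> lift \<phi> (left_translate x f) = \<xi> x * lift \<phi> f" "\<forall>x. cmod (\<xi> x) = 1" using tr[OF True] by blast
  have "\<forall>F. \<exists>X. F \<in> lift ` S --> (\<forall>x f. integrable \<mu> f --> F (left_translate x f) = X x * F f) \<and> (\<forall>x. cmod (X x) = 1)"
  proof
   fix F
   show "\<exists>X. F \<in> lift ` S --> (\<forall>x f. integrable \<mu> f --> F (left_translate x f) = X x * F f) \<and> (\<forall>x. cmod (X x) = 1)"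
   proof (cases "F \<in> lift ` S")
    case True
    then obtain \<psi> where "\<psi> \<in> characters ?A" "F = lift \<psi>" using S(2) by blast
    then show ?thesis using tr by blast
   qed simp
  qed
  from choice[OF this] obtain X where X: "\<forall>F. F \<in> lift ` S --> (\<forall>x f. integrable \<mu> f --> F (left_translate x f) = X F x * F f) \<and> (\<forall>x. cmod (X F x) = 1)" by (rule exE)
  \<comment> \<open>Two characters with the same translation factor agree on all classes by
    \<open>L1_mult_eqI\<close>, and outside the carrier both vanish.\<close>
  have ne: "\<exists>x. X F x \<noteq> \<xi> x" if F: "F \<in> lift ` S" for F
  proof (rule ccontr)
   assume "\<nexists>x. X F x \<noteq> \<xi> x"
   then have eq: "X F = \<xi>" by blast
   obtain \<psi> where \<psi>: "\<psi> \<in> characters ?A" "\<psi> \<noteq> \<phi>" "F = lift \<psi>" using F S(2) by blast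
   obtain f1 where f1: "integrable \<mu> f1" "lift \<psi> f1 \<noteq> 0" using ln[OF \<psi>(1)] by blast
   obtain f2 where f2: "integrable \<mu> f2" "lift \<phi> f2 \<noteq> 0" using ln[OF True] by blast
   have same: "lift \<psi> f = lift \<phi> f" if f: "integrable \<mu> f" for f
   proof (rule L1_mult_eqI[OF lm[OF \<psi>(1)] f1 lm[OF True] f2 _ _ f])
    show "lift \<psi> (left_translate x f) = \<xi> x * lift \<psi> f" if "integrable \<mu> f" for x f
     using X F that eq unfolding \<psi>(3) by auto
    show "lift \<phi> (left_translate x f) = \<xi> x * lift \<phi> f" if "integrable \<mu> f" for x f using \<xi>(1) that by blast
   qed
   have "\<psi> x = \<phi> x" for x
   proof (cases "x \<in> vcarrier ?A")
    case x: True
    show ?thesis by (rule L1_carrierE[OF x]) (use same in \<open>simp add: lift_def\<close>)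
   next
    case x: False
    then show ?thesis using \<psi>(1) True unfolding characters_def linear_functional_def by simp
   qed
   then show False using \<psi>(2) by blast
  qed
  have "\<exists>r. integrable \<mu> r \<and> L1_norm r \<le> L1_norm e \<and> lift \<phi> r = lift \<phi> e \<and> (\<forall>F\<in>lift ` S. cmod (F r) < \<epsilon> / 3)"
  proof (rule L1_mult_separate[OF lm[OF True] _ _ e(1) \<epsilon>2 fin])
   show "lift \<phi> (left_translate x f) = \<xi> x * lift \<phi> f" if "integrable \<mu> f" for x f using \<xi>(1) that by blast
   show "cmod (\<xi> x) = 1" for x using \<xi>(2) by blast
   show "L1_mult F \<and> (\<forall>x f. integrable \<mu> f --> F (left_translate x f) = X F x * F f) \<and> (\<forall>x. cmod (X F x) = 1) \<and> (\<exists>x. X F x \<noteq> \<xi> x)"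
    if F: "F \<in> lift ` S" for F
   proof (intro conjI)
    show "L1_mult F" using F S(2) lm by blast
   qed (use X F ne[OF F] in blast)+
  qed
  then show ?thesis unfolding e(2) lift_def .
 qed
 then obtain r where r: "integrable \<mu> r" "L1_norm r \<le> 1" "\<phi> (L1_class r) = \<phi> (L1_class e)" "\<And>F. F \<in> lift ` S ==> cmod (F r) < \<epsilon> / 3" by blast
 have "cmod (\<psi> (L1_class e) - \<psi> (L1_class r) - 1) < \<epsilon>" if "\<psi> \<in> S" for \<psi>
  using e(3)[of "lift \<psi>"] r(4)[of "lift \<psi>"] that \<epsilon> norm_triangle_ineq4[of "lift \<psi> e - 1" "lift \<psi> r"]
  by (simp add: lift_def algebra_simps)
 then show "\<exists>a b. a \<in> vcarrier ?A \<and> b \<in> vcarrier ?A \<and> vnorm ?A a \<le> 1 \<and> vnorm ?A b \<le> 1 \<and>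
     cmod (\<phi> a - \<phi> b) < \<epsilon> \<and> (\<forall>\<psi>\<in>S. cmod (\<psi> a - \<psi> b - 1) < \<epsilon>)"
  using r e \<epsilon> by (intro exI[of _ "L1_class e"] exI[of _ "L1_class r"]) (simp add: L1_vnorm L1_class_carrier)
qed

end

theorem theorem4p2:
  fixes \<mu> :: "'g::{topological_group_add,t2_space} measure"
  assumes "locally compact (UNIV :: 'g set)"
    and "left_haar_measure \<mu>"
  shows "(amenable_group \<mu> \<longrightarrow>
            (\<forall>\<phi> \<in> characters (L1_algebra \<mu>) \<union> {\<lambda>_. 0}. Delta_weak_amenable (L1_algebra \<mu>) \<phi>)) \<and>
         (\<forall>p>1. \<forall>\<phi> \<in> characters (Ap_algebra p \<mu>) \<union> {\<lambda>_. 0}.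
            Delta_weak_amenable (Ap_algebra p \<mu>) \<phi> \<longleftrightarrow> amenable_group \<mu>)"
proof -
 interpret haar \<mu> using assms by (rule haar.intro)
 show ?thesis
 proof (intro conjI impI allI ballI)
  fix \<phi> assume "\<phi> \<in> characters (L1_algebra \<mu>) \<union> {\<lambda>_. 0}"
  then show "Delta_weak_amenable (L1_algebra \<mu>) \<phi>" by (rule L1_Delta_weak_amenable)
 next
  fix p :: real and \<phi> assume p: "1 < p" and \<phi>: "\<phi> \<in> characters (Ap_algebra p \<mu>) \<union> {\<lambda>_. 0}"
  interpret haar_p \<mu> p by unfold_locales (rule p)
  show "Delta_weak_amenable (Ap_algebra p \<mu>) \<phi> \<longleftrightarrow> amenable_group \<mu>"
  proof
   assume "Delta_weak_amenable (Ap_algebra p \<mu>) \<phi>"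
   then show "amenable_group \<mu>" using reiter_imp_amenable Delta_weak_amenable_imp_reiter[OF _ \<phi>] by blast
  next
   assume "amenable_group \<mu>"
   then show "Delta_weak_amenable (Ap_algebra p \<mu>) \<phi>" by (rule reiter_imp_Delta_weak_amenable[OF amenable_imp_reiter \<phi>])
  qed
 qed
qed

end
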